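(* Let $(\xi_i)_{i\in\mathbb{Z}}$ be i.i.d. centered random variables with finite second moment. Assume that for a certain $t>2$ and a slowly varying function $h$, $\mathbb{P}(\xi_0\ge x)=h(x)/x^t$ as $x\to\infty$ (i.e. for all sufficiently large $x$), and that $\mathbb{E}|\xi_0|^p<\infty$ for a certain $p>2$. Let $1/2<r<1$, let $l$ be a positive slowly varying function, and let $a_i=l(i+1)(1+i)^{-r}$ for $i\ge0$, $a_i=0$ for $i<0$ (with $a_0=1$). Let $X_k=\sum_{j=-\infty}^ka_{k-j}\xi_j$, $S_n=\sum_{k=1}^nX_k=\sum_{i\le n}b_{ni}\xi_i$ with $b_{ni}=a_{1-i}+\cdots+a_{n-i}$, and $\sigma_n^2=\mathbb{E}\xi_0^2\sum_{i\le n}b_{ni}^2$. Then for every sequence $(x_n)$ with $x_n\ge c$ for all $n$, for some $c>0$, as $n\to\infty$, $$\mathbb{P}(S_n\ge x_n\sigma_n)=(1+o(1))\sum_{i\le n}\mathbb{P}(b_{ni}\xi_0\ge x_n\sigma_n)+(1-\Phi(x_n))(1+o(1)).$$ In particular, $$\mathbb{P}(S_n\ge x_n\sigma_n)=(1+o(1))\sum_{i\le n}\mathbb{P}(b_{ni}\xi_0\ge x_n\sigma_n)\quad\text{as } n\to\infty$$ whenever $x_n\ge c_1(\ln n)^{1/2}$ with a constant $c_1>(t-2)^{1/2}$, while $$\mathbb{P}(S_n\ge x_n\sigma_n)=(1-\Phi(x_n))(1+o(1))\quad\text{as } n\to\infty$$ whenever $0<x_n\le c_2(\ln n)^{1/2}$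 with a constant $c_2<(t-2)^{1/2}$.
   Context: $\Phi$ is the standard normal distribution function. A (measurable, eventually positive) function $h$ is slowly varying if $\lim_{x\to\infty}h(\lambda x)/h(x)=1$ for all $\lambda>0$. Each $o(1)$ denotes a (possibly different) sequence, which may depend on $(x_n)$ and on the underlying distribution, converging to $0$ as $n\to\infty$. *)

theory Defs
  imports "HOL-Probability.Probability"
begin

definition slowly_varying :: "(real \<Rightarrow> real) \<Rightarrow> bool" where
  "slowly_varying h \<longleftrightarrow>
     h \<in> borel_measurable borel \<and>
     (\<forall>\<^sub>F x in at_top. 0 < h x) \<and>
     (\<forall>c>0. ((\<lambda>x. h (c * x) / h x) \<longlongrightarrow> 1) at_top)"

text \<open>
  \<open>X k = (\<Sum>j\<le>k. a (k - j) * \<xi> j)\<close>, reindexed by \<open>m = k - j\<close>. For square-summable coefficients and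
  i.i.d. centered square-integrable innovations the series converges almost surely, but in
  general only conditionally; it is therefore an ordered series and not an unordered sum
  over the set of all \<open>j \<le> k\<close>.
\<close>
definition linear_process :: "(int \<Rightarrow> real) \<Rightarrow> (int \<Rightarrow> 'w \<Rightarrow> real) \<Rightarrow> int \<Rightarrow> 'w \<Rightarrow> real" where
  "linear_process a \<xi> k \<omega> = (\<Sum>m. a (int m) * \<xi> (k - int m) \<omega>)"

definition partial_sum :: "(int \<Rightarrow> real) \<Rightarrow> (int \<Rightarrow> 'w \<Rightarrow> real) \<Rightarrow> nat \<Rightarrow> 'w \<Rightarrow> real" where
  "partial_sum a \<xi> n \<omega> = (\<Sum>k\<in>{1..int n}. linear_process a \<xi> k \<omega>)"

definition weight :: "(int \<Rightarrow> real) \<Rightarrow> nat \<Rightarrow> int \<Rightarrow> real" where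
  "weight a n i = (\<Sum>k\<in>{1..int n}. a (k - i))"

definition std_dev :: "'w measure \<Rightarrow> (int \<Rightarrow> real) \<Rightarrow> (int \<Rightarrow> 'w \<Rightarrow> real) \<Rightarrow> nat \<Rightarrow> real" where
  "std_dev M a \<xi> n =
     sqrt ((LINT \<omega>|M. (\<xi> 0 \<omega>)\<^sup>2) * (\<Sum>\<^sub>\<infinity>i\<in>{..int n}. (weight a n i)\<^sup>2))"

definition dev_prob ::
    "'w measure \<Rightarrow> (int \<Rightarrow> real) \<Rightarrow> (int \<Rightarrow> 'w \<Rightarrow> real) \<Rightarrow> nat \<Rightarrow> real \<Rightarrow> real" where
  "dev_prob M a \<xi> n x =
     measure M {\<omega> \<in> space M. partial_sum a \<xi> n \<omega> \<ge> x * std_dev M a \<xi> n}"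

definition tail_sum ::
    "'w measure \<Rightarrow> (int \<Rightarrow> real) \<Rightarrow> (int \<Rightarrow> 'w \<Rightarrow> real) \<Rightarrow> nat \<Rightarrow> real \<Rightarrow> real" where
  "tail_sum M a \<xi> n x =
     (\<Sum>\<^sub>\<infinity>i\<in>{..int n}.
        measure M {\<omega> \<in> space M. weight a n i * \<xi> 0 \<omega> \<ge> x * std_dev M a \<xi> n})"

definition std_normal_cdf :: "real \<Rightarrow> real" where
  "std_normal_cdf = cdf std_normal_distribution"

end

theory Submission
  imports Defs "HOL-Real_Asymp.Real_Asymp"
begin

text \<open>
  Put \<open>Y i = b i * \<xi> i / \<sigma>\<close>, so that the normalised partial sum is the sum of the \<open>Y i\<close>. If no \<open>Y i\<close>
  exceeds a level \<open>\<eta>\<close>, the sum is a sum of variables truncated from above, whose exponential moments are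
  those of a normal variable up to a negligible factor. For \<open>x\<close> of order at most \<open>sqrt (ln n)\<close>,
  Lindeberg's replacement method, run with error terms weighted by \<open>exp (x * s)\<close>, then gives the normal
  tail with small \<^emph>\<open>relative\<close> error; for larger \<open>x\<close> Chernoff's bound shows that this contribution is
  negligible. Exactly one large \<open>Y i\<close> contributes the sum of the tails of the \<open>Y i\<close>, by regular
  variation, and two or more large terms are negligible.

  No precise asymptotics of the weights are needed: \<open>b i / \<sigma>\<close> lies below \<open>n powr (- 1 / 2 + e)\<close>
  for all \<open>i\<close> and above \<open>n powr (- 1 / 2 - e)\<close> for a positive fraction of the first \<open>n\<close> indices, and the powers
  \<open>n powr e\<close> are absorbed because the two terms of the statement differ by a power of \<open>n\<close> away
  from \<open>x = sqrt ((t - 2) * ln n)\<close>. All estimates are uniform over finite families of weights and pass to the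
  infinite sums by almost sure convergence.
\<close>


section \<open>Regular variation\<close>

text \<open>The error of the Gaussian part must be small relative to \<open>normal_tail x\<close>,
  which for \<open>x\<close> of order \<open>sqrt (ln n)\<close> is itself a negative power of
  \<open>n\<close>; an additive error bound is too coarse there. The weight
  \<open>exp (l * s)\<close> supplies the missing factor at the price of exponential moments, hence
  the truncation. Its level has to meet two demands: \<open>exp (l * \<eta>)\<close> must stay
  harmless against the Lyapunov sum, yet a summand above \<open>\<eta>\<close> must not be much
  likelier than one above \<open>x\<close>. The level \<open>1 / ln n\<close> serves for
  \<open>x\<close> up to a multiple of \<open>sqrt (ln n)\<close>, since Potter's bounds then charge
  only powers of \<open>ln n\<close>; beyond that the level is \<open>a * x\<close> with a small
  constant \<open>a\<close>. Replacing a summand by a Gaussian one is encoded as a Gaussian average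
  of the test function, so that no Gaussian variables have to be adjoined to \<open>M\<close>.
  Finite blocks are normalised by their own standard deviation, which makes the variance exactly 1;
  the limit is taken afterwards with a small shift of the threshold, removed by continuity of the
  normal tail and regular variation of the other tails.\<close>

definition regvar_tail :: "(real \<Rightarrow> real) \<Rightarrow> real \<Rightarrow> bool" where
  "regvar_tail G t \<longleftrightarrow> antimono G \<and> (\<forall>u. 0 < G u) \<and>
     (\<forall>c>0. ((\<lambda>u. G (c * u) / G u) \<longlongrightarrow> c powr (- t)) at_top)"

text \<open>Positivity at every \<open>u\<close>, not only far out, comes from monotonicity: some
  later \<open>v\<close> has \<open>0 < G v\<close>, and \<open>G v \<le> G u\<close>. The powers of
  \<open>u\<close> contribute exactly \<open>c powr (- t)\<close> to the quotient, so slow variation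
  of \<open>h\<close> gives the limit.\<close>

lemma regvar_tailI:
  assumes h: "slowly_varying h" and G: "antimono G" and e: "\<forall>\<^sub>F u in at_top. G u = h u / u powr t"
  shows "regvar_tail G t"
proof -
  have pos: "\<forall>\<^sub>F u in at_top. 0 < G u"
  proof -
    have "\<forall>\<^sub>F u in at_top. 0 < h u" using h by (simp add: slowly_varying_def)
    with e eventually_gt_at_top[of 0] show ?thesis by eventually_elim auto
  qed
  have "0 < G u" for u
  proof -
    obtain v where "0 < G v" "u \<le> v"
      using eventually_happens[OF eventually_conj[OF pos eventually_ge_at_top[of u]]] by auto
    then show ?thesis using antimonoD[OF G, of u v] by linarith
  qed
  moreover have "((\<lambda>u. G (c * u) / G u) \<longlongrightarrow> c powr (- t)) at_top" if c: "0 < c" for c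
  proof -
    have "filterlim (\<lambda>u. c * u) at_top at_top" using c by real_asymp
    then have e2: "\<forall>\<^sub>F u in at_top. G (c * u) = h (c * u) / (c * u) powr t"
      using e by (rule eventually_compose_filterlim[rotated])
    have "((\<lambda>u. h (c * u) / h u * c powr (- t)) \<longlongrightarrow> 1 * c powr (- t)) at_top"
      using h c by (intro tendsto_intros) (auto simp: slowly_varying_def)
    moreover have "\<forall>\<^sub>F u in at_top. h (c * u) / h u * c powr (- t) = G (c * u) / G u"
      using e e2 eventually_gt_at_top[of 0]
    proof eventually_elim
      case (elim u)
      have hu: "h u = G u * u powr t" using elim by simp
      have hcu: "h (c * u) = G (c * u) * (c powr t * u powr t)" using elim c by (simp add: powr_mult)
      show ?case unfolding hu hcu using elim(3) c by (simp add: powr_minus)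
    qed
    ultimately show ?thesis by (simp add: tendsto_cong)
  qed
  ultimately show ?thesis using G by (simp add: regvar_tail_def)
qed

section \<open>Potter bounds along powers of two\<close>

lemma power_of_two_bracket:
  fixes \<kappa> :: real assumes "1 \<le> \<kappa>"
  obtains k :: nat where "2 ^ k \<le> \<kappa>" "\<kappa> \<le> 2 ^ Suc k"
proof -
  have "\<exists>n::nat. \<kappa> < 2 ^ n" using real_arch_pow[of 2 \<kappa>] by auto
  define n where "n = (LEAST n::nat. \<kappa> < 2 ^ n)"
  have n: "\<kappa> < 2 ^ n" unfolding n_def by (rule LeastI_ex) fact
  have "n \<noteq> 0" using n assms by (cases n) auto
  then obtain k where k: "n = Suc k" by (cases n) auto
  have "\<not> \<kappa> < 2 ^ k" using not_less_Least[of k "\<lambda>n. \<kappa> < 2 ^ n"] k by (auto simp: n_def)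
  then show thesis using n k by (intro that[of k]) auto
qed

text \<open>A doubling step keeps at least the factor \<open>2 powr (- (t + e))\<close> once
  \<open>u\<close> is large. Iterated, it reaches \<open>2 ^ Suc k\<close>, and monotonicity covers
  the way from there back to \<open>\<kappa>\<close>. As
  \<open>2 ^ Suc k \<le> 2 * \<kappa>\<close>, the rounding costs the factor 2 inside the
  power.\<close>

lemma potter_lower:
  assumes G: "regvar_tail G t" and t: "0 < t" and e: "0 < e"
  shows "\<exists>u0>0. \<forall>u\<ge>u0. \<forall>\<kappa>\<ge>1. (2 * \<kappa>) powr (- (t + e)) * G u \<le> G (\<kappa> * u)"
proof -
  have lim: "((\<lambda>u. G (2 * u) / G u) \<longlongrightarrow> 2 powr (- t)) at_top" and pos: "0 < G u" and mono: "antimono G" for u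
    using G by (auto simp: regvar_tail_def)
  have "2 powr (- (t + e)) < 2 powr (- t)" using e by simp
  from order_tendstoD(1)[OF lim this] obtain u1 where u1: "\<And>u. u1 \<le> u \<Longrightarrow> 2 powr (- (t + e)) < G (2 * u) / G u"
    by (auto simp: eventually_at_top_linorder)
  define u0 where "u0 = max 1 u1"
  have step: "2 powr (- (t + e)) * G u \<le> G (2 * u)" if "u0 \<le> u" for u
    using u1[of u] that pos[of u] by (simp add: u0_def field_simps)
  have it: "(2 ^ k) powr (- (t + e)) * G u \<le> G (2 ^ k * u)" if u: "u0 \<le> u" for u and k :: nat
  proof (induction k)
    case (Suc k)
    have "1 * u \<le> 2 ^ k * u" using u by (intro mult_right_mono) (auto simp: u0_def)
    then have "u0 \<le> 2 ^ k * u" using u by simp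
    from step[OF this] have "2 powr (- (t + e)) * G (2 ^ k * u) \<le> G (2 ^ Suc k * u)" by (simp add: mult.assoc)
    moreover have "2 powr (- (t + e)) * ((2 ^ k) powr (- (t + e)) * G u) \<le> 2 powr (- (t + e)) * G (2 ^ k * u)"
      using Suc by (intro mult_left_mono) auto
    moreover have "2 powr (- (t + e)) * ((2 ^ k) powr (- (t + e)) * G u) = (2 ^ Suc k) powr (- (t + e)) * G u"
      by (simp add: powr_mult)
    ultimately show ?case by linarith
  qed simp
  have "(2 * \<kappa>) powr (- (t + e)) * G u \<le> G (\<kappa> * u)" if u: "u0 \<le> u" and k1: "1 \<le> \<kappa>" for u \<kappa>
  proof -
    obtain k :: nat where k: "2 ^ k \<le> \<kappa>" "\<kappa> \<le> 2 ^ Suc k" using power_of_two_bracket[OF k1] .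
    have "(2 * \<kappa>) powr (- (t + e)) \<le> (2 ^ Suc k) powr (- (t + e))"
      using k k1 t e by (intro powr_mono2') auto
    then have "(2 * \<kappa>) powr (- (t + e)) * G u \<le> (2 ^ Suc k) powr (- (t + e)) * G u"
      using pos[of u] by (intro mult_right_mono) auto
    also have "\<dots> \<le> G (2 ^ Suc k * u)" by (rule it[OF u])
    also have "\<dots> \<le> G (\<kappa> * u)" using k u by (intro antimonoD[OF mono] mult_right_mono) (auto simp: u0_def)
    finally show ?thesis .
  qed
  then show ?thesis by (intro exI[of _ u0]) (auto simp: u0_def)
qed

text \<open>The mirror image of the lower bound: \<open>\<kappa>\<close> is rounded down to
  \<open>2 ^ k\<close>, which is at least \<open>\<kappa> / 2\<close>.\<close>

lemma potter_upper:
  assumes G: "regvar_tail G t" and e: "0 < e" "e < t"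
  shows "\<exists>u0>0. \<forall>u\<ge>u0. \<forall>\<kappa>\<ge>1. G (\<kappa> * u) \<le> (\<kappa> / 2) powr (- (t - e)) * G u"
proof -
  have lim: "((\<lambda>u. G (2 * u) / G u) \<longlongrightarrow> 2 powr (- t)) at_top" and pos: "0 < G u" and mono: "antimono G" for u
    using G by (auto simp: regvar_tail_def)
  have "2 powr (- t) < 2 powr (- (t - e))" using e by simp
  from order_tendstoD(2)[OF lim this] obtain u1 where u1: "\<And>u. u1 \<le> u \<Longrightarrow> G (2 * u) / G u < 2 powr (- (t - e))"
    by (auto simp: eventually_at_top_linorder)
  define u0 where "u0 = max 1 u1"
  have step: "G (2 * u) \<le> 2 powr (- (t - e)) * G u" if "u0 \<le> u" for u
    using u1[of u] that pos[of u] by (simp add: u0_def pos_divide_less_eq)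
  have it: "G (2 ^ k * u) \<le> (2 ^ k) powr (- (t - e)) * G u" if u: "u0 \<le> u" for u and k :: nat
  proof (induction k)
    case (Suc k)
    have "1 * u \<le> 2 ^ k * u" using u by (intro mult_right_mono) (auto simp: u0_def)
    then have "u0 \<le> 2 ^ k * u" using u by simp
    from step[OF this] have "G (2 ^ Suc k * u) \<le> 2 powr (- (t - e)) * G (2 ^ k * u)" by (simp add: mult.assoc)
    moreover have "2 powr (- (t - e)) * G (2 ^ k * u) \<le> 2 powr (- (t - e)) * ((2 ^ k) powr (- (t - e)) * G u)"
      using Suc by (intro mult_left_mono) auto
    moreover have "2 powr (- (t - e)) * ((2 ^ k) powr (- (t - e)) * G u) = (2 ^ Suc k) powr (- (t - e)) * G u"
      by (simp add: powr_mult)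
    ultimately show ?case by linarith
  qed simp
  have "G (\<kappa> * u) \<le> (\<kappa> / 2) powr (- (t - e)) * G u" if u: "u0 \<le> u" and k1: "1 \<le> \<kappa>" for u \<kappa>
  proof -
    obtain k :: nat where k: "2 ^ k \<le> \<kappa>" "\<kappa> \<le> 2 ^ Suc k" using power_of_two_bracket[OF k1] .
    have "G (\<kappa> * u) \<le> G (2 ^ k * u)" using k u by (intro antimonoD[OF mono] mult_right_mono) (auto simp: u0_def)
    also have "\<dots> \<le> (2 ^ k) powr (- (t - e)) * G u" by (rule it[OF u])
    also have "(2 ^ k) powr (- (t - e)) \<le> (\<kappa> / 2) powr (- (t - e))"
      using k k1 e by (intro powr_mono2') auto
    finally show ?thesis using pos[of u] by (simp add: mult_right_mono)
  qed
  then show ?thesis by (intro exI[of _ u0]) (auto simp: u0_def)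
qed

text \<open>Potter's bound with the base point frozen at \<open>u0\<close> and
  \<open>\<kappa> = u / u0\<close>; whatever depends on \<open>u0\<close> alone goes into the
  constant.\<close>

lemma regvar_tail_lower:
  assumes G: "regvar_tail G t" and t: "0 < t" and e: "0 < e"
  shows "\<exists>u0>0. \<exists>c>0. \<forall>u\<ge>u0. c * u powr (- (t + e)) \<le> G u"
proof -
  obtain u0 where u0: "0 < u0" "\<And>u \<kappa>. u0 \<le> u \<Longrightarrow> 1 \<le> \<kappa> \<Longrightarrow> (2 * \<kappa>) powr (- (t + e)) * G u \<le> G (\<kappa> * u)"
    using potter_lower[OF G t e] by blast
  have pos: "0 < G u0" using G by (auto simp: regvar_tail_def)
  have "(2 / u0) powr (- (t + e)) * G u0 * u powr (- (t + e)) \<le> G u" if "u0 \<le> u" for u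
  proof -
    have "(2 * (u / u0)) powr (- (t + e)) * G u0 \<le> G (u / u0 * u0)" using u0 that by (intro u0(2)) auto
    moreover have "(2 * (u / u0)) powr (- (t + e)) = (2 / u0) powr (- (t + e)) * u powr (- (t + e))"
      using u0(1) that by (simp flip: powr_mult)
    ultimately show ?thesis using u0(1) by (simp add: mult_ac)
  qed
  then show ?thesis using u0(1) pos
    by (intro exI[of _ u0] conjI exI[of _ "(2 / u0) powr (- (t + e)) * G u0"]) auto
qed

lemma regvar_tail_upper:
  assumes G: "regvar_tail G t" and e: "0 < e" "e < t"
  shows "\<exists>u0>0. \<exists>c>0. \<forall>u\<ge>u0. G u \<le> c * u powr (- (t - e))"
proof -
  obtain u0 where u0: "0 < u0" "\<And>u \<kappa>. u0 \<le> u \<Longrightarrow> 1 \<le> \<kappa> \<Longrightarrow> G (\<kappa> * u) \<le> (\<kappa> / 2) powr (- (t - e)) * G u"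
    using potter_upper[OF G e] by blast
  have pos: "0 < G u0" using G by (auto simp: regvar_tail_def)
  have "G u \<le> (1 / (2 * u0)) powr (- (t - e)) * G u0 * u powr (- (t - e))" if "u0 \<le> u" for u
  proof -
    have "G (u / u0 * u0) \<le> (u / u0 / 2) powr (- (t - e)) * G u0" using u0 that by (intro u0(2)) auto
    moreover have "(u / u0 / 2) powr (- (t - e)) = (1 / (2 * u0)) powr (- (t - e)) * u powr (- (t - e))"
      using u0(1) that by (simp add: mult.commute flip: powr_mult)
    ultimately show ?thesis using u0(1) by (simp add: mult_ac)
  qed
  then show ?thesis using u0(1) pos
    by (intro exI[of _ u0] conjI exI[of _ "(1 / (2 * u0)) powr (- (t - e)) * G u0"]) auto
qed

text \<open>The measure-theoretic proof of the uniform convergence theorem: if it failed along \<open>x m\<close>, \<open>u m\<close>,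
  two sets of shifts, each filling most of an interval of length 2 inside \<open>{0..3}\<close>, would have to be disjoint.\<close>

lemma slow_variation_uniform:
  fixes k :: "real \<Rightarrow> real"
  assumes [measurable]: "k \<in> borel_measurable borel"
    and lim: "\<And>v. ((\<lambda>x. k (x + v) - k x) \<longlongrightarrow> 0) at_top"
  shows "\<exists>X. \<forall>x\<ge>X. \<forall>u\<in>{0..1}. \<bar>k (x + u) - k x\<bar> \<le> 1"
proof (rule ccontr)
  assume "\<not> ?thesis"
  then have "\<forall>n::nat. \<exists>x u. real n \<le> x \<and> u \<in> {0..1} \<and> 1 < \<bar>k (x + u) - k x\<bar>"
    by (force simp: not_le)
  then obtain x u where xu: "\<And>n::nat. real n \<le> x n" "\<And>n. u n \<in> {0..1}" "\<And>n. 1 < \<bar>k (x n + u n) - k (x n)\<bar>"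
    by metis
  \<comment> \<open>For each fixed \<open>v\<close> the inequality holds from some \<open>m\<close>
    on, so these sets increase to \<open>{0..2}\<close> and their measures tend to 2: pointwise
    convergence turned into a statement about measure. It is used for the base points
    \<open>x n\<close> and \<open>x n + u n\<close>.\<close>
  have big: "\<exists>N. \<forall>n\<ge>N. 3 / 2 < measure lborel {v\<in>{0..2}. \<forall>m\<ge>n. \<bar>k (y m + v) - k (y m)\<bar> \<le> 1 / 2}"
    if y: "\<And>n::nat. real n \<le> y n" for y
  proof -
    define V where "V n = {v\<in>{0..2}. \<forall>m\<ge>n. \<bar>k (y m + v) - k (y m)\<bar> \<le> 1 / 2}" for n
    have Vm: "V n \<in> sets borel" for n unfolding V_def by measurable
    have ylim: "filterlim y at_top sequentially"
      by (rule filterlim_at_top_mono[OF filterlim_real_sequentially]) (simp add: y)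
    have U: "(\<Union>n. V n) = {0..2}"
    proof (intro equalityI subsetI)
      fix v :: real assume v: "v \<in> {0..2}"
      have "((\<lambda>m. k (y m + v) - k (y m)) \<longlongrightarrow> 0) sequentially" by (rule filterlim_compose[OF lim ylim])
      then have "\<forall>\<^sub>F m in sequentially. dist (k (y m + v) - k (y m)) 0 < 1 / 2" by (rule tendstoD) simp
      then show "v \<in> (\<Union>n. V n)" using v by (auto simp: V_def eventually_sequentially intro: less_imp_le)
    qed (auto simp: V_def)
    have fin: "emeasure lborel (V n) \<noteq> \<infinity>" for n
    proof -
      have "emeasure lborel (V n) \<le> emeasure lborel {0..2::real}" by (intro emeasure_mono) (auto simp: V_def)
      then show ?thesis by (auto simp: top_unique)
    qed
    have "(\<lambda>n. measure lborel (V n)) \<longlonglongrightarrow> measure lborel (\<Union>n. V n)"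
    proof (rule Lim_measure_incseq)
      show "incseq V" by (auto simp: incseq_def V_def)
      show "emeasure lborel (\<Union>n. V n) \<noteq> \<infinity>" unfolding U by simp
    qed (use Vm in auto)
    then have "(\<lambda>n. measure lborel (V n)) \<longlonglongrightarrow> 2" by (simp add: U)
    from order_tendstoD(1)[OF this, of "3 / 2"] show ?thesis by (auto simp: V_def eventually_sequentially)
  qed
  obtain N1 where N1: "\<And>n. N1 \<le> n \<Longrightarrow> 3 / 2 < measure lborel {v\<in>{0..2}. \<forall>m\<ge>n. \<bar>k (x m + v) - k (x m)\<bar> \<le> 1 / 2}"
    using big[of x] xu(1) by blast
  have "real n \<le> x n + u n" for n using xu(1)[of n] xu(2)[of n] by simp
  from big[of "\<lambda>n. x n + u n", OF this] obtain N2 where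
    N2: "\<And>n. N2 \<le> n \<Longrightarrow> 3 / 2 < measure lborel {v\<in>{0..2}. \<forall>m\<ge>n. \<bar>k (x m + u m + v) - k (x m + u m)\<bar> \<le> 1 / 2}"
    by blast
  define n where "n = max N1 N2"
  define V where "V = {v\<in>{0..2}. \<forall>m\<ge>n. \<bar>k (x m + v) - k (x m)\<bar> \<le> 1 / 2}"
  define W where "W = {v\<in>{0..2}. \<forall>m\<ge>n. \<bar>k (x m + u m + v) - k (x m + u m)\<bar> \<le> 1 / 2}"
  have [measurable]: "V \<in> sets borel" "W \<in> sets borel" unfolding V_def W_def by measurable
  have mV: "3 / 2 < measure lborel V" using N1[of n] by (simp add: V_def n_def)
  have mW: "3 / 2 < measure lborel W" using N2[of n] by (simp add: W_def n_def)
  \<comment> \<open>\<open>W'\<close> is \<open>W\<close> shifted to the right by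
    \<open>u n\<close>, so that membership in either set speaks about the same value
    \<open>k (x n + v)\<close>. As \<open>u n\<close> lies in \<open>{0..1}\<close>, the shifted set
    stays inside \<open>{0..3}\<close>.\<close>
  define W' where "W' = (+) (- u n) -` W"
  have sm: "(+) (- u n) \<in> borel_measurable borel" by measurable
  have "(+) (- u n) -` W \<inter> space borel \<in> sets borel" by (rule measurable_sets[OF sm]) measurable
  then have [measurable]: "W' \<in> sets borel" by (simp only: space_borel Int_UNIV_right W'_def)
  have "measure lborel W = measure (distr lborel borel ((+) (- u n))) W" by (simp add: lborel_distr_plus)
  also have "\<dots> = measure lborel W'" by (subst measure_distr) (auto simp: W'_def)
  finally have mW': "3 / 2 < measure lborel W'" using mW by simp
  have sub: "V \<subseteq> {0..3}" "W' \<subseteq> {0..3}"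
    using xu(2)[of n] by (auto simp: V_def W_def W'_def)
  have fV: "emeasure lborel A \<noteq> \<infinity>" if "A \<subseteq> {0..3}" "A \<in> sets borel" for A :: "real set"
  proof -
    have "emeasure lborel A \<le> emeasure lborel {0..3::real}" using that by (intro emeasure_mono) auto
    then show ?thesis by (auto simp: top_unique)
  qed
  have "V \<inter> W' \<noteq> {}"
  proof
    assume "V \<inter> W' = {}"
    then have "measure lborel (V \<union> W') = measure lborel V + measure lborel W'"
      using fV[OF sub(1)] fV[OF sub(2)] by (intro measure_Union) auto
    moreover have "measure lborel (V \<union> W') \<le> measure lborel {0..3::real}"
      using sub by (intro measure_mono_fmeasurable) (auto simp: fmeasurable_def)
    ultimately show False using mV mW' by simp
  qed
  then obtain v where v: "v \<in> V" "- u n + v \<in> W" by (auto simp: W'_def)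
  have "\<bar>k (x n + v) - k (x n)\<bar> \<le> 1 / 2" using v(1) by (auto simp: V_def)
  moreover have "\<bar>k (x n + u n + (- u n + v)) - k (x n + u n)\<bar> \<le> 1 / 2" using v(2) by (auto simp: W_def)
  then have "\<bar>k (x n + v) - k (x n + u n)\<bar> \<le> 1 / 2" by simp
  ultimately show False using xu(3)[of n] by linarith
qed

text \<open>In the logarithmic coordinate, with \<open>k x = ln (l (exp x))\<close>, slow variation
  says that the unit increments of \<open>k\<close> tend to 0. Hence \<open>\<bar>k x\<bar>\<close>
  grows at most like \<open>e * x\<close>, and exponentiating gives the power bounds for all large
  arguments.\<close>

lemma slowly_varying_nat_bounds:
  assumes l: "slowly_varying l" and pos: "\<forall>x>0. 0 < l x" and e: "0 < e"
  shows "\<exists>C>0. \<forall>m::nat. 1 \<le> m \<longrightarrow> l (real m) \<le> C * real m powr e \<and> real m powr (- e) / C \<le> l (real m)"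
proof -
  define k where "k x = ln (l (exp x))" for x
  have lm: "l \<in> borel_measurable borel" using l by (simp add: slowly_varying_def)
  have [measurable]: "k \<in> borel_measurable borel" unfolding k_def using lm by measurable
  have kl: "l (exp x) = exp (k x)" for x using pos by (simp add: k_def)
  have lim: "((\<lambda>x. k (x + v) - k x) \<longlongrightarrow> 0) at_top" for v
  proof -
    have "((\<lambda>x. l (exp v * x) / l x) \<longlongrightarrow> 1) at_top" using l by (simp add: slowly_varying_def)
    from filterlim_compose[OF this exp_at_top]
    have "((\<lambda>x. ln (l (exp v * exp x) / l (exp x))) \<longlongrightarrow> ln 1) at_top" by (intro tendsto_ln) auto
    moreover have "ln (l (exp v * exp x) / l (exp x)) = k (x + v) - k x" for x
    proof -
      have "0 < l (exp (x + v))" "0 < l (exp x)" using pos by auto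
      then show ?thesis by (simp add: k_def ln_div add.commute flip: exp_add)
    qed
    ultimately show ?thesis by simp
  qed
  obtain X where X: "\<And>x u. X \<le> x \<Longrightarrow> u \<in> {0..1} \<Longrightarrow> \<bar>k (x + u) - k x\<bar> \<le> 1"
    using slow_variation_uniform[OF \<open>k \<in> borel_measurable borel\<close> lim] by blast
  have "\<forall>\<^sub>F x in at_top. dist (k (x + 1) - k x) 0 < e" using lim[of 1] e by (rule tendstoD)
  then obtain X2 where X2: "\<And>x. X2 \<le> x \<Longrightarrow> \<bar>k (x + 1) - k x\<bar> < e" by (auto simp: eventually_at_top_linorder)
  define Y where "Y = max 0 (max X X2)"
  have it: "\<bar>k (x + real j) - k x\<bar> \<le> e * real j" if "Y \<le> x" for x j
  proof (induction j)
    case (Suc j)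
    have "\<bar>k (x + real j + 1) - k (x + real j)\<bar> < e" using that by (intro X2) (auto simp: Y_def)
    then show ?case using Suc by (simp add: algebra_simps)
  qed simp
  \<comment> \<open>Each of the \<open>j\<close> unit steps costs at most \<open>e\<close>; the
    remaining fraction \<open>f\<close> costs at most 1 by the uniform convergence on
    \<open>{0..1}\<close>.\<close>
  have grow: "\<bar>k x\<bar> \<le> \<bar>k Y\<bar> + 1 + e * x" if x: "Y \<le> x" for x
  proof -
    define j where "j = nat \<lfloor>x - Y\<rfloor>"
    define f where "f = x - Y - real j"
    have j: "real j = of_int \<lfloor>x - Y\<rfloor>" using x by (simp add: j_def)
    have f: "f \<in> {0..1}" unfolding f_def j by (auto simp: algebra_simps) linarith+
    have "\<bar>k (Y + f) - k Y\<bar> \<le> 1" using f by (intro X) (auto simp: Y_def)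
    moreover have "\<bar>k (Y + f + real j) - k (Y + f)\<bar> \<le> e * real j" using f by (intro it) auto
    moreover have xe: "Y + f + real j = x" by (simp add: f_def)
    moreover have "e * real j \<le> e * x" using e f by (intro mult_left_mono) (auto simp: f_def Y_def)
    ultimately show ?thesis unfolding xe by linarith
  qed
  define C0 where "C0 = exp (\<bar>k Y\<bar> + 1)"
  have b0: "l y \<le> C0 * y powr e \<and> y powr (- e) / C0 \<le> l y" if y: "exp Y \<le> y" for y
  proof -
    have y0: "0 < y" using y exp_gt_zero[of Y] by linarith
    have "Y \<le> ln y" using y y0 by (simp add: ln_ge_iff)
    from grow[OF this] have g: "\<bar>k (ln y)\<bar> \<le> \<bar>k Y\<bar> + 1 + e * ln y" .
    have ly: "l y = exp (k (ln y))" using kl[of "ln y"] y0 by simp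
    have g1: "exp (k (ln y)) \<le> exp (\<bar>k Y\<bar> + 1 + e * ln y)" using g by simp
    have g2: "exp (- (\<bar>k Y\<bar> + 1) - e * ln y) \<le> exp (k (ln y))" using g by simp
    have "y powr e = exp (e * ln y)" using y0 by (simp add: powr_def)
    then have "exp (\<bar>k Y\<bar> + 1 + e * ln y) = C0 * y powr e" by (simp only: C0_def exp_add)
    moreover have "exp (- (\<bar>k Y\<bar> + 1) - e * ln y) = y powr (- e) / C0"
    proof -
      have "exp (- A - b) = exp (- b) / exp A" for A b :: real
        by (simp add: exp_minus exp_diff field_simps)
      moreover have "y powr (- e) = exp (- (e * ln y))" using y0 by (simp add: powr_def)
      ultimately show ?thesis unfolding C0_def by (simp only:)
    qed
    ultimately show ?thesis unfolding ly using g1 g2 by simp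
  qed
  define N where "N = nat \<lceil>exp Y\<rceil>"
  \<comment> \<open>Adding \<open>l m + 1 / l m\<close> for the finitely many small \<open>m\<close>
    makes \<open>C\<close> dominate both \<open>l m\<close> and its reciprocal there.\<close>
  define C where "C = C0 + (\<Sum>m\<in>{1..N}. l (real m) + 1 / l (real m))"
  have lp: "0 < l (real m)" if "1 \<le> m" for m using that pos by simp
  have C0: "0 < C0" by (simp add: C0_def)
  have sp: "0 \<le> l (real m) + 1 / l (real m)" if "1 \<le> m" for m
    using lp[OF that] by (intro add_nonneg_nonneg) auto
  then have "0 \<le> (\<Sum>m\<in>{1..N}. l (real m) + 1 / l (real m))" by (intro sum_nonneg) auto
  then have CC: "C0 \<le> C" unfolding C_def by simp
  have "l (real m) \<le> C * real m powr e \<and> real m powr (- e) / C \<le> l (real m)" if m: "1 \<le> m" for m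
  proof (cases "m \<le> N")
    case False
    then have "exp Y \<le> real m" unfolding N_def by linarith
    from b0[OF this] have b: "l (real m) \<le> C0 * real m powr e" "real m powr (- e) / C0 \<le> l (real m)" by auto
    have "C0 * real m powr e \<le> C * real m powr e" using CC by (intro mult_right_mono) auto
    moreover have "real m powr (- e) / C \<le> real m powr (- e) / C0" using CC C0 by (intro divide_left_mono) auto
    ultimately show ?thesis using b by linarith
  next
    case True
    have "l (real m) + 1 / l (real m) \<le> (\<Sum>m\<in>{1..N}. l (real m) + 1 / l (real m))"
      using True m sp by (intro member_le_sum) auto
    then have s: "l (real m) + 1 / l (real m) \<le> C" unfolding C_def using C0 by linarith
    have i: "0 < 1 / l (real m)" using lp[OF m] by simp
    have "1 \<le> real m powr e" "real m powr (- e) \<le> 1" using m e by (auto simp: ge_one_powr_ge_zero powr_le_one_le powr_minus_divide)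
    have "l (real m) \<le> C * 1" using s i by linarith
    also have "\<dots> \<le> C * real m powr e" using \<open>1 \<le> real m powr e\<close> C0 CC by (intro mult_left_mono) auto
    finally have 1: "l (real m) \<le> C * real m powr e" .
    have "1 / l (real m) \<le> C" using s lp[OF m] by linarith
    then have "1 / C \<le> l (real m)" using lp[OF m] C0 CC by (simp add: field_simps)
    moreover have "real m powr (- e) / C \<le> 1 / C" using \<open>real m powr (- e) \<le> 1\<close> C0 CC by (intro divide_right_mono) auto
    ultimately show ?thesis using 1 by linarith
  qed
  then show ?thesis using C0 CC by (intro exI[of _ C]) auto
qed

text \<open>The third-order remainder is nonpositive for \<open>u \<le> 0\<close>; on
  \<open>{0<..1}\<close> the cube is below \<open>u powr p\<close> because \<open>p \<le> 3\<close>;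
  beyond 1 the error term alone exceeds \<open>exp u\<close>. Only the positive part of
  \<open>u\<close> enters the exponential, which is why truncation from above will be
  enough.\<close>

lemma exp_le_taylor2_powr:
  fixes u p :: real assumes p: "2 \<le> p" "p \<le> 3"
  shows "exp u \<le> 1 + u + u\<^sup>2 / 2 + \<bar>u\<bar> powr p * exp (max u 0)"
proof -
  obtain t where t: "\<bar>t\<bar> \<le> \<bar>u\<bar>" "exp u = (\<Sum>m<3. u ^ m / fact m) + exp t / fact 3 * u ^ 3"
    using Maclaurin_exp_le[of u 3] by blast
  have e: "exp u = 1 + u + u\<^sup>2 / 2 + exp t * u ^ 3 / 6"
    unfolding t(2) by (simp add: eval_nat_numeral)
  consider "u \<le> 0" | "0 < u" "u \<le> 1" | "1 < u" by linarith
  then show ?thesis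
  proof cases
    case 1
    then have "u ^ 3 \<le> 0" by (simp add: power3_eq_cube mult_nonpos_nonneg mult_nonneg_nonpos zero_le_mult_iff mult_le_0_iff)
    then have "exp t * u ^ 3 / 6 \<le> 0" by (simp add: mult_le_0_iff)
    moreover have "0 \<le> \<bar>u\<bar> powr p * exp (max u 0)" by simp
    ultimately show ?thesis using e by linarith
  next
    case 2
    have "u powr 3 \<le> u powr p" using 2 p by (intro powr_mono') auto
    then have u3: "u ^ 3 \<le> u powr p" using 2 by (simp add: powr_numeral)
    have "exp t * u ^ 3 / 6 \<le> exp t * u ^ 3" using 2 by simp
    also have "\<dots> \<le> exp u * u powr p" using 2 t(1) u3 by (intro mult_mono) auto
    finally show ?thesis using e 2 by (simp add: mult.commute)
  next
    case 3
    have "1 \<le> u powr p" using 3 p by (simp add: ge_one_powr_ge_zero)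
    then have "exp u \<le> u powr p * exp u" by simp
    then show ?thesis using 3 by (simp add: add_increasing)
  qed
qed

section \<open>Gaussian averages\<close>

abbreviation gaussian :: "real measure" where "gaussian \<equiv> std_normal_distribution"

lemma prob_space_gaussian: "prob_space gaussian"
  using real_dist_normal_dist by (simp add: real_distribution_def)

interpretation gaussian: prob_space gaussian by (rule prob_space_gaussian)

text \<open>Completing the square: tilting by \<open>exp (l * z)\<close> turns the standard density
  into that of mean \<open>l\<close>, up to the factor \<open>exp (l\<^sup>2 / 2)\<close>.\<close>

lemma gaussian_mgf:
  "integrable gaussian (\<lambda>z. exp (l * z))" "(LINT z|gaussian. exp (l * z)) = exp (l\<^sup>2 / 2)"
proof -
  have e: "std_normal_density z * exp (l * z) = exp (l\<^sup>2 / 2) * normal_density l 1 z" for z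
    unfolding std_normal_density_def normal_density_def
    by (simp add: exp_add[symmetric] power2_eq_square field_simps)
  have "integrable lborel (\<lambda>z. std_normal_density z *\<^sub>R exp (l * z))"
    using e by simp
  then show "integrable gaussian (\<lambda>z. exp (l * z))"
    by (subst integrable_density) auto
  have "(LINT z|gaussian. exp (l * z)) = (LINT z|lborel. std_normal_density z *\<^sub>R exp (l * z))"
    by (subst integral_density) auto
  also have "\<dots> = exp (l\<^sup>2 / 2)" using e by simp
  finally show "(LINT z|gaussian. exp (l * z)) = exp (l\<^sup>2 / 2)" .
qed

lemma gaussian_first_moment: "integrable gaussian (\<lambda>z. z)" "(LINT z|gaussian. z) = 0"
  using integrable_std_normal_distribution_moment[of 1]
    integral_std_normal_distribution_moment_odd[of 1] by auto

lemma gaussian_second_moment: "integrable gaussian (\<lambda>z. z\<^sup>2)" "(LINT z|gaussian. z\<^sup>2) = 1"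
  using integrable_std_normal_distribution_moment[of 2]
    std_normal_distribution_even_moments(1)[of 1] by (auto simp: numeral_eq_Suc)

text \<open>The argument \<open>v\<close> is a variance: this is the heat semigroup at time
  \<open>v\<close>. Replacing an independent summand by a centred normal one of variance
  \<open>v\<close> amounts to replacing the test function \<open>f\<close> by
  \<open>gauss_avg v f\<close>.\<close>

definition gauss_avg :: "real \<Rightarrow> (real \<Rightarrow> real) \<Rightarrow> real \<Rightarrow> real" where
  "gauss_avg v f s = (LINT z|gaussian. f (s + sqrt v * z))"

lemma gauss_avg_0 [simp]: "gauss_avg 0 f s = f s"
  by (simp add: gauss_avg_def gaussian.prob_space[simplified])

lemma measurable_gauss_avg [measurable]:
  assumes [measurable]: "f \<in> borel_measurable borel"
  shows "gauss_avg v f \<in> borel_measurable borel"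
  unfolding gauss_avg_def by measurable

lemma integrable_gauss_shift:
  assumes [measurable]: "f \<in> borel_measurable borel" and "\<And>s. \<bar>f s\<bar> \<le> (K::real)"
  shows "integrable gaussian (\<lambda>z. f (s + c * z))"
  by (rule gaussian.integrable_const_bound[where B=K]) (use assms in auto)

lemma gauss_avg_bound:
  assumes [measurable]: "f \<in> borel_measurable borel" and K: "\<And>s. \<bar>f s\<bar> \<le> K"
  shows "\<bar>gauss_avg v f s\<bar> \<le> K"
proof -
  have "\<bar>gauss_avg v f s\<bar> \<le> (LINT z|gaussian. \<bar>f (s + sqrt v * z)\<bar>)"
    unfolding gauss_avg_def by (rule integral_abs_bound)
  also have "\<dots> \<le> (LINT z|gaussian. K)"
    by (intro integral_mono integrable_abs integrable_gauss_shift[where K=K]) (use K in \<open>auto intro: order_trans[OF abs_ge_zero]\<close>)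
  finally show ?thesis by (simp add: gaussian.prob_space[simplified])
qed

text \<open>The sum of independent normal variables with variances \<open>v\<close> and
  \<open>w\<close> is normal with variance \<open>v + w\<close>; the two variables are the
  coordinates of a product space. Zero variances are split off, as they have no density.\<close>

lemma gauss_avg_gauss_avg:
  assumes [measurable]: "f \<in> borel_measurable borel" and K: "\<And>s. \<bar>f s\<bar> \<le> K"
    and v: "0 \<le> v" "0 \<le> w"
  shows "gauss_avg v (gauss_avg w f) s = gauss_avg (v + w) f s"
proof (cases "v = 0 \<or> w = 0")
  case True
  moreover have "gauss_avg 0 f = f" by (rule ext) simp
  ultimately show ?thesis by auto
next
  case False
  with v have vw: "0 < v" "0 < w" by auto
  interpret P: pair_prob_space gaussian gaussian by unfold_locales
  let ?P = "gaussian \<Otimes>\<^sub>M gaussian"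
  have f1: "distr ?P borel fst = gaussian"
    using gaussian.distr_pair_fst[of gaussian] by (simp cong: distr_cong)
  have sn: "distr ?P borel snd = gaussian"
  proof -
    have "distr ?P borel snd = distr (distr (gaussian \<Otimes>\<^sub>M gaussian) ?P (\<lambda>(x, y). (y, x))) borel snd"
      using P.distr_pair_swap by simp
    also have "\<dots> = distr ?P borel (snd \<circ> (\<lambda>(x, y). (y, x)))"
      by (rule distr_distr) auto
    also have "snd \<circ> (\<lambda>(x, y). (y, x)) = fst" by auto
    finally show ?thesis using f1 by simp
  qed
  have D1: "distributed ?P lborel fst std_normal_density"
    unfolding distributed_def using f1 by (auto cong: distr_cong)
  have D2: "distributed ?P lborel snd std_normal_density"
    unfolding distributed_def using sn by (auto cong: distr_cong)
  have ind: "P.indep_var borel fst borel snd"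
    unfolding P.indep_var_distribution_eq f1 sn
    by (auto simp: distr_id2[symmetric] id_def cong: distr_cong)
  have ind': "P.indep_var borel (\<lambda>x. sqrt v * fst x) borel (\<lambda>x. sqrt w * snd x)"
    using P.indep_var_compose[OF ind, of "\<lambda>x. sqrt v * x" borel "\<lambda>x. sqrt w * x" borel]
    by (simp add: comp_def)
  have E1: "distributed ?P lborel (\<lambda>x. sqrt v * fst x) (normal_density 0 (sqrt v))"
    using P.normal_density_affine[OF D1, of "sqrt v" 0] vw by simp
  have E2: "distributed ?P lborel (\<lambda>x. sqrt w * snd x) (normal_density 0 (sqrt w))"
    using P.normal_density_affine[OF D2, of "sqrt w" 0] vw by simp
  have E3: "distributed ?P lborel (\<lambda>x. sqrt v * fst x + sqrt w * snd x) (normal_density 0 (sqrt (v + w)))"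
    using P.add_indep_normal[OF ind' _ _ E1 E2] vw by simp
  have E4: "distributed gaussian lborel (\<lambda>x. sqrt (v + w) * x) (normal_density 0 (sqrt (v + w)))"
  proof -
    have "distributed gaussian lborel (\<lambda>x. x) std_normal_density"
      unfolding distributed_def by (auto simp: distr_id2 cong: distr_cong)
    from gaussian.normal_density_affine[OF this, of "sqrt (v + w)" 0] vw show ?thesis by simp
  qed
  have "gauss_avg v (gauss_avg w f) s = (LINT x|gaussian. LINT y|gaussian. f (s + (sqrt v * x + sqrt w * y)))"
    unfolding gauss_avg_def by (simp add: add.assoc)
  also have "\<dots> = (LINT z|?P. f (s + (sqrt v * fst z + sqrt w * snd z)))"
    by (subst P.integral_fst'[symmetric])
       (auto intro!: P.integrable_const_bound[where B=K] simp: K case_prod_beta)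
  also have "\<dots> = (LINT u|lborel. normal_density 0 (sqrt (v + w)) u * f (s + u))"
    by (rule distributed_integral[OF E3, symmetric]) auto
  also have "\<dots> = (LINT z|gaussian. f (s + sqrt (v + w) * z))"
    by (rule distributed_integral[OF E4]) auto
  finally show ?thesis by (simp add: gauss_avg_def)
qed

text \<open>The constant of the Gaussian half of a replacement step. The factor
  \<open>exp \<bar>z\<bar>\<close> bounds the exponential weight of the Taylor error when
  \<open>l * sqrt v \<le> 1\<close>.\<close>

definition gauss_const :: "real \<Rightarrow> real" where
  "gauss_const p = (LINT z|gaussian. exp \<bar>z\<bar> * \<bar>z\<bar> powr p)"

text \<open>Since \<open>p \<le> 3\<close>, the power is at most
  \<open>1 + \<bar>z\<bar> ^ 3\<close>, and the exponential series gives
  \<open>\<bar>z\<bar> ^ 3 \<le> 6 * exp \<bar>z\<bar>\<close>. This leaves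
  \<open>7 * exp (2 * \<bar>z\<bar>)\<close>, dominated by the moment generating functions at 2 and
  -2.\<close>

lemma gauss_const_integrable:
  assumes p: "2 \<le> p" "p \<le> 3"
  shows "integrable gaussian (\<lambda>z. exp \<bar>z\<bar> * \<bar>z\<bar> powr p)"
proof (rule Bochner_Integration.integrable_bound)
  show "integrable gaussian (\<lambda>z. 7 * (exp (2 * z) + exp (- 2 * z)))"
    using gaussian_mgf(1)[of 2] gaussian_mgf(1)[of "-2"] by auto
  show "AE z in gaussian. norm (exp \<bar>z\<bar> * \<bar>z\<bar> powr p) \<le> norm (7 * (exp (2 * z) + exp (- 2 * z)))"
  proof (rule AE_I2)
    fix z :: real
    have "\<bar>z\<bar> powr p \<le> 1 + \<bar>z\<bar> ^ 3"
    proof (cases "\<bar>z\<bar> \<le> 1")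
      case True
      then have "\<bar>z\<bar> powr p \<le> 1" using p by (simp add: powr_le1)
      then show ?thesis by (simp add: add_increasing2)
    next
      case False
      then have "\<bar>z\<bar> powr p \<le> \<bar>z\<bar> powr 3" using p by (intro powr_mono) auto
      also have "\<dots> = \<bar>z\<bar> ^ 3" using False by (simp add: powr_numeral)
      finally show ?thesis by simp
    qed
    also have "\<bar>z\<bar> ^ 3 \<le> 6 * exp \<bar>z\<bar>"
    proof -
      have "(\<bar>z\<bar> ^ 3 / fact 3) \<le> exp \<bar>z\<bar>"
      proof -
        obtain t where "exp \<bar>z\<bar> = (\<Sum>m<4. \<bar>z\<bar> ^ m / fact m) + exp t / fact 4 * \<bar>z\<bar> ^ 4"
          using Maclaurin_exp_le[of "\<bar>z\<bar>" 4] by blast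
        moreover have "0 \<le> exp t / fact 4 * \<bar>z\<bar> ^ 4" by simp
        moreover have "(\<Sum>m<4. \<bar>z\<bar> ^ m / fact m) = 1 + \<bar>z\<bar> + \<bar>z\<bar>\<^sup>2 / 2 + \<bar>z\<bar> ^ 3 / fact 3"
          by (simp add: eval_nat_numeral)
        moreover have "0 \<le> 1 + \<bar>z\<bar> + \<bar>z\<bar>\<^sup>2 / 2" by simp
        ultimately show ?thesis by linarith
      qed
      then show ?thesis by (simp add: eval_nat_numeral)
    qed
    finally have "\<bar>z\<bar> powr p \<le> 7 * exp \<bar>z\<bar>" using one_le_exp_iff[of "\<bar>z\<bar>"] by linarith
    then have "exp \<bar>z\<bar> * \<bar>z\<bar> powr p \<le> exp \<bar>z\<bar> * (7 * exp \<bar>z\<bar>)" by (intro mult_left_mono) auto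
    also have "\<dots> = 7 * exp (2 * \<bar>z\<bar>)" by (simp add: mult_exp_exp)
    also have "\<dots> \<le> 7 * (exp (2 * z) + exp (- 2 * z))" by (auto simp: abs_if)
    finally show "norm (exp \<bar>z\<bar> * \<bar>z\<bar> powr p) \<le> norm (7 * (exp (2 * z) + exp (- 2 * z)))"
      by simp
  qed
qed auto

text \<open>A quantitative second-order expansion with exponentially growing error. Unlike
  differentiability, it passes to Gaussian averages simply by integrating the inequalities.\<close>

definition taylor2 ::
    "real \<Rightarrow> real \<Rightarrow> real \<Rightarrow> (real \<Rightarrow> real) \<Rightarrow> (real \<Rightarrow> real) \<Rightarrow> (real \<Rightarrow> real) \<Rightarrow> bool" where
  "taylor2 p l B f f1 f2 \<longleftrightarrow>
     f \<in> borel_measurable borel \<and> f1 \<in> borel_measurable borel \<and> f2 \<in> borel_measurable borel \<and>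
     (\<exists>K. \<forall>s. \<bar>f s\<bar> \<le> K \<and> \<bar>f1 s\<bar> \<le> K \<and> \<bar>f2 s\<bar> \<le> K) \<and>
     (\<forall>s. \<bar>f1 s\<bar> \<le> B * exp (l * s)) \<and> (\<forall>s. \<bar>f2 s\<bar> \<le> B * exp (l * s)) \<and>
     (\<forall>s y. \<bar>f (s + y) - f s - f1 s * y - f2 s * y\<^sup>2 / 2\<bar>
              \<le> B * exp (l * s) * (exp (l * max y 0) * \<bar>y\<bar> powr p))"

text \<open>Averaging the bounding function \<open>exp (l * s)\<close> multiplies it by its Gaussian
  mean \<open>exp (l\<^sup>2 * v / 2)\<close>; the boundedness by \<open>K\<close> only secures
  integrability.\<close>

lemma gauss_avg_exp_bound:
  assumes [measurable]: "g \<in> borel_measurable borel" and K: "\<And>s. \<bar>g s\<bar> \<le> K"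
    and b: "\<And>s. \<bar>g s\<bar> \<le> c * exp (l * s)" and v: "0 \<le> v"
  shows "\<bar>gauss_avg v g s\<bar> \<le> c * exp (l\<^sup>2 * v / 2) * exp (l * s)"
proof -
  have e: "c * exp (l * (s + sqrt v * z)) = c * exp (l * s) * exp ((l * sqrt v) * z)" for z
    by (simp add: exp_add[symmetric] algebra_simps)
  have le: "\<bar>g (s + sqrt v * z)\<bar> \<le> c * exp (l * s) * exp ((l * sqrt v) * z)" for z
    using b[of "s + sqrt v * z"] unfolding e .
  have "\<bar>gauss_avg v g s\<bar> \<le> (LINT z|gaussian. \<bar>g (s + sqrt v * z)\<bar>)"
    unfolding gauss_avg_def by (rule integral_abs_bound)
  also have "\<dots> \<le> (LINT z|gaussian. c * exp (l * s) * exp ((l * sqrt v) * z))"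
    by (intro integral_mono integrable_abs integrable_gauss_shift[where K=K] integrable_mult_right
        gaussian_mgf(1)) (use K le in auto)
  also have "\<dots> = c * exp (l * s) * exp ((l * sqrt v)\<^sup>2 / 2)"
    by (simp add: gaussian_mgf(2))
  also have "(l * sqrt v)\<^sup>2 = l\<^sup>2 * v" using v by (simp add: power_mult_distrib)
  finally show ?thesis by (simp add: mult_ac)
qed

text \<open>The expansion is linear in \<open>f\<close>, \<open>f1\<close>, \<open>f2\<close>, so
  averaging it keeps its form, with the averages of \<open>f1\<close> and \<open>f2\<close> as
  coefficients. Only the weight changes, by \<open>exp (l\<^sup>2 * v / 2)\<close>; it is this
  closure that lets the replacement be iterated.\<close>

lemma taylor2_gauss_avg:
  assumes t: "taylor2 p l B f f1 f2" and v: "0 \<le> v"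
  shows "taylor2 p l (B * exp (l\<^sup>2 * v / 2)) (gauss_avg v f) (gauss_avg v f1) (gauss_avg v f2)"
proof -
  note m = t[unfolded taylor2_def]
  have [measurable]: "f \<in> borel_measurable borel" "f1 \<in> borel_measurable borel" "f2 \<in> borel_measurable borel"
    using m by auto
  obtain K where K: "\<And>s. \<bar>f s\<bar> \<le> K" "\<And>s. \<bar>f1 s\<bar> \<le> K" "\<And>s. \<bar>f2 s\<bar> \<le> K" using m by blast
  have B: "\<And>s. \<bar>f1 s\<bar> \<le> B * exp (l * s)" "\<And>s. \<bar>f2 s\<bar> \<le> B * exp (l * s)" using m by auto
  have T: "\<bar>f (s + y) - f s - f1 s * y - f2 s * y\<^sup>2 / 2\<bar>
              \<le> (B * (exp (l * max y 0) * \<bar>y\<bar> powr p)) * exp (l * s)" for s y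
  proof -
    have "\<bar>f (s + y) - f s - f1 s * y - f2 s * y\<^sup>2 / 2\<bar> \<le> B * exp (l * s) * (exp (l * max y 0) * \<bar>y\<bar> powr p)"
      using m by blast
    then show ?thesis by (simp add: mult_ac)
  qed
  have "\<bar>gauss_avg v f (s + y) - gauss_avg v f s - gauss_avg v f1 s * y - gauss_avg v f2 s * y\<^sup>2 / 2\<bar>
     \<le> B * exp (l\<^sup>2 * v / 2) * exp (l * s) * (exp (l * max y 0) * \<bar>y\<bar> powr p)" for s y
  proof -
    define g where "g s = f (s + y) - f s - f1 s * y - f2 s * y\<^sup>2 / 2" for s
    have [measurable]: "g \<in> borel_measurable borel" unfolding g_def by measurable
    have gK: "\<bar>g s\<bar> \<le> K + K + K * \<bar>y\<bar> + K * y\<^sup>2 / 2" for s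
    proof -
      have "\<bar>f1 s * y\<bar> \<le> K * \<bar>y\<bar>" "\<bar>f2 s * y\<^sup>2 / 2\<bar> \<le> K * y\<^sup>2 / 2"
        using K by (auto simp: abs_mult intro!: mult_right_mono divide_right_mono)
      then show ?thesis unfolding g_def using K(1)[of s] K(1)[of "s + y"] by linarith
    qed
    have "gauss_avg v g s = gauss_avg v f (s + y) - gauss_avg v f s - gauss_avg v f1 s * y - gauss_avg v f2 s * y\<^sup>2 / 2"
    proof -
      have i: "integrable gaussian (\<lambda>z. f (s + y + sqrt v * z))" "integrable gaussian (\<lambda>z. f (s + sqrt v * z))"
        "integrable gaussian (\<lambda>z. f1 (s + sqrt v * z))" "integrable gaussian (\<lambda>z. f2 (s + sqrt v * z))"
        using K by (auto intro!: integrable_gauss_shift)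
      have "gauss_avg v g s = (LINT z|gaussian. f (s + y + sqrt v * z) - f (s + sqrt v * z)
          - f1 (s + sqrt v * z) * y - f2 (s + sqrt v * z) * y\<^sup>2 / 2)"
        unfolding gauss_avg_def g_def by (simp add: add_ac)
      also have "\<dots> = gauss_avg v f (s + y) - gauss_avg v f s - gauss_avg v f1 s * y - gauss_avg v f2 s * y\<^sup>2 / 2"
        unfolding gauss_avg_def using i by simp
      finally show ?thesis .
    qed
    moreover have "\<bar>gauss_avg v g s\<bar> \<le> (B * (exp (l * max y 0) * \<bar>y\<bar> powr p)) * exp (l\<^sup>2 * v / 2) * exp (l * s)"
      by (rule gauss_avg_exp_bound[OF _ gK _ v]) (use T g_def in auto)
    ultimately show ?thesis by (simp add: mult_ac)
  qed
  moreover have "\<exists>K. \<forall>s. \<bar>gauss_avg v f s\<bar> \<le> K \<and> \<bar>gauss_avg v f1 s\<bar> \<le> K \<and> \<bar>gauss_avg v f2 s\<bar> \<le> K"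
    using K by (intro exI[of _ K]) (auto intro!: gauss_avg_bound)
  moreover have "\<bar>gauss_avg v f1 s\<bar> \<le> B * exp (l\<^sup>2 * v / 2) * exp (l * s)"
    "\<bar>gauss_avg v f2 s\<bar> \<le> B * exp (l\<^sup>2 * v / 2) * exp (l * s)" for s
    using K B v by (auto intro!: gauss_avg_exp_bound)
  ultimately show ?thesis unfolding taylor2_def by simp
qed

text \<open>The linear term of the expansion has Gaussian mean 0 and the quadratic one gives
  \<open>f2 s * v / 2\<close>. In the remainder \<open>l * sqrt v \<le> 1\<close> reduces the weight
  to \<open>exp \<bar>z\<bar>\<close>, and scaling extracts \<open>v powr (p / 2)\<close>.\<close>

lemma taylor2_gauss_step:
  assumes t: "taylor2 p l B f f1 f2" and v: "0 \<le> v" and l: "0 \<le> l" "l * sqrt v \<le> 1"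
    and p: "2 \<le> p" "p \<le> 3"
  shows "\<bar>gauss_avg v f s - f s - f2 s * v / 2\<bar> \<le> B * exp (l * s) * (v powr (p / 2) * gauss_const p)"
proof -
  note m = t[unfolded taylor2_def]
  have [measurable]: "f \<in> borel_measurable borel" "f1 \<in> borel_measurable borel" "f2 \<in> borel_measurable borel"
    using m by auto
  obtain K where K: "\<And>s. \<bar>f s\<bar> \<le> K" using m by blast
  have T: "\<bar>f (s + y) - f s - f1 s * y - f2 s * y\<^sup>2 / 2\<bar>
              \<le> B * exp (l * s) * (exp (l * max y 0) * \<bar>y\<bar> powr p)" for s y
    using m by blast
  have "\<bar>f1 s\<bar> \<le> B * exp (l * s)" using m by simp
  then have B: "0 \<le> B * exp (l * s)" using abs_ge_zero[of "f1 s"] by linarith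
  have i: "integrable gaussian (\<lambda>z. f (s + sqrt v * z))" using K by (rule integrable_gauss_shift[rotated]) auto
  have "gauss_avg v f s - f s - f2 s * v / 2
      = (LINT z|gaussian. f (s + sqrt v * z) - f s - f1 s * sqrt v * z - f2 s * v / 2 * z\<^sup>2)"
    using i gaussian_first_moment gaussian_second_moment
    by (simp add: gauss_avg_def gaussian.prob_space[simplified])
  also have "\<dots> = (LINT z|gaussian. f (s + sqrt v * z) - f s - f1 s * (sqrt v * z) - f2 s * (sqrt v * z)\<^sup>2 / 2)"
    using v by (simp add: power_mult_distrib mult_ac)
  finally have "\<bar>gauss_avg v f s - f s - f2 s * v / 2\<bar> =
    \<bar>LINT z|gaussian. f (s + sqrt v * z) - f s - f1 s * (sqrt v * z) - f2 s * (sqrt v * z)\<^sup>2 / 2\<bar>"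
    by simp
  also have "\<dots> \<le> (LINT z|gaussian. \<bar>f (s + sqrt v * z) - f s - f1 s * (sqrt v * z) - f2 s * (sqrt v * z)\<^sup>2 / 2\<bar>)"
    by (rule integral_abs_bound)
  also have "\<dots> \<le> (LINT z|gaussian. B * exp (l * s) * v powr (p / 2) * (exp \<bar>z\<bar> * \<bar>z\<bar> powr p))"
  proof (intro integral_mono)
    have "(\<lambda>z. f (s + sqrt v * z) - f s - f1 s * (sqrt v * z) - f2 s * (sqrt v * z)\<^sup>2 / 2) =
      (\<lambda>z. f (s + sqrt v * z) - f s - f1 s * sqrt v * z - f2 s * v / 2 * z\<^sup>2)"
      using v by (simp add: power_mult_distrib mult_ac)
    moreover have "integrable gaussian (\<lambda>z. f (s + sqrt v * z) - f s - f1 s * sqrt v * z - f2 s * v / 2 * z\<^sup>2)"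
      using i gaussian_first_moment gaussian_second_moment by auto
    ultimately show "integrable gaussian (\<lambda>z. \<bar>f (s + sqrt v * z) - f s - f1 s * (sqrt v * z) - f2 s * (sqrt v * z)\<^sup>2 / 2\<bar>)"
      by simp
    show "integrable gaussian (\<lambda>z. B * exp (l * s) * v powr (p / 2) * (exp \<bar>z\<bar> * \<bar>z\<bar> powr p))"
      using gauss_const_integrable[OF p] by simp
    fix z :: real
    have e: "exp (l * max (sqrt v * z) 0) \<le> exp \<bar>z\<bar>"
    proof -
      have "l * max (sqrt v * z) 0 \<le> l * (sqrt v * \<bar>z\<bar>)"
        using l v by (intro mult_left_mono) (auto intro!: mult_left_mono)
      also have "\<dots> \<le> 1 * \<bar>z\<bar>" unfolding mult.assoc[symmetric] using l by (intro mult_right_mono) auto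
      finally show ?thesis by simp
    qed
    have q: "\<bar>sqrt v * z\<bar> powr p = v powr (p / 2) * \<bar>z\<bar> powr p"
      using v by (simp add: abs_mult powr_mult powr_half_sqrt[symmetric] powr_powr)
    have "\<bar>f (s + sqrt v * z) - f s - f1 s * (sqrt v * z) - f2 s * (sqrt v * z)\<^sup>2 / 2\<bar>
       \<le> B * exp (l * s) * (exp (l * max (sqrt v * z) 0) * \<bar>sqrt v * z\<bar> powr p)" by (rule T)
    also have "\<dots> \<le> B * exp (l * s) * (exp \<bar>z\<bar> * \<bar>sqrt v * z\<bar> powr p)"
      using B e by (intro mult_left_mono mult_right_mono) auto
    finally show "\<bar>f (s + sqrt v * z) - f s - f1 s * (sqrt v * z) - f2 s * (sqrt v * z)\<^sup>2 / 2\<bar>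
       \<le> B * exp (l * s) * v powr (p / 2) * (exp \<bar>z\<bar> * \<bar>z\<bar> powr p)"
      unfolding q by (simp add: mult_ac)
  qed
  also have "\<dots> = B * exp (l * s) * (v powr (p / 2) * gauss_const p)"
    by (simp add: gauss_const_def)
  finally show ?thesis .
qed

section \<open>The normal tail\<close>

definition normal_tail :: "real \<Rightarrow> real" where "normal_tail x = 1 - std_normal_cdf x"

interpretation gaussian: real_distribution gaussian by (rule real_dist_normal_dist)

lemma normal_tail_eq: "normal_tail x = measure gaussian {x<..}"
proof -
  have "measure gaussian {x<..} = measure gaussian (space gaussian - {..x})"
    by (rule arg_cong[where f="measure gaussian"]) auto
  also have "\<dots> = 1 - measure gaussian {..x}" by (rule gaussian.prob_compl) simp
  finally show ?thesis by (simp add: normal_tail_def std_normal_cdf_def cdf_def)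
qed

lemma normal_tail_nonneg: "0 \<le> normal_tail x" and normal_tail_le_1: "normal_tail x \<le> 1"
  by (auto simp: normal_tail_eq gaussian.prob_le_1[simplified])

lemma normal_tail_mono: "a \<le> b \<Longrightarrow> normal_tail b \<le> normal_tail a"
  unfolding normal_tail_eq by (intro gaussian.finite_measure_mono) auto

lemma normal_tail_diff:
  assumes "a \<le> b" shows "normal_tail a - normal_tail b = measure gaussian {a<..b}"
proof (cases "a = b")
  case False
  then have "cdf gaussian b - cdf gaussian a = measure gaussian {a<..b}"
    using gaussian.cdf_diff_eq[of a b] assms by simp
  then show ?thesis by (simp add: normal_tail_def std_normal_cdf_def)
qed simp

lemma gaussian_interval_le:
  assumes "a \<le> b" "\<And>z. a \<le> z \<Longrightarrow> z \<le> b \<Longrightarrow> std_normal_density z \<le> C"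
  shows "measure gaussian {a<..b} \<le> C * (b - a)"
proof -
  have C: "0 \<le> C" using assms(2)[of a] assms(1) normal_density_nonneg[of 0 1 a] by linarith
  have "emeasure gaussian {a<..b} = (\<integral>\<^sup>+z. ennreal (std_normal_density z) * indicator {a<..b} z \<partial>lborel)"
    by (subst emeasure_density) auto
  also have "\<dots> \<le> (\<integral>\<^sup>+z. ennreal C * indicator {a<..b} z \<partial>lborel)"
    by (intro nn_integral_mono) (use assms in \<open>auto simp: indicator_def intro!: ennreal_leI\<close>)
  also have "\<dots> = ennreal (C * (b - a))"
    using assms C by (simp add: nn_integral_cmult_indicator ennreal_mult'[symmetric])
  finally show ?thesis
    using C assms by (simp add: gaussian.emeasure_eq_measure[simplified])
qed

lemma gaussian_interval_ge:
  assumes "a \<le> b" "0 \<le> C" "\<And>z. a \<le> z \<Longrightarrow> z \<le> b \<Longrightarrow> C \<le> std_normal_density z"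
  shows "C * (b - a) \<le> measure gaussian {a<..b}"
proof -
  have "ennreal (C * (b - a)) = (\<integral>\<^sup>+z. ennreal C * indicator {a<..b} z \<partial>lborel)"
    using assms by (simp add: nn_integral_cmult_indicator ennreal_mult'[symmetric])
  also have "\<dots> \<le> (\<integral>\<^sup>+z. ennreal (std_normal_density z) * indicator {a<..b} z \<partial>lborel)"
    by (intro nn_integral_mono) (use assms in \<open>auto simp: indicator_def intro!: ennreal_leI\<close>)
  also have "\<dots> = emeasure gaussian {a<..b}"
    by (subst emeasure_density) auto
  finally show ?thesis
    using assms by (simp add: gaussian.emeasure_eq_measure[simplified])
qed

lemma std_normal_density_le:
  assumes "x\<^sup>2 \<le> z\<^sup>2 + 2 * c" shows "std_normal_density z \<le> std_normal_density x * exp c"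
proof -
  have "exp (- z\<^sup>2 / 2) \<le> exp (- x\<^sup>2 / 2 + c)" using assms by simp
  then have "exp (- z\<^sup>2 / 2) \<le> exp (- x\<^sup>2 / 2) * exp c" by (simp only: exp_add)
  then have "1 / sqrt (2 * pi) * exp (- z\<^sup>2 / 2) \<le> 1 / sqrt (2 * pi) * (exp (- x\<^sup>2 / 2) * exp c)"
    by (rule mult_left_mono) simp
  then show ?thesis unfolding std_normal_density_def by (simp only: mult.assoc)
qed

text \<open>On \<open>{x - d..x}\<close> the density is at most \<open>exp (x * d)\<close> times its
  value at \<open>x\<close>. So moving the threshold by \<open>d\<close> costs an amount of order
  \<open>d\<close> relative to the density, as long as \<open>x * d\<close> is bounded.\<close>

lemma normal_tail_shift_left:
  assumes "0 \<le> x" "0 \<le> d"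
  shows "normal_tail (x - d) - normal_tail x \<le> std_normal_density x * exp (x * d) * d"
proof -
  have "normal_tail (x - d) - normal_tail x = measure gaussian {x - d<..x}"
    using assms by (intro normal_tail_diff) auto
  also have "\<dots> \<le> std_normal_density x * exp (x * d) * (x - (x - d))"
  proof (rule gaussian_interval_le)
    fix z assume z: "x - d \<le> z" "z \<le> x"
    have "x\<^sup>2 - z\<^sup>2 = 2 * x * (x - z) - (x - z)\<^sup>2" by (simp add: power2_eq_square algebra_simps)
    also have "\<dots> \<le> 2 * x * d" using z assms
      by (smt (verit) mult_left_mono zero_le_power2)
    finally show "std_normal_density z \<le> std_normal_density x * exp (x * d)"
      by (intro std_normal_density_le) simp
  qed (use assms in auto)
  finally show ?thesis by simp
qed

lemma normal_tail_shift_right: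
  assumes "0 \<le> x" "0 \<le> d"
  shows "normal_tail x - normal_tail (x + d) \<le> std_normal_density x * d"
proof -
  have "normal_tail x - normal_tail (x + d) = measure gaussian {x<..x + d}"
    using assms by (intro normal_tail_diff) auto
  also have "\<dots> \<le> std_normal_density x * (x + d - x)"
  proof (rule gaussian_interval_le)
    fix z assume z: "x \<le> z" "z \<le> x + d"
    have "x\<^sup>2 \<le> z\<^sup>2" using z assms by (intro power_mono) auto
    then show "std_normal_density z \<le> std_normal_density x"
      using std_normal_density_le[of x z 0] by simp
  qed (use assms in auto)
  finally show ?thesis by simp
qed

text \<open>Over the interval of length \<open>1 / (1 + x)\<close> to the right of \<open>x\<close> the density drops by at most a
  constant factor.\<close>

lemma normal_tail_ge:
  assumes "0 \<le> x"
  shows "exp (- 3 / 2) * std_normal_density x / (1 + x) \<le> normal_tail x"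
proof -
  have "std_normal_density x * exp (- 3 / 2) * (x + 1 / (1 + x) - x)
      \<le> measure gaussian {x<..x + 1 / (1 + x)}"
  proof (rule gaussian_interval_ge)
    fix z assume z: "x \<le> z" "z \<le> x + 1 / (1 + x)"
    have "z\<^sup>2 \<le> (x + 1 / (1 + x))\<^sup>2" using z assms by (intro power_mono) auto
    also have "\<dots> = x\<^sup>2 + 2 * (x / (1 + x)) + (1 / (1 + x))\<^sup>2"
      by (simp add: power2_eq_square algebra_simps)
    \<comment> \<open>The cross term adds at most 2 and the last square at most 1, so the exponent
      of the density drops by at most 3 / 2.\<close>
    also have "x / (1 + x) \<le> 1" using assms by simp
    also have "(1 / (1 + x))\<^sup>2 \<le> 1" using assms by (intro power_le_one) auto
    finally have "z\<^sup>2 \<le> x\<^sup>2 + 2 * (3 / 2)" by simp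
    from std_normal_density_le[OF this]
    have "std_normal_density x \<le> std_normal_density z * exp (3 / 2)" .
    then have "std_normal_density x * exp (- 3 / 2) \<le> std_normal_density z * exp (3 / 2) * exp (- 3 / 2)"
      by (rule mult_right_mono) simp
    then show "std_normal_density x * exp (- 3 / 2) \<le> std_normal_density z"
      by (simp add: mult.assoc exp_add[symmetric])
  qed (use assms in auto)
  also have "\<dots> \<le> normal_tail x"
    unfolding normal_tail_eq by (intro gaussian.finite_measure_mono) auto
  finally show ?thesis by (simp add: mult.commute)
qed

lemma normal_tail_pos: assumes "0 \<le> x" shows "0 < normal_tail x"
proof -
  have "0 < exp (- 3 / 2) * std_normal_density x / (1 + x)"
    using assms by (intro divide_pos_pos mult_pos_pos normal_density_pos) auto
  then show ?thesis using normal_tail_ge[OF assms] by linarith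
qed

text \<open>Exponential Markov bound with rate \<open>x\<close>, the optimal one.\<close>

lemma normal_tail_le_exp:
  assumes "0 \<le> x" shows "normal_tail x \<le> exp (- x\<^sup>2 / 2)"
proof -
  have "normal_tail x = (LINT z|gaussian. indicator {x<..} z)" by (simp add: normal_tail_eq)
  also have "\<dots> \<le> (LINT z|gaussian. exp (- x\<^sup>2) * exp (x * z))"
  proof (intro integral_mono integrable_mult_right gaussian_mgf(1))
    show "integrable gaussian (indicator {x<..} :: real \<Rightarrow> real)"
      by (intro gaussian.integrable_const_bound[where B=1]) auto
    fix z :: real
    have "1 \<le> exp (- x\<^sup>2) * exp (x * z)" if "x < z"
      using that assms by (auto simp: exp_add[symmetric] power2_eq_square intro!: mult_left_mono)
    then show "indicator {x<..} z \<le> exp (- x\<^sup>2) * exp (x * z)" by (auto simp: indicator_def)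
  qed
  also have "\<dots> = exp (- x\<^sup>2) * exp (x\<^sup>2 / 2)" by (simp add: gaussian_mgf(2))
  also have "\<dots> = exp (- x\<^sup>2 / 2)" by (simp add: exp_add[symmetric] field_simps)
  finally show ?thesis .
qed

text \<open>The density is at most 1, so the tail is 1-Lipschitz. Continuity serves the two limits
  at the end: block length to infinity and threshold shift to 0.\<close>

lemma isCont_normal_tail: "isCont normal_tail x"
proof -
  have b: "std_normal_density z \<le> 1" for z
  proof -
    have "std_normal_density z \<le> std_normal_density 0 * exp 0" by (intro std_normal_density_le) simp
    also have "\<dots> \<le> 1" using pi_ge_two by (simp add: std_normal_density_def)
    finally show ?thesis .
  qed
  have "\<bar>normal_tail a - normal_tail b\<bar> \<le> 1 * dist a b" for a b
  proof (induction a b rule: linorder_wlog)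
    case (le a b)
    have "normal_tail a - normal_tail b \<le> 1 * (b - a)"
      unfolding normal_tail_diff[OF le] by (intro gaussian_interval_le le b)
    then show ?case using normal_tail_mono[OF le] le by (simp add: dist_real_def)
  qed (simp add: dist_commute abs_minus_commute)
  then have "1-lipschitz_on UNIV normal_tail"
    by (intro lipschitz_onI) (auto simp: dist_real_def)
  then have "continuous_on UNIV normal_tail" by (rule lipschitz_on_continuous_on)
  then show ?thesis by (simp add: continuous_on_eq_continuous_at)
qed

section \<open>A smooth indicator function\<close>

text \<open>The distribution function of the sum of three independent uniform variables on
  \<open>{0..1}\<close>: a cubic spline rising from 0 at 0 to 1 at 3. Its second derivative is
  Lipschitz, which is what a Taylor remainder of order up to 3 asks for.\<close>

definition ramp :: "real \<Rightarrow> real" where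
  "ramp u = ((max 0 u)^3 - 3 * (max 0 (u - 1))^3 + 3 * (max 0 (u - 2))^3 - (max 0 (u - 3))^3) / 6"
definition ramp' :: "real \<Rightarrow> real" where
  "ramp' u = ((max 0 u)\<^sup>2 - 3 * (max 0 (u - 1))\<^sup>2 + 3 * (max 0 (u - 2))\<^sup>2 - (max 0 (u - 3))\<^sup>2) / 2"
definition ramp'' :: "real \<Rightarrow> real" where
  "ramp'' u = max 0 u - 3 * max 0 (u - 1) + 3 * max 0 (u - 2) - max 0 (u - 3)"

text \<open>At the knot \<open>u = c\<close> the difference quotient is bounded by
  \<open>\<bar>h\<bar> ^ Suc n\<close> and tends to 0; the form \<open>Suc (Suc n)\<close> keeps the
  exponent at least 2, where this works.\<close>

lemma DERIV_max_0_power: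
  "((\<lambda>u. (max 0 (u - c)) ^ Suc (Suc n)) has_field_derivative
     real (Suc (Suc n)) * (max 0 (u - c)) ^ Suc n) (at (u::real))"
proof -
  consider "u < c" | "u > c" | "u = c" by linarith
  then show ?thesis
  proof cases
    case 1
    have "eventually (\<lambda>x. x < c) (nhds u)" using 1 by (rule eventually_nhds_in_open[of "{..<c}", simplified])
    then have "eventually (\<lambda>x. (max 0 (x - c)) ^ Suc (Suc n) = 0) (nhds u)"
      by eventually_elim auto
    then have "((\<lambda>u. (max 0 (u - c)) ^ Suc (Suc n)) has_field_derivative 0) (at u)"
      using DERIV_cong_ev[of u u "\<lambda>u. (max 0 (u - c)) ^ Suc (Suc n)" "\<lambda>_. 0" 0 0] by simp
    then show ?thesis using 1 by simp
  next
    case 2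
    have "((\<lambda>u. (u - c) ^ Suc (Suc n)) has_field_derivative real (Suc (Suc n)) * (u - c) ^ Suc n) (at u)"
      by (rule DERIV_cong, rule DERIV_power[where f="\<lambda>u. u - c" and D=1])
        (auto intro!: derivative_eq_intros)
    moreover have "eventually (\<lambda>x. c < x) (nhds u)" using 2 by (rule eventually_nhds_in_open[of "{c<..}", simplified])
    then have "eventually (\<lambda>x. (max 0 (x - c)) ^ Suc (Suc n) = (x - c) ^ Suc (Suc n)) (nhds u)"
      by eventually_elim auto
    ultimately show ?thesis using 2 by (subst DERIV_cong_ev[OF refl _ refl]) auto
  next
    case 3
    have "(\<lambda>h. (max 0 h) ^ Suc (Suc n) / h) \<midarrow>0\<rightarrow> (0::real)"
    proof (rule Lim_null_comparison)
      show "\<forall>\<^sub>F h in at 0. norm ((max 0 h) ^ Suc (Suc n) / h) \<le> \<bar>h\<bar> ^ Suc n"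
      proof (rule always_eventually, rule allI)
        fix h :: real
        show "norm ((max 0 h) ^ Suc (Suc n) / h) \<le> \<bar>h\<bar> ^ Suc n"
          by (cases "h \<le> 0") (auto simp: max_def intro: mult_nonpos_nonneg)
      qed
      show "(\<lambda>h::real. \<bar>h\<bar> ^ Suc n) \<midarrow>0\<rightarrow> 0" by (auto intro!: tendsto_eq_intros)
    qed
    then show ?thesis using 3 by (simp add: DERIV_def)
  qed
qed

lemma DERIV_ramp: "(ramp has_field_derivative ramp' u) (at u)"
proof -
  have D: "((\<lambda>u. (max 0 (u - c)) ^ 3) has_field_derivative 3 * (max 0 (u - c))\<^sup>2) (at u)" for c
    using DERIV_max_0_power[of c 1 u] by (simp add: numeral_eq_Suc)
  have "((\<lambda>u. ((max 0 (u - 0))^3 - 3 * (max 0 (u - 1))^3 + 3 * (max 0 (u - 2))^3 - (max 0 (u - 3))^3) / 6)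
    has_field_derivative (3 * (max 0 (u - 0))\<^sup>2 - 3 * (3 * (max 0 (u - 1))\<^sup>2) + 3 * (3 * (max 0 (u - 2))\<^sup>2)
       - 3 * (max 0 (u - 3))\<^sup>2) / 6) (at u)"
    by (intro DERIV_cdivide DERIV_diff DERIV_add DERIV_cmult D)
  then have "(ramp has_field_derivative (3 * (max 0 (u - 0))\<^sup>2 - 3 * (3 * (max 0 (u - 1))\<^sup>2) + 3 * (3 * (max 0 (u - 2))\<^sup>2)
       - 3 * (max 0 (u - 3))\<^sup>2) / 6) (at u)" unfolding ramp_def[abs_def] diff_0_right .
  then show ?thesis by (rule DERIV_cong) (simp add: ramp'_def)
qed

lemma DERIV_ramp': "(ramp' has_field_derivative ramp'' u) (at u)"
proof -
  have D: "((\<lambda>u. (max 0 (u - c))\<^sup>2) has_field_derivative 2 * (max 0 (u - c))) (at u)" for c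
    using DERIV_max_0_power[of c 0 u] by (simp add: numeral_eq_Suc)
  have "((\<lambda>u. ((max 0 (u - 0))\<^sup>2 - 3 * (max 0 (u - 1))\<^sup>2 + 3 * (max 0 (u - 2))\<^sup>2 - (max 0 (u - 3))\<^sup>2) / 2)
    has_field_derivative (2 * (max 0 (u - 0)) - 3 * (2 * (max 0 (u - 1))) + 3 * (2 * (max 0 (u - 2)))
       - 2 * (max 0 (u - 3))) / 2) (at u)"
    by (intro DERIV_cdivide DERIV_diff DERIV_add DERIV_cmult D)
  then have "(ramp' has_field_derivative (2 * (max 0 (u - 0)) - 3 * (2 * (max 0 (u - 1))) + 3 * (2 * (max 0 (u - 2)))
       - 2 * (max 0 (u - 3))) / 2) (at u)" unfolding ramp'_def[abs_def] diff_0_right .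
  then show ?thesis by (rule DERIV_cong) (simp add: ramp''_def)
qed

lemma ramp_cases:
  obtains "u \<le> 0" "ramp' u = 0" "ramp'' u = 0" | "0 \<le> u" "u \<le> 1" "ramp' u = u\<^sup>2 / 2" "ramp'' u = u"
  | "1 \<le> u" "u \<le> 2" "ramp' u = 3 / 4 - (u - 3 / 2)\<^sup>2" "ramp'' u = 3 - 2 * u"
  | "2 \<le> u" "u \<le> 3" "ramp' u = (3 - u)\<^sup>2 / 2" "ramp'' u = u - 3"
  | "3 \<le> u" "ramp' u = 0" "ramp'' u = 0"
proof -
  consider "u \<le> 0" | "0 \<le> u" "u \<le> 1" | "1 \<le> u" "u \<le> 2" | "2 \<le> u" "u \<le> 3" | "3 \<le> u"
    by linarith
  then show thesis
  proof cases
    case 1 then show thesis by (intro that(1)) (auto simp: ramp'_def ramp''_def)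
  next
    case 2 then show thesis by (intro that(2)) (auto simp: ramp'_def ramp''_def max_def)
  next
    case 3
    then have "ramp' u = (u\<^sup>2 - 3 * (u - 1)\<^sup>2) / 2" by (simp add: ramp'_def max_def)
    also have "\<dots> = 3 / 4 - (u - 3 / 2)\<^sup>2" by (simp add: power2_eq_square algebra_simps add_divide_distrib diff_divide_distrib)
    finally show thesis using 3 by (intro that(3)) (auto simp: ramp''_def)
  next
    case 4
    then have "ramp' u = (u\<^sup>2 - 3 * (u - 1)\<^sup>2 + 3 * (u - 2)\<^sup>2) / 2" by (simp add: ramp'_def max_def)
    also have "\<dots> = (3 - u)\<^sup>2 / 2" by (simp add: power2_eq_square algebra_simps)
    finally show thesis using 4 by (intro that(4)) (auto simp: ramp''_def)
  next
    case 5
    then have "ramp' u = (u\<^sup>2 - 3 * (u - 1)\<^sup>2 + 3 * (u - 2)\<^sup>2 - (u - 3)\<^sup>2) / 2" by (simp add: ramp'_def max_def)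
    also have "\<dots> = 0" by (simp add: power2_eq_square algebra_simps)
    finally show thesis using 5 by (intro that(5)) (auto simp: ramp''_def)
  qed
qed

lemma ramp_le_0: "u \<le> 0 \<Longrightarrow> ramp u = 0" by (simp add: ramp_def)
lemma ramp'_le_0: "u \<le> 0 \<Longrightarrow> ramp' u = 0" by (simp add: ramp'_def)
lemma ramp''_le_0: "u \<le> 0 \<Longrightarrow> ramp'' u = 0" by (simp add: ramp''_def)
lemma ramp_ge_3: "3 \<le> u \<Longrightarrow> ramp u = 1"
proof -
  assume "3 \<le> u"
  then have "ramp u = (u ^ 3 - 3 * (u - 1) ^ 3 + 3 * (u - 2) ^ 3 - (u - 3) ^ 3) / 6"
    by (simp add: ramp_def max_def)
  also have "u ^ 3 - 3 * (u - 1) ^ 3 + 3 * (u - 2) ^ 3 - (u - 3) ^ 3 = 6"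
    by (simp add: power3_eq_cube algebra_simps)
  finally show ?thesis by simp
qed

lemma ramp'_bounds: "0 \<le> ramp' u" "\<bar>ramp' u\<bar> \<le> 1"
proof -
  have "0 \<le> ramp' u \<and> ramp' u \<le> 1"
  proof (cases rule: ramp_cases[of u])
    case 2
    then have "u\<^sup>2 \<le> 1" by (intro power_le_one) auto
    with 2(3) show ?thesis using zero_le_power2[of u] by linarith
  next
    case 3
    then have "\<bar>u - 3 / 2\<bar> \<le> 1 / 2" by linarith
    then have "\<bar>u - 3 / 2\<bar>\<^sup>2 \<le> (1 / 2)\<^sup>2" by (intro power_mono) auto
    then have "(u - 3 / 2)\<^sup>2 \<le> 1 / 4" by (simp add: power2_eq_square)
    with 3(3) show ?thesis using zero_le_power2[of "u - 3 / 2"] by linarith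
  next
    case 4
    then have "(3 - u)\<^sup>2 \<le> 1" by (intro power_le_one) auto
    with 4(3) show ?thesis using zero_le_power2[of "3 - u"] by linarith
  qed auto
  then show "0 \<le> ramp' u" "\<bar>ramp' u\<bar> \<le> 1" by auto
qed

lemma ramp''_bound: "\<bar>ramp'' u\<bar> \<le> 1"
  by (cases rule: ramp_cases[of u]) auto

lemma ramp_mono: "u \<le> w \<Longrightarrow> ramp u \<le> ramp w"
  using DERIV_nonneg_imp_nondecreasing[of u w ramp] DERIV_ramp ramp'_bounds(1) by blast

lemma ramp_bounds: "0 \<le> ramp u" "ramp u \<le> 1"
  using ramp_mono[of "min u 0" u] ramp_le_0[of "min u 0"]
    ramp_mono[of u "max u 3"] ramp_ge_3[of "max u 3"] by auto

text \<open>Each positive part is 1-Lipschitz, and the absolute coefficients 1, 3, 3, 1 add up to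
  8.\<close>

lemma ramp''_lipschitz: "\<bar>ramp'' u - ramp'' w\<bar> \<le> 8 * \<bar>u - w\<bar>"
proof -
  have "\<bar>max 0 (u - c) - max 0 (w - c)\<bar> \<le> \<bar>u - w\<bar>" for c by auto
  from this[of 0] this[of 1] this[of 2] this[of 3]
  have "\<bar>max 0 u - max 0 w\<bar> \<le> \<bar>u - w\<bar>" "\<bar>max 0 (u - 1) - max 0 (w - 1)\<bar> \<le> \<bar>u - w\<bar>"
    "\<bar>max 0 (u - 2) - max 0 (w - 2)\<bar> \<le> \<bar>u - w\<bar>" "\<bar>max 0 (u - 3) - max 0 (w - 3)\<bar> \<le> \<bar>u - w\<bar>"
    unfolding diff_0_right .
  moreover have "\<bar>(a0 - 3 * a1 + 3 * a2 - a3) - (b0 - 3 * b1 + 3 * b2 - b3)\<bar> \<le> 8 * d"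
    if "\<bar>a0 - b0\<bar> \<le> d" "\<bar>a1 - b1\<bar> \<le> d" "\<bar>a2 - b2\<bar> \<le> d" "\<bar>a3 - b3\<bar> \<le> d"
    for a0 a1 a2 a3 b0 b1 b2 b3 d :: real
    using that unfolding abs_le_iff by linarith
  ultimately show ?thesis unfolding ramp''_def by blast
qed

lemma measurable_ramp [measurable]: "ramp \<in> borel_measurable borel"
  "ramp' \<in> borel_measurable borel" "ramp'' \<in> borel_measurable borel"
  unfolding ramp_def[abs_def] ramp'_def[abs_def] ramp''_def[abs_def] by measurable

text \<open>The second-order remainder is half of \<open>y\<^sup>2\<close> times a difference of
  values of \<open>ramp''\<close>. For \<open>\<bar>y\<bar> \<le> 1\<close> the Lipschitz bound
  gives a cube, otherwise boundedness gives a square; with \<open>2 \<le> p \<le> 3\<close> both lie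
  below \<open>\<bar>y\<bar> powr p\<close>.\<close>

lemma ramp_taylor:
  assumes p: "2 \<le> p" "p \<le> 3"
  shows "\<bar>ramp (u + y) - ramp u - ramp' u * y - ramp'' u * y\<^sup>2 / 2\<bar> \<le> 4 * \<bar>y\<bar> powr p"
proof (cases "y = 0")
  case False
  define diff where "diff m = (if m = (0::nat) then ramp else if m = 1 then ramp' else ramp'')" for m
  have "\<exists>t. (if u + y < u then u + y < t \<and> t < u else u < t \<and> t < u + y) \<and>
      ramp (u + y) = (\<Sum>m<2. diff m u / fact m * (u + y - u) ^ m) + diff 2 t / fact 2 * (u + y - u) ^ 2"
    by (rule Taylor[where a="min u (u + y)" and b="max u (u + y)"])
       (use False DERIV_ramp DERIV_ramp' in \<open>auto simp: diff_def less_Suc_eq numeral_2_eq_2\<close>)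
  then obtain t where t: "if u + y < u then u + y < t \<and> t < u else u < t \<and> t < u + y"
    "ramp (u + y) = (\<Sum>m<2. diff m u / fact m * (u + y - u) ^ m) + diff 2 t / fact 2 * (u + y - u) ^ 2"
    by blast
  have tu: "\<bar>t - u\<bar> \<le> \<bar>y\<bar>" using t(1) by (auto split: if_splits)
  have "ramp (u + y) - ramp u - ramp' u * y - ramp'' u * y\<^sup>2 / 2 = (ramp'' t - ramp'' u) * y\<^sup>2 / 2"
    using t(2) by (simp add: diff_def numeral_2_eq_2 field_simps)
  then have *: "\<bar>ramp (u + y) - ramp u - ramp' u * y - ramp'' u * y\<^sup>2 / 2\<bar> = \<bar>ramp'' t - ramp'' u\<bar> * y\<^sup>2 / 2"
    by (simp only: abs_mult abs_divide abs_power2 abs_numeral)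
  show ?thesis
  proof (cases "\<bar>y\<bar> \<le> 1")
    case True
    have "\<bar>ramp'' t - ramp'' u\<bar> \<le> 8 * \<bar>y\<bar>"
      by (rule order_trans[OF ramp''_lipschitz]) (use tu in simp)
    then have "\<bar>ramp'' t - ramp'' u\<bar> * y\<^sup>2 / 2 \<le> (8 * \<bar>y\<bar>) * y\<^sup>2 / 2"
      by (intro divide_right_mono mult_right_mono) auto
    also have "\<dots> = 4 * (\<bar>y\<bar> * \<bar>y\<bar>\<^sup>2)" by simp
    also have "\<bar>y\<bar> * \<bar>y\<bar>\<^sup>2 = \<bar>y\<bar> ^ 3" by (simp only: power3_eq_cube power2_eq_square mult.assoc)
    also have "\<bar>y\<bar> ^ 3 = \<bar>y\<bar> powr 3" using False by (simp add: powr_numeral)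
    also have "\<dots> \<le> \<bar>y\<bar> powr p" using True p by (intro powr_mono') auto
    finally show ?thesis unfolding * by simp
  next
    case big: False
    have "\<bar>ramp'' t - ramp'' u\<bar> \<le> 2" using ramp''_bound[of t] ramp''_bound[of u] by linarith
    then have "\<bar>ramp'' t - ramp'' u\<bar> * y\<^sup>2 / 2 \<le> 2 * y\<^sup>2 / 2"
      by (intro divide_right_mono mult_right_mono) auto
    also have "\<dots> = \<bar>y\<bar> powr 2" using False by (simp add: powr_numeral)
    also have "\<dots> \<le> \<bar>y\<bar> powr p" using big p by (intro powr_mono) auto
    finally show ?thesis unfolding * using powr_ge_zero[of "\<bar>y\<bar>" p] by linarith
  qed
qed (use p in simp)

text \<open>The function and its derivatives vanish to the left of \<open>a\<close>, and to the
  right of \<open>a\<close> the weight \<open>exp (l * (s - a))\<close> is at least 1. Hence the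
  weight is free of charge, and the prefactor \<open>exp (- l * a)\<close> is the gain that makes
  later errors relative. The power \<open>d ^ 3\<close> in the denominator dominates all scaling
  factors.\<close>

lemma taylor2_ramp:
  assumes p: "2 \<le> p" "p \<le> 3" and d: "0 < d" "d \<le> 1" and l: "0 \<le> l"
  shows "taylor2 p l (4 / d ^ 3 * exp (- l * a)) (\<lambda>s. ramp ((s - a) / d))
    (\<lambda>s. ramp' ((s - a) / d) / d) (\<lambda>s. ramp'' ((s - a) / d) / d\<^sup>2)"
proof -
  define B where "B = 4 / d ^ 3 * exp (- l * a)"
  have d3: "1 \<le> 1 / d ^ 3" "1 / d \<le> 1 / d ^ 3" "1 / d\<^sup>2 \<le> 1 / d ^ 3" "1 / d powr p \<le> 1 / d ^ 3"
  proof -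
    show "1 \<le> 1 / d ^ 3" using d by (simp add: power_le_one)
    show "1 / d\<^sup>2 \<le> 1 / d ^ 3" using d by (intro divide_left_mono power_decreasing) auto
    show "1 / d \<le> 1 / d ^ 3" using d power_decreasing[of 1 3 d] by (intro divide_left_mono) auto
    have "d powr 3 \<le> d powr p" using d p by (intro powr_mono') auto
    then have "d ^ 3 \<le> d powr p" using d by (simp add: powr_numeral)
    then show "1 / d powr p \<le> 1 / d ^ 3" using d by (intro divide_left_mono) auto
  qed
  have B1: "4 / d ^ 3 \<le> B * exp (l * s)" if "a \<le> s" for s
  proof -
    have "1 \<le> exp (l * (s - a))" using that l by simp
    then have "4 / d ^ 3 * 1 \<le> 4 / d ^ 3 * exp (l * (s - a))" using d by (intro mult_left_mono) auto
    also have "\<dots> = B * exp (l * s)" unfolding B_def by (simp add: mult.assoc exp_add[symmetric] algebra_simps)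
    finally show ?thesis by simp
  qed
  have B0: "0 \<le> B" using d by (simp add: B_def)
  have 1: "\<bar>ramp' ((s - a) / d) / d\<bar> \<le> B * exp (l * s)" for s
  proof (cases "a \<le> s")
    case True
    have "\<bar>ramp' ((s - a) / d) / d\<bar> \<le> 1 / d" using ramp'_bounds(2) d by (simp add: divide_right_mono)
    then show ?thesis using d3 B1[OF True] by linarith
  next
    case False
    then have "ramp' ((s - a) / d) = 0" using d by (intro ramp'_le_0) (simp add: divide_le_0_iff)
    then show ?thesis using B0 by simp
  qed
  have 2: "\<bar>ramp'' ((s - a) / d) / d\<^sup>2\<bar> \<le> B * exp (l * s)" for s
  proof (cases "a \<le> s")
    case True
    have "\<bar>ramp'' ((s - a) / d) / d\<^sup>2\<bar> \<le> 1 / d\<^sup>2" using ramp''_bound d by (simp add: divide_right_mono)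
    then show ?thesis using d3 B1[OF True] by linarith
  next
    case False
    then have "ramp'' ((s - a) / d) = 0" using d by (intro ramp''_le_0) (simp add: divide_le_0_iff)
    then show ?thesis using B0 by simp
  qed
  have 3: "\<bar>ramp ((s + y - a) / d) - ramp ((s - a) / d) - ramp' ((s - a) / d) / d * y
      - ramp'' ((s - a) / d) / d\<^sup>2 * y\<^sup>2 / 2\<bar> \<le> B * exp (l * s) * (exp (l * max y 0) * \<bar>y\<bar> powr p)" for s y
  \<comment> \<open>Either the larger of \<open>s\<close> and \<open>s + y\<close> has reached
    \<open>a\<close>, where the weight is at least 1, or both points lie left of \<open>a\<close>
    and every term vanishes. This is why the error of \<open>taylor2\<close> carries
    \<open>max y 0\<close>.\<close>
  proof (cases "a \<le> s + max y 0")
    case True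
    have e: "(s + y - a) / d = (s - a) / d + y / d" by (simp add: diff_divide_distrib add_divide_distrib)
    have "\<bar>ramp ((s - a) / d + y / d) - ramp ((s - a) / d) - ramp' ((s - a) / d) * (y / d)
      - ramp'' ((s - a) / d) * (y / d)\<^sup>2 / 2\<bar> \<le> 4 * \<bar>y / d\<bar> powr p"
      by (rule ramp_taylor[OF p])
    also have "4 * \<bar>y / d\<bar> powr p = 4 * (1 / d powr p) * \<bar>y\<bar> powr p" using d by (simp add: powr_divide)
    also have "\<dots> \<le> 4 * (1 / d ^ 3) * \<bar>y\<bar> powr p" using d3(4) by (intro mult_right_mono mult_left_mono) auto
    also have "\<dots> \<le> B * exp (l * (s + max y 0)) * \<bar>y\<bar> powr p"
      using B1[OF True] by (intro mult_right_mono) auto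
    also have "exp (l * (s + max y 0)) = exp (l * s) * exp (l * max y 0)" by (simp add: exp_add distrib_left)
    finally show ?thesis unfolding e by (simp add: power_divide mult_ac)
  next
    case False
    then have "(s - a) / d \<le> 0" "(s + y - a) / d \<le> 0" using d by (auto simp: divide_le_0_iff)
    then show ?thesis using B0 by (simp add: ramp_le_0 ramp'_le_0 ramp''_le_0)
  qed
  have 4: "\<exists>K. \<forall>s. \<bar>ramp ((s - a) / d)\<bar> \<le> K \<and> \<bar>ramp' ((s - a) / d) / d\<bar> \<le> K \<and> \<bar>ramp'' ((s - a) / d) / d\<^sup>2\<bar> \<le> K"
  proof (intro exI[of _ "1 / d ^ 3"] allI conjI)
    fix s
    show "\<bar>ramp ((s - a) / d)\<bar> \<le> 1 / d ^ 3" using ramp_bounds[of "(s - a) / d"] d3(1) by linarith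
    have "\<bar>ramp' ((s - a) / d) / d\<bar> \<le> 1 / d" using ramp'_bounds(2) d by (simp add: divide_right_mono)
    then show "\<bar>ramp' ((s - a) / d) / d\<bar> \<le> 1 / d ^ 3" using d3 by linarith
    have "\<bar>ramp'' ((s - a) / d) / d\<^sup>2\<bar> \<le> 1 / d\<^sup>2" using ramp''_bound d by (simp add: divide_right_mono)
    then show "\<bar>ramp'' ((s - a) / d) / d\<^sup>2\<bar> \<le> 1 / d ^ 3" using d3 by linarith
  qed
  show ?thesis unfolding taylor2_def B_def[symmetric]
    by (intro conjI 4 allI 1 2 3) measurable
qed

text \<open>\<open>ramp ((s - a) / d)\<close> is 0 up to \<open>a\<close> and 1 from
  \<open>a + 3 * d\<close> on. Together with the bound below it is sandwiched between two
  indicators, which translates smooth averages back into tails.\<close>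

lemma gauss_avg_ramp_le:
  assumes d: "0 < d" shows "gauss_avg 1 (\<lambda>s. ramp ((s - a) / d)) 0 \<le> normal_tail a"
proof -
  have "gauss_avg 1 (\<lambda>s. ramp ((s - a) / d)) 0 \<le> (LINT z|gaussian. indicator {a<..} z)"
    unfolding gauss_avg_def
  proof (rule integral_mono)
    show "integrable gaussian (\<lambda>z. ramp ((0 + sqrt 1 * z - a) / d))"
      by (rule gaussian.integrable_const_bound[where B=1]) (auto simp: ramp_bounds)
    show "integrable gaussian (indicator {a<..} :: real \<Rightarrow> real)"
      by (rule gaussian.integrable_const_bound[where B=1]) auto
    show "ramp ((0 + sqrt 1 * z - a) / d) \<le> indicator {a<..} z" for z
      using d by (auto simp: indicator_def ramp_bounds ramp_le_0 divide_le_0_iff)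
  qed
  then show ?thesis by (simp add: normal_tail_eq)
qed

lemma gauss_avg_ramp_ge:
  assumes d: "0 < d" shows "normal_tail (a + 3 * d) \<le> gauss_avg 1 (\<lambda>s. ramp ((s - a) / d)) 0"
proof -
  have "(LINT z|gaussian. indicator {a + 3 * d<..} z) \<le> gauss_avg 1 (\<lambda>s. ramp ((s - a) / d)) 0"
    unfolding gauss_avg_def
  proof (rule integral_mono)
    show "integrable gaussian (\<lambda>z. ramp ((0 + sqrt 1 * z - a) / d))"
      by (rule gaussian.integrable_const_bound[where B=1]) (auto simp: ramp_bounds)
    show "integrable gaussian (indicator {a + 3 * d<..} :: real \<Rightarrow> real)"
      by (rule gaussian.integrable_const_bound[where B=1]) auto
    show "indicator {a + 3 * d<..} z \<le> ramp ((0 + sqrt 1 * z - a) / d)" for z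
      using d by (auto simp: indicator_def ramp_bounds ramp_ge_3 field_simps)
  qed
  then show ?thesis by (simp add: normal_tail_eq)
qed

section \<open>Truncated weighted sums\<close>

text \<open>A value above the level is replaced by 0, not by the level. Thus a truncated sum is
  unaffected by removing an index whose term is large, and for \<open>\<eta> \<ge> 0\<close>
  truncation only decreases values. Negative values are kept, since only positive exponential rates
  occur.\<close>

definition trunc :: "real \<Rightarrow> real \<Rightarrow> real" where
  "trunc \<eta> y = (if y \<le> \<eta> then y else 0)"

lemma measurable_trunc [measurable]: "trunc \<eta> \<in> borel_measurable borel"
  unfolding trunc_def[abs_def] by measurable

text \<open>The cap at 3 on \<open>p\<close> matches the order of the Taylor estimates for
  \<open>exp\<close> and \<open>ramp\<close>; a higher moment is lowered to at most 3 before the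
  locale is entered.\<close>

locale iid_sequence = prob_space M for M :: "'w measure" +
  fixes \<xi> :: "int \<Rightarrow> 'w \<Rightarrow> real" and p :: real
  assumes indep: "indep_vars (\<lambda>_. borel) \<xi> UNIV"
    and ident: "distr M borel (\<xi> i) = distr M borel (\<xi> 0)"
    and centered: "expectation (\<xi> 0) = 0"
    and p: "2 < p" "p \<le> 3"
    and p_moment: "integrable M (\<lambda>\<omega>. \<bar>\<xi> 0 \<omega>\<bar> powr p)"
    and variance_pos: "0 < expectation (\<lambda>\<omega>. (\<xi> 0 \<omega>)\<^sup>2)"
begin

definition s2 :: real where "s2 = expectation (\<lambda>\<omega>. (\<xi> 0 \<omega>)\<^sup>2)"
definition mu :: real where "mu = expectation (\<lambda>\<omega>. \<bar>\<xi> 0 \<omega>\<bar> powr p)"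

lemma s2_pos: "0 < s2" using variance_pos by (simp add: s2_def)
lemma mu_nonneg: "0 \<le> mu" by (simp add: mu_def)

lemma measurable_xi [measurable]: "\<xi> i \<in> borel_measurable M"
  using indep by (auto simp: indep_vars_def)

lemma xi_integrable_iff:
  assumes [measurable]: "g \<in> borel_measurable borel"
  shows "integrable M (\<lambda>\<omega>. (g (\<xi> i \<omega>) :: real)) \<longleftrightarrow> integrable M (\<lambda>\<omega>. g (\<xi> 0 \<omega>))"
  using integrable_distr_eq[of "\<xi> i" M borel g] integrable_distr_eq[of "\<xi> 0" M borel g] ident[of i]
  by simp

lemma xi_expectation:
  assumes [measurable]: "g \<in> borel_measurable borel"
  shows "expectation (\<lambda>\<omega>. (g (\<xi> i \<omega>) :: real)) = expectation (\<lambda>\<omega>. g (\<xi> 0 \<omega>))"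
  using integral_distr[of "\<xi> i" M borel g] integral_distr[of "\<xi> 0" M borel g] ident[of i]
  by simp

lemma xi_prob:
  assumes [measurable]: "Measurable.pred borel P"
  shows "\<P>(\<omega> in M. P (\<xi> i \<omega>)) = \<P>(\<omega> in M. P (\<xi> 0 \<omega>))"
proof -
  have "measure (distr M borel (\<xi> j)) {y \<in> space borel. P y} = \<P>(\<omega> in M. P (\<xi> j \<omega>))" for j
    by (subst measure_distr) (auto intro!: arg_cong[where f="measure M"])
  from this[of i] this[of 0] ident[of i] show ?thesis by simp
qed

lemma square_le_powr: "y\<^sup>2 \<le> 1 + \<bar>y\<bar> powr p"
proof (cases "\<bar>y\<bar> \<le> 1")
  case True
  then have "\<bar>y\<bar>\<^sup>2 \<le> 1" by (intro power_le_one) auto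
  then show ?thesis by (simp add: add_increasing2)
next
  case False
  have "y\<^sup>2 = \<bar>y\<bar> powr 2" using False by (simp add: powr_numeral)
  also have "\<dots> \<le> \<bar>y\<bar> powr p" using False p by (intro powr_mono) auto
  finally show ?thesis by simp
qed

lemma xi_square_integrable: "integrable M (\<lambda>\<omega>. (\<xi> i \<omega>)\<^sup>2)"
proof -
  have "integrable M (\<lambda>\<omega>. (\<xi> 0 \<omega>)\<^sup>2)"
  proof (rule Bochner_Integration.integrable_bound)
    show "integrable M (\<lambda>\<omega>. 1 + \<bar>\<xi> 0 \<omega>\<bar> powr p)" using p_moment by simp
    show "AE \<omega> in M. norm ((\<xi> 0 \<omega>)\<^sup>2) \<le> norm (1 + \<bar>\<xi> 0 \<omega>\<bar> powr p)"
      using square_le_powr by (intro AE_I2) (auto intro: order_trans)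
  qed measurable
  then show ?thesis using xi_integrable_iff[of "\<lambda>y. y\<^sup>2" i] by simp
qed

lemma xi_integrable: "integrable M (\<xi> i)"
  using square_integrable_imp_integrable[OF measurable_xi xi_square_integrable] .

lemma xi_powr_integrable: "integrable M (\<lambda>\<omega>. \<bar>\<xi> i \<omega>\<bar> powr p)"
  using xi_integrable_iff[of "\<lambda>y. \<bar>y\<bar> powr p" i] p_moment by simp

lemma xi_moments:
  "expectation (\<xi> i) = 0" "expectation (\<lambda>\<omega>. (\<xi> i \<omega>)\<^sup>2) = s2" "expectation (\<lambda>\<omega>. \<bar>\<xi> i \<omega>\<bar> powr p) = mu"
  using xi_expectation[of "\<lambda>y. y" i] xi_expectation[of "\<lambda>y. y\<^sup>2" i]
    xi_expectation[of "\<lambda>y. \<bar>y\<bar> powr p" i] centered by (auto simp: s2_def mu_def)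

definition wsum :: "(int \<Rightarrow> real) \<Rightarrow> int set \<Rightarrow> 'w \<Rightarrow> real" where
  "wsum w I \<omega> = (\<Sum>i\<in>I. w i * \<xi> i \<omega>)"

definition tsum :: "real \<Rightarrow> (int \<Rightarrow> real) \<Rightarrow> int set \<Rightarrow> 'w \<Rightarrow> real" where
  "tsum \<eta> w I \<omega> = (\<Sum>i\<in>I. trunc \<eta> (w i * \<xi> i \<omega>))"

text \<open>The Lyapunov sum without its moment factor \<open>mu\<close>; every truncation and
  Taylor error below is a multiple of it.\<close>

definition lyap :: "(int \<Rightarrow> real) \<Rightarrow> int set \<Rightarrow> real" where
  "lyap w I = (\<Sum>i\<in>I. w i powr p)"

definition vsum :: "(int \<Rightarrow> real) \<Rightarrow> int set \<Rightarrow> real" where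
  "vsum w I = (\<Sum>i\<in>I. (w i)\<^sup>2 * s2)"

lemma measurable_wsum [measurable]: "wsum w I \<in> borel_measurable M"
  unfolding wsum_def[abs_def] by measurable
lemma measurable_tsum [measurable]: "tsum \<eta> w I \<in> borel_measurable M"
  unfolding tsum_def[abs_def] by measurable

lemma lyap_nonneg: "0 \<le> lyap w I" by (simp add: lyap_def sum_nonneg)
lemma vsum_nonneg: "0 \<le> vsum w I" using s2_pos by (simp add: vsum_def sum_nonneg)

lemma exp_trunc_integrable:
  assumes "0 \<le> l" "0 \<le> \<eta>"
  shows "integrable M (\<lambda>\<omega>. exp (l * trunc \<eta> (c * \<xi> i \<omega>)))"
proof (rule integrable_const_bound[where B="exp (l * \<eta>)"])
  show "AE \<omega> in M. norm (exp (l * trunc \<eta> (c * \<xi> i \<omega>))) \<le> exp (l * \<eta>)"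
    using assms by (intro AE_I2) (auto simp: trunc_def intro!: mult_left_mono)
qed measurable

text \<open>Insert the second-order bound for \<open>exp\<close>: the linear term has mean 0, the
  quadratic one gives the normal exponent, and the rest is controlled by the moment of order
  \<open>p\<close>. Then \<open>1 + z \<le> exp z\<close> puts the bound in a form that multiplies
  over independent terms.\<close>

lemma exp_trunc_le:
  assumes l: "0 \<le> l" and e: "0 \<le> \<eta>" and c: "0 < c"
  shows "expectation (\<lambda>\<omega>. exp (l * trunc \<eta> (c * \<xi> i \<omega>)))
     \<le> exp (l\<^sup>2 / 2 * (c\<^sup>2 * s2) + l powr p * exp (l * \<eta>) * mu * c powr p)"
proof -
  define A where "A = l powr p * exp (l * \<eta>) * c powr p"
  have pt: "exp (l * trunc \<eta> y) \<le> 1 + l * y + l\<^sup>2 / 2 * y\<^sup>2 + l powr p * exp (l * \<eta>) * \<bar>y\<bar> powr p" for y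
  proof -
    define u where "u = l * trunc \<eta> y"
    \<comment> \<open>Truncation to 0 lowers values above \<open>\<eta> \<ge> 0\<close>, so in an
      upper bound the linear term may be that of the untruncated, centred variable; no bias
      appears.\<close>
    have 1: "u \<le> l * y" using l e by (auto simp: u_def trunc_def intro!: mult_left_mono)
    have "\<bar>trunc \<eta> y\<bar> \<le> \<bar>y\<bar>" by (auto simp: trunc_def)
    then have au: "\<bar>u\<bar> \<le> l * \<bar>y\<bar>" using l by (simp add: u_def abs_mult mult_left_mono)
    then have "\<bar>u\<bar>\<^sup>2 \<le> (l * \<bar>y\<bar>)\<^sup>2" by (intro power_mono) auto
    then have 2: "u\<^sup>2 / 2 \<le> l\<^sup>2 / 2 * y\<^sup>2" by (simp add: power_mult_distrib)
    have "\<bar>u\<bar> powr p \<le> (l * \<bar>y\<bar>) powr p" using au p by (intro powr_mono2) auto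
    then have 3: "\<bar>u\<bar> powr p \<le> l powr p * \<bar>y\<bar> powr p" using l by (simp add: powr_mult)
    have "u \<le> l * \<eta>" "0 \<le> l * \<eta>" using l e by (auto simp: u_def trunc_def intro!: mult_left_mono)
    then have 4: "exp (max u 0) \<le> exp (l * \<eta>)" by simp
    have "exp u \<le> 1 + u + u\<^sup>2 / 2 + \<bar>u\<bar> powr p * exp (max u 0)"
      using p by (intro exp_le_taylor2_powr) auto
    also have "\<bar>u\<bar> powr p * exp (max u 0) \<le> (l powr p * \<bar>y\<bar> powr p) * exp (l * \<eta>)"
      using 3 4 by (intro mult_mono) auto
    finally show ?thesis using 1 2 by (simp add: u_def mult_ac)
  qed
  have "expectation (\<lambda>\<omega>. exp (l * trunc \<eta> (c * \<xi> i \<omega>)))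
    \<le> expectation (\<lambda>\<omega>. 1 + l * c * \<xi> i \<omega> + l\<^sup>2 / 2 * c\<^sup>2 * (\<xi> i \<omega>)\<^sup>2 + A * \<bar>\<xi> i \<omega>\<bar> powr p)"
  proof (intro integral_mono exp_trunc_integrable l e)
    show "integrable M (\<lambda>\<omega>. 1 + l * c * \<xi> i \<omega> + l\<^sup>2 / 2 * c\<^sup>2 * (\<xi> i \<omega>)\<^sup>2 + A * \<bar>\<xi> i \<omega>\<bar> powr p)"
      using xi_integrable xi_square_integrable xi_powr_integrable by auto
    show "exp (l * trunc \<eta> (c * \<xi> i \<omega>)) \<le> 1 + l * c * \<xi> i \<omega> + l\<^sup>2 / 2 * c\<^sup>2 * (\<xi> i \<omega>)\<^sup>2 + A * \<bar>\<xi> i \<omega>\<bar> powr p" for \<omega>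
      using pt[of "c * \<xi> i \<omega>"] c by (simp add: A_def abs_mult powr_mult power_mult_distrib mult_ac)
  qed
  also have "\<dots> = 1 + (l\<^sup>2 / 2 * c\<^sup>2 * s2 + A * mu)"
    using xi_integrable[of i] xi_square_integrable[of i] xi_powr_integrable[of i] xi_moments[of i]
    by (simp add: prob_space)
  also have "\<dots> \<le> exp (l\<^sup>2 / 2 * c\<^sup>2 * s2 + A * mu)" by (rule exp_ge_add_one_self)
  finally show ?thesis by (simp add: A_def mult_ac)
qed

lemma indep_vars_fun_xi: "indep_vars (\<lambda>_. borel) (\<lambda>i \<omega>. g i (\<xi> i \<omega>)) I"
  if [measurable]: "\<And>i. g i \<in> borel_measurable borel" for g :: "int \<Rightarrow> real \<Rightarrow> real"
  by (rule indep_vars_compose2[OF indep_vars_subset[OF indep subset_UNIV]]) (rule that)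

lemma exp_tsum_eq: "finite I \<Longrightarrow> exp (l * tsum \<eta> w I \<omega>) = (\<Prod>i\<in>I. exp (l * trunc \<eta> (w i * \<xi> i \<omega>)))"
  by (simp add: tsum_def sum_distrib_left exp_sum)

lemma exp_tsum:
  assumes I: "finite I" and l: "0 \<le> l" and e: "0 \<le> \<eta>" and w: "\<And>i. i \<in> I \<Longrightarrow> 0 < w i"
  shows "integrable M (\<lambda>\<omega>. exp (l * tsum \<eta> w I \<omega>))"
    and "expectation (\<lambda>\<omega>. exp (l * tsum \<eta> w I \<omega>))
     \<le> exp (l\<^sup>2 / 2 * vsum w I + l powr p * exp (l * \<eta>) * mu * lyap w I)"
proof -
  have ind: "indep_vars (\<lambda>_. borel) (\<lambda>i \<omega>. exp (l * trunc \<eta> (w i * \<xi> i \<omega>))) I"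
    by (rule indep_vars_fun_xi[of "\<lambda>i y. exp (l * trunc \<eta> (w i * y))"]) measurable
  show "integrable M (\<lambda>\<omega>. exp (l * tsum \<eta> w I \<omega>))"
    unfolding exp_tsum_eq[OF I] by (rule indep_vars_integrable[OF I ind]) (rule exp_trunc_integrable[OF l e])
  have "expectation (\<lambda>\<omega>. exp (l * tsum \<eta> w I \<omega>)) = (\<Prod>i\<in>I. expectation (\<lambda>\<omega>. exp (l * trunc \<eta> (w i * \<xi> i \<omega>))))"
    unfolding exp_tsum_eq[OF I] by (rule indep_vars_lebesgue_integral[OF I ind]) (rule exp_trunc_integrable[OF l e])
  also have "\<dots> \<le> (\<Prod>i\<in>I. exp (l\<^sup>2 / 2 * ((w i)\<^sup>2 * s2) + l powr p * exp (l * \<eta>) * mu * w i powr p))"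
    using w by (intro prod_mono conjI exp_trunc_le l e integral_nonneg_AE) auto
  also have "\<dots> = exp (l\<^sup>2 / 2 * vsum w I + l powr p * exp (l * \<eta>) * mu * lyap w I)"
    using I by (simp add: exp_sum[symmetric] vsum_def lyap_def sum.distrib sum_distrib_left)
  finally show "expectation (\<lambda>\<omega>. exp (l * tsum \<eta> w I \<omega>))
     \<le> exp (l\<^sup>2 / 2 * vsum w I + l powr p * exp (l * \<eta>) * mu * lyap w I)" .
qed

text \<open>The rate \<open>l\<close> is left free: it becomes \<open>x\<close> when
  \<open>x\<close> is of order at most \<open>sqrt (ln n)\<close>, and
  \<open>K * ln (n * x) / x\<close> beyond.\<close>

lemma tsum_chernoff:
  assumes I: "finite I" and l: "0 \<le> l" and e: "0 \<le> \<eta>" and w: "\<And>i. i \<in> I \<Longrightarrow> 0 < w i"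
  shows "\<P>(\<omega> in M. y \<le> tsum \<eta> w I \<omega>)
     \<le> exp (l\<^sup>2 / 2 * vsum w I + l powr p * exp (l * \<eta>) * mu * lyap w I - l * y)"
proof -
  have "\<P>(\<omega> in M. y \<le> tsum \<eta> w I \<omega>) = expectation (indicator {\<omega>\<in>space M. y \<le> tsum \<eta> w I \<omega>})" by simp
  also have "\<dots> \<le> expectation (\<lambda>\<omega>. exp (- l * y) * exp (l * tsum \<eta> w I \<omega>))"
  proof (intro integral_mono integrable_mult_right exp_tsum(1) I l e w)
    show "integrable M (indicator {\<omega>\<in>space M. y \<le> tsum \<eta> w I \<omega>} :: _ \<Rightarrow> real)"
      by (intro integrable_const_bound[where B=1]) auto
    fix \<omega>
    have "1 \<le> exp (- l * y) * exp (l * tsum \<eta> w I \<omega>)" if "y \<le> tsum \<eta> w I \<omega>"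
      using mult_left_mono[OF that l] by (simp add: exp_add[symmetric])
    then show "indicator {\<omega>\<in>space M. y \<le> tsum \<eta> w I \<omega>} \<omega> \<le> exp (- l * y) * exp (l * tsum \<eta> w I \<omega>)"
      by (auto simp: indicator_def)
  qed
  also have "\<dots> = exp (- l * y) * expectation (\<lambda>\<omega>. exp (l * tsum \<eta> w I \<omega>))" by simp
  also have "\<dots> \<le> exp (- l * y) * exp (l\<^sup>2 / 2 * vsum w I + l powr p * exp (l * \<eta>) * mu * lyap w I)"
    by (intro mult_left_mono exp_tsum(2) I l e w) auto
  finally show ?thesis by (simp add: exp_add[symmetric] algebra_simps)
qed

text \<open>Twice \<open>mu\<close> for the errors of truncated mean and variance,
  \<open>exp 1 * mu\<close> for the Taylor remainder of the summand (weight at most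
  \<open>exp 1\<close>), and the last term for the Gaussian that takes its place.\<close>

definition lindeberg_const :: real where
  "lindeberg_const = (2 + exp 1) * mu + s2 powr (p / 2) * gauss_const p"

lemma gauss_const_nonneg: "0 \<le> gauss_const q"
  by (simp add: gauss_const_def)

text \<open>The discarded part lives on \<open>\<eta> < y\<close>, where \<open>y\<close> and
  \<open>y\<^sup>2\<close> are both at most \<open>y powr p / \<eta>\<^sup>2\<close>: the missing
  powers of \<open>y\<close> exceed those of \<open>\<eta>\<close>, and
  \<open>\<eta> \<le> 1\<close> with \<open>p \<le> 3\<close> lets one exponent 2 serve for both.
  Centring and the true variance then give the comparison values.\<close>

lemma trunc_moments:
  assumes e: "0 < \<eta>" "\<eta> \<le> 1" and c: "0 < c"
  shows "integrable M (\<lambda>\<omega>. trunc \<eta> (c * \<xi> i \<omega>))" "integrable M (\<lambda>\<omega>. (trunc \<eta> (c * \<xi> i \<omega>))\<^sup>2)"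
    "\<bar>expectation (\<lambda>\<omega>. trunc \<eta> (c * \<xi> i \<omega>))\<bar> \<le> mu * c powr p / \<eta>\<^sup>2"
    "\<bar>expectation (\<lambda>\<omega>. (trunc \<eta> (c * \<xi> i \<omega>))\<^sup>2) - c\<^sup>2 * s2\<bar> \<le> mu * c powr p / \<eta>\<^sup>2"
proof -
  have pt: "\<bar>trunc \<eta> y - y\<bar> \<le> \<bar>y\<bar> powr p / \<eta>\<^sup>2" "\<bar>(trunc \<eta> y)\<^sup>2 - y\<^sup>2\<bar> \<le> \<bar>y\<bar> powr p / \<eta>\<^sup>2" for y
  proof -
    have "y * \<eta>\<^sup>2 \<le> y powr p \<and> y\<^sup>2 * \<eta>\<^sup>2 \<le> y powr p" if y: "\<eta> < y"
    proof -
      have "\<eta>\<^sup>2 = \<eta> powr 2" using e by (simp add: powr_numeral)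
      have "\<eta> powr 2 \<le> \<eta> powr (p - 1)" using e p by (intro powr_mono') auto
      also have "\<dots> \<le> y powr (p - 1)" using e p y by (intro powr_mono2) auto
      finally have "y powr 1 * \<eta>\<^sup>2 \<le> y powr 1 * y powr (p - 1)" using e y by (simp add: powr_numeral)
      also have "\<dots> = y powr p" by (simp only: powr_add[symmetric]) simp
      finally have 1: "y * \<eta>\<^sup>2 \<le> y powr p" using e y by simp
      have "\<eta> powr 2 \<le> \<eta> powr (p - 2)" using e p by (intro powr_mono') auto
      also have "\<dots> \<le> y powr (p - 2)" using e p y by (intro powr_mono2) auto
      finally have "y powr 2 * \<eta>\<^sup>2 \<le> y powr 2 * y powr (p - 2)" using e y by (simp add: powr_numeral)
      also have "\<dots> = y powr p" by (simp only: powr_add[symmetric]) simp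
      finally show ?thesis using 1 e y by (simp add: powr_numeral)
    qed
    then show "\<bar>trunc \<eta> y - y\<bar> \<le> \<bar>y\<bar> powr p / \<eta>\<^sup>2" "\<bar>(trunc \<eta> y)\<^sup>2 - y\<^sup>2\<bar> \<le> \<bar>y\<bar> powr p / \<eta>\<^sup>2"
      using e by (auto simp: trunc_def field_simps)
  qed
  have pt': "\<bar>trunc \<eta> (c * \<xi> i \<omega>) - c * \<xi> i \<omega>\<bar> \<le> c powr p / \<eta>\<^sup>2 * \<bar>\<xi> i \<omega>\<bar> powr p"
    "\<bar>(trunc \<eta> (c * \<xi> i \<omega>))\<^sup>2 - c\<^sup>2 * (\<xi> i \<omega>)\<^sup>2\<bar> \<le> c powr p / \<eta>\<^sup>2 * \<bar>\<xi> i \<omega>\<bar> powr p" for \<omega>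
    using pt[of "c * \<xi> i \<omega>"] c by (auto simp: abs_mult powr_mult power_mult_distrib)
  have m: "integrable M (\<lambda>\<omega>. c powr p / \<eta>\<^sup>2 * \<bar>\<xi> i \<omega>\<bar> powr p)" using xi_powr_integrable by simp
  have d1: "integrable M (\<lambda>\<omega>. trunc \<eta> (c * \<xi> i \<omega>) - c * \<xi> i \<omega>)"
    by (rule Bochner_Integration.integrable_bound[OF m])
       (use pt'(1) in \<open>auto intro!: AE_I2 order_trans[OF pt'(1)]\<close>)
  have d2: "integrable M (\<lambda>\<omega>. (trunc \<eta> (c * \<xi> i \<omega>))\<^sup>2 - c\<^sup>2 * (\<xi> i \<omega>)\<^sup>2)"
    by (rule Bochner_Integration.integrable_bound[OF m])
       (use pt'(2) in \<open>auto intro!: AE_I2 order_trans[OF pt'(2)]\<close>)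
  have i1: "integrable M (\<lambda>\<omega>. c * \<xi> i \<omega>)" and i2: "integrable M (\<lambda>\<omega>. c\<^sup>2 * (\<xi> i \<omega>)\<^sup>2)"
    using xi_integrable xi_square_integrable by auto
  show t1: "integrable M (\<lambda>\<omega>. trunc \<eta> (c * \<xi> i \<omega>))"
    using Bochner_Integration.integrable_add[OF d1 i1] by simp
  show t2: "integrable M (\<lambda>\<omega>. (trunc \<eta> (c * \<xi> i \<omega>))\<^sup>2)"
    using Bochner_Integration.integrable_add[OF d2 i2] by simp
  have e: "expectation (\<lambda>\<omega>. c powr p / \<eta>\<^sup>2 * \<bar>\<xi> i \<omega>\<bar> powr p) = mu * c powr p / \<eta>\<^sup>2"
    using xi_moments(3)[of i] by simp
  have "expectation (\<lambda>\<omega>. trunc \<eta> (c * \<xi> i \<omega>)) = expectation (\<lambda>\<omega>. trunc \<eta> (c * \<xi> i \<omega>) - c * \<xi> i \<omega>)"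
    using t1 i1 xi_moments(1)[of i] by simp
  moreover have "\<bar>expectation (\<lambda>\<omega>. trunc \<eta> (c * \<xi> i \<omega>) - c * \<xi> i \<omega>)\<bar> \<le> expectation (\<lambda>\<omega>. \<bar>trunc \<eta> (c * \<xi> i \<omega>) - c * \<xi> i \<omega>\<bar>)"
    by (rule integral_abs_bound)
  moreover have "\<dots> \<le> expectation (\<lambda>\<omega>. c powr p / \<eta>\<^sup>2 * \<bar>\<xi> i \<omega>\<bar> powr p)"
    using d1 m pt'(1) by (intro integral_mono) auto
  ultimately show "\<bar>expectation (\<lambda>\<omega>. trunc \<eta> (c * \<xi> i \<omega>))\<bar> \<le> mu * c powr p / \<eta>\<^sup>2" unfolding e by linarith
  have "expectation (\<lambda>\<omega>. (trunc \<eta> (c * \<xi> i \<omega>))\<^sup>2) - c\<^sup>2 * s2 = expectation (\<lambda>\<omega>. (trunc \<eta> (c * \<xi> i \<omega>))\<^sup>2 - c\<^sup>2 * (\<xi> i \<omega>)\<^sup>2)"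
    using t2 i2 xi_moments(2)[of i] by simp
  moreover have "\<bar>expectation (\<lambda>\<omega>. (trunc \<eta> (c * \<xi> i \<omega>))\<^sup>2 - c\<^sup>2 * (\<xi> i \<omega>)\<^sup>2)\<bar> \<le> expectation (\<lambda>\<omega>. \<bar>(trunc \<eta> (c * \<xi> i \<omega>))\<^sup>2 - c\<^sup>2 * (\<xi> i \<omega>)\<^sup>2\<bar>)"
    by (rule integral_abs_bound)
  moreover have "\<dots> \<le> expectation (\<lambda>\<omega>. c powr p / \<eta>\<^sup>2 * \<bar>\<xi> i \<omega>\<bar> powr p)"
    using d2 m pt'(2) by (intro integral_mono) auto
  ultimately show "\<bar>expectation (\<lambda>\<omega>. (trunc \<eta> (c * \<xi> i \<omega>))\<^sup>2) - c\<^sup>2 * s2\<bar> \<le> mu * c powr p / \<eta>\<^sup>2" unfolding e by linarith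
qed

text \<open>Stated for \<open>\<xi> k\<close> itself: its truncation, the square of that and its
  absolute power are then covered by composition.\<close>

lemma indep_xi_tsum:
  assumes "finite I" "k \<notin> I"
  shows "indep_var borel (\<lambda>\<omega>. \<xi> k \<omega>) borel (tsum \<eta> w I)"
proof -
  have "indep_vars (\<lambda>_. borel) (\<lambda>i \<omega>. (if i = k then \<xi> i \<omega> else trunc \<eta> (w i * \<xi> i \<omega>))) (insert k I)"
    by (rule indep_vars_fun_xi[of "\<lambda>i y. if i = k then y else trunc \<eta> (w i * y)"]) measurable
  from indep_vars_sum[OF assms this] assms show ?thesis
    unfolding tsum_def[abs_def] by (auto cong: sum.cong simp: if_distrib intro: back_subst[where P="\<lambda>f. indep_var borel (\<lambda>\<omega>. \<xi> k \<omega>) borel f"] intro!: ext sum.cong)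
qed

text \<open>Expand \<open>f\<close> around the sum over \<open>I\<close> once for the truncated term
  and once for a normal one of variance \<open>(w k)\<^sup>2 * s2\<close>. The expansions differ by
  the defects of truncated mean and variance and by two remainders. Each carries the weight
  \<open>exp (l * U)\<close>, whose mean factors out by independence.\<close>

lemma lindeberg_step:
  assumes t: "taylor2 p l B f f1 f2" and l: "0 \<le> l" "l * \<eta> \<le> 1" and e: "0 < \<eta>" "\<eta> \<le> 1"
    and I: "finite I" "k \<notin> I" and w: "\<And>i. i \<in> insert k I \<Longrightarrow> 0 < w i"
    and lk: "l * sqrt ((w k)\<^sup>2 * s2) \<le> 1"
  shows "\<bar>expectation (\<lambda>\<omega>. f (tsum \<eta> w (insert k I) \<omega>))
           - expectation (\<lambda>\<omega>. gauss_avg ((w k)\<^sup>2 * s2) f (tsum \<eta> w I \<omega>))\<bar>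
     \<le> B * expectation (\<lambda>\<omega>. exp (l * tsum \<eta> w I \<omega>)) * (lindeberg_const / \<eta>\<^sup>2 * w k powr p)"
proof -
  define U where "U = tsum \<eta> w I"
  define T where "T \<omega> = trunc \<eta> (w k * \<xi> k \<omega>)" for \<omega>
  define c where "c = w k"
  define v where "v = c\<^sup>2 * s2"
  have c: "0 < c" using w by (simp add: c_def)
  have v: "0 \<le> v" using s2_pos by (simp add: v_def)
  note m = t[unfolded taylor2_def]
  have fm [measurable]: "f \<in> borel_measurable borel" "f1 \<in> borel_measurable borel" "f2 \<in> borel_measurable borel"
    using m by auto
  have [measurable]: "U \<in> borel_measurable M" "T \<in> borel_measurable M"
    unfolding U_def T_def[abs_def] by auto
  obtain K where K: "\<And>s. \<bar>f s\<bar> \<le> K" "\<And>s. \<bar>f1 s\<bar> \<le> K" "\<And>s. \<bar>f2 s\<bar> \<le> K" using m by blast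
  have b1: "\<And>s. \<bar>f1 s\<bar> \<le> B * exp (l * s)" and b2: "\<And>s. \<bar>f2 s\<bar> \<le> B * exp (l * s)" using m by auto
  have tay: "\<bar>f (s + y) - f s - f1 s * y - f2 s * y\<^sup>2 / 2\<bar>
              \<le> B * exp (l * s) * (exp (l * max y 0) * \<bar>y\<bar> powr p)" for s y
    using m by blast
  have B: "0 \<le> B"
  proof -
    have "\<bar>f1 0\<bar> \<le> B" using b1[of 0] by simp
    then show ?thesis using abs_ge_zero[of "f1 0"] by linarith
  qed
  have ins: "tsum \<eta> w (insert k I) \<omega> = U \<omega> + T \<omega>" for \<omega>
    using I by (simp add: tsum_def U_def T_def)
  have expU: "integrable M (\<lambda>\<omega>. exp (l * U \<omega>))"
    unfolding U_def using I l e w by (intro exp_tsum(1)) auto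
  define EU where "EU = expectation (\<lambda>\<omega>. exp (l * U \<omega>))"
  have EU: "0 \<le> EU" by (simp add: EU_def)
  have ind: "indep_var borel (\<xi> k) borel U" unfolding U_def by (rule indep_xi_tsum[OF I])
  have ind': "indep_var borel (\<lambda>\<omega>. g (\<xi> k \<omega>)) borel (\<lambda>\<omega>. h (U \<omega>))"
    if "g \<in> borel_measurable borel" "h \<in> borel_measurable borel" for g h :: "real \<Rightarrow> real"
    using indep_var_compose[OF ind that] by (simp add: comp_def)
  have Tint: "integrable M T" "integrable M (\<lambda>\<omega>. (T \<omega>)\<^sup>2)"
    using trunc_moments(1,2)[OF e c, of k] unfolding T_def[abs_def] c_def by auto
  have bnd: "integrable M (\<lambda>\<omega>. h (U \<omega>))" if "h \<in> borel_measurable borel" "\<And>s. \<bar>h s\<bar> \<le> K" for h :: "real \<Rightarrow> real"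
    using that by (intro integrable_const_bound[where B=K]) auto
  have f1T: "integrable M (\<lambda>\<omega>. T \<omega> * f1 (U \<omega>))"
    "expectation (\<lambda>\<omega>. T \<omega> * f1 (U \<omega>)) = expectation T * expectation (\<lambda>\<omega>. f1 (U \<omega>))"
    unfolding T_def[abs_def]
    by (intro indep_var_integrable indep_var_lebesgue_integral ind'[of "\<lambda>y. trunc \<eta> (w k * y)" f1]
        Tint(1)[unfolded T_def[abs_def]] bnd K; measurable)+
  have f2T: "integrable M (\<lambda>\<omega>. (T \<omega>)\<^sup>2 * f2 (U \<omega>))"
    "expectation (\<lambda>\<omega>. (T \<omega>)\<^sup>2 * f2 (U \<omega>)) = expectation (\<lambda>\<omega>. (T \<omega>)\<^sup>2) * expectation (\<lambda>\<omega>. f2 (U \<omega>))"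
    unfolding T_def[abs_def]
    by (intro indep_var_integrable indep_var_lebesgue_integral ind'[of "\<lambda>y. (trunc \<eta> (w k * y))\<^sup>2" f2]
        Tint(2)[unfolded T_def[abs_def]] bnd K; measurable)+
  have xU: "integrable M (\<lambda>\<omega>. \<bar>\<xi> k \<omega>\<bar> powr p * exp (l * U \<omega>))"
    "expectation (\<lambda>\<omega>. \<bar>\<xi> k \<omega>\<bar> powr p * exp (l * U \<omega>)) = mu * EU"
    unfolding EU_def xi_moments(3)[of k, symmetric]
    by (intro indep_var_integrable indep_var_lebesgue_integral ind'[of "\<lambda>y. \<bar>y\<bar> powr p" "\<lambda>u. exp (l * u)"]
        xi_powr_integrable expU; measurable)+
  \<comment> \<open>\<open>R\<close> is the Taylor remainder of the actual summand; \<open>D\<close>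
    further down is its Gaussian counterpart, already averaged.\<close>
  define R where "R \<omega> = f (U \<omega> + T \<omega>) - f (U \<omega>) - f1 (U \<omega>) * T \<omega> - f2 (U \<omega>) * (T \<omega>)\<^sup>2 / 2" for \<omega>
  have fUT: "integrable M (\<lambda>\<omega>. f (U \<omega> + T \<omega>))" using K by (intro integrable_const_bound[where B=K]) auto
  have fU: "integrable M (\<lambda>\<omega>. f (U \<omega>))" "integrable M (\<lambda>\<omega>. f1 (U \<omega>))" "integrable M (\<lambda>\<omega>. f2 (U \<omega>))"
    using K by (auto intro!: bnd)
  have gU: "integrable M (\<lambda>\<omega>. gauss_avg v f (U \<omega>))"
    using K by (intro bnd) (auto intro!: gauss_avg_bound)
  have Ri: "integrable M R"
    unfolding R_def[abs_def] using fUT fU f1T(1) f2T(1) by (auto simp: mult.commute)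
  have RE: "\<bar>expectation R\<bar> \<le> B * EU * (exp 1 * mu * c powr p)"
  proof -
    have pt: "\<bar>R \<omega>\<bar> \<le> B * exp 1 * c powr p * (\<bar>\<xi> k \<omega>\<bar> powr p * exp (l * U \<omega>))" for \<omega>
    proof -
      have "max (T \<omega>) 0 \<le> \<eta>" using e by (auto simp: T_def trunc_def)
      then have "l * max (T \<omega>) 0 \<le> l * \<eta>" using l by (intro mult_left_mono) auto
      then have 1: "exp (l * max (T \<omega>) 0) \<le> exp 1" using l by simp
      have "\<bar>T \<omega>\<bar> \<le> c * \<bar>\<xi> k \<omega>\<bar>" using c by (auto simp: T_def trunc_def c_def abs_mult)
      then have "\<bar>T \<omega>\<bar> powr p \<le> (c * \<bar>\<xi> k \<omega>\<bar>) powr p" using p by (intro powr_mono2) auto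
      then have 2: "\<bar>T \<omega>\<bar> powr p \<le> c powr p * \<bar>\<xi> k \<omega>\<bar> powr p" using c by (simp add: powr_mult)
      have "\<bar>R \<omega>\<bar> \<le> B * exp (l * U \<omega>) * (exp (l * max (T \<omega>) 0) * \<bar>T \<omega>\<bar> powr p)"
        unfolding R_def by (rule tay)
      also have "\<dots> \<le> B * exp (l * U \<omega>) * (exp 1 * (c powr p * \<bar>\<xi> k \<omega>\<bar> powr p))"
        using 1 2 B by (intro mult_left_mono mult_mono) auto
      finally show ?thesis by (simp add: mult_ac)
    qed
    have "\<bar>expectation R\<bar> \<le> expectation (\<lambda>\<omega>. \<bar>R \<omega>\<bar>)" by (rule integral_abs_bound)
    also have "\<dots> \<le> expectation (\<lambda>\<omega>. B * exp 1 * c powr p * (\<bar>\<xi> k \<omega>\<bar> powr p * exp (l * U \<omega>)))"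
      using Ri xU(1) pt by (intro integral_mono) auto
    also have "\<dots> = B * exp 1 * c powr p * (mu * EU)" using xU by simp
    finally show ?thesis by (simp add: mult_ac)
  qed
  have e1: "\<bar>expectation (\<lambda>\<omega>. f1 (U \<omega>))\<bar> \<le> B * EU" and e2: "\<bar>expectation (\<lambda>\<omega>. f2 (U \<omega>))\<bar> \<le> B * EU"
  proof -
    have "\<bar>expectation (\<lambda>\<omega>. h (U \<omega>))\<bar> \<le> B * EU"
      if [measurable]: "h \<in> borel_measurable borel" and h: "\<And>s. \<bar>h s\<bar> \<le> B * exp (l * s)" "\<And>s. \<bar>h s\<bar> \<le> K" for h :: "real \<Rightarrow> real"
    proof -
      have "\<bar>expectation (\<lambda>\<omega>. h (U \<omega>))\<bar> \<le> expectation (\<lambda>\<omega>. \<bar>h (U \<omega>)\<bar>)" by (rule integral_abs_bound)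
      also have "\<dots> \<le> expectation (\<lambda>\<omega>. B * exp (l * U \<omega>))"
        using h expU bnd[of h] by (intro integral_mono) auto
      finally show ?thesis by (simp add: EU_def)
    qed
    from this[of f1] this[of f2] show "\<bar>expectation (\<lambda>\<omega>. f1 (U \<omega>))\<bar> \<le> B * EU" "\<bar>expectation (\<lambda>\<omega>. f2 (U \<omega>))\<bar> \<le> B * EU"
      using b1 b2 K by auto
  qed
  define D where "D \<omega> = gauss_avg v f (U \<omega>) - f (U \<omega>) - f2 (U \<omega>) * v / 2" for \<omega>
  have Di: "integrable M D" unfolding D_def[abs_def] using gU fU by auto
  have DE: "\<bar>expectation D\<bar> \<le> B * EU * (v powr (p / 2) * gauss_const p)"
  proof -
    have "\<bar>expectation D\<bar> \<le> expectation (\<lambda>\<omega>. \<bar>D \<omega>\<bar>)" by (rule integral_abs_bound)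
    also have "\<dots> \<le> expectation (\<lambda>\<omega>. (B * (v powr (p / 2) * gauss_const p)) * exp (l * U \<omega>))"
    proof (intro integral_mono integrable_mult_right expU)
      show "integrable M (\<lambda>\<omega>. \<bar>D \<omega>\<bar>)" using Di by simp
      fix \<omega>
      have "\<bar>D \<omega>\<bar> \<le> B * exp (l * U \<omega>) * (v powr (p / 2) * gauss_const p)"
        unfolding D_def using t v l(1) lk p by (intro taylor2_gauss_step) (auto simp: v_def c_def)
      then show "\<bar>D \<omega>\<bar> \<le> (B * (v powr (p / 2) * gauss_const p)) * exp (l * U \<omega>)" by (simp add: mult_ac)
    qed
    also have "\<dots> = (B * (v powr (p / 2) * gauss_const p)) * EU" by (simp add: EU_def)
    finally show ?thesis by (simp add: mult_ac)
  qed
  have vp: "v powr (p / 2) = s2 powr (p / 2) * c powr p"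
    using c s2_pos by (simp add: v_def powr_mult powr_powr flip: powr_numeral)
  \<comment> \<open>The common term \<open>f (U)\<close> cancels. By independence the moments of
    \<open>T\<close> separate from \<open>f1 (U)\<close> and \<open>f2 (U)\<close>, and the two
    second-order terms leave only the variance defect.\<close>
  have "expectation (\<lambda>\<omega>. f (U \<omega> + T \<omega>)) - expectation (\<lambda>\<omega>. gauss_avg v f (U \<omega>))
     = expectation R + expectation T * expectation (\<lambda>\<omega>. f1 (U \<omega>))
       + (expectation (\<lambda>\<omega>. (T \<omega>)\<^sup>2) - v) * expectation (\<lambda>\<omega>. f2 (U \<omega>)) / 2 - expectation D"
  proof -
    have "expectation R = expectation (\<lambda>\<omega>. f (U \<omega> + T \<omega>)) - expectation (\<lambda>\<omega>. f (U \<omega>))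
        - expectation (\<lambda>\<omega>. T \<omega> * f1 (U \<omega>)) - expectation (\<lambda>\<omega>. (T \<omega>)\<^sup>2 * f2 (U \<omega>)) / 2"
      unfolding R_def[abs_def] using fUT fU f1T(1) f2T(1) by (simp add: mult.commute)
    moreover have "expectation D = expectation (\<lambda>\<omega>. gauss_avg v f (U \<omega>)) - expectation (\<lambda>\<omega>. f (U \<omega>))
        - expectation (\<lambda>\<omega>. f2 (U \<omega>)) * v / 2"
      unfolding D_def[abs_def] using gU fU by simp
    ultimately show ?thesis unfolding f1T(2) f2T(2) by (simp add: algebra_simps diff_divide_distrib)
  qed
  moreover have "\<bar>expectation T * expectation (\<lambda>\<omega>. f1 (U \<omega>))\<bar> \<le> (mu * c powr p / \<eta>\<^sup>2) * (B * EU)"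
    unfolding abs_mult using trunc_moments(3)[OF e c, of k] e1
    by (intro mult_mono) (auto simp: T_def[abs_def] c_def)
  moreover have "\<bar>(expectation (\<lambda>\<omega>. (T \<omega>)\<^sup>2) - v) * expectation (\<lambda>\<omega>. f2 (U \<omega>)) / 2\<bar> \<le> (mu * c powr p / \<eta>\<^sup>2) * (B * EU)"
  proof -
    have "\<bar>(expectation (\<lambda>\<omega>. (T \<omega>)\<^sup>2) - v) * expectation (\<lambda>\<omega>. f2 (U \<omega>))\<bar> \<le> (mu * c powr p / \<eta>\<^sup>2) * (B * EU)"
      unfolding abs_mult using trunc_moments(4)[OF e c, of k] e2
      by (intro mult_mono) (auto simp: T_def[abs_def] c_def v_def)
    then show ?thesis by (rule order_trans[rotated]) simp
  qed
  ultimately have "\<bar>expectation (\<lambda>\<omega>. f (U \<omega> + T \<omega>)) - expectation (\<lambda>\<omega>. gauss_avg v f (U \<omega>))\<bar>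
     \<le> B * EU * (exp 1 * mu * c powr p) + 2 * ((mu * c powr p / \<eta>\<^sup>2) * (B * EU)) + B * EU * (v powr (p / 2) * gauss_const p)"
    using RE DE by linarith
  also have "\<dots> = B * EU * ((exp 1 * mu + s2 powr (p / 2) * gauss_const p) * c powr p + 2 * mu * c powr p / \<eta>\<^sup>2)"
    unfolding vp by (simp add: algebra_simps)
  also have "\<dots> \<le> B * EU * (lindeberg_const / \<eta>\<^sup>2 * c powr p)"
  proof (intro mult_left_mono)
    have "1 \<le> 1 / \<eta>\<^sup>2" using e by (simp add: power_le_one)
    moreover have "0 \<le> (exp 1 * mu + s2 powr (p / 2) * gauss_const p) * c powr p"
      using mu_nonneg gauss_const_nonneg by (intro mult_nonneg_nonneg add_nonneg_nonneg) auto
    ultimately have "(exp 1 * mu + s2 powr (p / 2) * gauss_const p) * c powr p * 1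
      \<le> (exp 1 * mu + s2 powr (p / 2) * gauss_const p) * c powr p * (1 / \<eta>\<^sup>2)" by (rule mult_left_mono)
    then show "(exp 1 * mu + s2 powr (p / 2) * gauss_const p) * c powr p + 2 * mu * c powr p / \<eta>\<^sup>2
      \<le> lindeberg_const / \<eta>\<^sup>2 * c powr p"
      unfolding lindeberg_const_def by (simp add: algebra_simps add_divide_distrib)
  qed (use B EU in auto)
  finally show ?thesis unfolding ins by (simp add: U_def EU_def c_def v_def)
qed

lemma vsum_insert: "finite I \<Longrightarrow> k \<notin> I \<Longrightarrow> vsum w (insert k I) = (w k)\<^sup>2 * s2 + vsum w I"
  and lyap_insert: "finite I \<Longrightarrow> k \<notin> I \<Longrightarrow> lyap w (insert k I) = w k powr p + lyap w I"
  by (simp_all add: vsum_def lyap_def)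

lemma lindeberg_const_nonneg: "0 \<le> lindeberg_const"
  unfolding lindeberg_const_def using mu_nonneg gauss_const_nonneg by (intro add_nonneg_nonneg mult_nonneg_nonneg) auto

text \<open>Replace one term at a time: the step turns the test function into its Gaussian average,
  to which the induction hypothesis applies on the smaller set. The semigroup law collects the
  variances into \<open>vsum w I\<close>.\<close>

lemma lindeberg:
  assumes "taylor2 p l B f f1 f2" and l: "0 \<le> l" "l * \<eta> \<le> 1" and e: "0 < \<eta>" "\<eta> \<le> 1"
    and "finite I" and "\<And>i. i \<in> I \<Longrightarrow> 0 < w i"
    and "\<And>i. i \<in> I \<Longrightarrow> l * sqrt ((w i)\<^sup>2 * s2) \<le> 1"
  shows "\<bar>expectation (\<lambda>\<omega>. f (tsum \<eta> w I \<omega>)) - gauss_avg (vsum w I) f 0\<bar>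
     \<le> B * exp (l\<^sup>2 / 2 * vsum w I + l powr p * exp 1 * mu * lyap w I) * (lindeberg_const / \<eta>\<^sup>2 * lyap w I)"
  using assms(6,1,7,8)
proof (induction I arbitrary: f f1 f2 B rule: finite_induct)
  case empty
  then show ?case by (simp add: tsum_def vsum_def lyap_def prob_space)
next
  case (insert k I)
  define v where "v = (w k)\<^sup>2 * s2"
  \<comment> \<open>The exponent of the moment bound. It grows with the index set, and by at least
    \<open>l\<^sup>2 * v / 2\<close> when \<open>k\<close> is added, so every intermediate error can
    be charged at the final exponent.\<close>
  define G where "G J = l\<^sup>2 / 2 * vsum w J + l powr p * exp 1 * mu * lyap w J" for J
  have v: "0 \<le> v" using s2_pos by (simp add: v_def)
  note m = insert.prems(1)[unfolded taylor2_def]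
  have fm: "f \<in> borel_measurable borel" using m by auto
  obtain K where K: "\<And>s. \<bar>f s\<bar> \<le> K" using m by blast
  have "\<bar>f1 0\<bar> \<le> B * exp (l * 0)" using m by blast
  then have B: "0 \<le> B" using abs_ge_zero[of "f1 0"] by simp
  have G1: "G I \<le> G (insert k I)"
  proof -
    have "l\<^sup>2 / 2 * vsum w I \<le> l\<^sup>2 / 2 * vsum w (insert k I)"
      using insert.hyps v by (intro mult_left_mono) (auto simp: vsum_insert v_def)
    moreover have "l powr p * exp 1 * mu * lyap w I \<le> l powr p * exp 1 * mu * lyap w (insert k I)"
      using insert.hyps mu_nonneg by (intro mult_left_mono) (auto simp: lyap_insert)
    ultimately show ?thesis unfolding G_def by linarith
  qed
  have G2: "l\<^sup>2 * v / 2 + G I \<le> G (insert k I)"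
  proof -
    have "l powr p * exp 1 * mu * lyap w I \<le> l powr p * exp 1 * mu * lyap w (insert k I)"
      using insert.hyps mu_nonneg by (intro mult_left_mono) (auto simp: lyap_insert)
    then show ?thesis unfolding G_def using insert.hyps by (simp add: vsum_insert v_def algebra_simps)
  qed
  have "\<bar>expectation (\<lambda>\<omega>. f (tsum \<eta> w (insert k I) \<omega>)) - expectation (\<lambda>\<omega>. gauss_avg v f (tsum \<eta> w I \<omega>))\<bar>
     \<le> B * expectation (\<lambda>\<omega>. exp (l * tsum \<eta> w I \<omega>)) * (lindeberg_const / \<eta>\<^sup>2 * w k powr p)"
    unfolding v_def using insert l e by (intro lindeberg_step[OF insert.prems(1)]) auto
  also have "\<dots> \<le> B * exp (G (insert k I)) * (lindeberg_const / \<eta>\<^sup>2 * w k powr p)"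
  proof (intro mult_right_mono mult_left_mono)
    have "expectation (\<lambda>\<omega>. exp (l * tsum \<eta> w I \<omega>)) \<le> exp (l\<^sup>2 / 2 * vsum w I + l powr p * exp (l * \<eta>) * mu * lyap w I)"
      using insert l e by (intro exp_tsum(2)) auto
    also have "\<dots> \<le> exp (G I)" unfolding G_def using l lyap_nonneg mu_nonneg
      by (auto intro!: mult_right_mono mult_left_mono)
    also have "\<dots> \<le> exp (G (insert k I))" using G1 by simp
    finally show "expectation (\<lambda>\<omega>. exp (l * tsum \<eta> w I \<omega>)) \<le> exp (G (insert k I))" .
  qed (use B lindeberg_const_nonneg in auto)
  finally have 1: "\<bar>expectation (\<lambda>\<omega>. f (tsum \<eta> w (insert k I) \<omega>)) - expectation (\<lambda>\<omega>. gauss_avg v f (tsum \<eta> w I \<omega>))\<bar>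
     \<le> B * exp (G (insert k I)) * (lindeberg_const / \<eta>\<^sup>2 * w k powr p)" .
  \<comment> \<open>The induction hypothesis is used for \<open>gauss_avg v f\<close>; the inflation
    \<open>exp (l\<^sup>2 * v / 2)\<close> of its constant is exactly the contribution of the
    removed index to the exponent.\<close>
  have "\<bar>expectation (\<lambda>\<omega>. gauss_avg v f (tsum \<eta> w I \<omega>)) - gauss_avg (vsum w I) (gauss_avg v f) 0\<bar>
     \<le> B * exp (l\<^sup>2 * v / 2) * exp (G I) * (lindeberg_const / \<eta>\<^sup>2 * lyap w I)"
    unfolding G_def using insert.prems by (intro insert.IH[OF taylor2_gauss_avg[OF insert.prems(1) v]]) auto
  also have "\<dots> = B * exp (l\<^sup>2 * v / 2 + G I) * (lindeberg_const / \<eta>\<^sup>2 * lyap w I)" by (simp add: exp_add)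
  also have "\<dots> \<le> B * exp (G (insert k I)) * (lindeberg_const / \<eta>\<^sup>2 * lyap w I)"
    using G2 B lindeberg_const_nonneg lyap_nonneg by (intro mult_right_mono mult_left_mono) auto
  finally have 2: "\<bar>expectation (\<lambda>\<omega>. gauss_avg v f (tsum \<eta> w I \<omega>)) - gauss_avg (vsum w I) (gauss_avg v f) 0\<bar>
     \<le> B * exp (G (insert k I)) * (lindeberg_const / \<eta>\<^sup>2 * lyap w I)" .
  have 3: "gauss_avg (vsum w I) (gauss_avg v f) 0 = gauss_avg (vsum w (insert k I)) f 0"
    using gauss_avg_gauss_avg[OF fm K vsum_nonneg v, of w I] insert.hyps by (simp add: vsum_insert v_def add.commute)
  have 4: "B * exp (G (insert k I)) * (lindeberg_const / \<eta>\<^sup>2 * w k powr p)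
    + B * exp (G (insert k I)) * (lindeberg_const / \<eta>\<^sup>2 * lyap w I)
    = B * exp (G (insert k I)) * (lindeberg_const / \<eta>\<^sup>2 * lyap w (insert k I))"
    using insert.hyps by (simp add: lyap_insert algebra_simps add_divide_distrib)
  show ?case using 1 2 unfolding 3 G_def[symmetric] using 4 by linarith
qed


text \<open>\<open>3 * exp 3\<close> comes from moving the threshold by the ramp width
  \<open>3 * d\<close>. In the other term 4 is the Taylor constant of the ramp, \<open>exp 4\<close>
  combines \<open>exp 3\<close> for this shift with \<open>exp 1\<close> for the Lyapunov term, and
  \<open>sqrt (2 * pi)\<close> normalises the density. The outer factor is that of
  \<open>normal_tail_ge\<close>.\<close>

definition clt_const :: real where
  "clt_const = exp (3 / 2) * (3 * exp 3 + 4 * exp 4 * sqrt (2 * pi) * lindeberg_const)"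

lemma clt_const_nonneg: "0 \<le> clt_const"
  unfolding clt_const_def using lindeberg_const_nonneg by simp

text \<open>Exponential weighting with exactly \<open>l = x\<close> balances \<open>exp (- l * x + l\<^sup>2 / 2)\<close> against the
  normal tail, so that the Lindeberg error is small relative to \<open>normal_tail x\<close>.\<close>

lemma tsum_normal_approx:
  assumes I: "finite I" and w: "\<And>i. i \<in> I \<Longrightarrow> 0 < w i" and V: "vsum w I = 1"
    and x: "0 \<le> x" and d: "0 < d" "d \<le> 1" "x * d \<le> 1" and e: "0 < \<eta>" "\<eta> \<le> 1" "x * \<eta> \<le> 1"
    and xw: "\<And>i. i \<in> I \<Longrightarrow> x * sqrt ((w i)\<^sup>2 * s2) \<le> 1"
    and xl: "x powr p * exp 1 * mu * lyap w I \<le> 1"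
  shows "\<bar>\<P>(\<omega> in M. x \<le> tsum \<eta> w I \<omega>) - normal_tail x\<bar>
     \<le> clt_const * (1 + x) * (d + lyap w I / (\<eta>\<^sup>2 * d ^ 3)) * normal_tail x"
proof -
  define f where "f a s = ramp ((s - a) / d)" for a s
  define P where "P = \<P>(\<omega> in M. x \<le> tsum \<eta> w I \<omega>)"
  define E where "E = lyap w I / (\<eta>\<^sup>2 * d ^ 3)"
  define \<phi> where "\<phi> = std_normal_density x"
  define err where "err = 4 * exp 4 * sqrt (2 * pi) * lindeberg_const * E * \<phi>"
  have E0: "0 \<le> E" using lyap_nonneg e d by (simp add: E_def)
  have \<phi>0: "0 \<le> \<phi>" by (simp add: \<phi>_def)
  \<comment> \<open>Used for \<open>a = x - 3 * d\<close>, where the ramp has reached 1 at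
    \<open>x\<close> and bounds the probability from above, and for \<open>a = x\<close>, which
    bounds it from below. For such \<open>a\<close>, \<open>exp (- x * a)\<close> is at most
    \<open>exp (- x\<^sup>2 + 3)\<close>.\<close>
  have lind: "\<bar>expectation (\<lambda>\<omega>. f a (tsum \<eta> w I \<omega>)) - gauss_avg 1 (f a) 0\<bar> \<le> err" if a: "x - 3 * d \<le> a" for a
  proof -
    have "\<bar>expectation (\<lambda>\<omega>. f a (tsum \<eta> w I \<omega>)) - gauss_avg (vsum w I) (f a) 0\<bar>
       \<le> (4 / d ^ 3 * exp (- x * a)) * exp (x\<^sup>2 / 2 * vsum w I + x powr p * exp 1 * mu * lyap w I) * (lindeberg_const / \<eta>\<^sup>2 * lyap w I)"
      unfolding f_def[abs_def] using p d x e I w xw by (intro lindeberg[OF taylor2_ramp]) auto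
    also have "\<dots> \<le> (4 / d ^ 3 * exp (- x\<^sup>2 + 3)) * exp (x\<^sup>2 / 2 + 1) * (lindeberg_const / \<eta>\<^sup>2 * lyap w I)"
    proof (intro mult_mono mult_left_mono)
      have "x * (x - 3 * d) \<le> x * a" using a x by (intro mult_left_mono) auto
      then show "exp (- x * a) \<le> exp (- x\<^sup>2 + 3)" using d(3) by (simp add: algebra_simps power2_eq_square)
      show "exp (x\<^sup>2 / 2 * vsum w I + x powr p * exp 1 * mu * lyap w I) \<le> exp (x\<^sup>2 / 2 + 1)" using V xl by simp
    qed (use d lindeberg_const_nonneg lyap_nonneg in auto)
    also have "\<dots> = 4 * (exp (- x\<^sup>2 + 3) * exp (x\<^sup>2 / 2 + 1)) * lindeberg_const * E"
      unfolding E_def by (simp add: field_simps)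
    also have "exp (- x\<^sup>2 + 3) * exp (x\<^sup>2 / 2 + 1) = exp 4 * sqrt (2 * pi) * \<phi>"
    proof -
      have "exp (- x\<^sup>2 + 3) * exp (x\<^sup>2 / 2 + 1) = exp (4 + - x\<^sup>2 / 2)" by (simp add: exp_add[symmetric] field_simps)
      then show ?thesis unfolding \<phi>_def std_normal_density_def exp_add by simp
    qed
    finally show ?thesis unfolding V err_def by (simp add: mult_ac)
  qed
  have fi: "integrable M (\<lambda>\<omega>. f a (tsum \<eta> w I \<omega>))" for a
    unfolding f_def by (intro integrable_const_bound[where B=1]) (auto simp: ramp_bounds)
  have ii: "integrable M (indicator {\<omega>\<in>space M. x \<le> tsum \<eta> w I \<omega>} :: _ \<Rightarrow> real)"
    by (intro integrable_const_bound[where B=1]) auto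
  have Pe: "P = expectation (indicator {\<omega>\<in>space M. x \<le> tsum \<eta> w I \<omega>})" by (simp add: P_def)
  have "P \<le> expectation (\<lambda>\<omega>. f (x - 3 * d) (tsum \<eta> w I \<omega>))"
    unfolding Pe using d by (intro integral_mono fi ii) (auto simp: f_def indicator_def ramp_bounds ramp_ge_3 field_simps)
  also have "\<dots> \<le> gauss_avg 1 (f (x - 3 * d)) 0 + err" using lind[of "x - 3 * d"] by simp
  also have "gauss_avg 1 (f (x - 3 * d)) 0 \<le> normal_tail (x - 3 * d)"
    unfolding f_def[abs_def] by (rule gauss_avg_ramp_le[OF d(1)])
  also have "normal_tail (x - 3 * d) \<le> normal_tail x + \<phi> * exp (x * (3 * d)) * (3 * d)"
    using normal_tail_shift_left[OF x, of "3 * d"] d by (simp add: \<phi>_def)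
  also have "\<phi> * exp (x * (3 * d)) * (3 * d) \<le> \<phi> * exp 3 * (3 * d)"
    using d(1,3) \<phi>0 by (intro mult_right_mono mult_left_mono) auto
  finally have up: "P - normal_tail x \<le> \<phi> * exp 3 * (3 * d) + err" by simp
  have "expectation (\<lambda>\<omega>. f x (tsum \<eta> w I \<omega>)) \<le> P"
    unfolding Pe using d
    by (intro integral_mono fi ii) (auto simp: f_def indicator_def ramp_bounds ramp_le_0 divide_le_0_iff)
  moreover have "gauss_avg 1 (f x) 0 - err \<le> expectation (\<lambda>\<omega>. f x (tsum \<eta> w I \<omega>))"
    using lind[of x] d by simp
  moreover have "normal_tail (x + 3 * d) \<le> gauss_avg 1 (f x) 0"
    unfolding f_def[abs_def] by (rule gauss_avg_ramp_ge[OF d(1)])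
  moreover have "normal_tail x - normal_tail (x + 3 * d) \<le> \<phi> * (3 * d)"
    using normal_tail_shift_right[OF x, of "3 * d"] d by (simp add: \<phi>_def)
  moreover have "\<phi> * (3 * d) \<le> \<phi> * exp 3 * (3 * d)"
  proof -
    have "\<phi> * 1 \<le> \<phi> * exp 3" using \<phi>0 by (intro mult_left_mono) auto
    then show ?thesis using d by (intro mult_right_mono) auto
  qed
  ultimately have "normal_tail x - P \<le> \<phi> * exp 3 * (3 * d) + err" by linarith
  with up have "\<bar>P - normal_tail x\<bar> \<le> \<phi> * exp 3 * (3 * d) + err" by linarith
  also have "\<dots> = \<phi> * (3 * exp 3 * d + 4 * exp 4 * sqrt (2 * pi) * lindeberg_const * E)"
    unfolding err_def by (simp add: algebra_simps)
  \<comment> \<open>The lower bound for the normal tail, read backwards, trades the density for the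
    tail at the price of the factor \<open>1 + x\<close>.\<close>
  also have "\<dots> \<le> (exp (3 / 2) * (1 + x) * normal_tail x)
      * ((3 * exp 3 + 4 * exp 4 * sqrt (2 * pi) * lindeberg_const) * (d + E))"
  proof (intro mult_mono)
    have "exp (3 / 2) * (1 + x) * (exp (- 3 / 2) * \<phi> / (1 + x)) \<le> exp (3 / 2) * (1 + x) * normal_tail x"
      using normal_tail_ge[OF x] x by (intro mult_left_mono) (auto simp: \<phi>_def)
    moreover have "exp (3 / 2) * (1 + x) * (exp (- 3 / 2) * \<phi> / (1 + x)) = (exp (3 / 2) * exp (- 3 / 2)) * \<phi>"
      using x by (simp add: field_simps)
    moreover have "exp (3 / 2) * exp (- 3 / 2) = (1::real)" by (simp add: exp_add[symmetric])
    ultimately show "\<phi> \<le> exp (3 / 2) * (1 + x) * normal_tail x" by simp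
    define A where "A = 4 * exp 4 * sqrt (2 * pi) * lindeberg_const"
    have A: "0 \<le> A" unfolding A_def using lindeberg_const_nonneg by simp
    have "0 \<le> A * d" "0 \<le> 3 * exp 3 * E" using A E0 d by auto
    then show "3 * exp 3 * d + 4 * exp 4 * sqrt (2 * pi) * lindeberg_const * E
      \<le> (3 * exp 3 + 4 * exp 4 * sqrt (2 * pi) * lindeberg_const) * (d + E)"
      unfolding A_def[symmetric] by (simp add: algebra_simps)
  qed (use x normal_tail_nonneg E0 d lindeberg_const_nonneg in auto)
  also have "\<dots> = clt_const * (1 + x) * (d + E) * normal_tail x"
    unfolding clt_const_def by (simp add: mult_ac)
  finally show ?thesis unfolding P_def E_def .
qed

section \<open>One big jump\<close>

definition tailp :: "real \<Rightarrow> real" where "tailp u = \<P>(\<omega> in M. u \<le> \<xi> 0 \<omega>)"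

definition tails :: "(int \<Rightarrow> real) \<Rightarrow> int set \<Rightarrow> real \<Rightarrow> real" where
  "tails w I y = (\<Sum>i\<in>I. tailp (y / w i))"

lemma tailp_nonneg: "0 \<le> tailp u" by (simp add: tailp_def)
lemma tails_nonneg: "0 \<le> tails w I y" by (simp add: tails_def tailp_nonneg sum_nonneg)
lemma tailp_antimono: "u \<le> v \<Longrightarrow> tailp v \<le> tailp u"
  unfolding tailp_def by (intro finite_measure_mono) auto

lemma tails_antimono: "(\<And>i. i \<in> I \<Longrightarrow> 0 < w i) \<Longrightarrow> u \<le> v \<Longrightarrow> tails w I v \<le> tails w I u"
  unfolding tails_def by (intro sum_mono tailp_antimono divide_right_mono) (auto intro: less_imp_le)

lemma prob_scaled_xi: "0 < c \<Longrightarrow> \<P>(\<omega> in M. y \<le> c * \<xi> i \<omega>) = tailp (y / c)"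
  using xi_prob[of "\<lambda>z. y \<le> c * z" i] unfolding tailp_def
  by (simp add: field_simps pos_divide_le_eq)

lemma prob_scaled_xi_gt: "0 < c \<Longrightarrow> \<P>(\<omega> in M. y < c * \<xi> i \<omega>) \<le> tailp (y / c)"
  unfolding prob_scaled_xi[of c y i, symmetric] by (intro finite_measure_mono) auto

lemma prob_xi_tsum:
  assumes "finite I" "k \<notin> I" and [measurable]: "Measurable.pred borel P" "Measurable.pred borel Q"
  shows "\<P>(\<omega> in M. P (\<xi> k \<omega>) \<and> Q (tsum \<eta> w I \<omega>)) = \<P>(\<omega> in M. P (\<xi> k \<omega>)) * \<P>(\<omega> in M. Q (tsum \<eta> w I \<omega>))"
  using indep_varD[OF indep_xi_tsum[OF assms(1,2), of \<eta> w], of "{y. P y}" "{y. Q y}"] assms(3,4)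
  by (simp add: vimage_def Int_def conj_commute)

lemma prob_xi_xi:
  assumes "i \<noteq> j" and [measurable]: "Measurable.pred borel P" "Measurable.pred borel Q"
  shows "\<P>(\<omega> in M. P (\<xi> i \<omega>) \<and> Q (\<xi> j \<omega>)) = \<P>(\<omega> in M. P (\<xi> i \<omega>)) * \<P>(\<omega> in M. Q (\<xi> j \<omega>))"
proof -
  have "indep_vars (\<lambda>_. borel) \<xi> (insert i {j})" by (rule indep_vars_subset[OF indep]) auto
  from indep_vars_sum[OF _ _ this] assms(1) have "indep_var borel (\<xi> i) borel (\<xi> j)" by simp
  from indep_varD[OF this, of "{y. P y}" "{y. Q y}"] show ?thesis
    by (simp add: vimage_def Int_def conj_commute)
qed

lemma tsum_remove:
  assumes "finite I" "i \<in> I"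
  shows "tsum \<eta> w I \<omega> = trunc \<eta> (w i * \<xi> i \<omega>) + tsum \<eta> w (I - {i}) \<omega>"
  unfolding tsum_def using assms by (rule sum.remove)

lemma wsum_remove:
  assumes "finite I" "i \<in> I"
  shows "wsum w I \<omega> = w i * \<xi> i \<omega> + wsum w (I - {i}) \<omega>"
  unfolding wsum_def using assms by (rule sum.remove)

lemma tsum_eq_wsum: "(\<And>i. i \<in> I \<Longrightarrow> w i * \<xi> i \<omega> \<le> \<eta>) \<Longrightarrow> tsum \<eta> w I \<omega> = wsum w I \<omega>"
  by (auto simp: tsum_def wsum_def trunc_def intro!: sum.cong)

text \<open>If no term exceeds \<open>\<eta>\<close>, truncation changes nothing. If exactly one
  does, either it carries \<open>(1 - \<epsilon>) * x\<close> alone, or the independent truncated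
  rest reaches \<open>\<epsilon> * x\<close>, which costs the factor \<open>q\<close>. Two large
  terms cost a product of tails, in total at most the square.\<close>

lemma big_jump_upper:
  assumes I: "finite I" and w: "\<And>i. i \<in> I \<Longrightarrow> 0 < w i"
    and q: "\<And>i. i \<in> I \<Longrightarrow> \<P>(\<omega> in M. \<epsilon> * x \<le> tsum \<eta> w (I - {i}) \<omega>) \<le> q"
  shows "\<P>(\<omega> in M. x \<le> wsum w I \<omega>)
    \<le> \<P>(\<omega> in M. x \<le> tsum \<eta> w I \<omega>) + tails w I ((1 - \<epsilon>) * x) + tails w I \<eta> * q + (tails w I \<eta>)\<^sup>2"
proof -
  define A0 where "A0 = {\<omega>\<in>space M. x \<le> tsum \<eta> w I \<omega>}"
  define A where "A i = {\<omega>\<in>space M. (1 - \<epsilon>) * x \<le> w i * \<xi> i \<omega>}" for i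
  define B where "B i = {\<omega>\<in>space M. \<eta> < w i * \<xi> i \<omega> \<and> \<epsilon> * x \<le> tsum \<eta> w (I - {i}) \<omega>}" for i
  define C where "C i j = {\<omega>\<in>space M. \<eta> < w i * \<xi> i \<omega> \<and> \<eta> < w j * \<xi> j \<omega>}" for i j
  have [measurable]: "A0 \<in> sets M" "A i \<in> sets M" "B i \<in> sets M" "C i j \<in> sets M" for i j
    unfolding A0_def A_def B_def C_def by measurable
  have "{\<omega>\<in>space M. x \<le> wsum w I \<omega>} \<subseteq> A0 \<union> (\<Union>i\<in>I. A i) \<union> (\<Union>i\<in>I. B i) \<union> (\<Union>i\<in>I. \<Union>j\<in>I - {i}. C i j)"
  proof
    fix \<omega> assume "\<omega> \<in> {\<omega>\<in>space M. x \<le> wsum w I \<omega>}"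
    then have \<omega>: "\<omega> \<in> space M" "x \<le> wsum w I \<omega>" by auto
    show "\<omega> \<in> A0 \<union> (\<Union>i\<in>I. A i) \<union> (\<Union>i\<in>I. B i) \<union> (\<Union>i\<in>I. \<Union>j\<in>I - {i}. C i j)"
    proof (cases "\<exists>i\<in>I. \<eta> < w i * \<xi> i \<omega>")
      case False
      then have "tsum \<eta> w I \<omega> = wsum w I \<omega>" by (intro tsum_eq_wsum) (auto simp: not_less)
      then show ?thesis using \<omega> by (simp add: A0_def)
    next
      case True
      then obtain i where i: "i \<in> I" "\<eta> < w i * \<xi> i \<omega>" by blast
      show ?thesis
      proof (cases "\<exists>j\<in>I - {i}. \<eta> < w j * \<xi> j \<omega>")
        case True
        then show ?thesis using i \<omega> by (auto simp: C_def)
      next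
        case False
        then have "tsum \<eta> w (I - {i}) \<omega> = wsum w (I - {i}) \<omega>" by (intro tsum_eq_wsum) (auto simp: not_less)
        then have "x \<le> w i * \<xi> i \<omega> + tsum \<eta> w (I - {i}) \<omega>" using \<omega> wsum_remove[OF I i(1), of w \<omega>] by simp
        then have "(1 - \<epsilon>) * x \<le> w i * \<xi> i \<omega> \<or> \<epsilon> * x \<le> tsum \<eta> w (I - {i}) \<omega>" by (simp add: algebra_simps) linarith
        then show ?thesis using i \<omega> by (auto simp: A_def B_def)
      qed
    qed
  qed
  then have "\<P>(\<omega> in M. x \<le> wsum w I \<omega>) \<le> prob (A0 \<union> (\<Union>i\<in>I. A i) \<union> (\<Union>i\<in>I. B i) \<union> (\<Union>i\<in>I. \<Union>j\<in>I - {i}. C i j))"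
    using I by (intro finite_measure_mono) auto
  also have "\<dots> \<le> prob A0 + prob (\<Union>i\<in>I. A i) + prob (\<Union>i\<in>I. B i) + prob (\<Union>i\<in>I. \<Union>j\<in>I - {i}. C i j)"
    using I by (intro order_trans[OF measure_Un_le] add_mono order_refl) auto
  also have "prob (\<Union>i\<in>I. A i) \<le> (\<Sum>i\<in>I. prob (A i))"
    using I by (intro measure_UNION_le) auto
  also have "(\<Sum>i\<in>I. prob (A i)) = tails w I ((1 - \<epsilon>) * x)"
    unfolding tails_def A_def using w by (intro sum.cong prob_scaled_xi) auto
  also have "prob (\<Union>i\<in>I. B i) \<le> (\<Sum>i\<in>I. prob (B i))"
    using I by (intro measure_UNION_le) auto
  also have "(\<Sum>i\<in>I. prob (B i)) \<le> (\<Sum>i\<in>I. tailp (\<eta> / w i) * q)"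
  proof (intro sum_mono)
    fix i assume i: "i \<in> I"
    have "prob (B i) = \<P>(\<omega> in M. \<eta> < w i * \<xi> i \<omega>) * \<P>(\<omega> in M. \<epsilon> * x \<le> tsum \<eta> w (I - {i}) \<omega>)"
      unfolding B_def using I by (intro prob_xi_tsum) auto
    also have "\<dots> \<le> tailp (\<eta> / w i) * q"
      using prob_scaled_xi_gt[of "w i" \<eta> i] w i q by (intro mult_mono) (auto simp: tailp_nonneg)
    finally show "prob (B i) \<le> tailp (\<eta> / w i) * q" .
  qed
  also have "(\<Sum>i\<in>I. tailp (\<eta> / w i) * q) = tails w I \<eta> * q" by (simp add: tails_def sum_distrib_right)
  also have "prob (\<Union>i\<in>I. \<Union>j\<in>I - {i}. C i j) \<le> (\<Sum>i\<in>I. prob (\<Union>j\<in>I - {i}. C i j))"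
    using I by (intro measure_UNION_le) auto
  also have "\<dots> \<le> (\<Sum>i\<in>I. \<Sum>j\<in>I - {i}. prob (C i j))"
    using I by (intro sum_mono measure_UNION_le) auto
  also have "\<dots> \<le> (\<Sum>i\<in>I. \<Sum>j\<in>I - {i}. tailp (\<eta> / w i) * tailp (\<eta> / w j))"
  proof (intro sum_mono)
    fix i j assume ij: "i \<in> I" "j \<in> I - {i}"
    have "prob (C i j) = \<P>(\<omega> in M. \<eta> < w i * \<xi> i \<omega>) * \<P>(\<omega> in M. \<eta> < w j * \<xi> j \<omega>)"
      unfolding C_def using ij by (intro prob_xi_xi) auto
    also have "\<dots> \<le> tailp (\<eta> / w i) * tailp (\<eta> / w j)"
      using prob_scaled_xi_gt[of "w i" \<eta> i] prob_scaled_xi_gt[of "w j" \<eta> j] w ij by (intro mult_mono) (auto simp: tailp_nonneg)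
    finally show "prob (C i j) \<le> tailp (\<eta> / w i) * tailp (\<eta> / w j)" .
  qed
  also have "\<dots> \<le> (\<Sum>i\<in>I. \<Sum>j\<in>I. tailp (\<eta> / w i) * tailp (\<eta> / w j))"
    using I by (intro sum_mono sum_mono2) (auto simp: tailp_nonneg)
  also have "\<dots> = (tails w I \<eta>)\<^sup>2"
    by (simp add: tails_def power2_eq_square sum_product)
  finally show ?thesis by (simp add: A0_def)
qed

text \<open>An inclusion-exclusion inequality between indicators, so that one integration gives the
  lower bound. A jump counts unless the rest is very negative or a second term is large. The last
  correction pays for the first indicator when it holds although some term was cut.\<close>

lemma big_jump_pointwise:
  fixes x \<epsilon> \<eta> :: real
  assumes I: "finite I" and x: "\<eta> < (1 + \<epsilon>) * x"
  shows "of_bool (x \<le> tsum \<eta> w I \<omega>)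
    + (\<Sum>i\<in>I. of_bool ((1 + \<epsilon>) * x \<le> w i * \<xi> i \<omega>)
         - of_bool ((1 + \<epsilon>) * x \<le> w i * \<xi> i \<omega> \<and> tsum \<eta> w (I - {i}) \<omega> < - \<epsilon> * x)
         - (\<Sum>j\<in>I - {i}. of_bool ((1 + \<epsilon>) * x \<le> w i * \<xi> i \<omega> \<and> \<eta> < w j * \<xi> j \<omega>))
         - of_bool (\<eta> < w i * \<xi> i \<omega> \<and> x \<le> tsum \<eta> w (I - {i}) \<omega>))
    \<le> (of_bool (x \<le> wsum w I \<omega>) :: real)"
proof -
  define y where "y i = w i * \<xi> i \<omega>" for i
  define U where "U i = tsum \<eta> w (I - {i}) \<omega>" for i
  define s where "s i = (\<Sum>j\<in>I - {i}. of_bool ((1 + \<epsilon>) * x \<le> y i \<and> \<eta> < y j) :: real)" for i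
  define t where "t i = (of_bool ((1 + \<epsilon>) * x \<le> y i) - of_bool ((1 + \<epsilon>) * x \<le> y i \<and> U i < - \<epsilon> * x) - s i
     - of_bool (\<eta> < y i \<and> x \<le> U i) :: real)" for i
  have s0: "0 \<le> s i" for i unfolding s_def by (intro sum_nonneg) auto
  have t0: "t i = 0" if "\<not> \<eta> < y i" for i
  proof -
    have "\<not> (1 + \<epsilon>) * x \<le> y i" using that x by linarith
    then show ?thesis using that by (simp add: t_def s_def)
  qed
  \<comment> \<open>A large term is truncated to 0, so leaving it out does not change the truncated
    sum; here the choice of 0 as the cut value matters.\<close>
  have UI: "U i = tsum \<eta> w I \<omega>" if "i \<in> I" "\<eta> < y i" for i
    using tsum_remove[OF I that(1), of \<eta> w \<omega>] that(2) by (simp add: U_def trunc_def y_def)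
  have main: "of_bool (x \<le> tsum \<eta> w I \<omega>) + sum t I \<le> (of_bool (x \<le> wsum w I \<omega>) :: real)"
  proof (cases "\<exists>i\<in>I. \<eta> < y i")
    case False
    then have "sum t I = 0" by (intro sum.neutral) (auto simp: t0)
    moreover have "tsum \<eta> w I \<omega> = wsum w I \<omega>" using False by (intro tsum_eq_wsum) (auto simp: not_less y_def)
    ultimately show ?thesis by simp
  next
    case True
    then obtain i where i: "i \<in> I" "\<eta> < y i" by blast
    show ?thesis
    proof (cases "\<exists>j\<in>I - {i}. \<eta> < y j")
      case True
      then obtain j where j: "j \<in> I" "j \<noteq> i" "\<eta> < y j" by blast
      \<comment> \<open>With at least two large terms the gain of index \<open>k\<close> is
        cancelled by a pair correction, and the last correction equals the indicator of
        \<open>x \<le> tsum\<close>. One large index therefore offsets the first summand, and the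
        others contribute at most 0.\<close>
      have tk: "t k \<le> - of_bool (x \<le> tsum \<eta> w I \<omega>)" if k: "k \<in> I" "\<eta> < y k" for k
      proof -
        have "of_bool ((1 + \<epsilon>) * x \<le> y k) \<le> s k"
        proof -
          obtain m where m: "m \<in> I - {k}" "\<eta> < y m" using i j by (cases "k = i") auto
          have "of_bool ((1 + \<epsilon>) * x \<le> y k) = (\<Sum>j\<in>{m}. of_bool ((1 + \<epsilon>) * x \<le> y k \<and> \<eta> < y j) :: real)" using m by simp
          also have "\<dots> \<le> s k" unfolding s_def using m I by (intro sum_mono2) auto
          finally show ?thesis .
        qed
        then show ?thesis unfolding t_def UI[OF k] using k s0[of k] by (auto simp: of_bool_def split: if_splits)
      qed
      have "t k \<le> 0" if "k \<in> I" for k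
        using tk[OF that] t0[of k] by (cases "\<eta> < y k") (auto split: if_splits simp: of_bool_def)
      then have "sum t (I - {i}) \<le> 0" by (intro sum_nonpos) auto
      then have "sum t I \<le> t i" using sum.remove[OF I i(1), of t] by linarith
      also note tk[OF i]
      finally show ?thesis by simp
    next
      case False
      then have "sum t (I - {i}) = 0" by (intro sum.neutral) (auto simp: t0)
      then have "sum t I = t i" using sum.remove[OF I i(1), of t] by simp
      moreover have "wsum w I \<omega> = y i + U i"
        using wsum_remove[OF I i(1), of w \<omega>] tsum_eq_wsum[of "I - {i}" w \<omega> \<eta>] False
        by (auto simp: y_def U_def not_less)
      moreover have "x \<le> y i + U i" if "(1 + \<epsilon>) * x \<le> y i" "\<not> U i < - \<epsilon> * x"
        using that by (simp add: algebra_simps)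
      ultimately show ?thesis using s0[of i] i unfolding UI[OF i, symmetric] t_def
        by (auto simp: of_bool_def)
    qed
  qed
  then show ?thesis unfolding t_def s_def y_def U_def .
qed

lemma expectation_of_bool:
  assumes [measurable]: "Measurable.pred M P"
  shows "integrable M (\<lambda>\<omega>. of_bool (P \<omega>) :: real)" "expectation (\<lambda>\<omega>. of_bool (P \<omega>) :: real) = \<P>(\<omega> in M. P \<omega>)"
proof -
  have e: "expectation (\<lambda>\<omega>. of_bool (P \<omega>) :: real) = expectation (indicator {\<omega>\<in>space M. P \<omega>})"
    by (intro Bochner_Integration.integral_cong) (auto simp: indicator_def)
  then show "expectation (\<lambda>\<omega>. of_bool (P \<omega>) :: real) = \<P>(\<omega> in M. P \<omega>)" by simp
  show "integrable M (\<lambda>\<omega>. of_bool (P \<omega>) :: real)"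
    by (intro integrable_const_bound[where B=1]) auto
qed

text \<open>Integrate the pointwise inequality. By independence the first two corrections are the
  jump probability times \<open>q3\<close> and times at most \<open>tails w I \<eta>\<close>. The
  third only sees a term above \<open>\<eta>\<close>, hence the separate loss
  \<open>tails w I \<eta> * q2\<close>.\<close>

lemma big_jump_lower:
  assumes I: "finite I" and w: "\<And>i. i \<in> I \<Longrightarrow> 0 < w i" and x: "\<eta> < (1 + \<epsilon>) * x"
    and q2: "\<And>i. i \<in> I \<Longrightarrow> \<P>(\<omega> in M. x \<le> tsum \<eta> w (I - {i}) \<omega>) \<le> q2"
    and q3: "\<And>i. i \<in> I \<Longrightarrow> \<P>(\<omega> in M. tsum \<eta> w (I - {i}) \<omega> < - \<epsilon> * x) \<le> q3"
  shows "\<P>(\<omega> in M. x \<le> tsum \<eta> w I \<omega>) - tails w I \<eta> * q2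
      + tails w I ((1 + \<epsilon>) * x) * (1 - q3 - tails w I \<eta>) \<le> \<P>(\<omega> in M. x \<le> wsum w I \<omega>)"
proof -
  define a where "a i = \<P>(\<omega> in M. (1 + \<epsilon>) * x \<le> w i * \<xi> i \<omega>)" for i
  define b where "b i = \<P>(\<omega> in M. (1 + \<epsilon>) * x \<le> w i * \<xi> i \<omega> \<and> tsum \<eta> w (I - {i}) \<omega> < - \<epsilon> * x)" for i
  define c where "c i j = \<P>(\<omega> in M. (1 + \<epsilon>) * x \<le> w i * \<xi> i \<omega> \<and> \<eta> < w j * \<xi> j \<omega>)" for i j
  define d where "d i = \<P>(\<omega> in M. \<eta> < w i * \<xi> i \<omega> \<and> x \<le> tsum \<eta> w (I - {i}) \<omega>)" for i
  define F where "F \<omega> = of_bool (x \<le> tsum \<eta> w I \<omega>)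
    + (\<Sum>i\<in>I. of_bool ((1 + \<epsilon>) * x \<le> w i * \<xi> i \<omega>)
         - of_bool ((1 + \<epsilon>) * x \<le> w i * \<xi> i \<omega> \<and> tsum \<eta> w (I - {i}) \<omega> < - \<epsilon> * x)
         - (\<Sum>j\<in>I - {i}. of_bool ((1 + \<epsilon>) * x \<le> w i * \<xi> i \<omega> \<and> \<eta> < w j * \<xi> j \<omega>))
         - (of_bool (\<eta> < w i * \<xi> i \<omega> \<and> x \<le> tsum \<eta> w (I - {i}) \<omega>) :: real))" for \<omega>
  have int: "integrable M (\<lambda>\<omega>. of_bool (x \<le> tsum \<eta> w I \<omega>) :: real)"
    "integrable M (\<lambda>\<omega>. of_bool ((1 + \<epsilon>) * x \<le> w i * \<xi> i \<omega>) :: real)"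
    "integrable M (\<lambda>\<omega>. of_bool ((1 + \<epsilon>) * x \<le> w i * \<xi> i \<omega> \<and> tsum \<eta> w (I - {i}) \<omega> < - \<epsilon> * x) :: real)"
    "integrable M (\<lambda>\<omega>. of_bool ((1 + \<epsilon>) * x \<le> w i * \<xi> i \<omega> \<and> \<eta> < w j * \<xi> j \<omega>) :: real)"
    "integrable M (\<lambda>\<omega>. of_bool (\<eta> < w i * \<xi> i \<omega> \<and> x \<le> tsum \<eta> w (I - {i}) \<omega>) :: real)" for i j
    by (intro expectation_of_bool; measurable)+
  have ex: "expectation (\<lambda>\<omega>. of_bool (x \<le> tsum \<eta> w I \<omega>) :: real) = \<P>(\<omega> in M. x \<le> tsum \<eta> w I \<omega>)"
    "expectation (\<lambda>\<omega>. of_bool ((1 + \<epsilon>) * x \<le> w i * \<xi> i \<omega>) :: real) = a i"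
    "expectation (\<lambda>\<omega>. of_bool ((1 + \<epsilon>) * x \<le> w i * \<xi> i \<omega> \<and> tsum \<eta> w (I - {i}) \<omega> < - \<epsilon> * x) :: real) = b i"
    "expectation (\<lambda>\<omega>. of_bool ((1 + \<epsilon>) * x \<le> w i * \<xi> i \<omega> \<and> \<eta> < w j * \<xi> j \<omega>) :: real) = c i j"
    "expectation (\<lambda>\<omega>. of_bool (\<eta> < w i * \<xi> i \<omega> \<and> x \<le> tsum \<eta> w (I - {i}) \<omega>) :: real) = d i" for i j
    unfolding a_def b_def c_def d_def by (intro expectation_of_bool; measurable)+
  have "expectation F \<le> expectation (\<lambda>\<omega>. of_bool (x \<le> wsum w I \<omega>))"
  proof (rule integral_mono)
    show "integrable M F" unfolding F_def[abs_def]
      by (intro Bochner_Integration.integrable_add Bochner_Integration.integrable_diff Bochner_Integration.integrable_sum int)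
    show "integrable M (\<lambda>\<omega>. of_bool (x \<le> wsum w I \<omega>) :: real)" by (intro expectation_of_bool) measurable
    show "F \<omega> \<le> of_bool (x \<le> wsum w I \<omega>)" for \<omega> unfolding F_def by (rule big_jump_pointwise[OF I x])
  qed
  also have "\<dots> = \<P>(\<omega> in M. x \<le> wsum w I \<omega>)" by (intro expectation_of_bool) measurable
  finally have 1: "expectation F \<le> \<P>(\<omega> in M. x \<le> wsum w I \<omega>)" .
  have 2: "expectation F = \<P>(\<omega> in M. x \<le> tsum \<eta> w I \<omega>) + (\<Sum>i\<in>I. a i - b i - (\<Sum>j\<in>I - {i}. c i j) - d i)"
  proof -
    define G where "G i \<omega> = of_bool ((1 + \<epsilon>) * x \<le> w i * \<xi> i \<omega>)
         - of_bool ((1 + \<epsilon>) * x \<le> w i * \<xi> i \<omega> \<and> tsum \<eta> w (I - {i}) \<omega> < - \<epsilon> * x)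
         - (\<Sum>j\<in>I - {i}. of_bool ((1 + \<epsilon>) * x \<le> w i * \<xi> i \<omega> \<and> \<eta> < w j * \<xi> j \<omega>))
         - (of_bool (\<eta> < w i * \<xi> i \<omega> \<and> x \<le> tsum \<eta> w (I - {i}) \<omega>) :: real)" for i \<omega>
    have Gi: "integrable M (G i)" for i unfolding G_def[abs_def]
      by (intro Bochner_Integration.integrable_diff Bochner_Integration.integrable_sum int)
    have "expectation (G i) = a i - b i - (\<Sum>j\<in>I - {i}. c i j) - d i" for i
    proof -
      have "expectation (\<lambda>\<omega>. \<Sum>j\<in>I - {i}. of_bool ((1 + \<epsilon>) * x \<le> w i * \<xi> i \<omega> \<and> \<eta> < w j * \<xi> j \<omega>) :: real) = (\<Sum>j\<in>I - {i}. c i j)"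
        using int(4) by (subst Bochner_Integration.integral_sum) (auto simp only: ex)
      then show ?thesis unfolding G_def[abs_def]
        by (subst Bochner_Integration.integral_diff Bochner_Integration.integrable_diff
           | intro Bochner_Integration.integrable_diff Bochner_Integration.integrable_sum int | simp only: ex)+
    qed
    then have "expectation (\<lambda>\<omega>. \<Sum>i\<in>I. G i \<omega>) = (\<Sum>i\<in>I. a i - b i - (\<Sum>j\<in>I - {i}. c i j) - d i)"
      using Gi by (subst Bochner_Integration.integral_sum) auto
    moreover have "expectation F = expectation (\<lambda>\<omega>. of_bool (x \<le> tsum \<eta> w I \<omega>)) + expectation (\<lambda>\<omega>. \<Sum>i\<in>I. G i \<omega>)"
      unfolding F_def[abs_def] G_def[symmetric] using Gi int(1) by (intro Bochner_Integration.integral_add) auto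
    ultimately show ?thesis by (simp only: ex)
  qed
  have a: "a i = tailp ((1 + \<epsilon>) * x / w i)" if "i \<in> I" for i
    unfolding a_def using w[OF that] by (rule prob_scaled_xi)
  have "tailp ((1 + \<epsilon>) * x / w i) * (1 - q3 - tails w I \<eta>) - tailp (\<eta> / w i) * q2
      \<le> a i - b i - (\<Sum>j\<in>I - {i}. c i j) - d i" if i: "i \<in> I" for i
  proof -
    have "b i = a i * \<P>(\<omega> in M. tsum \<eta> w (I - {i}) \<omega> < - \<epsilon> * x)"
      unfolding b_def a_def using I by (intro prob_xi_tsum) auto
    then have b: "b i \<le> a i * q3" using q3[OF i] by (simp add: a_def mult_left_mono)
    have "d i = \<P>(\<omega> in M. \<eta> < w i * \<xi> i \<omega>) * \<P>(\<omega> in M. x \<le> tsum \<eta> w (I - {i}) \<omega>)"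
      unfolding d_def using I by (intro prob_xi_tsum) auto
    also have "\<dots> \<le> tailp (\<eta> / w i) * q2"
      using prob_scaled_xi_gt[of "w i" \<eta> i] w i q2 by (intro mult_mono) (auto simp: tailp_nonneg)
    finally have d: "d i \<le> tailp (\<eta> / w i) * q2" .
    have "(\<Sum>j\<in>I - {i}. c i j) \<le> (\<Sum>j\<in>I - {i}. a i * tailp (\<eta> / w j))"
    proof (intro sum_mono)
      fix j assume j: "j \<in> I - {i}"
      have "c i j = a i * \<P>(\<omega> in M. \<eta> < w j * \<xi> j \<omega>)"
        unfolding c_def a_def using j by (intro prob_xi_xi) auto
      also have "\<dots> \<le> a i * tailp (\<eta> / w j)"
        using prob_scaled_xi_gt[of "w j" \<eta> j] w j by (intro mult_left_mono) (auto simp: a_def)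
      finally show "c i j \<le> a i * tailp (\<eta> / w j)" .
    qed
    also have "\<dots> \<le> (\<Sum>j\<in>I. a i * tailp (\<eta> / w j))"
      using I by (intro sum_mono2) (auto simp: a_def tailp_nonneg)
    also have "\<dots> = a i * tails w I \<eta>" by (simp add: tails_def sum_distrib_left)
    finally have "(\<Sum>j\<in>I - {i}. c i j) \<le> a i * tails w I \<eta>" .
    then show ?thesis using b d unfolding a[OF i, symmetric] by (simp add: algebra_simps)
  qed
  then have "(\<Sum>i\<in>I. tailp ((1 + \<epsilon>) * x / w i) * (1 - q3 - tails w I \<eta>) - tailp (\<eta> / w i) * q2)
    \<le> (\<Sum>i\<in>I. a i - b i - (\<Sum>j\<in>I - {i}. c i j) - d i)" by (rule sum_mono)
  also have "(\<Sum>i\<in>I. tailp ((1 + \<epsilon>) * x / w i) * (1 - q3 - tails w I \<eta>) - tailp (\<eta> / w i) * q2)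
    = tails w I ((1 + \<epsilon>) * x) * (1 - q3 - tails w I \<eta>) - tails w I \<eta> * q2"
    by (simp only: sum_subtractf sum_distrib_right[symmetric] tails_def[symmetric])
  finally show ?thesis using 1 2 by linarith
qed

text \<open>Truncation changes the sum only on the event that some term is large.\<close>

lemma prob_wsum_tsum:
  assumes I: "finite I" and w: "\<And>i. i \<in> I \<Longrightarrow> 0 < w i" and [measurable]: "Measurable.pred borel P"
  shows "\<bar>\<P>(\<omega> in M. P (wsum w I \<omega>)) - \<P>(\<omega> in M. P (tsum \<eta> w I \<omega>))\<bar> \<le> tails w I \<eta>"
proof -
  define A where "A = (\<Union>i\<in>I. {\<omega>\<in>space M. \<eta> < w i * \<xi> i \<omega>})"
  have [measurable]: "A \<in> sets M" unfolding A_def using I by measurable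
  have eq: "tsum \<eta> w I \<omega> = wsum w I \<omega>" if "\<omega> \<in> space M" "\<omega> \<notin> A" for \<omega>
    using that by (intro tsum_eq_wsum) (auto simp: A_def not_less)
  have "prob A \<le> (\<Sum>i\<in>I. \<P>(\<omega> in M. \<eta> < w i * \<xi> i \<omega>))"
    unfolding A_def using I by (intro measure_UNION_le) auto
  also have "\<dots> \<le> tails w I \<eta>"
    unfolding tails_def using w by (intro sum_mono prob_scaled_xi_gt) auto
  finally have A: "prob A \<le> tails w I \<eta>" .
  have "\<P>(\<omega> in M. P (wsum w I \<omega>)) \<le> prob ({\<omega>\<in>space M. P (tsum \<eta> w I \<omega>)} \<union> A)"
    using eq by (intro finite_measure_mono) auto
  also have "\<dots> \<le> \<P>(\<omega> in M. P (tsum \<eta> w I \<omega>)) + prob A" by (intro measure_Un_le) auto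
  finally have 1: "\<P>(\<omega> in M. P (wsum w I \<omega>)) \<le> \<P>(\<omega> in M. P (tsum \<eta> w I \<omega>)) + prob A" .
  have "\<P>(\<omega> in M. P (tsum \<eta> w I \<omega>)) \<le> prob ({\<omega>\<in>space M. P (wsum w I \<omega>)} \<union> A)"
    using eq by (intro finite_measure_mono) auto
  also have "\<dots> \<le> \<P>(\<omega> in M. P (wsum w I \<omega>)) + prob A" by (intro measure_Un_le) auto
  finally show ?thesis using 1 A by linarith
qed

lemma wsum_moments:
  assumes I: "finite I"
  shows "integrable M (\<lambda>\<omega>. (wsum w I \<omega>)\<^sup>2)" "expectation (\<lambda>\<omega>. (wsum w I \<omega>)\<^sup>2) = vsum w I"
proof -
  have ind: "indep_vars (\<lambda>_. borel) (\<lambda>i \<omega>. w i * \<xi> i \<omega>) I"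
    by (rule indep_vars_fun_xi[of "\<lambda>i y. w i * y"]) measurable
  have e: "expectation (\<lambda>\<omega>. w i * \<xi> i \<omega>) = 0" for i using xi_moments(1)[of i] by simp
  have int: "integrable M (\<lambda>\<omega>. (w i * \<xi> i \<omega>) * (w j * \<xi> j \<omega>))
    \<and> expectation (\<lambda>\<omega>. (w i * \<xi> i \<omega>) * (w j * \<xi> j \<omega>)) = (if i = j then (w i)\<^sup>2 * s2 else 0)" for i j
  proof (cases "i = j")
    case True
    then show ?thesis using xi_square_integrable[of j] xi_moments(2)[of j]
      by (simp add: power2_eq_square mult_ac flip: power_mult_distrib)
  next
    case False
    have "indep_vars (\<lambda>_. borel) \<xi> (insert i {j})" by (rule indep_vars_subset[OF indep]) auto
    from indep_vars_sum[OF _ _ this] False have "indep_var borel (\<xi> i) borel (\<xi> j)" by simp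
    from indep_var_compose[OF this, of "\<lambda>y. w i * y" borel "\<lambda>y. w j * y" borel]
    have iv: "indep_var borel (\<lambda>\<omega>. w i * \<xi> i \<omega>) borel (\<lambda>\<omega>. w j * \<xi> j \<omega>)" by (simp add: comp_def)
    have wi: "integrable M (\<lambda>\<omega>. w i * \<xi> i \<omega>)" for i using xi_integrable by simp
    show ?thesis
      using indep_var_integrable[OF iv wi wi] indep_var_lebesgue_integral[OF iv wi wi] False unfolding e by simp
  qed
  have sq: "(wsum w I \<omega>)\<^sup>2 = (\<Sum>i\<in>I. \<Sum>j\<in>I. (w i * \<xi> i \<omega>) * (w j * \<xi> j \<omega>))" for \<omega>
    by (simp add: wsum_def power2_eq_square sum_product)
  show "integrable M (\<lambda>\<omega>. (wsum w I \<omega>)\<^sup>2)" unfolding sq using int by auto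
  show "expectation (\<lambda>\<omega>. (wsum w I \<omega>)\<^sup>2) = vsum w I" unfolding sq
    using I int by (simp add: vsum_def)
qed

lemma wsum_chebyshev:
  assumes I: "finite I" and y: "0 < y"
  shows "\<P>(\<omega> in M. y \<le> \<bar>wsum w I \<omega>\<bar>) \<le> vsum w I / y\<^sup>2"
proof -
  have "\<P>(\<omega> in M. y \<le> \<bar>wsum w I \<omega>\<bar>) = \<P>(\<omega> in M. y\<^sup>2 \<le> (wsum w I \<omega>)\<^sup>2)"
  proof -
    have "y \<le> \<bar>s\<bar> \<longleftrightarrow> y\<^sup>2 \<le> s\<^sup>2" for s using abs_le_square_iff[of y s] y by simp
    then show ?thesis by simp
  qed
  also have "\<dots> \<le> expectation (\<lambda>\<omega>. (wsum w I \<omega>)\<^sup>2) / y\<^sup>2"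
    using y by (intro integral_Markov_inequality_measure[where A="space M - space M"] wsum_moments I) auto
  finally show ?thesis by (simp add: wsum_moments(2)[OF I])
qed

text \<open>Markov's inequality for the moment of order \<open>p\<close>: it yields smallness of the
  tail sum, whereas regular variation compares tail sums at different levels.\<close>

lemma tails_markov:
  assumes I: "finite I" and w: "\<And>i. i \<in> I \<Longrightarrow> 0 < w i" and y: "0 < y"
  shows "tails w I y \<le> mu * lyap w I / y powr p"
proof -
  have t: "tailp u \<le> mu / u powr p" if u: "0 < u" for u
  proof -
    have "tailp u \<le> \<P>(\<omega> in M. u powr p \<le> \<bar>\<xi> 0 \<omega>\<bar> powr p)"
      unfolding tailp_def using u p by (intro finite_measure_mono) (auto intro!: powr_mono2)
    also have "\<dots> \<le> mu / u powr p"
      unfolding mu_def using u by (intro integral_Markov_inequality_measure[where A="space M - space M"] p_moment) auto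
    finally show ?thesis .
  qed
  have "tails w I y \<le> (\<Sum>i\<in>I. mu * w i powr p / y powr p)"
    unfolding tails_def
  proof (intro sum_mono)
    fix i assume "i \<in> I"
    then show "tailp (y / w i) \<le> mu * w i powr p / y powr p"
      using t[of "y / w i"] w[of i] y by (simp add: powr_divide)
  qed
  then show ?thesis by (simp add: lyap_def sum_distrib_left sum_divide_distrib)
qed


section \<open>Almost sure convergence\<close>

text \<open>\<open>\<sigma>\<close> lists the innovations in the order in which the series adds
  them. The order is kept, because in general only ordered partial sums converge.\<close>

definition psum :: "(nat \<Rightarrow> real) \<Rightarrow> (nat \<Rightarrow> int) \<Rightarrow> nat \<Rightarrow> 'w \<Rightarrow> real" where
  "psum c \<sigma> N \<omega> = (\<Sum>m<N. c m * \<xi> (\<sigma> m) \<omega>)"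

lemma measurable_psum [measurable]: "psum c \<sigma> N \<in> borel_measurable M"
  unfolding psum_def[abs_def] by measurable

lemma psum_moments:
  assumes "inj \<sigma>"
  shows "integrable M (\<lambda>\<omega>. (psum c \<sigma> N \<omega>)\<^sup>2)" "expectation (\<lambda>\<omega>. (psum c \<sigma> N \<omega>)\<^sup>2) = s2 * (\<Sum>m<N. (c m)\<^sup>2)"
proof -
  have inj: "inj_on \<sigma> {..<N}" using assms by (rule inj_on_subset) auto
  have e: "psum c \<sigma> N \<omega> = wsum (\<lambda>i. c (inv \<sigma> i)) (\<sigma> ` {..<N}) \<omega>" for \<omega>
    using assms inj by (simp add: psum_def wsum_def sum.reindex)
  show "integrable M (\<lambda>\<omega>. (psum c \<sigma> N \<omega>)\<^sup>2)" unfolding e by (rule wsum_moments) auto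
  have "vsum (\<lambda>i. c (inv \<sigma> i)) (\<sigma> ` {..<N}) = s2 * (\<Sum>m<N. (c m)\<^sup>2)"
    using assms inj by (simp add: vsum_def sum.reindex sum_distrib_left mult.commute)
  then show "expectation (\<lambda>\<omega>. (psum c \<sigma> N \<omega>)\<^sup>2) = s2 * (\<Sum>m<N. (c m)\<^sup>2)"
    unfolding e using wsum_moments(2)[of "\<sigma> ` {..<N}"] by simp
qed

text \<open>Split by the first index \<open>j\<close> at which the partial sums leave the interval.
  The sum up to \<open>j\<close>, restricted to that event, is independent of the later increment,
  which has mean 0, so the cross term vanishes and the second moment of the full sum bounds every
  piece.\<close>

lemma kolmogorov_inequality:
  assumes \<sigma>: "inj \<sigma>" and e: "0 < e"
  shows "\<P>(\<omega> in M. \<exists>j\<le>N. e \<le> \<bar>psum c \<sigma> j \<omega>\<bar>) \<le> s2 * (\<Sum>m<N. (c m)\<^sup>2) / e\<^sup>2"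
proof -
  define S where "S j = psum c \<sigma> j" for j
  define A where "A j = {\<omega>\<in>space M. e \<le> \<bar>S j \<omega>\<bar> \<and> (\<forall>i<j. \<bar>S i \<omega>\<bar> < e)}" for j
  have [measurable]: "S j \<in> borel_measurable M" for j by (simp add: S_def)
  have [measurable]: "A j \<in> sets M" for j unfolding A_def by measurable
  have disj: "disjoint_family_on A {..N}"
    unfolding disjoint_family_on_def A_def by (auto simp: not_le) (metis linorder_neqE_nat not_le)
  have U: "{\<omega>\<in>space M. \<exists>j\<le>N. e \<le> \<bar>S j \<omega>\<bar>} = (\<Union>j\<in>{..N}. A j)"
  proof (intro equalityI subsetI)
    fix \<omega> assume "\<omega> \<in> {\<omega>\<in>space M. \<exists>j\<le>N. e \<le> \<bar>S j \<omega>\<bar>}"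
    then obtain j where j: "\<omega> \<in> space M" "j \<le> N" "e \<le> \<bar>S j \<omega>\<bar>" by auto
    define k where "k = (LEAST j. e \<le> \<bar>S j \<omega>\<bar>)"
    have "e \<le> \<bar>S k \<omega>\<bar>" unfolding k_def by (rule LeastI) (rule j(3))
    moreover have "k \<le> j" unfolding k_def by (rule Least_le) (rule j(3))
    moreover have "\<bar>S i \<omega>\<bar> < e" if "i < k" for i using not_less_Least[of i "\<lambda>j. e \<le> \<bar>S j \<omega>\<bar>"] that by (auto simp: k_def)
    ultimately show "\<omega> \<in> (\<Union>j\<in>{..N}. A j)" using j by (auto simp: A_def)
  qed (auto simp: A_def)
  have Sq: "integrable M (\<lambda>\<omega>. (S j \<omega>)\<^sup>2)" for j unfolding S_def using psum_moments(1)[OF \<sigma>] .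
  have key: "e\<^sup>2 * prob (A j) \<le> expectation (\<lambda>\<omega>. indicator (A j) \<omega> * (S N \<omega>)\<^sup>2)" if j: "j \<le> N" for j
  proof -
    define R where "R \<omega> = (\<Sum>m\<in>{j..<N}. c m * \<xi> (\<sigma> m) \<omega>)" for \<omega>
    have [measurable]: "R \<in> borel_measurable M" unfolding R_def[abs_def] by measurable
    have SN: "S N \<omega> = S j \<omega> + R \<omega>" for \<omega>
      unfolding S_def psum_def R_def using j
      by (subst sum.union_disjoint[symmetric]) (auto intro!: sum.cong)
    define B1 where "B1 = \<sigma> ` {..<j}"
    define B2 where "B2 = \<sigma> ` {j..<N}"
    have B: "B1 \<inter> B2 = {}" by (auto simp: B1_def B2_def dest!: injD[OF \<sigma>])
    \<comment> \<open>The past and the future are written as functions of the coordinates in the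
      disjoint sets \<open>B1\<close> and \<open>B2\<close>; independence of these two blocks passes
      on to \<open>F\<close> and \<open>R\<close>.\<close>
    define s where "s i x = (\<Sum>m<i. c m * x (\<sigma> m))" for i and x :: "int \<Rightarrow> real"
    define f where "f x = s j x * of_bool (e \<le> \<bar>s j x\<bar> \<and> (\<forall>i<j. \<bar>s i x\<bar> < e))" for x :: "int \<Rightarrow> real"
    define g where "g x = (\<Sum>m\<in>{j..<N}. c m * x (\<sigma> m))" for x :: "int \<Rightarrow> real"
    have sm: "s i \<in> borel_measurable (PiM B1 (\<lambda>_. borel))" if "i \<le> j" for i
      unfolding s_def[abs_def] using that by (intro borel_measurable_sum borel_measurable_times) (auto simp: B1_def)
    have fm: "f \<in> borel_measurable (PiM B1 (\<lambda>_. borel))"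
    proof -
      have [measurable]: "s j \<in> borel_measurable (PiM B1 (\<lambda>_. borel))" by (intro sm) auto
      have "Measurable.pred (PiM B1 (\<lambda>_. borel)) (\<lambda>x. \<forall>i<j. \<bar>s i x\<bar> < e)"
      proof -
        have [measurable]: "Measurable.pred (PiM B1 (\<lambda>_. borel)) (\<lambda>x. \<bar>s i x\<bar> < e)" if "i \<in> {..<j}" for i
        proof -
          have [measurable]: "s i \<in> borel_measurable (PiM B1 (\<lambda>_. borel))" using that by (intro sm) auto
          show ?thesis by measurable
        qed
        have "Measurable.pred (PiM B1 (\<lambda>_. borel)) (\<lambda>x. \<forall>i\<in>{..<j}. \<bar>s i x\<bar> < e)" by measurable
        then show ?thesis by (simp add: Ball_def)
      qed
      then show ?thesis unfolding f_def[abs_def] by measurable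
    qed
    have gm: "g \<in> borel_measurable (PiM B2 (\<lambda>_. borel))"
      unfolding g_def[abs_def] by (intro borel_measurable_sum borel_measurable_times) (auto simp: B2_def)
    have ind: "indep_var (PiM B1 (\<lambda>_. borel)) (\<lambda>\<omega>. restrict (\<lambda>i. \<xi> i \<omega>) B1) (PiM B2 (\<lambda>_. borel)) (\<lambda>\<omega>. restrict (\<lambda>i. \<xi> i \<omega>) B2)"
      by (rule indep_var_restrict[OF indep B]) auto
    have iv: "indep_var borel (f \<circ> (\<lambda>\<omega>. restrict (\<lambda>i. \<xi> i \<omega>) B1)) borel (g \<circ> (\<lambda>\<omega>. restrict (\<lambda>i. \<xi> i \<omega>) B2))"
      by (rule indep_var_compose[OF ind fm gm])
    have sr: "s i (restrict (\<lambda>i. \<xi> i \<omega>) B1) = S i \<omega>" if "i \<le> j" for i \<omega>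
      unfolding s_def S_def psum_def using that by (intro sum.cong) (auto simp: B1_def)
    have gr: "g (restrict (\<lambda>i. \<xi> i \<omega>) B2) = R \<omega>" for \<omega>
      unfolding g_def R_def by (intro sum.cong) (auto simp: B2_def)
    define F where "F \<omega> = S j \<omega> * of_bool (e \<le> \<bar>S j \<omega>\<bar> \<and> (\<forall>i<j. \<bar>S i \<omega>\<bar> < e))" for \<omega>
    have fr: "f (restrict (\<lambda>i. \<xi> i \<omega>) B1) = F \<omega>" for \<omega>
      unfolding f_def F_def by (simp add: sr)
    have iv': "indep_var borel F borel R" using iv by (simp add: comp_def fr gr)
    have Si: "integrable M (S j)" by (rule square_integrable_imp_integrable[OF _ Sq]) simp
    have [measurable]: "F \<in> borel_measurable M" using iv' by (rule indep_var_rv1)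
    have Fi: "integrable M F"
      by (rule Bochner_Integration.integrable_bound[OF Si]) (auto simp: F_def)
    have Ri: "integrable M R" unfolding R_def[abs_def] using xi_integrable by auto
    have "expectation R = 0" unfolding R_def[abs_def] using xi_integrable xi_moments(1) by simp
    then have FR: "integrable M (\<lambda>\<omega>. F \<omega> * R \<omega>)" "expectation (\<lambda>\<omega>. F \<omega> * R \<omega>) = 0"
      using indep_var_integrable[OF iv' Fi Ri] indep_var_lebesgue_integral[OF iv' Fi Ri] by auto
    have ai: "integrable M (\<lambda>\<omega>. e\<^sup>2 * indicator (A j) \<omega> :: real)"
      by (intro integrable_mult_right integrable_const_bound[where B=1]) auto
    \<comment> \<open>The cross term has mean 0 and may be added freely; pointwise it completes
      \<open>(S j)\<^sup>2\<close> to the square of \<open>S N\<close> up to the nonnegative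
      \<open>R\<^sup>2\<close>.\<close>
    have "e\<^sup>2 * prob (A j) = expectation (\<lambda>\<omega>. e\<^sup>2 * indicator (A j) \<omega> + 2 * (F \<omega> * R \<omega>))"
      using Bochner_Integration.integral_add[OF ai integrable_mult_right[OF FR(1), of 2]] FR(2) by simp
    also have "\<dots> \<le> expectation (\<lambda>\<omega>. indicator (A j) \<omega> * (S N \<omega>)\<^sup>2)"
    proof (rule integral_mono)
      show "integrable M (\<lambda>\<omega>. e\<^sup>2 * indicator (A j) \<omega> + 2 * (F \<omega> * R \<omega>))"
        using FR by (intro Bochner_Integration.integrable_add ai) auto
      show "integrable M (\<lambda>\<omega>. indicator (A j) \<omega> * (S N \<omega>)\<^sup>2)"
        using integrable_mult_indicator[OF _ Sq, of "A j" N] by simp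
      fix \<omega> assume w: "\<omega> \<in> space M"
      show "e\<^sup>2 * indicator (A j) \<omega> + 2 * (F \<omega> * R \<omega>) \<le> indicator (A j) \<omega> * (S N \<omega>)\<^sup>2"
      proof (cases "\<omega> \<in> A j")
        case True
        then have F: "F \<omega> = S j \<omega>" and "e \<le> \<bar>S j \<omega>\<bar>" by (auto simp: F_def A_def)
        then have "e\<^sup>2 \<le> \<bar>S j \<omega>\<bar>\<^sup>2" using e by (intro power_mono) auto
        then have "e\<^sup>2 \<le> (S j \<omega>)\<^sup>2" by simp
        moreover have "(S N \<omega>)\<^sup>2 = (S j \<omega>)\<^sup>2 + 2 * (S j \<omega> * R \<omega>) + (R \<omega>)\<^sup>2"
          unfolding SN by (simp add: power2_eq_square algebra_simps)
        ultimately have "e\<^sup>2 + 2 * (S j \<omega> * R \<omega>) \<le> (S N \<omega>)\<^sup>2"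
          using zero_le_power2[of "R \<omega>"] by linarith
        then show ?thesis using True by (simp only: F indicator_simps mult_1_right mult_1_left)
      next
        case False
        then have "F \<omega> = 0" using w by (auto simp: F_def A_def)
        then show ?thesis using False by simp
      qed
    qed
    finally show ?thesis .
  qed
  have iN: "integrable M (\<lambda>\<omega>. indicator (A j) \<omega> * (S N \<omega>)\<^sup>2)" for j
    using integrable_mult_indicator[OF _ Sq, of "A j" N] by simp
  have "e\<^sup>2 * \<P>(\<omega> in M. \<exists>j\<le>N. e \<le> \<bar>S j \<omega>\<bar>) = (\<Sum>j\<le>N. e\<^sup>2 * prob (A j))"
    unfolding U using disj by (subst finite_measure_finite_Union) (auto simp: sum_distrib_left)
  also have "\<dots> \<le> (\<Sum>j\<le>N. expectation (\<lambda>\<omega>. indicator (A j) \<omega> * (S N \<omega>)\<^sup>2))" using key by (intro sum_mono) auto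
  also have "\<dots> = expectation (\<lambda>\<omega>. \<Sum>j\<le>N. indicator (A j) \<omega> * (S N \<omega>)\<^sup>2)"
    by (rule Bochner_Integration.integral_sum[symmetric]) (rule iN)
  also have "\<dots> \<le> expectation (\<lambda>\<omega>. (S N \<omega>)\<^sup>2)"
  proof (rule integral_mono)
    show "integrable M (\<lambda>\<omega>. \<Sum>j\<le>N. indicator (A j) \<omega> * (S N \<omega>)\<^sup>2)"
      by (intro Bochner_Integration.integrable_sum iN)
    fix \<omega>
    have "(\<Sum>j\<le>N. indicator (A j) \<omega>) = (indicator (\<Union>j\<in>{..N}. A j) \<omega> :: real)"
      using disj by (subst indicator_UN_disjoint) auto
    also have "\<dots> \<le> 1" by (simp add: indicator_def)
    finally have "(\<Sum>j\<le>N. indicator (A j) \<omega>) * (S N \<omega>)\<^sup>2 \<le> 1 * (S N \<omega>)\<^sup>2" by (intro mult_right_mono) auto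
    then show "(\<Sum>j\<le>N. indicator (A j) \<omega> * (S N \<omega>)\<^sup>2) \<le> (S N \<omega>)\<^sup>2" by (simp only: sum_distrib_right mult_1_left)
  qed (rule Sq)
  also have "\<dots> = s2 * (\<Sum>m<N. (c m)\<^sup>2)" unfolding S_def by (rule psum_moments(2)[OF \<sigma>])
  finally show ?thesis using e by (simp add: S_def field_simps)
qed

text \<open>Kolmogorov's inequality for the series from \<open>n\<close> on bounds the chance of any
  later oscillation of size \<open>e\<close> by the tail of the sum of squares. As this tends to 0,
  the partial sums are almost surely Cauchy.\<close>

lemma summable_AE:
  assumes \<sigma>: "inj \<sigma>" and c: "summable (\<lambda>m. (c m)\<^sup>2)"
  shows "AE \<omega> in M. summable (\<lambda>m. c m * \<xi> (\<sigma> m) \<omega>)"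
proof -
  define S where "S j = psum c \<sigma> j" for j
  have [measurable]: "S j \<in> borel_measurable M" for j by (simp add: S_def)
  have shift: "psum (\<lambda>m. c (n + m)) (\<lambda>m. \<sigma> (n + m)) j \<omega> = S (n + j) \<omega> - S n \<omega>" for n j \<omega>
    unfolding S_def psum_def by (induction j) (auto simp: algebra_simps)
  \<comment> \<open>The finite-horizon bound does not depend on \<open>N\<close> once the partial
    sum of squares is replaced by the whole series, so continuity from below removes the
    horizon.\<close>
  have tail: "\<P>(\<omega> in M. \<exists>j. e \<le> \<bar>S (n + j) \<omega> - S n \<omega>\<bar>) \<le> s2 * (\<Sum>m. (c (n + m))\<^sup>2) / e\<^sup>2" if e: "0 < e" for e n
  proof -
    define E where "E N = {\<omega>\<in>space M. \<exists>j\<le>N. e \<le> \<bar>S (n + j) \<omega> - S n \<omega>\<bar>}" for N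
    have [measurable]: "E N \<in> sets M" for N unfolding E_def by measurable
    have cs: "summable (\<lambda>m. (c (n + m))\<^sup>2)" using c summable_iff_shift[of "\<lambda>m. (c m)\<^sup>2" n] by (simp add: add.commute)
    have "(\<lambda>N. prob (E N)) \<longlonglongrightarrow> prob (\<Union>N. E N)"
      by (rule finite_Lim_measure_incseq) (auto simp: incseq_def E_def intro: order_trans)
    moreover have "prob (E N) \<le> s2 * (\<Sum>m. (c (n + m))\<^sup>2) / e\<^sup>2" for N
    proof -
      have "inj (\<lambda>m. \<sigma> (n + m))" by (rule injI) (auto dest!: injD[OF \<sigma>])
      from kolmogorov_inequality[OF this e, of N "\<lambda>m. c (n + m)"]
      have "prob (E N) \<le> s2 * (\<Sum>m<N. (c (n + m))\<^sup>2) / e\<^sup>2" unfolding E_def by (simp add: shift)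
      also have "\<dots> \<le> s2 * (\<Sum>m. (c (n + m))\<^sup>2) / e\<^sup>2"
        using s2_pos cs by (intro divide_right_mono mult_left_mono sum_le_suminf) auto
      finally show ?thesis .
    qed
    ultimately have "prob (\<Union>N. E N) \<le> s2 * (\<Sum>m. (c (n + m))\<^sup>2) / e\<^sup>2" by (intro LIMSEQ_le_const2) auto
    moreover have "(\<Union>N. E N) = {\<omega>\<in>space M. \<exists>j. e \<le> \<bar>S (n + j) \<omega> - S n \<omega>\<bar>}" by (auto simp: E_def)
    ultimately show ?thesis by simp
  qed
  have lim: "(\<lambda>n. \<Sum>m. (c (n + m))\<^sup>2) \<longlonglongrightarrow> 0"
  proof -
    have "(\<lambda>n. suminf (\<lambda>m. (c m)\<^sup>2) - (\<Sum>m<n. (c m)\<^sup>2)) \<longlonglongrightarrow> suminf (\<lambda>m. (c m)\<^sup>2) - suminf (\<lambda>m. (c m)\<^sup>2)"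
      using c by (intro tendsto_intros summable_LIMSEQ)
    moreover have "suminf (\<lambda>m. (c m)\<^sup>2) - (\<Sum>m<n. (c m)\<^sup>2) = (\<Sum>m. (c (n + m))\<^sup>2)" for n
      using suminf_minus_initial_segment[OF c, of n] by (simp add: add.commute)
    ultimately show ?thesis by simp
  qed
  have ae: "AE \<omega> in M. \<exists>n. \<forall>j. \<bar>S (n + j) \<omega> - S n \<omega>\<bar> < e" if e: "0 < e" for e
  proof -
    define B where "B = {\<omega>\<in>space M. \<forall>n. \<exists>j. e \<le> \<bar>S (n + j) \<omega> - S n \<omega>\<bar>}"
    have [measurable]: "B \<in> sets M" unfolding B_def by measurable
    have "prob B \<le> s2 * (\<Sum>m. (c (n + m))\<^sup>2) / e\<^sup>2" for n
    proof -
      have "prob B \<le> \<P>(\<omega> in M. \<exists>j. e \<le> \<bar>S (n + j) \<omega> - S n \<omega>\<bar>)" unfolding B_def by (intro finite_measure_mono) auto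
      then show ?thesis using tail[OF e, of n] by linarith
    qed
    moreover have "(\<lambda>n. s2 * (\<Sum>m. (c (n + m))\<^sup>2) / e\<^sup>2) \<longlonglongrightarrow> s2 * 0 / e\<^sup>2" using e by (intro tendsto_intros lim) auto
    ultimately have "prob B \<le> s2 * 0 / e\<^sup>2" by (intro LIMSEQ_le_const) auto
    then have "prob B = 0" by (simp add: measure_le_0_iff)
    then have "B \<in> null_sets M" by (simp add: emeasure_eq_measure null_sets_def)
    then have "AE \<omega> in M. \<omega> \<notin> B" by (rule AE_not_in)
    then show ?thesis by (auto simp: B_def not_le)
  qed
  have "AE \<omega> in M. \<forall>k::nat. \<exists>n. \<forall>j. \<bar>S (n + j) \<omega> - S n \<omega>\<bar> < 1 / real (Suc k)"
    unfolding AE_all_countable by (intro allI ae) simp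
  then show ?thesis
  proof eventually_elim
    case (elim \<omega>)
    have "Cauchy (\<lambda>n. S n \<omega>)"
    proof (rule metric_CauchyI)
      fix e :: real assume e: "0 < e"
      obtain k where k: "1 / real (Suc k) < e / 2" using reals_Archimedean[of "e / 2"] e by (auto simp: inverse_eq_divide)
      obtain n where n: "\<And>j. \<bar>S (n + j) \<omega> - S n \<omega>\<bar> < 1 / real (Suc k)" using elim by blast
      have "dist (S i \<omega>) (S j \<omega>) < e" if "n \<le> i" "n \<le> j" for i j
        using n[of "i - n"] n[of "j - n"] that k by (simp add: dist_real_def)
      then show "\<exists>n. \<forall>i\<ge>n. \<forall>j\<ge>n. dist (S i \<omega>) (S j \<omega>) < e" by blast
    qed
    then have "convergent (\<lambda>n. S n \<omega>)" by (rule Cauchy_convergent)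
    then show ?case unfolding summable_iff_convergent S_def psum_def .
  qed
qed

end

section \<open>Regularly varying innovations and admissible families of weights\<close>

locale heavy_tailed = iid_sequence +
  fixes t :: real
  assumes t: "2 < t" and regvar: "regvar_tail tailp t"
begin

lemma tailp_pos: "0 < tailp u"
  using regvar by (simp add: regvar_tail_def)

text \<open>Potter's bound applied termwise. The constants do not depend on the family, provided
  every argument \<open>y / w i\<close> lies beyond \<open>u0\<close>; any exponent above
  \<open>t\<close> would serve in place of \<open>t + 1\<close>.\<close>

lemma tails_potter:
  "\<exists>u0>0. \<exists>C>0. \<forall>I w y k. (\<forall>i\<in>I. 0 < w i \<and> u0 \<le> y / w i) \<longrightarrow> 1 \<le> k \<longrightarrow>
     tails w I y \<le> C * k powr (t + 1) * tails w I (k * y)"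
proof -
  obtain u0 where u0: "0 < u0" "\<And>u k. u0 \<le> u \<Longrightarrow> 1 \<le> k \<Longrightarrow> (2 * k) powr (- (t + 1)) * tailp u \<le> tailp (k * u)"
    using potter_lower[OF regvar, of 1] t by auto
  have "tails w I y \<le> 2 powr (t + 1) * k powr (t + 1) * tails w I (k * y)"
    if w: "\<forall>i\<in>I. 0 < w i \<and> u0 \<le> y / w i" and k: "1 \<le> k" for I w y k
  proof -
    have "tailp (y / w i) \<le> 2 powr (t + 1) * k powr (t + 1) * tailp (k * y / w i)" if "i \<in> I" for i
    proof -
      have "(2 * k) powr (t + 1) * ((2 * k) powr (- (t + 1)) * tailp (y / w i)) \<le> (2 * k) powr (t + 1) * tailp (k * (y / w i))"
        using w k that by (intro mult_left_mono u0(2)) auto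
      moreover have "(2 * k) powr (t + 1) * ((2 * k) powr (- (t + 1)) * tailp (y / w i)) = tailp (y / w i)"
        using k unfolding mult.assoc[symmetric] powr_add[symmetric] by simp
      ultimately have "tailp (y / w i) \<le> (2 * k) powr (t + 1) * tailp (k * (y / w i))" by linarith
      also have "(2 * k) powr (t + 1) = 2 powr (t + 1) * k powr (t + 1)" by (rule powr_mult)
      finally show ?thesis by simp
    qed
    then show ?thesis unfolding tails_def sum_distrib_left by (rule sum_mono)
  qed
  then show ?thesis using u0(1) by (intro exI[of _ u0] conjI exI[of _ "2 powr (t + 1)"]) auto
qed

text \<open>\<open>d\<close> is chosen with \<open>(1 - d) powr (- t) < 1 + e\<close> and
  \<open>1 - e < (1 + d) powr (- t)\<close>; termwise regular variation then makes a relative shift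
  of the level by \<open>d\<close> cost at most \<open>e\<close>, uniformly in the family.\<close>

lemma tails_regular:
  assumes e: "0 < e"
  shows "\<exists>d u0. 0 < d \<and> d < 1 \<and> 0 < u0 \<and> (\<forall>I w y. (\<forall>i\<in>I. 0 < w i \<and> u0 \<le> y / w i) \<longrightarrow>
     tails w I ((1 - d) * y) \<le> (1 + e) * tails w I y \<and> (1 - e) * tails w I y \<le> tails w I ((1 + d) * y))"
proof -
  have "((\<lambda>d. (1 - d) powr (- t)) \<longlongrightarrow> (1 - 0) powr (- t)) (at_right (0::real))"
    "((\<lambda>d. (1 + d) powr (- t)) \<longlongrightarrow> (1 + 0) powr (- t)) (at_right (0::real))"
    by (intro tendsto_intros; simp)+
  then have "\<forall>\<^sub>F d in at_right (0::real). (1 - d) powr (- t) < 1 + e" "\<forall>\<^sub>F d in at_right (0::real). 1 - e < (1 + d) powr (- t)"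
    using order_tendstoD(2)[of "\<lambda>d. (1 - d) powr (- t)" 1 _ "1 + e"]
      order_tendstoD(1)[of "\<lambda>d. (1 + d) powr (- t)" 1 _ "1 - e"] e by auto
  moreover have "\<forall>\<^sub>F d in at_right (0::real). 0 < d \<and> d < 1"
    by (auto intro!: eventually_at_right_less eventually_conj simp: eventually_at_right_field intro: exI[of _ 1])
  ultimately have "\<forall>\<^sub>F d in at_right (0::real). (1 - d) powr (- t) < 1 + e \<and> 1 - e < (1 + d) powr (- t) \<and> 0 < d \<and> d < 1"
    by eventually_elim auto
  then obtain d where d: "(1 - d) powr (- t) < 1 + e" "1 - e < (1 + d) powr (- t)" "0 < d" "d < 1"
    using eventually_happens[of _ "at_right (0::real)"] by (auto simp: trivial_limit_at_right_real)
  have lim: "((\<lambda>u. tailp (c * u) / tailp u) \<longlongrightarrow> c powr (- t)) at_top" if "0 < c" for c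
    using regvar that by (simp add: regvar_tail_def)
  have "\<forall>\<^sub>F u in at_top. tailp ((1 - d) * u) / tailp u < 1 + e" "\<forall>\<^sub>F u in at_top. 1 - e < tailp ((1 + d) * u) / tailp u"
    using order_tendstoD(2)[OF lim[of "1 - d"] d(1)] order_tendstoD(1)[OF lim[of "1 + d"] d(2)] d by auto
  then have "\<forall>\<^sub>F u in at_top. tailp ((1 - d) * u) \<le> (1 + e) * tailp u \<and> (1 - e) * tailp u \<le> tailp ((1 + d) * u)"
  proof eventually_elim
    case (elim u)
    then show ?case using tailp_pos[of u] by (auto simp: field_simps intro: less_imp_le)
  qed
  then obtain u1 where u1: "\<And>u. u1 \<le> u \<Longrightarrow> tailp ((1 - d) * u) \<le> (1 + e) * tailp u \<and> (1 - e) * tailp u \<le> tailp ((1 + d) * u)"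
    by (auto simp: eventually_at_top_linorder)
  have "tails w I ((1 - d) * y) \<le> (1 + e) * tails w I y \<and> (1 - e) * tails w I y \<le> tails w I ((1 + d) * y)"
    if w: "\<forall>i\<in>I. 0 < w i \<and> max 1 u1 \<le> y / w i" for I w y
  proof -
    have "tailp ((1 - d) * y / w i) \<le> (1 + e) * tailp (y / w i)" "(1 - e) * tailp (y / w i) \<le> tailp ((1 + d) * y / w i)"
      if "i \<in> I" for i using u1[of "y / w i"] w that by (auto simp: mult.assoc)
    then show ?thesis unfolding tails_def sum_distrib_left by (auto intro!: sum_mono)
  qed
  then show ?thesis using d by (intro exI[of _ d] exI[of _ "max 1 u1"]) auto
qed

text \<open>What is retained of the normalised weights. The exponents are -1/2 + 1/4 and -1/2 - 1/4.
  The ceiling makes Lyapunov sums and tail sums at fixed levels a negative power of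
  \<open>n\<close>; the many weights above the floor give a polynomial lower bound for the tail
  sum.\<close>

definition good :: "nat \<Rightarrow> int set \<Rightarrow> (int \<Rightarrow> real) \<Rightarrow> bool" where
  "good n I w \<longleftrightarrow> finite I \<and> (\<forall>i\<in>I. 0 < w i \<and> w i \<le> real n powr (- 1 / 4)) \<and> vsum w I = 1 \<and>
     real n / 4 \<le> real (card {i\<in>I. real n powr (- 3 / 4) \<le> w i})"

lemma goodD:
  assumes "good n I w"
  shows "finite I" "\<And>i. i \<in> I \<Longrightarrow> 0 < w i" "\<And>i. i \<in> I \<Longrightarrow> w i \<le> real n powr (- 1 / 4)" "vsum w I = 1"
  using assms by (auto simp: good_def)

lemma good_vsum_subset:
  assumes "good n I w" "J \<subseteq> I" shows "vsum w J \<le> 1"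
proof -
  have "vsum w J \<le> vsum w I" unfolding vsum_def using assms goodD(1)[OF assms(1)] s2_pos by (intro sum_mono2) auto
  then show ?thesis using goodD(4)[OF assms(1)] by simp
qed

text \<open>Pull out the factor \<open>w i powr (p - 2)\<close>, bounded by the ceiling on the
  weights; the remaining squares sum to at most \<open>1 / s2\<close>.\<close>

lemma good_lyap:
  assumes g: "good n I w" and J: "J \<subseteq> I" shows "lyap w J \<le> real n powr (- ((p - 2) / 4)) / s2"
proof -
  have "w i powr p \<le> (w i)\<^sup>2 * s2 * (real n powr (- ((p - 2) / 4)) / s2)" if "i \<in> J" for i
  proof -
    have i: "0 < w i" "w i \<le> real n powr (- 1 / 4)" using goodD[OF g] J that by auto
    have "w i powr p = w i powr 2 * w i powr (p - 2)" by (simp flip: powr_add)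
    also have "\<dots> \<le> w i powr 2 * (real n powr (- 1 / 4)) powr (p - 2)"
      using i p by (intro mult_left_mono powr_mono2) auto
    also have "(real n powr (- 1 / 4)) powr (p - 2) = real n powr (- ((p - 2) / 4))"
      by (simp add: powr_powr algebra_simps)
    finally show ?thesis using i s2_pos by (simp add: powr_numeral)
  qed
  then have "lyap w J \<le> (\<Sum>i\<in>J. (w i)\<^sup>2 * s2 * (real n powr (- ((p - 2) / 4)) / s2))"
    unfolding lyap_def by (rule sum_mono)
  also have "\<dots> = vsum w J * (real n powr (- ((p - 2) / 4)) / s2)" unfolding vsum_def sum_distrib_right ..
  also have "\<dots> \<le> 1 * (real n powr (- ((p - 2) / 4)) / s2)"
    using good_vsum_subset[OF g J] s2_pos by (intro mult_right_mono) auto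
  finally show ?thesis by simp
qed

text \<open>Ensures that all tail arguments are uniformly large, as the termwise regular variation
  estimates demand.\<close>

lemma good_scale:
  assumes g: "good n I w" and i: "i \<in> I" and n: "0 < n" and y: "0 \<le> y"
  shows "y * real n powr (1 / 4) \<le> y / w i"
proof -
  have w: "0 < w i" "w i \<le> real n powr (- 1 / 4)" using goodD[OF g] i by auto
  have "y / (real n powr (- 1 / 4)) \<le> y / w i" using w y n by (intro divide_left_mono mult_pos_pos) auto
  moreover have "y / (real n powr (- 1 / 4)) = y * real n powr (1 / 4)" using n by (simp add: powr_minus_divide field_simps flip: powr_add)
  ultimately show ?thesis by simp
qed

lemma tails_markov_good:
  assumes g: "good n I w" and J: "J \<subseteq> I" and y: "0 < y"
  shows "tails w J y \<le> mu / s2 * real n powr (- ((p - 2) / 4)) / y powr p"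
proof -
  have fin: "finite J" using goodD(1)[OF g] J by (rule rev_finite_subset)
  have "tails w J y \<le> mu * lyap w J / y powr p" using goodD(2)[OF g] J by (intro tails_markov fin y) auto
  also have "\<dots> \<le> mu * (real n powr (- ((p - 2) / 4)) / s2) / y powr p"
    using good_lyap[OF g J] mu_nonneg by (intro divide_right_mono mult_left_mono) auto
  finally show ?thesis by simp
qed

lemma tails_subset: "finite I \<Longrightarrow> J \<subseteq> I \<Longrightarrow> tails w J y \<le> tails w I y"
  unfolding tails_def by (intro sum_mono2) (auto simp: tailp_nonneg)

text \<open>A crude polynomial bound is enough: it is compared only with Gaussian and Chernoff
  bounds that can be made smaller than any prescribed power of \<open>n * x\<close>.\<close>

lemma tails_lower_good:
  "\<exists>c>0. \<exists>u0>0. \<forall>n I w x. good n I w \<longrightarrow> 1 \<le> n \<longrightarrow> 1 \<le> x \<longrightarrow> u0 \<le> real n powr (3 / 4) \<longrightarrow>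
     c * (real n * x) powr (- (t + 1)) \<le> tails w I x"
proof -
  obtain u0 c where u0: "0 < u0" "0 < c" "\<And>u. u0 \<le> u \<Longrightarrow> c * u powr (- (t + 1)) \<le> tailp u"
    using regvar_tail_lower[OF regvar, of 1] t by auto
  have "c / 4 * (real n * x) powr (- (t + 1)) \<le> tails w I x"
    if g: "good n I w" and n: "1 \<le> n" and x: "1 \<le> x" and u: "u0 \<le> real n powr (3 / 4)" for n I w x
  proof -
    define A where "A = {i\<in>I. real n powr (- 3 / 4) \<le> w i}"
    have A: "finite A" "A \<subseteq> I" "real n / 4 \<le> real (card A)" using g by (auto simp: A_def good_def)
    \<comment> \<open>The spare factor \<open>real n\<close> on the right is cancelled below against
      \<open>card A\<close>, which is at least \<open>n / 4\<close>; this leaves the constant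
      \<open>c / 4\<close>.\<close>
    have "c * (real n * x) powr (- (t + 1)) \<le> tailp (x / w i) * real n" if "i \<in> A" for i
    proof -
      have wi: "real n powr (- 3 / 4) \<le> w i" "0 < w i" using that goodD(2)[OF g] by (auto simp: A_def)
      have "x / w i \<le> x / (real n powr (- 3 / 4))" using wi x n by (intro divide_left_mono) auto
      also have "\<dots> = x * real n powr (3 / 4)" using n by (simp add: powr_minus_divide field_simps flip: powr_add)
      finally have 1: "tailp (x * real n powr (3 / 4)) \<le> tailp (x / w i)" by (rule tailp_antimono)
      have "1 * real n powr (3 / 4) \<le> x * real n powr (3 / 4)" using x by (intro mult_right_mono) auto
      then have "c * (x * real n powr (3 / 4)) powr (- (t + 1)) \<le> tailp (x * real n powr (3 / 4))" using u by (intro u0(3)) simp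
      moreover have "(real n * x) powr (- (t + 1)) \<le> (x * real n powr (3 / 4)) powr (- (t + 1))"
      proof (rule powr_mono2')
        have "real n powr (3 / 4) \<le> real n powr 1" using n by (intro powr_mono) auto
        then show "x * real n powr (3 / 4) \<le> real n * x" using x n by (simp add: mult.commute mult_left_mono)
      qed (use x n t in auto)
      then have "c * (real n * x) powr (- (t + 1)) \<le> c * (x * real n powr (3 / 4)) powr (- (t + 1))"
        using u0(2) by (intro mult_left_mono) auto
      ultimately have "c * (real n * x) powr (- (t + 1)) \<le> tailp (x / w i)" using 1 by linarith
      also have "\<dots> = tailp (x / w i) * 1" by simp
      also have "\<dots> \<le> tailp (x / w i) * real n" using n tailp_nonneg by (intro mult_left_mono) auto
      finally show ?thesis .
    qed
    then have "(\<Sum>i\<in>A. c * (real n * x) powr (- (t + 1))) \<le> (\<Sum>i\<in>A. tailp (x / w i) * real n)" by (rule sum_mono)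
    also have "\<dots> = tails w A x * real n" by (simp add: tails_def sum_distrib_right)
    also have "\<dots> \<le> tails w I x * real n" using tails_subset[OF goodD(1)[OF g] A(2)] by (intro mult_right_mono) auto
    finally have "real (card A) * (c * (real n * x) powr (- (t + 1))) \<le> tails w I x * real n" by simp
    moreover have "real n / 4 * (c * (real n * x) powr (- (t + 1))) \<le> real (card A) * (c * (real n * x) powr (- (t + 1)))"
      using A(3) u0(2) by (intro mult_right_mono) auto
    ultimately have "real n * (c / 4 * (real n * x) powr (- (t + 1))) \<le> real n * tails w I x" by (simp add: mult_ac)
    then show ?thesis using n by simp
  qed
  then show ?thesis using u0(1,2) by (intro exI[of _ "c / 4"] conjI exI[of _ u0]) auto
qed

section \<open>The Gaussian range\<close>

text \<open>Truncation level and ramp width are both \<open>1 / ln n\<close>. Their powers 2 and 3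
  make up \<open>ln n ^ 5\<close>, which the Lyapunov sum \<open>n powr (- (p - 2) / 4)\<close>
  absorbs, while \<open>x / ln n\<close> tends to 0 for \<open>x\<close> of order
  \<open>sqrt (ln n)\<close>. The bound for subfamilies, Chernoff with rate \<open>x\<close>, serves
  the sums left after removing one index.\<close>

lemma truncated_gaussian_range:
  assumes C: "0 < C" and e: "0 < e"
  shows "\<forall>\<^sub>F n in sequentially. \<forall>I w. good n I w \<longrightarrow>
     (\<forall>x. 0 \<le> x \<longrightarrow> x \<le> C * sqrt (ln (real n)) \<longrightarrow>
        \<bar>\<P>(\<omega> in M. x \<le> tsum (1 / ln (real n)) w I \<omega>) - normal_tail x\<bar> \<le> e * normal_tail x) \<and>
     (\<forall>J x. J \<subseteq> I \<longrightarrow> 0 \<le> x \<longrightarrow> x \<le> C * sqrt (ln (real n)) \<longrightarrow>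
        \<P>(\<omega> in M. x \<le> tsum (1 / ln (real n)) w J \<omega>) \<le> exp (1 - x\<^sup>2 / 2))"
proof -
  define \<kappa> where "\<kappa> = (p - 2) / 4"
  have \<kappa>: "0 < \<kappa>" using p by (simp add: \<kappa>_def)
  have l1: "((\<lambda>n::nat. 1 / ln (real n)) \<longlonglongrightarrow> 0)" by real_asymp
  have l2: "((\<lambda>n::nat. sqrt (ln (real n)) / ln (real n)) \<longlonglongrightarrow> 0)" by real_asymp
  have l3: "((\<lambda>n::nat. ln (real n) ^ 5 * real n powr (- \<kappa>)) \<longlonglongrightarrow> 0)" using \<kappa> by real_asymp
  have l4: "((\<lambda>n::nat. sqrt (ln (real n)) * ln (real n) ^ 5 * real n powr (- \<kappa>)) \<longlonglongrightarrow> 0)" using \<kappa> by real_asymp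
  have l5: "((\<lambda>n::nat. sqrt (ln (real n)) * real n powr (- 1 / 4)) \<longlonglongrightarrow> 0)" by real_asymp
  have l6: "((\<lambda>n::nat. sqrt (ln (real n)) powr p * real n powr (- \<kappa>)) \<longlonglongrightarrow> 0)" using \<kappa> by real_asymp
  have "(\<lambda>n::nat. clt_const * (1 / ln (real n) + C * (sqrt (ln (real n)) / ln (real n))
      + ln (real n) ^ 5 * real n powr (- \<kappa>) / s2 + C / s2 * (sqrt (ln (real n)) * ln (real n) ^ 5 * real n powr (- \<kappa>))))
      \<longlonglongrightarrow> clt_const * (0 + C * 0 + 0 / s2 + C / s2 * 0)"
    using s2_pos by (intro tendsto_intros l1 l2 l3 l4) auto
  then have e1: "\<forall>\<^sub>F n in sequentially. clt_const * (1 / ln (real n) + C * (sqrt (ln (real n)) / ln (real n))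
      + ln (real n) ^ 5 * real n powr (- \<kappa>) / s2 + C / s2 * (sqrt (ln (real n)) * ln (real n) ^ 5 * real n powr (- \<kappa>))) < e"
    using e by (intro order_tendstoD(2)) auto
  have "(\<lambda>n::nat. C * (sqrt (ln (real n)) / ln (real n))) \<longlonglongrightarrow> C * 0" by (intro tendsto_intros l2)
  then have e2: "\<forall>\<^sub>F n in sequentially. C * (sqrt (ln (real n)) / ln (real n)) < 1" by (intro order_tendstoD(2)) auto
  have "(\<lambda>n::nat. C * sqrt s2 * (sqrt (ln (real n)) * real n powr (- 1 / 4))) \<longlonglongrightarrow> C * sqrt s2 * 0" by (intro tendsto_intros l5)
  then have e3: "\<forall>\<^sub>F n in sequentially. C * sqrt s2 * (sqrt (ln (real n)) * real n powr (- 1 / 4)) < 1" by (intro order_tendstoD(2)) auto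
  have "(\<lambda>n::nat. C powr p * exp 1 * mu / s2 * (sqrt (ln (real n)) powr p * real n powr (- \<kappa>))) \<longlonglongrightarrow> C powr p * exp 1 * mu / s2 * 0"
    by (intro tendsto_intros l6)
  then have e4: "\<forall>\<^sub>F n in sequentially. C powr p * exp 1 * mu / s2 * (sqrt (ln (real n)) powr p * real n powr (- \<kappa>)) < 1"
    by (intro order_tendstoD(2)) auto
  have e5: "\<forall>\<^sub>F n in sequentially. 1 \<le> ln (real n)" by real_asymp
  have e6: "\<forall>\<^sub>F n in sequentially. (1::nat) \<le> n" by (rule eventually_ge_at_top)
  from e1 e2 e3 e4 e5 e6 show ?thesis
  proof eventually_elim
    case (elim n)
    define L where "L = ln (real n)"
    have L: "1 \<le> L" using elim by (simp add: L_def)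
    have xl: "x * (1 / L) \<le> 1" if "x \<le> C * sqrt L" for x
    proof -
      have "x * (1 / L) \<le> C * sqrt L * (1 / L)" using that L by (intro mult_right_mono) auto
      then show ?thesis using elim(2) by (simp add: L_def)
    qed
    have xly: "x powr p * exp 1 * mu * lyap w J \<le> 1"
      if g: "good n I w" "J \<subseteq> I" and x: "0 \<le> x" "x \<le> C * sqrt L" for x I J w
    proof -
      have "x powr p * exp 1 * mu * lyap w J \<le> (C * sqrt L) powr p * exp 1 * mu * (real n powr (- \<kappa>) / s2)"
        using x p mu_nonneg good_lyap[OF g] lyap_nonneg by (intro mult_mono powr_mono2) (auto simp: \<kappa>_def)
      also have "\<dots> = C powr p * exp 1 * mu / s2 * (sqrt (ln (real n)) powr p * real n powr (- \<kappa>))"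
        using C L by (simp add: powr_mult L_def)
      finally show ?thesis using elim(4) by linarith
    qed
    show ?case unfolding L_def[symmetric]
    proof (intro allI impI conjI)
      fix I w x assume g: "good n I w" and x: "0 \<le> x" "x \<le> C * sqrt L"
      have "\<bar>\<P>(\<omega> in M. x \<le> tsum (1 / L) w I \<omega>) - normal_tail x\<bar>
        \<le> clt_const * (1 + x) * (1 / L + lyap w I / ((1 / L)\<^sup>2 * (1 / L) ^ 3)) * normal_tail x"
      proof (rule tsum_normal_approx)
        fix i assume i: "i \<in> I"
        have wi: "0 < w i" "w i \<le> real n powr (- 1 / 4)" using goodD[OF g] i by auto
        have "x * sqrt ((w i)\<^sup>2 * s2) = x * (sqrt s2 * w i)" using wi by (simp add: real_sqrt_mult)
        also have "\<dots> \<le> C * sqrt L * (sqrt s2 * real n powr (- 1 / 4))"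
          using x wi s2_pos by (intro mult_mono) auto
        finally show "x * sqrt ((w i)\<^sup>2 * s2) \<le> 1" using elim(3) by (simp add: L_def mult_ac)
      qed (use goodD[OF g] x xl xly[OF g order_refl] L in auto)
      also have "\<dots> \<le> e * normal_tail x"
      proof (intro mult_right_mono normal_tail_nonneg)
        have "lyap w I / ((1 / L)\<^sup>2 * (1 / L) ^ 3) = lyap w I * L ^ 5"
          using L by (simp add: power_divide flip: power_add)
        also have "\<dots> \<le> real n powr (- \<kappa>) / s2 * L ^ 5"
          using good_lyap[OF g order_refl] L by (intro mult_right_mono) (auto simp: \<kappa>_def)
        finally have "clt_const * (1 + x) * (1 / L + lyap w I / ((1 / L)\<^sup>2 * (1 / L) ^ 3))
          \<le> clt_const * (1 + C * sqrt L) * (1 / L + real n powr (- \<kappa>) / s2 * L ^ 5)"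
          using x clt_const_nonneg L lyap_nonneg by (intro mult_mono add_mono) auto
        also have "\<dots> = clt_const * (1 / L + C * (sqrt L / L) + L ^ 5 * real n powr (- \<kappa>) / s2 + C / s2 * (sqrt L * L ^ 5 * real n powr (- \<kappa>)))"
          by (simp add: algebra_simps add_divide_distrib)
        finally show "clt_const * (1 + x) * (1 / L + lyap w I / ((1 / L)\<^sup>2 * (1 / L) ^ 3)) \<le> e"
          using elim(1) by (simp add: L_def)
      qed
      finally show "\<bar>\<P>(\<omega> in M. x \<le> tsum (1 / L) w I \<omega>) - normal_tail x\<bar> \<le> e * normal_tail x" .
    next
      fix I w J x assume g: "good n I w" and J: "J \<subseteq> I" and x: "0 \<le> x" "x \<le> C * sqrt L"
      have fin: "finite J" using goodD(1)[OF g] J by (rule rev_finite_subset)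
      have "\<P>(\<omega> in M. x \<le> tsum (1 / L) w J \<omega>)
        \<le> exp (x\<^sup>2 / 2 * vsum w J + x powr p * exp (x * (1 / L)) * mu * lyap w J - x * x)"
        using goodD(2)[OF g] J L x by (intro tsum_chernoff fin) auto
      also have "\<dots> \<le> exp (x\<^sup>2 / 2 * 1 + 1 - x * x)"
      proof -
        have "x powr p * exp (x * (1 / L)) * mu * lyap w J \<le> x powr p * exp 1 * mu * lyap w J"
          using xl[OF x(2)] mu_nonneg lyap_nonneg by (intro mult_right_mono mult_left_mono) auto
        moreover have "x\<^sup>2 / 2 * vsum w J \<le> x\<^sup>2 / 2 * 1" using good_vsum_subset[OF g J] by (intro mult_left_mono) auto
        ultimately show ?thesis using xly[OF g J x] by simp
      qed
      finally show "\<P>(\<omega> in M. x \<le> tsum (1 / L) w J \<omega>) \<le> exp (1 - x\<^sup>2 / 2)"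
        by (simp add: power2_eq_square)
    qed
  qed
qed


text \<open>The form in which the tail is compared with powers of \<open>n\<close>, the factor
  \<open>1 + x\<close> being at most logarithmic where it is used.\<close>

lemma normal_tail_exp_ge:
  assumes "0 \<le> x"
  shows "exp (- x\<^sup>2 / 2) \<le> sqrt (2 * pi) * exp (3 / 2) * (1 + x) * normal_tail x"
proof -
  have "exp (3 / 2) * (1 + x) * (exp (- 3 / 2) * std_normal_density x / (1 + x)) \<le> exp (3 / 2) * (1 + x) * normal_tail x"
    using normal_tail_ge[OF assms] assms by (intro mult_left_mono) auto
  moreover have "exp (3 / 2) * (1 + x) * (exp (- 3 / 2) * std_normal_density x / (1 + x)) = (exp (3 / 2) * exp (- 3 / 2)) * std_normal_density x"
    using assms by (simp add: field_simps)
  moreover have "exp (3 / 2) * exp (- 3 / 2) = (1::real)" by (simp add: exp_add[symmetric])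
  ultimately have "std_normal_density x \<le> exp (3 / 2) * (1 + x) * normal_tail x" by simp
  then have "sqrt (2 * pi) * std_normal_density x \<le> sqrt (2 * pi) * (exp (3 / 2) * (1 + x) * normal_tail x)"
    by (intro mult_left_mono) auto
  then show ?thesis by (simp add: std_normal_density_def mult_ac)
qed

text \<open>With \<open>c0 = sqrt \<kappa>\<close> the normal tail is at least of order
  \<open>n powr (- \<kappa> / 2)\<close> up to logarithms. A term above \<open>1 / ln n\<close> has
  probability at most a power of \<open>ln n\<close> times \<open>n powr (- \<kappa>)\<close>, so
  the truncation is harmless.\<close>

lemma gaussian_range:
  "\<exists>c0>0. \<forall>e>0. \<forall>\<^sub>F n in sequentially. \<forall>I w x. good n I w \<longrightarrow> 0 \<le> x \<longrightarrow> x \<le> c0 * sqrt (ln (real n)) \<longrightarrow>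
     \<bar>\<P>(\<omega> in M. x \<le> wsum w I \<omega>) - normal_tail x\<bar> \<le> e * normal_tail x"
proof -
  define \<kappa> where "\<kappa> = (p - 2) / 4"
  have \<kappa>: "0 < \<kappa>" using p by (simp add: \<kappa>_def)
  define c0 where "c0 = sqrt \<kappa>"
  define K where "K = sqrt (2 * pi) * exp (3 / 2)"
  have K0: "0 < K" by (simp add: K_def)
  have c0: "0 < c0" using \<kappa> by (simp add: c0_def)
  have "\<forall>\<^sub>F n in sequentially. \<forall>I w x. good n I w \<longrightarrow> 0 \<le> x \<longrightarrow> x \<le> c0 * sqrt (ln (real n)) \<longrightarrow>
     \<bar>\<P>(\<omega> in M. x \<le> wsum w I \<omega>) - normal_tail x\<bar> \<le> e * normal_tail x" if e: "0 < e" for e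
  proof -
    have l1: "(\<lambda>n::nat. ln (real n) powr p * real n powr (- \<kappa>) * real n powr (\<kappa> / 2)) \<longlonglongrightarrow> 0" using \<kappa> by real_asymp
    have l2: "(\<lambda>n::nat. sqrt (ln (real n)) * (ln (real n) powr p * real n powr (- \<kappa>) * real n powr (\<kappa> / 2))) \<longlonglongrightarrow> 0" using \<kappa> by real_asymp
    have "(\<lambda>n::nat. mu / s2 * K * (ln (real n) powr p * real n powr (- \<kappa>) * real n powr (\<kappa> / 2)
        + c0 * (sqrt (ln (real n)) * (ln (real n) powr p * real n powr (- \<kappa>) * real n powr (\<kappa> / 2)))))
      \<longlonglongrightarrow> mu / s2 * K * (0 + c0 * 0)" by (intro tendsto_intros l1 l2)
    then have e1: "\<forall>\<^sub>F n in sequentially. mu / s2 * K * (ln (real n) powr p * real n powr (- \<kappa>) * real n powr (\<kappa> / 2)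
        + c0 * (sqrt (ln (real n)) * (ln (real n) powr p * real n powr (- \<kappa>) * real n powr (\<kappa> / 2)))) < e / 2"
      using e by (intro order_tendstoD(2)) auto
    have e2: "\<forall>\<^sub>F n in sequentially. 1 \<le> ln (real n)" by real_asymp
    have e3: "\<forall>\<^sub>F n in sequentially. (1::nat) \<le> n" by (rule eventually_ge_at_top)
    have "0 < e / 2" using e by simp
    from e1 e2 e3 truncated_gaussian_range[OF c0 this] show ?thesis
    proof eventually_elim
      case (elim n)
      define L where "L = ln (real n)"
      have L: "1 \<le> L" using elim by (simp add: L_def)
      show ?case
      proof (intro allI impI)
        fix I w x assume g: "good n I w" and x: "0 \<le> x" "x \<le> c0 * sqrt (ln (real n))"
        have 1: "\<bar>\<P>(\<omega> in M. x \<le> tsum (1 / L) w I \<omega>) - normal_tail x\<bar> \<le> e / 2 * normal_tail x"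
          using elim(4) g x unfolding L_def by blast
        have 2: "\<bar>\<P>(\<omega> in M. x \<le> wsum w I \<omega>) - \<P>(\<omega> in M. x \<le> tsum (1 / L) w I \<omega>)\<bar> \<le> tails w I (1 / L)"
          using goodD[OF g] by (intro prob_wsum_tsum) auto
        have ex: "real n powr (- (\<kappa> / 2)) \<le> exp (- x\<^sup>2 / 2)"
        proof -
          have "x\<^sup>2 \<le> (c0 * sqrt L)\<^sup>2" using x by (intro power_mono) (auto simp: L_def)
          also have "\<dots> = \<kappa> * L" using \<kappa> L by (simp add: power_mult_distrib c0_def)
          finally have "exp (- (\<kappa> * L) / 2) \<le> exp (- x\<^sup>2 / 2)" by simp
          moreover have "real n powr (- (\<kappa> / 2)) = exp (- (\<kappa> * L) / 2)" using elim(3) by (simp add: powr_def L_def)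
          ultimately show ?thesis by simp
        qed
        have "tails w I (1 / L) \<le> mu / s2 * real n powr (- \<kappa>) / (1 / L) powr p"
          using tails_markov_good[OF g order_refl, of "1 / L"] L by (simp add: \<kappa>_def)
        also have "\<dots> = mu / s2 * (L powr p * real n powr (- \<kappa>) * real n powr (\<kappa> / 2)) * real n powr (- (\<kappa> / 2))"
          using L elim(3) by (simp add: powr_divide flip: powr_add)
        also have "\<dots> \<le> mu / s2 * (L powr p * real n powr (- \<kappa>) * real n powr (\<kappa> / 2)) * (K * (1 + c0 * sqrt L) * normal_tail x)"
        proof (intro mult_left_mono)
          have "K * (1 + x) * normal_tail x \<le> K * (1 + c0 * sqrt L) * normal_tail x"
            using x K0 normal_tail_nonneg by (intro mult_right_mono mult_left_mono) (auto simp: L_def)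
          then show "real n powr (- (\<kappa> / 2)) \<le> K * (1 + c0 * sqrt L) * normal_tail x"
            using ex normal_tail_exp_ge[OF x(1)] unfolding K_def by linarith
        qed (use mu_nonneg s2_pos in auto)
        also have "\<dots> = (mu / s2 * K * (L powr p * real n powr (- \<kappa>) * real n powr (\<kappa> / 2)
           + c0 * (sqrt L * (L powr p * real n powr (- \<kappa>) * real n powr (\<kappa> / 2))))) * normal_tail x"
          by (simp add: algebra_simps add_divide_distrib)
        also have "\<dots> \<le> e / 2 * normal_tail x"
          using elim(1) normal_tail_nonneg by (intro mult_right_mono) (auto simp: L_def)
        finally have 3: "tails w I (1 / L) \<le> e / 2 * normal_tail x" .
        have "e / 2 * normal_tail x + e / 2 * normal_tail x = e * normal_tail x" by simp
        with 1 2 3 show "\<bar>\<P>(\<omega> in M. x \<le> wsum w I \<omega>) - normal_tail x\<bar> \<le> e * normal_tail x"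
          by linarith
      qed
    qed
  qed
  then show ?thesis using c0 by blast
qed

text \<open>Truncation biases the mean, so Chebyshev is applied to the untruncated sum and the
  difference is paid with the tail sum at \<open>\<eta>\<close>.\<close>

lemma prob_tsum_remove:
  assumes g: "good n I w" and x: "0 < x"
  shows "\<P>(\<omega> in M. x \<le> tsum \<eta> w (I - {i}) \<omega>) \<le> 1 / x\<^sup>2 + tails w I \<eta>"
    and "\<P>(\<omega> in M. tsum \<eta> w (I - {i}) \<omega> < - x) \<le> 1 / x\<^sup>2 + tails w I \<eta>"
proof -
  define J where "J = I - {i}"
  have J: "finite J" "J \<subseteq> I" "\<And>i. i \<in> J \<Longrightarrow> 0 < w i" using goodD[OF g] by (auto simp: J_def)
  have T: "tails w J \<eta> \<le> tails w I \<eta>" using goodD(1)[OF g] J(2) by (rule tails_subset)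
  have c: "\<P>(\<omega> in M. x \<le> \<bar>wsum w J \<omega>\<bar>) \<le> 1 / x\<^sup>2"
    using wsum_chebyshev[OF J(1) x, of w] good_vsum_subset[OF g J(2)] x
    by (smt (verit) divide_right_mono zero_le_power2)
  have "\<P>(\<omega> in M. x \<le> wsum w J \<omega>) \<le> \<P>(\<omega> in M. x \<le> \<bar>wsum w J \<omega>\<bar>)" by (intro finite_measure_mono) auto
  moreover have "\<bar>\<P>(\<omega> in M. x \<le> wsum w J \<omega>) - \<P>(\<omega> in M. x \<le> tsum \<eta> w J \<omega>)\<bar> \<le> tails w J \<eta>"
    using J by (intro prob_wsum_tsum) auto
  ultimately show "\<P>(\<omega> in M. x \<le> tsum \<eta> w (I - {i}) \<omega>) \<le> 1 / x\<^sup>2 + tails w I \<eta>"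
    using T c unfolding J_def by linarith
  have "\<P>(\<omega> in M. wsum w J \<omega> < - x) \<le> \<P>(\<omega> in M. x \<le> \<bar>wsum w J \<omega>\<bar>)" by (intro finite_measure_mono) auto
  moreover have "\<bar>\<P>(\<omega> in M. wsum w J \<omega> < - x) - \<P>(\<omega> in M. tsum \<eta> w J \<omega> < - x)\<bar> \<le> tails w J \<eta>"
    using J by (intro prob_wsum_tsum) auto
  ultimately show "\<P>(\<omega> in M. tsum \<eta> w (I - {i}) \<omega> < - x) \<le> 1 / x\<^sup>2 + tails w I \<eta>"
    using T c unfolding J_def by linarith
qed

section \<open>The intermediate range\<close>

text \<open>Here neither term need dominate, so each error is charged to one of them. The tail sum
  at \<open>1 / ln n\<close> exceeds that at \<open>x\<close> only by a power of
  \<open>ln n\<close>, and every error containing it carries a further negative power of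
  \<open>n\<close> or a Gaussian factor.\<close>

lemma intermediate_range:
  assumes c0: "0 < c0" and C: "0 < C" and e: "0 < e" "e \<le> 1"
  shows "\<forall>\<^sub>F n in sequentially. \<forall>I w x. good n I w \<longrightarrow> c0 * sqrt (ln (real n)) \<le> x \<longrightarrow> x \<le> C * sqrt (ln (real n)) \<longrightarrow>
     \<bar>\<P>(\<omega> in M. x \<le> wsum w I \<omega>) - (tails w I x + normal_tail x)\<bar> \<le> 3 * e * (tails w I x + normal_tail x)"
proof -
  define \<kappa> where "\<kappa> = (p - 2) / 4"
  have \<kappa>: "0 < \<kappa>" using p by (simp add: \<kappa>_def)
  obtain u0 D where D: "0 < u0" "0 < D" "\<And>I w y k. (\<forall>i\<in>I. 0 < w i \<and> u0 \<le> y / w i) \<Longrightarrow> 1 \<le> k \<Longrightarrow>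
     tails w I y \<le> D * k powr (t + 1) * tails w I (k * y)" using tails_potter by metis
  obtain d u1 where d: "0 < d" "d < 1" "0 < u1" "\<And>I w y. (\<forall>i\<in>I. 0 < w i \<and> u1 \<le> y / w i) \<Longrightarrow>
     tails w I ((1 - d) * y) \<le> (1 + e) * tails w I y \<and> (1 - e) * tails w I y \<le> tails w I ((1 + d) * y)"
    using tails_regular[OF e(1)] by metis
  \<comment> \<open>Chosen so that \<open>exp (- (d * x)\<^sup>2 / 2) \<le> n powr (- a)\<close> for
    all \<open>x \<ge> c0 * sqrt (ln n)\<close>.\<close>
  define a where "a = d\<^sup>2 * c0\<^sup>2 / 2"
  have a: "0 < a" using d c0 by (simp add: a_def)
  define K where "K = sqrt (2 * pi) * exp (3 / 2)"
  have K0: "0 < K" by (simp add: K_def)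
  have l1: "(\<lambda>n::nat. (sqrt (ln (real n)) * ln (real n)) powr (t + 1) * real n powr (- a)) \<longlonglongrightarrow> 0" using a by real_asymp
  have "(\<lambda>n::nat. D * C powr (t + 1) * exp 1 * ((sqrt (ln (real n)) * ln (real n)) powr (t + 1) * real n powr (- a))) \<longlonglongrightarrow> D * C powr (t + 1) * exp 1 * 0"
    by (intro tendsto_intros l1)
  then have e1: "\<forall>\<^sub>F n in sequentially. D * C powr (t + 1) * exp 1 * ((sqrt (ln (real n)) * ln (real n)) powr (t + 1) * real n powr (- a)) < e / 2"
    using e by (intro order_tendstoD(2)) auto
  have l2: "(\<lambda>n::nat. (sqrt (ln (real n)) * ln (real n)) powr (t + 1) * (ln (real n) powr p * real n powr (- \<kappa>))) \<longlonglongrightarrow> 0" using \<kappa> by real_asymp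
  have "(\<lambda>n::nat. D * C powr (t + 1) * (mu / s2) * ((sqrt (ln (real n)) * ln (real n)) powr (t + 1) * (ln (real n) powr p * real n powr (- \<kappa>)))) \<longlonglongrightarrow> D * C powr (t + 1) * (mu / s2) * 0"
    by (intro tendsto_intros l2)
  then have e2: "\<forall>\<^sub>F n in sequentially. D * C powr (t + 1) * (mu / s2) * ((sqrt (ln (real n)) * ln (real n)) powr (t + 1) * (ln (real n) powr p * real n powr (- \<kappa>))) < e / 2"
    using e by (intro order_tendstoD(2)) auto
  have l3: "(\<lambda>n::nat. ln (real n) powr p * real n powr (- \<kappa>)) \<longlonglongrightarrow> 0" using \<kappa> by real_asymp
  have l4: "(\<lambda>n::nat. sqrt (ln (real n)) * (ln (real n) powr p * real n powr (- \<kappa>))) \<longlonglongrightarrow> 0" using \<kappa> by real_asymp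
  have "(\<lambda>n::nat. mu / s2 * exp 1 * K * (ln (real n) powr p * real n powr (- \<kappa>) + C * (sqrt (ln (real n)) * (ln (real n) powr p * real n powr (- \<kappa>))))) \<longlonglongrightarrow> mu / s2 * exp 1 * K * (0 + C * 0)"
    by (intro tendsto_intros l3 l4)
  then have e3: "\<forall>\<^sub>F n in sequentially. mu / s2 * exp 1 * K * (ln (real n) powr p * real n powr (- \<kappa>) + C * (sqrt (ln (real n)) * (ln (real n) powr p * real n powr (- \<kappa>)))) < e"
    using e by (intro order_tendstoD(2)) auto
  have l5: "(\<lambda>n::nat. 1 / ln (real n)) \<longlonglongrightarrow> 0" by real_asymp
  have "(\<lambda>n::nat. 1 / (d\<^sup>2 * c0\<^sup>2) * (1 / ln (real n)) + 2 * (mu / s2) * (ln (real n) powr p * real n powr (- \<kappa>))) \<longlonglongrightarrow> 1 / (d\<^sup>2 * c0\<^sup>2) * 0 + 2 * (mu / s2) * 0"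
    by (intro tendsto_intros l3 l5)
  then have e4: "\<forall>\<^sub>F n in sequentially. 1 / (d\<^sup>2 * c0\<^sup>2) * (1 / ln (real n)) + 2 * (mu / s2) * (ln (real n) powr p * real n powr (- \<kappa>)) < e"
    using e by (intro order_tendstoD(2)) auto
  have "filterlim (\<lambda>n::nat. real n powr (1 / 4) / ln (real n)) at_top sequentially" by real_asymp
  then have e5: "\<forall>\<^sub>F n in sequentially. max u0 u1 \<le> real n powr (1 / 4) / ln (real n)"
    unfolding filterlim_at_top by blast
  have "filterlim (\<lambda>n::nat. sqrt (ln (real n))) at_top sequentially" by real_asymp
  then have e6: "\<forall>\<^sub>F n in sequentially. 1 / c0 \<le> sqrt (ln (real n))" by (simp add: filterlim_at_top)
  have e7: "\<forall>\<^sub>F n in sequentially. 1 \<le> ln (real n)" by real_asymp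
  have e8: "\<forall>\<^sub>F n in sequentially. (1::nat) \<le> n" by (rule eventually_ge_at_top)
  from e1 e2 e3 e4 e5 e6 e7 e8 truncated_gaussian_range[OF C e(1)] show ?thesis
  proof eventually_elim
    case (elim n)
    define L where "L = ln (real n)"
    have L: "1 \<le> L" using elim by (simp add: L_def)
    show ?case
    proof (intro allI impI)
      fix I w x assume g: "good n I w" and x: "c0 * sqrt (ln (real n)) \<le> x" "x \<le> C * sqrt (ln (real n))"
      define T where "T = tails w I x"
      define Te where "Te = tails w I (1 / L)"
      define Q where "Q = normal_tail x"
      define P' where "P' = \<P>(\<omega> in M. x \<le> tsum (1 / L) w I \<omega>)"
      have T0: "0 \<le> T" "0 \<le> Te" by (auto simp: T_def Te_def tails_nonneg)
      have x1: "1 \<le> x"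
      proof -
        have "1 = c0 * (1 / c0)" using c0 by simp
        also have "\<dots> \<le> c0 * sqrt (ln (real n))" using elim(6) c0 by (intro mult_left_mono) auto
        finally show ?thesis using x by simp
      qed
      have Q0: "0 \<le> Q" by (simp add: Q_def normal_tail_nonneg)
      have scale: "0 < w i \<and> max u0 u1 \<le> 1 / L / w i \<and> max u0 u1 \<le> x / w i" if "i \<in> I" for i
      proof -
        have n: "0 < n" using elim(8) by simp
        have "1 / L * real n powr (1 / 4) \<le> 1 / L / w i" using L by (intro good_scale[OF g that n]) auto
        moreover have "1 / L / w i \<le> x / w i"
          using goodD(2)[OF g that] x1 L by (intro divide_right_mono order_trans[of "1/L" 1 x]) auto
        ultimately show ?thesis using elim(5) goodD(2)[OF g that] by (simp add: L_def)
      qed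
      have reg: "tails w I ((1 - d) * x) \<le> (1 + e) * T" "(1 - e) * T \<le> tails w I ((1 + d) * x)"
        using d(4)[of I w x] scale by (auto simp: T_def)
      \<comment> \<open>Potter's bound with ratio \<open>x * L\<close>, which turns the level
        \<open>1 / L\<close> into \<open>x\<close>.\<close>
      have TeT: "Te \<le> D * C powr (t + 1) * (sqrt L * L) powr (t + 1) * T"
      proof -
        have xL: "1 \<le> x * L" using mult_mono[OF x1 L] x1 by simp
        have "Te \<le> D * (x * L) powr (t + 1) * tails w I (x * L * (1 / L))"
          unfolding Te_def using scale xL by (intro D(3)) auto
        also have "x * L * (1 / L) = x" using L by simp
        also have "D * (x * L) powr (t + 1) * tails w I x \<le> D * (C * (sqrt L * L)) powr (t + 1) * tails w I x"
        proof (intro mult_right_mono mult_left_mono powr_mono2 tails_nonneg)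
          have "x * L \<le> C * sqrt L * L" using x L by (intro mult_right_mono) (auto simp: L_def)
          then show "x * L \<le> C * (sqrt L * L)" by simp
        qed (use D t xL in auto)
        finally show ?thesis using C L by (simp add: powr_mult T_def)
      qed
      have Te: "Te \<le> mu / s2 * (L powr p * real n powr (- \<kappa>))"
        using tails_markov_good[OF g order_refl, of "1 / L"] L by (simp add: \<kappa>_def Te_def powr_divide mult_ac)
      have P': "\<bar>P' - Q\<bar> \<le> e * Q"
        using elim(9) g x x1 unfolding P'_def Q_def L_def by auto
      have sm: "\<P>(\<omega> in M. y \<le> tsum (1 / L) w J \<omega>) \<le> exp (1 - y\<^sup>2 / 2)"
        if "J \<subseteq> I" "0 \<le> y" "y \<le> C * sqrt (ln (real n))" for J y
        using elim(9) g that unfolding L_def by blast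
      have dx: "d * x \<le> x" using d x1 by (simp add: mult_left_le_one_le)
      have q1: "\<P>(\<omega> in M. d * x \<le> tsum (1 / L) w (I - {i}) \<omega>) \<le> exp 1 * real n powr (- a)" for i
      proof -
        have "\<P>(\<omega> in M. d * x \<le> tsum (1 / L) w (I - {i}) \<omega>) \<le> exp (1 - (d * x)\<^sup>2 / 2)"
          using order_trans[OF dx x(2)] x1 d by (intro sm) auto
        also have "\<dots> \<le> exp (1 - a * L)"
        proof -
          have "(c0 * sqrt L)\<^sup>2 \<le> x\<^sup>2" using x c0 L by (intro power_mono) (auto simp: L_def)
          then have "d\<^sup>2 / 2 * (c0\<^sup>2 * L) \<le> d\<^sup>2 / 2 * x\<^sup>2" using L by (intro mult_left_mono) (auto simp: power_mult_distrib)
          then show ?thesis by (simp add: a_def power_mult_distrib)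
        qed
        also have "\<dots> = exp 1 * real n powr (- a)" using elim(8) by (simp add: powr_def L_def exp_diff exp_minus field_simps)
        finally show ?thesis .
      qed
      have "\<P>(\<omega> in M. x \<le> wsum w I \<omega>)
        \<le> P' + tails w I ((1 - d) * x) + Te * (exp 1 * real n powr (- a)) + Te\<^sup>2"
        unfolding P'_def Te_def using goodD[OF g] q1 by (intro big_jump_upper) auto
      moreover have "Te * (exp 1 * real n powr (- a)) \<le> e / 2 * T"
      proof -
        have "Te * (exp 1 * real n powr (- a)) \<le> D * C powr (t + 1) * (sqrt L * L) powr (t + 1) * T * (exp 1 * real n powr (- a))"
          using TeT by (intro mult_right_mono) auto
        also have "\<dots> = (D * C powr (t + 1) * exp 1 * ((sqrt L * L) powr (t + 1) * real n powr (- a))) * T" by simp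
        also have "\<dots> \<le> e / 2 * T" using elim(1) T0 by (intro mult_right_mono) (auto simp: L_def)
        finally show ?thesis .
      qed
      moreover have "Te\<^sup>2 \<le> e / 2 * T"
      proof -
        have "Te\<^sup>2 \<le> (D * C powr (t + 1) * (sqrt L * L) powr (t + 1) * T) * (mu / s2 * (L powr p * real n powr (- \<kappa>)))"
          unfolding power2_eq_square using TeT Te T0 by (intro mult_mono) auto
        also have "\<dots> = (D * C powr (t + 1) * (mu / s2) * ((sqrt L * L) powr (t + 1) * (L powr p * real n powr (- \<kappa>)))) * T" by simp
        also have "\<dots> \<le> e / 2 * T" using elim(2) T0 by (intro mult_right_mono) (auto simp: L_def)
        finally show ?thesis .
      qed
      ultimately have "\<P>(\<omega> in M. x \<le> wsum w I \<omega>) \<le> (1 + e) * Q + (1 + e) * T + e / 2 * T + e / 2 * T"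
        using reg P' by (simp add: algebra_simps)
      then have up: "\<P>(\<omega> in M. x \<le> wsum w I \<omega>) - (T + Q) \<le> e * Q + 2 * (e * T)" by (simp add: algebra_simps)
      have q2: "\<P>(\<omega> in M. x \<le> tsum (1 / L) w (I - {i}) \<omega>) \<le> exp (1 - x\<^sup>2 / 2)" for i
        using x x1 by (intro sm) auto
      have q3: "\<P>(\<omega> in M. tsum (1 / L) w (I - {i}) \<omega> < - d * x) \<le> 1 / (d * x)\<^sup>2 + Te" for i
        using prob_tsum_remove(2)[OF g, of "d * x" "1 / L" i] d x1 by (simp add: Te_def)
      have "P' - Te * exp (1 - x\<^sup>2 / 2) + tails w I ((1 + d) * x) * (1 - (1 / (d * x)\<^sup>2 + Te) - Te) \<le> \<P>(\<omega> in M. x \<le> wsum w I \<omega>)"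
        unfolding P'_def Te_def
      proof (rule big_jump_lower)
        have "1 / L \<le> 1" using L by simp
        moreover have "x < (1 + d) * x" using d x1 by (simp add: algebra_simps)
        ultimately show "1 / L < (1 + d) * x" using x1 by linarith
      qed (use goodD[OF g] q2 q3 in \<open>auto simp: Te_def\<close>)
      \<comment> \<open>This is the one error charged to the Gaussian term:
        \<open>exp (- x\<^sup>2 / 2)\<close> exceeds \<open>Q\<close> by a factor of order at most
        \<open>sqrt L\<close>, which \<open>Te\<close>, a power of \<open>n\<close> small,
        absorbs.\<close>
      moreover have "Te * exp (1 - x\<^sup>2 / 2) \<le> e * Q"
      proof -
        have "exp (1 - x\<^sup>2 / 2) = exp 1 * exp (- x\<^sup>2 / 2)" by (simp add: exp_add[symmetric])
        also have "\<dots> \<le> exp 1 * (K * (1 + x) * Q)"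
          using normal_tail_exp_ge[of x] x1 by (intro mult_left_mono) (auto simp: K_def Q_def)
        also have "\<dots> \<le> exp 1 * (K * (1 + C * sqrt L) * Q)"
          using x K0 Q0 by (intro mult_left_mono mult_right_mono) (auto simp: L_def)
        finally have "Te * exp (1 - x\<^sup>2 / 2) \<le> mu / s2 * (L powr p * real n powr (- \<kappa>)) * (exp 1 * (K * (1 + C * sqrt L) * Q))"
          using Te T0 by (intro mult_mono) auto
        also have "\<dots> = (mu / s2 * exp 1 * K * (L powr p * real n powr (- \<kappa>) + C * (sqrt L * (L powr p * real n powr (- \<kappa>))))) * Q"
          by (simp add: algebra_simps add_divide_distrib)
        also have "\<dots> \<le> e * Q" using elim(3) Q0 by (intro mult_right_mono) (auto simp: L_def)
        finally show ?thesis .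
      qed
      moreover have "(1 - e) * T * (1 - e) \<le> tails w I ((1 + d) * x) * (1 - (1 / (d * x)\<^sup>2 + Te) - Te)"
      proof (rule mult_mono)
        have "1 / (d * x)\<^sup>2 \<le> 1 / (d\<^sup>2 * c0\<^sup>2) * (1 / L)"
        proof -
          have "(d * (c0 * sqrt L))\<^sup>2 \<le> (d * x)\<^sup>2" using x c0 L d by (intro power_mono mult_left_mono) (auto simp: L_def)
          then have "1 / (d * x)\<^sup>2 \<le> 1 / (d * (c0 * sqrt L))\<^sup>2"
            using d c0 L x1 by (intro divide_left_mono mult_pos_pos) auto
          then show ?thesis using L by (simp add: power_mult_distrib)
        qed
        then show "1 - e \<le> 1 - (1 / (d * x)\<^sup>2 + Te) - Te"
          using Te elim(4) by (simp add: L_def)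
      qed (use reg e tails_nonneg in auto)
      moreover have "(1 - 2 * e) * T \<le> (1 - e) * T * (1 - e)"
        using T0 by (simp add: algebra_simps power2_eq_square)
      ultimately have "(1 - 2 * e) * T + (Q - 2 * (e * Q)) \<le> \<P>(\<omega> in M. x \<le> wsum w I \<omega>)"
        using P' by linarith
      then have lo: "(T + Q) - \<P>(\<omega> in M. x \<le> wsum w I \<omega>) \<le> 2 * (e * Q) + 2 * (e * T)" by (simp add: algebra_simps)
      have "0 \<le> e * Q" "0 \<le> e * T" using e Q0 T0 by auto
      then show "\<bar>\<P>(\<omega> in M. x \<le> wsum w I \<omega>) - (tails w I x + normal_tail x)\<bar> \<le> 3 * e * (tails w I x + normal_tail x)"
        unfolding T_def[symmetric] Q_def[symmetric] using up lo by (simp add: abs_le_iff algebra_simps)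
    qed
  qed
qed

section \<open>The large deviation range\<close>

text \<open>Chernoff with \<open>l = K * ln (n * x) / x\<close>: the linear part gives the power
  \<open>- K\<close> of \<open>n * x\<close>, and the hypothesis on \<open>x\<^sup>2\<close> lets
  the quadratic part give back at most half of it. The truncation constant keeps the remaining
  exponent bounded.\<close>

lemma truncated_large_range:
  assumes g: "good n I w" and n: "1 \<le> n" and x: "1 \<le> x"
    and K: "1 \<le> K" and Kx: "K * ln (real n * x) \<le> x\<^sup>2" and a: "a = (p - 2) / (8 * K)"
  shows "\<P>(\<omega> in M. x \<le> tsum (a * x) w I \<omega>)
     \<le> exp (K powr p * (32 / (p - 2)) powr p * mu / s2) * (real n * x) powr (- (K / 2))"
proof -
  define \<kappa> where "\<kappa> = (p - 2) / 4"
  have \<kappa>: "0 < \<kappa>" "\<kappa> \<le> 1 / 4" using p by (auto simp: \<kappa>_def)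
  define Z where "Z = real n * x"
  define l where "l = K * ln Z / x"
  have Z1: "1 \<le> Z" using mult_mono[of 1 "real n" 1 x] n x by (simp add: Z_def)
  have M0: "0 \<le> ln Z" using Z1 by simp
  have l0: "0 \<le> l" using M0 K x by (simp add: l_def)
  have a0: "0 < a" using p K by (simp add: a)
  have "\<P>(\<omega> in M. x \<le> tsum (a * x) w I \<omega>)
     \<le> exp (l\<^sup>2 / 2 * vsum w I + l powr p * exp (l * (a * x)) * mu * lyap w I - l * x)"
    using goodD[OF g] l0 a0 x by (intro tsum_chernoff) auto
  also have "\<dots> \<le> exp (K * ln Z / 2 + K powr p * (32 / (p - 2)) powr p * mu / s2 - K * ln Z)"
  proof -
    have lx: "l * x = K * ln Z" using x by (simp add: l_def)
    have "l\<^sup>2 = K * ln Z * (K * ln Z / x\<^sup>2)" by (simp add: l_def power2_eq_square)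
    also have "\<dots> \<le> K * ln Z * 1"
    proof (rule mult_left_mono)
      show "K * ln Z / x\<^sup>2 \<le> 1" using Kx x by (simp add: Z_def)
    qed (use K M0 in auto)
    finally have 1: "l\<^sup>2 / 2 \<le> K * ln Z / 2" by simp
    \<comment> \<open>The choice of \<open>a\<close> makes the truncation factor
      \<open>exp (l * (a * x))\<close> equal to \<open>Z powr (\<kappa> / 2)\<close>, half of what
      the Lyapunov sum can compensate in \<open>n\<close>.\<close>
    have "l * (a * x) = a * K * ln Z" using lx by (simp add: algebra_simps)
    also have "a * K = \<kappa> / 2" using K by (simp add: a \<kappa>_def)
    finally have 2: "exp (l * (a * x)) = Z powr (\<kappa> / 2)" using Z1 by (simp add: powr_def)
    \<comment> \<open>The logarithm takes the other half. The constant \<open>32 / (p - 2)\<close>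
      is \<open>8 / \<kappa>\<close>, from bounding \<open>ln Z\<close> by a power with exponent
      \<open>\<kappa> / 8\<close>; raised to \<open>p \<le> 3\<close> this stays below
      \<open>\<kappa> / 2\<close>.\<close>
    have 3: "ln Z powr p \<le> Z powr (\<kappa> / 2) * (32 / (p - 2)) powr p"
    proof -
      have "ln Z \<le> Z powr (\<kappa> / 8) / (\<kappa> / 8)" using \<kappa> Z1 by (intro ln_powr_bound) auto
      also have "\<dots> = Z powr (\<kappa> / 8) * (32 / (p - 2))" using p by (simp add: \<kappa>_def)
      finally have "ln Z powr p \<le> (Z powr (\<kappa> / 8) * (32 / (p - 2))) powr p" using M0 p by (intro powr_mono2) auto
      also have "\<dots> = Z powr (\<kappa> / 8 * p) * (32 / (p - 2)) powr p" by (simp only: powr_mult powr_powr)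
      also have "Z powr (\<kappa> / 8 * p) \<le> Z powr (\<kappa> / 2)"
      proof (rule powr_mono)
        have "\<kappa> / 8 * p \<le> \<kappa> / 8 * 4" using p \<kappa> by (intro mult_left_mono) auto
        then show "\<kappa> / 8 * p \<le> \<kappa> / 2" by simp
      qed (rule Z1)
      finally show ?thesis by (simp add: mult_right_mono)
    qed
    have xp: "x powr \<kappa> \<le> x powr p" using x \<kappa> p by (intro powr_mono) auto
    have "l powr p * exp (l * (a * x)) * mu * lyap w I
      \<le> (K powr p * (Z powr (\<kappa> / 2) * (32 / (p - 2)) powr p) / x powr p) * Z powr (\<kappa> / 2) * mu * (real n powr (- \<kappa>) / s2)"
    proof (intro mult_mono)
      have "l powr p = K powr p * ln Z powr p / x powr p" using K M0 x by (simp add: l_def powr_mult powr_divide)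
      also have "\<dots> \<le> K powr p * (Z powr (\<kappa> / 2) * (32 / (p - 2)) powr p) / x powr p"
        using 3 by (intro divide_right_mono mult_left_mono) auto
      finally show "l powr p \<le> K powr p * (Z powr (\<kappa> / 2) * (32 / (p - 2)) powr p) / x powr p" .
      show "lyap w I \<le> real n powr (- \<kappa>) / s2" using good_lyap[OF g order_refl] by (simp add: \<kappa>_def)
    qed (use 2 mu_nonneg lyap_nonneg in auto)
    also have "\<dots> = (K powr p * (32 / (p - 2)) powr p * mu / s2) * (Z powr (\<kappa> / 2) * Z powr (\<kappa> / 2) * real n powr (- \<kappa>) / x powr p)"
      by (simp add: mult_ac)
    also have "Z powr (\<kappa> / 2) * Z powr (\<kappa> / 2) * real n powr (- \<kappa>) / x powr p = x powr \<kappa> / x powr p"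
    proof -
      have "Z powr (\<kappa> / 2) * Z powr (\<kappa> / 2) = Z powr \<kappa>" by (simp flip: powr_add)
      also have "\<dots> = real n powr \<kappa> * x powr \<kappa>" by (simp only: Z_def powr_mult)
      finally show ?thesis using n by (simp add: powr_minus field_simps)
    qed
    also have "(K powr p * (32 / (p - 2)) powr p * mu / s2) * (x powr \<kappa> / x powr p) \<le> (K powr p * (32 / (p - 2)) powr p * mu / s2) * 1"
      using xp x mu_nonneg s2_pos by (intro mult_left_mono) auto
    finally show ?thesis using 1 goodD(4)[OF g] lx by simp
  qed
  also have "\<dots> = exp (K powr p * (32 / (p - 2)) powr p * mu / s2) * exp (- (K / 2) * ln Z)"
    by (simp add: algebra_simps flip: exp_add)
  also have "exp (- (K / 2) * ln Z) = Z powr (- (K / 2))" using Z1 by (simp add: powr_def)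
  finally show ?thesis by (simp add: Z_def)
qed

text \<open>Chernoff at truncation level \<open>a * x\<close> and the normal tail are both of order
  at most \<open>(n * x) powr (- (t + 2))\<close>, so they are negligible against the tail sum.
  Level \<open>a * x\<close> differs from \<open>x\<close> by a constant factor, hence Potter costs
  a constant, and Chebyshev is enough for the remaining sums.\<close>

lemma large_range:
  "\<exists>C>0. \<forall>e. 0 < e \<longrightarrow> e \<le> 1 \<longrightarrow> (\<forall>\<^sub>F n in sequentially. \<forall>I w x. good n I w \<longrightarrow> C * sqrt (ln (real n)) \<le> x \<longrightarrow>
     \<bar>\<P>(\<omega> in M. x \<le> wsum w I \<omega>) - (tails w I x + normal_tail x)\<bar> \<le> 4 * e * (tails w I x + normal_tail x))"
proof -
  define \<kappa> where "\<kappa> = (p - 2) / 4"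
  have \<kappa>: "0 < \<kappa>" "\<kappa> \<le> 1 / 4" using p by (auto simp: \<kappa>_def)
  \<comment> \<open>\<open>K / 2 = t + 2\<close> is one more than the exponent in the lower bound
    for the tail sum; the surplus power is at most \<open>1 / n\<close>.\<close>
  define K where "K = 2 * (t + 2)"
  have K: "8 \<le> K" using t by (simp add: K_def)
  \<comment> \<open>With \<open>C\<^sup>2 = 2 * K\<close> the part \<open>K * ln n\<close> of
    \<open>K * ln (n * x)\<close> uses up half of \<open>x\<^sup>2\<close>; the other half covers
    \<open>K * ln x\<close>, as \<open>x \<ge> 2 * K\<close> eventually.\<close>
  define C where "C = sqrt (2 * K)"
  have C: "0 < C" "C\<^sup>2 = 2 * K" using K by (auto simp: C_def)
  define a where "a = (p - 2) / (8 * K)"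
  have a: "0 < a" "a \<le> 1"
  proof -
    show "0 < a" using p K by (simp add: a_def)
    have "p - 2 \<le> 8 * K" using p K by simp
    then show "a \<le> 1" using K by (simp add: a_def)
  qed
  define C1 where "C1 = K powr p * (32 / (p - 2)) powr p * mu / s2"
  have C1: "0 \<le> C1" using mu_nonneg s2_pos by (simp add: C1_def)
  obtain u0 D where D: "0 < u0" "0 < D" "\<And>I w y k. (\<forall>i\<in>I. 0 < w i \<and> u0 \<le> y / w i) \<Longrightarrow> 1 \<le> k \<Longrightarrow>
     tails w I y \<le> D * k powr (t + 1) * tails w I (k * y)" using tails_potter by metis
  obtain c u2 where c: "0 < c" "0 < u2" "\<And>n I w x. good n I w \<Longrightarrow> 1 \<le> n \<Longrightarrow> 1 \<le> x \<Longrightarrow> u2 \<le> real n powr (3 / 4) \<Longrightarrow>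
     c * (real n * x) powr (- (t + 1)) \<le> tails w I x" using tails_lower_good by metis
  have "\<forall>\<^sub>F n in sequentially. \<forall>I w x. good n I w \<longrightarrow> C * sqrt (ln (real n)) \<le> x \<longrightarrow>
     \<bar>\<P>(\<omega> in M. x \<le> wsum w I \<omega>) - (tails w I x + normal_tail x)\<bar> \<le> 4 * e * (tails w I x + normal_tail x)"
    if e: "0 < e" "e \<le> 1" for e
  proof -
    obtain d u1 where d: "0 < d" "d < 1" "0 < u1" "\<And>I w y. (\<forall>i\<in>I. 0 < w i \<and> u1 \<le> y / w i) \<Longrightarrow>
       tails w I ((1 - d) * y) \<le> (1 + e) * tails w I y \<and> (1 - e) * tails w I y \<le> tails w I ((1 + d) * y)"
      using tails_regular[OF e(1)] by metis
    define r where "r n = 1 / (d\<^sup>2 * C\<^sup>2) * (1 / ln (real n)) + 2 * (mu / s2 / a powr p) * real n powr (- \<kappa>)" for n :: nat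
    have l1: "(\<lambda>n::nat. 1 / ln (real n)) \<longlonglongrightarrow> 0" by real_asymp
    have l2: "(\<lambda>n::nat. real n powr (- \<kappa>)) \<longlonglongrightarrow> 0" using \<kappa> by real_asymp
    have l3: "(\<lambda>n::nat. 1 / real n) \<longlonglongrightarrow> 0" by real_asymp
    have "r \<longlonglongrightarrow> 1 / (d\<^sup>2 * C\<^sup>2) * 0 + 2 * (mu / s2 / a powr p) * 0" unfolding r_def by (intro tendsto_intros l1 l2)
    then have rl: "r \<longlonglongrightarrow> 0" by simp
    have e1: "\<forall>\<^sub>F n in sequentially. r n < e" using rl e by (intro order_tendstoD(2)) auto
    have "(\<lambda>n. D * (1 / a) powr (t + 1) * r n) \<longlonglongrightarrow> D * (1 / a) powr (t + 1) * 0" by (intro tendsto_intros rl)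
    then have e2: "\<forall>\<^sub>F n in sequentially. D * (1 / a) powr (t + 1) * r n < e" using e by (intro order_tendstoD(2)) auto
    have "(\<lambda>n::nat. exp C1 / c * (1 / real n)) \<longlonglongrightarrow> exp C1 / c * 0" by (intro tendsto_intros l3)
    then have e3: "\<forall>\<^sub>F n in sequentially. exp C1 / c * (1 / real n) < e" using e by (intro order_tendstoD(2)) auto
    have "filterlim (\<lambda>n::nat. real n powr (1 / 4)) at_top sequentially" by real_asymp
    then have e4: "\<forall>\<^sub>F n in sequentially. max u0 u1 / a \<le> real n powr (1 / 4)" unfolding filterlim_at_top by blast
    have "filterlim (\<lambda>n::nat. sqrt (ln (real n))) at_top sequentially" by real_asymp
    then have e5: "\<forall>\<^sub>F n in sequentially. 2 * K / C \<le> sqrt (ln (real n))" unfolding filterlim_at_top by blast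
    have "filterlim (\<lambda>n::nat. real n powr (3 / 4)) at_top sequentially" by real_asymp
    then have e6: "\<forall>\<^sub>F n in sequentially. u2 \<le> real n powr (3 / 4)" unfolding filterlim_at_top by blast
    have e7: "\<forall>\<^sub>F n in sequentially. 1 \<le> ln (real n)" by real_asymp
    have e8: "\<forall>\<^sub>F n in sequentially. (1::nat) \<le> n" by (rule eventually_ge_at_top)
    from e1 e2 e3 e4 e5 e6 e7 e8 show ?thesis
    proof eventually_elim
      case (elim n)
      define L where "L = ln (real n)"
      have L: "1 \<le> L" using elim by (simp add: L_def)
      show ?case
      proof (intro allI impI)
        fix I w x assume g: "good n I w" and x: "C * sqrt (ln (real n)) \<le> x"
        define T where "T = tails w I x"
        define Te where "Te = tails w I (a * x)"
        define Q where "Q = normal_tail x"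
        define P' where "P' = \<P>(\<omega> in M. x \<le> tsum (a * x) w I \<omega>)"
        define Z where "Z = real n * x"
        have T0: "0 \<le> T" "0 \<le> Te" by (auto simp: T_def Te_def tails_nonneg)
        have Q0: "0 \<le> Q" by (simp add: Q_def normal_tail_nonneg)
        have xK: "2 * K \<le> x"
        proof -
          have "2 * K = C * (2 * K / C)" using C by simp
          also have "\<dots> \<le> C * sqrt (ln (real n))" using elim(5) C by (intro mult_left_mono) auto
          finally show ?thesis using x by simp
        qed
        have x1: "1 \<le> x" using xK K by simp
        have n0: "0 < n" using elim(8) by simp
        have Z1: "1 \<le> Z" "real n \<le> Z" using mult_mono[of 1 "real n" 1 x] mult_left_mono[of 1 x "real n"] elim(8) x1 by (auto simp: Z_def)
        have KZ: "K * ln Z \<le> x\<^sup>2"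
        proof -
          have "(C * sqrt L)\<^sup>2 \<le> x\<^sup>2" using x C L by (intro power_mono) (auto simp: L_def)
          then have 1: "2 * K * L \<le> x\<^sup>2" using L C by (simp add: power_mult_distrib)
          have "ln x \<le> x" using x1 ln_le_minus_one[of x] by simp
          then have "K * ln x \<le> K * x" using K by (intro mult_left_mono) auto
          moreover have "2 * K * x \<le> x * x" using xK x1 by (intro mult_right_mono) auto
          moreover have "ln Z = L + ln x" using n0 x1 by (simp add: Z_def L_def ln_mult)
          ultimately show ?thesis using 1 by (simp add: power2_eq_square algebra_simps)
        qed
        have scale: "0 < w i \<and> max u0 u1 \<le> a * x / w i \<and> max u0 u1 \<le> x / w i" if "i \<in> I" for i
        proof -
          have "1 * a \<le> x * a" using x1 a by (intro mult_right_mono) auto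
          then have ax: "a \<le> a * x" by (simp add: mult.commute)
          have "max u0 u1 = a * (max u0 u1 / a)" using a by simp
          also have "\<dots> \<le> a * real n powr (1 / 4)" using elim(4) a by (intro mult_left_mono) auto
          also have "\<dots> \<le> a * x * real n powr (1 / 4)" using ax by (intro mult_right_mono) auto
          also have "\<dots> \<le> a * x / w i" using a x1 by (intro good_scale[OF g that n0]) auto
          finally have 1: "max u0 u1 \<le> a * x / w i" .
          moreover have "a * x / w i \<le> x / w i"
            using goodD(2)[OF g that] x1 a by (intro divide_right_mono) (auto simp: mult_left_le_one_le)
          ultimately show ?thesis using goodD(2)[OF g that] by simp
        qed
        have reg: "tails w I ((1 - d) * x) \<le> (1 + e) * T" "(1 - e) * T \<le> tails w I ((1 + d) * x)"
          using d(4)[of I w x] scale by (auto simp: T_def)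
        have TeT: "Te \<le> D * (1 / a) powr (t + 1) * T"
        proof -
          have "Te \<le> D * (1 / a) powr (t + 1) * tails w I (1 / a * (a * x))"
            unfolding Te_def using scale a by (intro D(3)) auto
          then show ?thesis using a by (simp add: T_def)
        qed
        have Te: "Te \<le> mu / s2 / a powr p * real n powr (- \<kappa>)"
        proof -
          have "Te \<le> mu / s2 * real n powr (- \<kappa>) / (a * x) powr p"
            unfolding Te_def \<kappa>_def using a x1 by (intro tails_markov_good[OF g order_refl]) auto
          also have "\<dots> \<le> mu / s2 * real n powr (- \<kappa>) / a powr p"
          proof (rule divide_left_mono)
            have "1 * a \<le> x * a" using x1 a by (intro mult_right_mono) auto
            then show "a powr p \<le> (a * x) powr p" using a p by (intro powr_mono2) (auto simp: mult.commute)
          qed (use a x1 mu_nonneg s2_pos in auto)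
          finally show ?thesis by simp
        qed
        have x2: "1 / (d * x)\<^sup>2 \<le> 1 / (d\<^sup>2 * C\<^sup>2) * (1 / L)"
        proof -
          have "(d * (C * sqrt L))\<^sup>2 \<le> (d * x)\<^sup>2" using x C L d by (intro power_mono mult_left_mono) (auto simp: L_def)
          then have "1 / (d * x)\<^sup>2 \<le> 1 / (d * (C * sqrt L))\<^sup>2"
            using d C L x1 by (intro divide_left_mono mult_pos_pos) auto
          then show ?thesis using L by (simp add: power_mult_distrib)
        qed
        have x3: "1 / x\<^sup>2 \<le> 1 / (d * x)\<^sup>2"
        proof -
          have "(d * x)\<^sup>2 \<le> x\<^sup>2" using d x1 by (intro power_mono) (auto simp: mult_left_le_one_le)
          then show ?thesis using d x1 by (intro divide_left_mono mult_pos_pos) auto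
        qed
        have qr: "1 / (d * x)\<^sup>2 + Te + Te \<le> r n" using x2 Te by (simp add: r_def L_def)
        \<comment> \<open>Applied twice: with \<open>s = exp C1\<close> for the truncated sum and
          with \<open>s = 1\<close> for the normal tail.\<close>
        have low: "s * Z powr (- (t + 2)) \<le> e * T" if s: "s \<le> exp C1" "0 \<le> s" for s
        proof -
          have cT: "c * Z powr (- (t + 1)) \<le> T" unfolding T_def Z_def using x1 elim by (intro c(3)[OF g]) auto
          have "- (t + 2) = - (t + 1) + - 1" by simp
          then have "Z powr (- (t + 2)) = Z powr (- (t + 1)) * Z powr (- 1)"
            by (simp only: powr_add)
          also have "Z powr (- 1) = 1 / Z" using Z1 by (simp add: powr_minus divide_inverse)
          also have "Z powr (- (t + 1)) * (1 / Z) \<le> (T / c) * (1 / real n)"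
          proof (intro mult_mono)
            show "Z powr (- (t + 1)) \<le> T / c" using cT c(1) by (simp add: field_simps)
            show "1 / Z \<le> 1 / real n" using Z1 n0 by (intro divide_left_mono) auto
          qed (use T0 c Z1 in auto)
          finally have "s * Z powr (- (t + 2)) \<le> exp C1 * ((T / c) * (1 / real n))" using s by (intro mult_mono) auto
          also have "\<dots> = (exp C1 / c * (1 / real n)) * T" by simp
          also have "\<dots> \<le> e * T" using elim(3) T0 by (intro mult_right_mono) auto
          finally show ?thesis .
        qed
        have P': "P' \<le> e * T"
        proof -
          have "P' \<le> exp (K powr p * (32 / (p - 2)) powr p * mu / s2) * (real n * x) powr (- (K / 2))"
            unfolding P'_def using K KZ by (intro truncated_large_range[OF g elim(8) x1 _ _ a_def]) (auto simp: Z_def)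
          moreover have "K / 2 = t + 2" by (simp add: K_def)
          ultimately have "P' \<le> exp C1 * Z powr (- (t + 2))" by (simp only: C1_def Z_def)
          then show ?thesis using low[of "exp C1"] by simp
        qed
        have Q: "Q \<le> e * T"
        proof -
          have "Q \<le> exp (- x\<^sup>2 / 2)" unfolding Q_def using x1 by (intro normal_tail_le_exp) auto
          also have "\<dots> \<le> exp (- (t + 2) * ln Z)" using KZ by (simp add: K_def algebra_simps)
          also have "\<dots> = 1 * Z powr (- (t + 2))" using Z1 by (simp add: powr_def)
          also have "\<dots> \<le> e * T" using C1 by (intro low) auto
          finally show ?thesis .
        qed
        have q: "\<P>(\<omega> in M. d * x \<le> tsum (a * x) w (I - {i}) \<omega>) \<le> 1 / (d * x)\<^sup>2 + Te"
          "\<P>(\<omega> in M. x \<le> tsum (a * x) w (I - {i}) \<omega>) \<le> 1 / (d * x)\<^sup>2 + Te"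
          "\<P>(\<omega> in M. tsum (a * x) w (I - {i}) \<omega> < - d * x) \<le> 1 / (d * x)\<^sup>2 + Te" for i
          using prob_tsum_remove[OF g, of "d * x" "a * x" i] prob_tsum_remove(1)[OF g, of x "a * x" i] d x1 x3
          by (auto simp: Te_def)
        have TeD: "Te * (1 / (d * x)\<^sup>2 + Te + Te) \<le> e * T"
        proof -
          have "Te * (1 / (d * x)\<^sup>2 + Te + Te) \<le> (D * (1 / a) powr (t + 1) * T) * r n"
            using TeT qr T0 by (intro mult_mono) auto
          also have "\<dots> = (D * (1 / a) powr (t + 1) * r n) * T" by simp
          also have "\<dots> \<le> e * T" using elim(2) T0 by (intro mult_right_mono) auto
          finally show ?thesis .
        qed
        have "\<P>(\<omega> in M. x \<le> wsum w I \<omega>)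
          \<le> P' + tails w I ((1 - d) * x) + Te * (1 / (d * x)\<^sup>2 + Te) + Te\<^sup>2"
          unfolding P'_def Te_def using goodD[OF g] q(1) by (intro big_jump_upper) (auto simp: Te_def)
        also have "\<dots> = P' + tails w I ((1 - d) * x) + Te * (1 / (d * x)\<^sup>2 + Te + Te)"
          by (simp add: algebra_simps power2_eq_square)
        finally have up: "\<P>(\<omega> in M. x \<le> wsum w I \<omega>) \<le> T + 3 * (e * T)"
          using P' reg(1) TeD by (simp add: algebra_simps)
        have "P' - Te * (1 / (d * x)\<^sup>2 + Te) + tails w I ((1 + d) * x) * (1 - (1 / (d * x)\<^sup>2 + Te) - Te) \<le> \<P>(\<omega> in M. x \<le> wsum w I \<omega>)"
          unfolding P'_def Te_def
        proof (rule big_jump_lower)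
          have "a * x \<le> 1 * x" using a x1 by (intro mult_right_mono) auto
          moreover have "x < (1 + d) * x" using d x1 by (simp add: algebra_simps)
          ultimately show "a * x < (1 + d) * x" by linarith
        qed (use goodD[OF g] q in \<open>auto simp: Te_def\<close>)
        moreover have "0 \<le> P'" by (simp add: P'_def)
        moreover have "Te * (1 / (d * x)\<^sup>2 + Te) \<le> Te * (1 / (d * x)\<^sup>2 + Te + Te)" using T0 by (intro mult_left_mono) auto
        moreover have "(1 - e) * T * (1 - e) \<le> tails w I ((1 + d) * x) * (1 - (1 / (d * x)\<^sup>2 + Te) - Te)"
          using reg e tails_nonneg qr elim(1) by (intro mult_mono) auto
        moreover have "T - 2 * (e * T) \<le> (1 - e) * T * (1 - e)"
          using T0 by (simp add: algebra_simps power2_eq_square)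
        ultimately have lo: "T - 3 * (e * T) \<le> \<P>(\<omega> in M. x \<le> wsum w I \<omega>)"
          using TeD by linarith
        have "0 \<le> e * Q" using e Q0 by auto
        moreover have "0 \<le> e * T" using e T0 by auto
        moreover have "4 * e * (T + Q) = 4 * (e * T) + 4 * (e * Q)" by (simp add: algebra_simps)
        ultimately have "\<bar>\<P>(\<omega> in M. x \<le> wsum w I \<omega>) - (T + Q)\<bar> \<le> 4 * e * (T + Q)"
          using up lo Q Q0 by linarith
        then show "\<bar>\<P>(\<omega> in M. x \<le> wsum w I \<omega>) - (tails w I x + normal_tail x)\<bar> \<le> 4 * e * (tails w I x + normal_tail x)"
          by (simp only: T_def Q_def)
      qed
    qed
  qed
  then show ?thesis using C(1) by blast
qed

lemma jump_range:
  assumes c: "0 < c" and e: "0 < e"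
  shows "\<forall>\<^sub>F n in sequentially. \<forall>I w x. good n I w \<longrightarrow> c * sqrt (ln (real n)) \<le> x \<longrightarrow>
       \<bar>\<P>(\<omega> in M. x \<le> wsum w I \<omega>) - (tails w I x + normal_tail x)\<bar> \<le> e * (tails w I x + normal_tail x)"
proof -
  obtain C where C: "0 < C" "\<And>e. 0 < e \<Longrightarrow> e \<le> 1 \<Longrightarrow> \<forall>\<^sub>F n in sequentially. \<forall>I w x. good n I w \<longrightarrow> C * sqrt (ln (real n)) \<le> x \<longrightarrow>
     \<bar>\<P>(\<omega> in M. x \<le> wsum w I \<omega>) - (tails w I x + normal_tail x)\<bar> \<le> 4 * e * (tails w I x + normal_tail x)"
    using large_range by blast
  define e' where "e' = min 1 (e / 4)"
  have e': "0 < e'" "e' \<le> 1" "4 * e' \<le> e" using e by (auto simp: e'_def)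
  from C(2)[OF e'(1,2)] intermediate_range[OF c C(1) e'(1,2)] show ?thesis
  proof eventually_elim
    case (elim n)
    show ?case
    proof (intro allI impI)
      fix I w x assume g: "good n I w" and x: "c * sqrt (ln (real n)) \<le> x"
      define S where "S = tails w I x + normal_tail x"
      have S: "0 \<le> S" by (simp add: S_def tails_nonneg normal_tail_nonneg)
      have "\<bar>\<P>(\<omega> in M. x \<le> wsum w I \<omega>) - S\<bar> \<le> 4 * e' * S"
      proof (cases "x \<le> C * sqrt (ln (real n))")
        case True
        then have "\<bar>\<P>(\<omega> in M. x \<le> wsum w I \<omega>) - S\<bar> \<le> 3 * e' * S" using elim(2) g x unfolding S_def by blast
        also have "\<dots> \<le> 4 * e' * S" using e' S by (intro mult_right_mono) auto
        finally show ?thesis .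
      next
        case False
        then show ?thesis using elim(1) g unfolding S_def by simp
      qed
      also have "\<dots> \<le> e * S" using e' S by (intro mult_right_mono) auto
      finally show "\<bar>\<P>(\<omega> in M. x \<le> wsum w I \<omega>) - (tails w I x + normal_tail x)\<bar> \<le> e * (tails w I x + normal_tail x)"
        unfolding S_def .
    qed
  qed
qed

end

section \<open>The weights of the partial sums\<close>

locale regular_linear_process = heavy_tailed +
  fixes r :: real and l :: "real \<Rightarrow> real" and a :: "int \<Rightarrow> real"
  assumes r: "1 / 2 < r" "r < 1"
    and l_slow: "slowly_varying l" and l_pos: "\<forall>x>0. 0 < l x"
    and a_nonneg: "\<forall>i\<ge>0. a i = l (of_int i + 1) * (1 + of_int i) powr (- r)"
    and a_neg: "\<forall>i<0. a i = 0"
begin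

abbreviation b :: "nat \<Rightarrow> int \<Rightarrow> real" where "b \<equiv> weight a"

lemma a_ge_0: "0 \<le> a i"
  using a_nonneg a_neg l_pos by (cases "0 \<le> i") (auto intro!: mult_nonneg_nonneg less_imp_le)

text \<open>The exponent actually used is \<open>min e (r / 2)\<close>: it keeps \<open>r\<close>
  minus the exponent positive, which gives the uniform bound \<open>C\<close>, and the stated power
  bounds follow by weakening.\<close>

lemma a_bounds:
  assumes e: "0 < e"
  obtains C where "0 < C" "\<And>i. a i \<le> C" "\<And>i. 0 \<le> i \<Longrightarrow> a i \<le> C * (1 + of_int i) powr (- (r - e))"
    "\<And>i. 0 \<le> i \<Longrightarrow> (1 + of_int i) powr (- (r + e)) / C \<le> a i"
proof -
  have "0 < min e (r / 2)" using e r by simp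
  from slowly_varying_nat_bounds[OF l_slow l_pos this] obtain C where
    C: "0 < C" "\<And>m::nat. 1 \<le> m \<Longrightarrow> l (real m) \<le> C * real m powr (min e (r / 2)) \<and> real m powr (- min e (r / 2)) / C \<le> l (real m)" by blast
  have ab: "a i \<le> C * (1 + of_int i) powr (- (r - min e (r / 2))) \<and> (1 + of_int i) powr (- (r + min e (r / 2))) / C \<le> a i"
    if i: "0 \<le> i" for i
  proof -
    define m where "m = nat (i + 1)"
    have m: "1 \<le> m" "real m = 1 + of_int i" using i by (auto simp: m_def)
    have ai: "a i = l (real m) * real m powr (- r)" using a_nonneg i m by (simp add: add.commute)
    have "l (real m) * real m powr (- r) \<le> C * real m powr (min e (r / 2)) * real m powr (- r)"
      using C(2)[OF m(1)] by (intro mult_right_mono) auto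
    also have "\<dots> = C * real m powr (- (r - min e (r / 2)))"
      unfolding mult.assoc powr_add[symmetric] by (simp add: algebra_simps)
    finally have 1: "a i \<le> C * real m powr (- (r - min e (r / 2)))" unfolding ai .
    have "real m powr (- min e (r / 2)) / C * real m powr (- r) \<le> l (real m) * real m powr (- r)"
      using C(2)[OF m(1)] by (intro mult_right_mono) auto
    moreover have "real m powr (- min e (r / 2)) / C * real m powr (- r) = real m powr (- (r + min e (r / 2))) / C"
      unfolding times_divide_eq_left powr_add[symmetric] by (simp add: algebra_simps)
    ultimately have 2: "real m powr (- (r + min e (r / 2))) / C \<le> a i" unfolding ai by linarith
    show ?thesis using 1 2 unfolding m(2) by blast
  qed
  show thesis
  proof (rule that[OF C(1)])
    fix i :: int assume i: "0 \<le> i"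
    have "(1 + of_int i) powr (- (r - min e (r / 2))) \<le> (1 + real_of_int i) powr (- (r - e))"
      using i by (intro powr_mono) auto
    then have "C * (1 + of_int i) powr (- (r - min e (r / 2))) \<le> C * (1 + real_of_int i) powr (- (r - e))"
      using C(1) by (intro mult_left_mono) auto
    then show "a i \<le> C * (1 + of_int i) powr (- (r - e))" using ab[OF i] by linarith
    have "(1 + real_of_int i) powr (- (r + e)) \<le> (1 + of_int i) powr (- (r + min e (r / 2)))"
      using i by (intro powr_mono) auto
    then have "(1 + real_of_int i) powr (- (r + e)) / C \<le> (1 + of_int i) powr (- (r + min e (r / 2))) / C"
      using C(1) by (intro divide_right_mono) auto
    then show "(1 + of_int i) powr (- (r + e)) / C \<le> a i" using ab[OF i] by linarith
  next
    fix i :: int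
    show "a i \<le> C"
    proof (cases "0 \<le> i")
      case True
      have "(1 + real_of_int i) powr (- (r - min e (r / 2))) \<le> (1 + real_of_int i) powr 0"
        using True r by (intro powr_mono) auto
      then have "C * (1 + of_int i) powr (- (r - min e (r / 2))) \<le> C * 1"
        using C(1) True by (intro mult_left_mono) auto
      then show ?thesis using ab[OF True] by linarith
    next
      case False then show ?thesis using a_neg C(1) by auto
    qed
  qed
qed

lemma weight_nonneg: "0 \<le> b n i"
  unfolding weight_def by (intro sum_nonneg a_ge_0)

lemma weight_pos:
  assumes "1 \<le> n" "i \<le> int n" shows "0 < b n i"
  unfolding weight_def
proof (rule sum_pos2)
  show "int n \<in> {1..int n}" using assms by auto
  have "0 < l (of_int (int n - i) + 1) * (1 + of_int (int n - i)) powr (- r)"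
    using assms l_pos by (intro mult_pos_pos) auto
  then show "0 < a (int n - i)" using a_nonneg assms by simp
qed (auto simp: a_ge_0)

text \<open>Comparing with the convergent series of exponent \<open>1 + e\<close> costs only a factor \<open>n powr e\<close>.\<close>

lemma power_sum_bound:
  assumes e: "0 < e"
  obtains Z :: real where "0 < Z" "\<And>A :: nat set. finite A \<Longrightarrow> (\<Sum>k\<in>A. real k powr (- (1 + e))) \<le> Z"
proof -
  have s: "summable (\<lambda>k. real k powr (- (1 + e)))" using e by (subst summable_real_powr_iff) auto
  have "(\<Sum>k\<in>A. real k powr (- (1 + e))) \<le> suminf (\<lambda>k. real k powr (- (1 + e))) + 1" if "finite A" for A
    using sum_le_suminf[OF s that] by simp
  moreover have "0 < suminf (\<lambda>k. real k powr (- (1 + e))) + 1"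
    using suminf_nonneg[OF s] by simp
  ultimately show thesis by (rule that[rotated])
qed

text \<open>For an arbitrary position \<open>i\<close> the window is relabelled by natural numbers
  up to \<open>n\<close>, and the summable exponent \<open>1 + e\<close> is split off. Far to the
  left all \<open>n\<close> coefficients are comparable to the one at distance \<open>- i\<close>,
  which gives the second bound.\<close>

lemma weight_upper:
  assumes e: "0 < e" "r + e < 1"
  obtains C where "0 < C" "\<And>n i. 1 \<le> n \<Longrightarrow> b n i \<le> C * real n powr (1 - r + 2 * e)"
    "\<And>n i. 1 \<le> n \<Longrightarrow> i < 0 \<Longrightarrow> b n i \<le> C * real n * (- of_int i) powr (- (r - e))"
proof -
  obtain C where C: "0 < C" "\<And>i. 0 \<le> i \<Longrightarrow> a i \<le> C * (1 + of_int i) powr (- (r - e))" using a_bounds[OF e(1)] by metis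
  obtain Z where Z: "0 < Z" "\<And>A :: nat set. finite A \<Longrightarrow> (\<Sum>k\<in>A. real k powr (- (1 + e))) \<le> Z"
    using power_sum_bound[OF e(1)] by metis
  have re: "0 \<le> 1 - r + 2 * e" using e r by simp
  show thesis
  proof (rule that[of "max C (C * Z)"])
    show "0 < max C (C * Z)" using C by simp
  next
    fix n :: nat and i :: int assume n: "1 \<le> n"
    \<comment> \<open>An injective label with \<open>1 \<le> m k\<close>, \<open>m k \<le> n\<close>
      and \<open>m k \<le> 1 + (k - i)\<close>. For \<open>i \<ge> 1\<close> the distance plus one
      already stays within \<open>n\<close>; otherwise \<open>k\<close> itself does and is no larger
      than that distance plus one.\<close>
    define m where "m k = (if 1 \<le> i then nat (k - i + 1) else nat k)" for k :: int
    define A where "A = {k\<in>{1..int n}. 0 \<le> k - i}"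
    have fin: "finite A" unfolding A_def by (rule finite_subset[of _ "{1..int n}"]) auto
    have inj: "inj_on m A" by (auto simp: inj_on_def m_def A_def)
    have "i \<le> k" if "a (k - i) \<noteq> 0" for k using a_neg that by (cases "k - i < 0") auto
    then have "b n i = (\<Sum>k\<in>A. a (k - i))"
      unfolding weight_def A_def by (intro sum.mono_neutral_cong_right) auto
    also have "\<dots> \<le> (\<Sum>k\<in>A. C * real n powr (1 - r + 2 * e) * real (m k) powr (- (1 + e)))"
    proof (rule sum_mono)
      fix k assume k: "k \<in> A"
      show "a (k - i) \<le> C * real n powr (1 - r + 2 * e) * real (m k) powr (- (1 + e))"
      proof (cases "m k \<le> n \<and> real (m k) \<le> 1 + of_int (k - i) \<and> 1 \<le> m k")
        case True
        have "a (k - i) \<le> C * (1 + of_int (k - i)) powr (- (r - e))" using k by (intro C(2)) (auto simp: A_def)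
        also have "\<dots> \<le> C * real (m k) powr (- (r - e))"
        proof (intro mult_left_mono)
          show "(1 + of_int (k - i)) powr (- (r - e)) \<le> real (m k) powr (- (r - e))"
          proof (cases "e \<le> r")
            case t: True
            then show ?thesis using True by (intro powr_mono2') auto
          next
            case False
            then show ?thesis using e r by simp
          qed
        qed (use C in auto)
        \<comment> \<open>The first exponent is nonnegative and is paid with
          \<open>m k \<le> n\<close>; the second one is summable over distinct labels.\<close>
        also have "real (m k) powr (- (r - e)) = real (m k) powr (1 - r + 2 * e) * real (m k) powr (- (1 + e))"
          unfolding powr_add[symmetric] by (simp add: algebra_simps)
        also have "\<dots> \<le> real n powr (1 - r + 2 * e) * real (m k) powr (- (1 + e))"
          using True re by (intro mult_right_mono powr_mono2) auto
        finally show ?thesis using C by (simp add: mult.assoc)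
      qed (use k n in \<open>auto simp: m_def A_def split: if_splits\<close>)
    qed
    also have "\<dots> = C * real n powr (1 - r + 2 * e) * (\<Sum>j\<in>m ` A. real j powr (- (1 + e)))"
      using inj by (simp add: sum.reindex sum_distrib_left)
    also have "\<dots> \<le> C * real n powr (1 - r + 2 * e) * Z"
      using fin C by (intro mult_left_mono Z) auto
    also have "\<dots> = C * Z * real n powr (1 - r + 2 * e)" by simp
    also have "\<dots> \<le> max C (C * Z) * real n powr (1 - r + 2 * e)" by (intro mult_right_mono) auto
    finally show "b n i \<le> max C (C * Z) * real n powr (1 - r + 2 * e)" .
  next
    fix n :: nat and i :: int assume n: "1 \<le> n" and i: "i < 0"
    have er: "e \<le> r" using e r by simp
    have "b n i \<le> (\<Sum>k\<in>{1..int n}. C * (- of_int i) powr (- (r - e)))"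
      unfolding weight_def
    proof (rule sum_mono)
      fix k assume k: "k \<in> {1..int n}"
      have "a (k - i) \<le> C * (1 + of_int (k - i)) powr (- (r - e))" using k i by (intro C(2)) auto
      also have "\<dots> \<le> C * (- of_int i) powr (- (r - e))"
        using C i k er by (intro mult_left_mono powr_mono2') auto
      finally show "a (k - i) \<le> C * (- of_int i) powr (- (r - e))" .
    qed
    also have "\<dots> = C * (real n * (- of_int i) powr (- (r - e)))" by simp
    also have "\<dots> \<le> max C (C * Z) * (real n * (- of_int i) powr (- (r - e)))" by (intro mult_right_mono) auto
    finally show "b n i \<le> max C (C * Z) * real n * (- of_int i) powr (- (r - e))" by (simp add: mult.assoc)
  qed
qed

text \<open>For \<open>i\<close> in the first half of the window at least \<open>n / 2\<close>
  indices \<open>k\<close> satisfy \<open>i \<le> k \<le> n\<close>, and each contributes a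
  coefficient at distance less than \<open>n\<close>.\<close>

lemma weight_lower:
  assumes e: "0 < e"
  obtains c where "0 < c" "\<And>n i. 1 \<le> n \<Longrightarrow> 1 \<le> i \<Longrightarrow> i \<le> int (n div 2) \<Longrightarrow> c * real n powr (1 - r - e) \<le> b n i"
proof -
  obtain C where C: "0 < C" "\<And>i. 0 \<le> i \<Longrightarrow> (1 + of_int i) powr (- (r + e)) / C \<le> a i" using a_bounds[OF e] by metis
  show thesis
  proof (rule that[of "1 / (2 * C)"])
    fix n :: nat and i :: int assume n: "1 \<le> n" and i: "1 \<le> i" "i \<le> int (n div 2)"
    have "real n / 2 * (real n powr (- (r + e)) / C) \<le> real (card {i..int n}) * (real n powr (- (r + e)) / C)"
    proof (rule mult_right_mono)
      define q where "q = n div 2"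
      have "2 * q \<le> n" by (simp add: q_def)
      then have "int n \<le> 2 * (int n - i + 1)" using i(2)[folded q_def] by presburger
      then show "real n / 2 \<le> real (card {i..int n})" using i by simp
    qed (use C in auto)
    also have "\<dots> = (\<Sum>k\<in>{i..int n}. real n powr (- (r + e)) / C)" by simp
    also have "\<dots> \<le> (\<Sum>k\<in>{i..int n}. a (k - i))"
    proof (rule sum_mono)
      fix k assume k: "k \<in> {i..int n}"
      have "real n powr (- (r + e)) / C \<le> (1 + of_int (k - i)) powr (- (r + e)) / C"
        using k i C(1) r e by (intro divide_right_mono powr_mono2') auto
      also have "\<dots> \<le> a (k - i)" using k by (intro C(2)) auto
      finally show "real n powr (- (r + e)) / C \<le> a (k - i)" .
    qed
    also have "\<dots> \<le> b n i" unfolding weight_def using i by (intro sum_mono2) (auto simp: a_ge_0)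
    finally have "1 / (2 * C) * (real n powr 1 * real n powr (- (r + e))) \<le> b n i" using n by simp
    then show "1 / (2 * C) * real n powr (1 - r - e) \<le> b n i"
      unfolding powr_add[symmetric] by (simp add: algebra_simps)
  qed (use C in auto)
qed

text \<open>Positions with \<open>\<bar>i\<bar> \<le> n\<close> number at most \<open>3 * n\<close>
  and use the uniform bound. Further left the decay of the coefficients counts: the squares have
  exponent \<open>- 2 * (r - e)\<close>, below -1 since \<open>r > 1 / 2\<close> and
  \<open>e\<close> is small.\<close>

lemma weight_square_sum:
  assumes e: "0 < e" "r + e < 1" "1 + 3 * e < 2 * r"
  obtains C where "0 < C" "\<And>n F. 1 \<le> n \<Longrightarrow> finite F \<Longrightarrow> F \<subseteq> {..int n} \<Longrightarrow> (\<Sum>i\<in>F. (b n i)\<^sup>2) \<le> C * real n powr (3 - 2 * r + 4 * e)"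
proof -
  obtain C where C: "0 < C" "\<And>n i. 1 \<le> n \<Longrightarrow> b n i \<le> C * real n powr (1 - r + 2 * e)"
    "\<And>n i. 1 \<le> n \<Longrightarrow> i < 0 \<Longrightarrow> b n i \<le> C * real n * (- of_int i) powr (- (r - e))"
    using weight_upper[OF e(1,2)] by metis
  obtain Z where Z: "0 < Z" "\<And>A :: nat set. finite A \<Longrightarrow> (\<Sum>k\<in>A. real k powr (- (1 + e))) \<le> Z"
    using power_sum_bound[OF e(1)] by metis
  show thesis
  proof (rule that[of "3 * C\<^sup>2 + C\<^sup>2 * Z"])
    show "0 < 3 * C\<^sup>2 + C\<^sup>2 * Z" using C Z by (intro add_pos_pos) auto
    fix n :: nat and F :: "int set" assume n: "1 \<le> n" and F: "finite F" "F \<subseteq> {..int n}"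
    define F1 where "F1 = F \<inter> {- int n..int n}"
    define F2 where "F2 = F - {- int n..int n}"
    have F2: "i < - int n" if "i \<in> F2" for i using that F by (auto simp: F2_def)
    have "(\<Sum>i\<in>F. (b n i)\<^sup>2) = (\<Sum>i\<in>F1. (b n i)\<^sup>2) + (\<Sum>i\<in>F2. (b n i)\<^sup>2)"
      unfolding F1_def F2_def using F(1) by (rule sum.Int_Diff)
    also have "(\<Sum>i\<in>F1. (b n i)\<^sup>2) \<le> (\<Sum>i\<in>{- int n..int n}. (b n i)\<^sup>2)"
      unfolding F1_def by (intro sum_mono2) auto
    also have "\<dots> \<le> (\<Sum>i\<in>{- int n..int n}. (C * real n powr (1 - r + 2 * e))\<^sup>2)"
      using C(2)[OF n] weight_nonneg by (intro sum_mono power_mono) auto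
    also have "\<dots> = (2 * real n + 1) * (C\<^sup>2 * (real n powr (1 - r + 2 * e))\<^sup>2)" by (simp add: power_mult_distrib)
    also have "\<dots> \<le> (3 * real n powr 1) * (C\<^sup>2 * (real n powr (1 - r + 2 * e))\<^sup>2)"
      using n by (intro mult_right_mono) auto
    also have "\<dots> = 3 * C\<^sup>2 * (real n powr 1 * real n powr (1 - r + 2 * e) * real n powr (1 - r + 2 * e))" by (simp add: power2_eq_square)
    also have "real n powr 1 * real n powr (1 - r + 2 * e) * real n powr (1 - r + 2 * e) = real n powr (3 - 2 * r + 4 * e)"
      unfolding powr_add[symmetric] by (rule arg_cong[where f="\<lambda>z. real n powr z"]) simp
    also have "(\<Sum>i\<in>F2. (b n i)\<^sup>2) \<le> (\<Sum>i\<in>F2. C\<^sup>2 * real n powr (3 - 2 * r + 4 * e) * real (nat (- i)) powr (- (1 + e)))"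
    proof (rule sum_mono)
      fix i assume i: "i \<in> F2"
      define m where "m = real (nat (- i))"
      have m: "m = - of_int i" "real n \<le> m" "1 \<le> m" using F2[OF i] n by (auto simp: m_def)
      have "(b n i)\<^sup>2 \<le> (C * real n * m powr (- (r - e)))\<^sup>2"
        using C(3)[OF n, of i] F2[OF i] n weight_nonneg by (intro power_mono) (auto simp: m(1))
      also have "\<dots> = C\<^sup>2 * (real n powr 2 * (m powr (- (r - e)) * m powr (- (r - e))))"
        using n by (simp add: power_mult_distrib power2_eq_square powr_numeral)
      \<comment> \<open>The first exponent is negative by the condition
        \<open>1 + 3 * e < 2 * r\<close> and is evaluated at \<open>m \<ge> n\<close>; the second
        one is summed.\<close>
      also have "m powr (- (r - e)) * m powr (- (r - e)) = m powr (1 + 3 * e - 2 * r) * m powr (- (1 + e))"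
        unfolding powr_add[symmetric] by (rule arg_cong[where f="\<lambda>z. m powr z"]) simp
      also have "m powr (1 + 3 * e - 2 * r) \<le> real n powr (1 + 3 * e - 2 * r)"
        using m n e by (intro powr_mono2') auto
      finally have "(b n i)\<^sup>2 \<le> C\<^sup>2 * (real n powr 2 * (real n powr (1 + 3 * e - 2 * r) * m powr (- (1 + e))))"
        by (simp add: mult_left_mono mult_right_mono)
      also have "\<dots> = C\<^sup>2 * ((real n powr 2 * real n powr (1 + 3 * e - 2 * r)) * m powr (- (1 + e)))" by (simp only: mult.assoc)
      also have "real n powr 2 * real n powr (1 + 3 * e - 2 * r) = real n powr (3 - 2 * r + 3 * e)"
        unfolding powr_add[symmetric] by (rule arg_cong[where f="\<lambda>z. real n powr z"]) simp
      also have "\<dots> \<le> real n powr (3 - 2 * r + 4 * e)" using n e by (intro powr_mono) auto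
      finally show "(b n i)\<^sup>2 \<le> C\<^sup>2 * real n powr (3 - 2 * r + 4 * e) * real (nat (- i)) powr (- (1 + e))"
        unfolding m_def[symmetric] by (simp add: mult_left_mono mult_right_mono mult.assoc)
    qed
    also have "\<dots> = C\<^sup>2 * real n powr (3 - 2 * r + 4 * e) * (\<Sum>k\<in>(\<lambda>i. nat (- i)) ` F2. real k powr (- (1 + e)))"
    proof -
      have "inj_on (\<lambda>i. nat (- i)) F2" using F2 by (fastforce simp: inj_on_def)
      then show ?thesis by (simp add: sum.reindex sum_distrib_left)
    qed
    also have "\<dots> \<le> C\<^sup>2 * real n powr (3 - 2 * r + 4 * e) * Z"
      using F by (intro mult_left_mono Z) (auto simp: F2_def)
    finally show "(\<Sum>i\<in>F. (b n i)\<^sup>2) \<le> (3 * C\<^sup>2 + C\<^sup>2 * Z) * real n powr (3 - 2 * r + 4 * e)"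
      by (simp add: algebra_simps)
  qed
qed

lemma weight_square_summable: "1 \<le> n \<Longrightarrow> (\<lambda>i. (b n i)\<^sup>2) summable_on {..int n}"
proof -
  assume n: "1 \<le> n"
  define e where "e = min ((1 - r) / 2) ((2 * r - 1) / 6)"
  have e: "0 < e" "r + e < 1" "1 + 3 * e < 2 * r" using r by (auto simp: e_def min_def field_simps)
  obtain C where "\<And>n F. 1 \<le> n \<Longrightarrow> finite F \<Longrightarrow> F \<subseteq> {..int n} \<Longrightarrow> (\<Sum>i\<in>F. (b n i)\<^sup>2) \<le> C * real n powr (3 - 2 * r + 4 * e)"
    using weight_square_sum[OF e] by metis
  then show ?thesis using n
    by (intro nonneg_bdd_above_summable_on bdd_aboveI2[where M="C * real n powr (3 - 2 * r + 4 * e)"]) auto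
qed

text \<open>Finite windows growing only to the left, the order in which the series for the partial
  sums converge.\<close>

definition block :: "nat \<Rightarrow> nat \<Rightarrow> int set" where "block n N = {- int N..int n}"

lemma finite_block [simp]: "finite (block n N)" by (simp add: block_def)
lemma block_subset: "block n N \<subseteq> {..int n}" by (auto simp: block_def)

text \<open>An unordered sum is a limit along finite subsets; blocks eventually contain every finite
  set of indices, so it is also the limit along blocks.\<close>

lemma block_exhausts: "filterlim (block n) (finite_subsets_at_top {..int n}) sequentially"
  unfolding filterlim_finite_subsets_at_top
proof (intro allI impI)
  fix X assume X: "finite X \<and> X \<subseteq> {..int n}"
  define N where "N = nat (Max (insert 0 (abs ` X)))"
  have "X \<subseteq> block n m" if "N \<le> m" for m
  proof
    fix x assume x: "x \<in> X"
    then have "\<bar>x\<bar> \<le> Max (insert 0 (abs ` X))" using X by (intro Max_ge) auto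
    moreover have "Max (insert 0 (abs ` X)) \<le> int m" using that unfolding N_def by linarith
    ultimately show "x \<in> block n m" using X x by (auto simp: block_def)
  qed
  then show "\<forall>\<^sub>F m in sequentially. finite (block n m) \<and> X \<subseteq> block n m \<and> block n m \<subseteq> {..int n}"
    using block_subset by (auto simp: eventually_sequentially)
qed

lemma sum_block_tendsto:
  fixes f :: "int \<Rightarrow> real"
  assumes "f summable_on {..int n}"
  shows "(\<lambda>N. \<Sum>i\<in>block n N. f i) \<longlonglongrightarrow> (\<Sum>\<^sub>\<infinity>i\<in>{..int n}. f i)"
  using has_sum_infsum[OF assms] block_exhausts unfolding has_sum_def by (rule filterlim_compose)

definition sd :: "nat \<Rightarrow> real" where "sd n = sqrt (s2 * (\<Sum>\<^sub>\<infinity>i\<in>{..int n}. (b n i)\<^sup>2))"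
text \<open>The standard deviation of a block rather than of the full sum: dividing by it makes the
  variance of the block exactly 1.\<close>

definition sdN :: "nat \<Rightarrow> nat \<Rightarrow> real" where "sdN n N = sqrt (vsum (b n) (block n N))"

lemma sdN_eq: "sdN n N = sqrt (s2 * (\<Sum>i\<in>block n N. (b n i)\<^sup>2))"
  by (simp add: sdN_def vsum_def sum_distrib_left mult.commute)

lemma sdN_tendsto: "1 \<le> n \<Longrightarrow> sdN n \<longlonglongrightarrow> sd n"
  unfolding sdN_eq[abs_def] sd_def by (intro tendsto_intros sum_block_tendsto weight_square_summable)

lemma sdN_le: "1 \<le> n \<Longrightarrow> sdN n N \<le> sd n"
  unfolding sdN_eq sd_def using s2_pos block_subset
  by (intro real_sqrt_le_mono mult_left_mono finite_sum_le_infsum weight_square_summable) auto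

lemma sdN_pos: "1 \<le> n \<Longrightarrow> 0 < sdN n N"
proof -
  assume n: "1 \<le> n"
  have "0 < (\<Sum>i\<in>block n N. (b n i)\<^sup>2)"
    using weight_pos[OF n, of "int n"] n by (intro sum_pos2[of _ "int n"]) (auto simp: block_def)
  then show ?thesis unfolding sdN_eq using s2_pos by simp
qed

lemma sd_pos: "1 \<le> n \<Longrightarrow> 0 < sd n"
  using sdN_pos[of n 0] sdN_le[of n 0] by linarith

text \<open>The bounds on \<open>b\<close> and on the sum of squares miss the true order by small
  powers of \<open>n\<close>, which together amount to \<open>3 * d\<close> in either direction; a
  further \<open>d\<close> absorbs the constants. The upper bound refers to every
  \<open>sdN n N\<close>, the lower one to the larger \<open>sd n\<close>.\<close>

lemma relative_weights:
  assumes e: "0 < e"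
  shows "\<forall>\<^sub>F n in sequentially. (\<forall>N i. b n i \<le> real n powr (- 1 / 2 + e) * sdN n N) \<and>
     (\<forall>i\<in>{1..int (n div 2)}. real n powr (- 1 / 2 - e) * sd n \<le> b n i)"
proof -
  define d where "d = min (e / 4) (min ((1 - r) / 2) ((2 * r - 1) / 6))"
  have d: "0 < d" "r + d < 1" "1 + 3 * d < 2 * r" "4 * d \<le> e" using r e by (auto simp: d_def min_def field_simps)
  obtain C1 where C1: "0 < C1" "\<And>n i. 1 \<le> n \<Longrightarrow> b n i \<le> C1 * real n powr (1 - r + 2 * d)" using weight_upper[OF d(1,2)] by metis
  obtain c where c: "0 < c" "\<And>n i. 1 \<le> n \<Longrightarrow> 1 \<le> i \<Longrightarrow> i \<le> int (n div 2) \<Longrightarrow> c * real n powr (1 - r - d) \<le> b n i"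
    using weight_lower[OF d(1)] by metis
  obtain C2 where C2: "0 < C2" "\<And>n F. 1 \<le> n \<Longrightarrow> finite F \<Longrightarrow> F \<subseteq> {..int n} \<Longrightarrow> (\<Sum>i\<in>F. (b n i)\<^sup>2) \<le> C2 * real n powr (3 - 2 * r + 4 * d)"
    using weight_square_sum[OF d(1,2,3)] by metis
  \<comment> \<open>\<open>k1\<close> and \<open>k2\<close> collect the constants of the two
    comparisons and are eventually below \<open>n powr d\<close>. The 3 comes from
    \<open>n div 2 \<ge> n / 3\<close>, valid for \<open>n \<ge> 2\<close>.\<close>
  define k1 where "k1 = C1 / sqrt (s2 * (c\<^sup>2 / 3))"
  define k2 where "k2 = sqrt (s2 * C2) / c"
  have "filterlim (\<lambda>n::nat. real n powr d) at_top sequentially" using d(1) by real_asymp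
  then have big: "\<forall>\<^sub>F n in sequentially. max k1 k2 \<le> real n powr d" unfolding filterlim_at_top by blast
  have two: "\<forall>\<^sub>F n in sequentially. (2::nat) \<le> n" by (rule eventually_ge_at_top)
  from big two show ?thesis
  proof eventually_elim
    case (elim n)
    have n: "1 \<le> n" using elim by simp
    have low: "sqrt (s2 * (c\<^sup>2 / 3)) * real n powr (3 / 2 - r - d) \<le> sdN n N" for N
    proof -
      have "c\<^sup>2 / 3 * real n powr (3 - 2 * r - 2 * d) \<le> (\<Sum>i\<in>block n N. (b n i)\<^sup>2)"
      proof -
        have "n \<le> 3 * (n div 2)" using elim(2) by presburger
        then have "real n / 3 \<le> real (n div 2)" by linarith
        then have "real n / 3 * (c * real n powr (1 - r - d))\<^sup>2 \<le> real (n div 2) * (c * real n powr (1 - r - d))\<^sup>2"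
          by (rule mult_right_mono) simp
        also have "\<dots> = (\<Sum>i\<in>{1..int (n div 2)}. (c * real n powr (1 - r - d))\<^sup>2)" by simp
        also have "\<dots> \<le> (\<Sum>i\<in>{1..int (n div 2)}. (b n i)\<^sup>2)"
          using c n by (intro sum_mono power_mono) auto
        also have "\<dots> \<le> (\<Sum>i\<in>block n N. (b n i)\<^sup>2)" by (intro sum_mono2) (auto simp: block_def)
        finally have "c\<^sup>2 / 3 * (real n powr 1 * real n powr (1 - r - d) * real n powr (1 - r - d)) \<le> (\<Sum>i\<in>block n N. (b n i)\<^sup>2)"
          by (simp add: power_mult_distrib power2_eq_square mult_ac)
        moreover have "real n powr 1 * real n powr (1 - r - d) * real n powr (1 - r - d) = real n powr (3 - 2 * r - 2 * d)"
          unfolding powr_add[symmetric] by (rule arg_cong[where f="\<lambda>z. real n powr z"]) simp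
        ultimately show ?thesis by simp
      qed
      then have "sqrt (s2 * (c\<^sup>2 / 3 * real n powr (3 - 2 * r - 2 * d))) \<le> sdN n N"
        unfolding sdN_eq using s2_pos by (intro real_sqrt_le_mono mult_left_mono) auto
      moreover have "sqrt (real n powr (3 - 2 * r - 2 * d)) = real n powr (3 / 2 - r - d)"
        by (simp add: powr_half_sqrt[symmetric] powr_powr field_simps)
      moreover have "sqrt (s2 * (c\<^sup>2 / 3 * X)) = sqrt (s2 * (c\<^sup>2 / 3)) * sqrt X" for X
        unfolding mult.assoc[symmetric] by (rule real_sqrt_mult)
      ultimately show ?thesis by (simp only:)
    qed
    have up: "sd n \<le> sqrt (s2 * C2) * real n powr (3 / 2 - r + 2 * d)"
    proof -
      have "(\<Sum>\<^sub>\<infinity>i\<in>{..int n}. (b n i)\<^sup>2) \<le> C2 * real n powr (3 - 2 * r + 4 * d)"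
        using C2(2)[OF n] by (intro infsum_le_finite_sums weight_square_summable n) auto
      then have "sd n \<le> sqrt (s2 * (C2 * real n powr (3 - 2 * r + 4 * d)))"
        unfolding sd_def using s2_pos by (intro real_sqrt_le_mono mult_left_mono) auto
      moreover have "sqrt (real n powr (3 - 2 * r + 4 * d)) = real n powr (3 / 2 - r + 2 * d)"
        by (simp add: powr_half_sqrt[symmetric] powr_powr field_simps)
      moreover have "sqrt (s2 * (C2 * X)) = sqrt (s2 * C2) * sqrt X" for X
        unfolding mult.assoc[symmetric] by (rule real_sqrt_mult)
      ultimately show ?thesis by (simp only:)
    qed
    have k0: "0 < sqrt (s2 * (c\<^sup>2 / 3))" using s2_pos c by simp
    show ?case
    proof (intro conjI allI ballI)
      fix N i
      have "b n i \<le> C1 * real n powr (1 - r + 2 * d)" by (rule C1(2)[OF n])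
      also have "C1 = k1 * sqrt (s2 * (c\<^sup>2 / 3))"
        using s2_pos c(1) by (simp add: k1_def)
      also have "k1 * sqrt (s2 * (c\<^sup>2 / 3)) * real n powr (1 - r + 2 * d) = k1 * (sqrt (s2 * (c\<^sup>2 / 3)) * real n powr (1 - r + 2 * d))"
        by (rule mult.assoc)
      also have "\<dots> \<le> real n powr d * (sqrt (s2 * (c\<^sup>2 / 3)) * real n powr (1 - r + 2 * d))"
        using elim(1) k0 by (intro mult_right_mono) auto
      also have "\<dots> = sqrt (s2 * (c\<^sup>2 / 3)) * (real n powr d * real n powr (1 - r + 2 * d))" by simp
      also have "real n powr d * real n powr (1 - r + 2 * d) = real n powr (- 1 / 2 + 4 * d) * real n powr (3 / 2 - r - d)"
        unfolding powr_add[symmetric] by (rule arg_cong[where f="\<lambda>z. real n powr z"]) simp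
      also have "sqrt (s2 * (c\<^sup>2 / 3)) * (real n powr (- 1 / 2 + 4 * d) * real n powr (3 / 2 - r - d))
         = real n powr (- 1 / 2 + 4 * d) * (sqrt (s2 * (c\<^sup>2 / 3)) * real n powr (3 / 2 - r - d))" by simp
      also have "\<dots> \<le> real n powr (- 1 / 2 + e) * sdN n N"
        using n d k0 by (intro mult_mono powr_mono low) auto
      finally show "b n i \<le> real n powr (- 1 / 2 + e) * sdN n N" .
    next
      fix i assume i: "i \<in> {1..int (n div 2)}"
      have "real n powr (- 1 / 2 - e) * sd n \<le> real n powr (- 1 / 2 - 4 * d) * (sqrt (s2 * C2) * real n powr (3 / 2 - r + 2 * d))"
        using n d sd_pos[OF n] by (intro mult_mono powr_mono up) auto
      also have "\<dots> = sqrt (s2 * C2) * (real n powr (- 1 / 2 - 4 * d) * real n powr (3 / 2 - r + 2 * d))" by simp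
      also have "real n powr (- 1 / 2 - 4 * d) * real n powr (3 / 2 - r + 2 * d) = real n powr (- d) * real n powr (1 - r - d)"
        unfolding powr_add[symmetric] by (rule arg_cong[where f="\<lambda>z. real n powr z"]) simp
      also have "sqrt (s2 * C2) * (real n powr (- d) * real n powr (1 - r - d)) = k2 * real n powr (- d) * (c * real n powr (1 - r - d))"
        using c by (simp add: k2_def)
      also have "\<dots> \<le> real n powr d * real n powr (- d) * (c * real n powr (1 - r - d))"
        using elim(1) c by (intro mult_right_mono) auto
      also have "real n powr d * real n powr (- d) = 1" using n by (simp flip: powr_add)
      also have "1 * (c * real n powr (1 - r - d)) \<le> b n i" using c(2)[OF n, of i] i by simp
      finally show "real n powr (- 1 / 2 - e) * sd n \<le> b n i" .
    qed
  qed
qed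

end

section \<open>From finite to infinite sums\<close>

context regular_linear_process begin

abbreviation S where "S \<equiv> partial_sum a \<xi>"
abbreviation SN where "SN n N \<equiv> wsum (b n) (block n N)"

lemma measurable_S [measurable]: "S n \<in> borel_measurable M"
  unfolding partial_sum_def[abs_def] linear_process_def[abs_def] by measurable

lemma a_square_summable: "summable (\<lambda>m. (a (int m))\<^sup>2)"
proof -
  define e where "e = (2 * r - 1) / 4"
  have e: "0 < e" "1 < 2 * (r - e)" using r by (auto simp: e_def field_simps)
  obtain C where C: "0 < C" "\<And>i. 0 \<le> i \<Longrightarrow> a i \<le> C * (1 + of_int i) powr (- (r - e))" using a_bounds[OF e(1)] by metis
  have "summable (\<lambda>m. real m powr (- (2 * (r - e))))" using e by (subst summable_real_powr_iff) auto
  then have "summable (\<lambda>m. C\<^sup>2 * real (Suc m) powr (- (2 * (r - e))))"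
    by (intro summable_mult) (subst summable_Suc_iff)
  then show ?thesis
  proof (rule summable_comparison_test')
    fix m :: nat
    have "(a (int m))\<^sup>2 \<le> (C * (1 + real m) powr (- (r - e)))\<^sup>2"
      using C(2)[of "int m"] a_ge_0 by (intro power_mono) auto
    also have "\<dots> = C\<^sup>2 * real (Suc m) powr (- (2 * (r - e)))"
      by (simp add: power_mult_distrib power2_eq_square flip: powr_add)
    finally show "norm ((a (int m))\<^sup>2) \<le> C\<^sup>2 * real (Suc m) powr (- (2 * (r - e)))" by simp
  qed
qed

text \<open>A block sum is a finite sum over \<open>k\<close> of ordered partial sums of the series
  for \<open>linear_process\<close>, each of which converges almost surely; no unordered convergence
  is involved.\<close>

lemma SN_tendsto_AE: "AE \<omega> in M. (\<lambda>N. SN n N \<omega>) \<longlonglongrightarrow> S n \<omega>"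
proof -
  have "AE \<omega> in M. \<forall>k\<in>{1..int n}. summable (\<lambda>m. a (int m) * \<xi> (k - int m) \<omega>)"
  proof (rule AE_finite_allI)
    fix k :: int
    have "inj (\<lambda>m. k - int m)" by (auto simp: inj_def)
    from summable_AE[OF this a_square_summable] show "AE \<omega> in M. summable (\<lambda>m. a (int m) * \<xi> (k - int m) \<omega>)" .
  qed simp
  then show ?thesis
  proof eventually_elim
    case (elim \<omega>)
    \<comment> \<open>After exchanging the sums, \<open>i\<close> running from \<open>- N\<close> to
      \<open>k\<close> becomes \<open>m = k - i\<close> from 0 to \<open>N + k\<close>, hence
      \<open>N + k + 1\<close> terms; positions \<open>i > k\<close> have coefficient 0.\<close>
    have eq: "SN n N \<omega> = (\<Sum>k\<in>{1..int n}. \<Sum>m<nat (int N + k + 1). a (int m) * \<xi> (k - int m) \<omega>)" for N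
    proof -
      have "SN n N \<omega> = (\<Sum>k\<in>{1..int n}. \<Sum>i\<in>block n N. a (k - i) * \<xi> i \<omega>)"
        unfolding wsum_def weight_def sum_distrib_right by (rule sum.swap)
      also have "\<dots> = (\<Sum>k\<in>{1..int n}. \<Sum>m<nat (int N + k + 1). a (int m) * \<xi> (k - int m) \<omega>)"
      proof (rule sum.cong[OF refl])
        fix k assume k: "k \<in> {1..int n}"
        have "(\<Sum>i\<in>block n N. a (k - i) * \<xi> i \<omega>) = (\<Sum>i\<in>{- int N..k}. a (k - i) * \<xi> i \<omega>)"
          using k by (intro sum.mono_neutral_right) (auto simp: block_def a_neg)
        also have "\<dots> = (\<Sum>m<nat (int N + k + 1). a (int m) * \<xi> (k - int m) \<omega>)"
          using k by (intro sum.reindex_bij_witness[where i="\<lambda>m. k - int m" and j="\<lambda>i. nat (k - i)"]) auto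
        finally show "(\<Sum>i\<in>block n N. a (k - i) * \<xi> i \<omega>) = (\<Sum>m<nat (int N + k + 1). a (int m) * \<xi> (k - int m) \<omega>)" .
      qed
      finally show ?thesis .
    qed
    show ?case unfolding eq partial_sum_def linear_process_def
    proof (rule tendsto_sum)
      fix k assume k: "k \<in> {1..int n}"
      have "filterlim (\<lambda>N. nat (int N + k + 1)) at_top sequentially"
        by (rule filterlim_at_top_mono[OF filterlim_ident], intro always_eventually allI) (use k in auto)
      from filterlim_compose[OF summable_LIMSEQ this] elim k
      show "(\<lambda>N. \<Sum>m<nat (int N + k + 1). a (int m) * \<xi> (k - int m) \<omega>) \<longlonglongrightarrow> (\<Sum>m. a (int m) * \<xi> (k - int m) \<omega>)" by blast
    qed
  qed
qed

lemma SN_tendsto_prob: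
  assumes y: "0 < y"
  shows "(\<lambda>N. \<P>(\<omega> in M. y \<le> \<bar>S n \<omega> - SN n N \<omega>\<bar>)) \<longlonglongrightarrow> 0"
proof -
  have "(\<lambda>N. expectation (\<lambda>\<omega>. of_bool (y \<le> \<bar>S n \<omega> - SN n N \<omega>\<bar>) :: real)) \<longlonglongrightarrow> expectation (\<lambda>\<omega>. 0)"
  proof (rule integral_dominated_convergence[where w="\<lambda>_. 1"])
    show "AE \<omega> in M. (\<lambda>N. of_bool (y \<le> \<bar>S n \<omega> - SN n N \<omega>\<bar>) :: real) \<longlonglongrightarrow> 0"
      using SN_tendsto_AE[of n]
    proof eventually_elim
      case (elim \<omega>)
      have "\<forall>\<^sub>F N in sequentially. of_bool (y \<le> \<bar>S n \<omega> - SN n N \<omega>\<bar>) = (0::real)"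
        using tendstoD[OF elim y] by eventually_elim (auto simp: dist_real_def abs_minus_commute)
      then show ?case by (rule tendsto_eventually)
    qed
  qed auto
  moreover have "expectation (\<lambda>\<omega>. of_bool (y \<le> \<bar>S n \<omega> - SN n N \<omega>\<bar>) :: real) = \<P>(\<omega> in M. y \<le> \<bar>S n \<omega> - SN n N \<omega>\<bar>)" for N
    by (rule expectation_of_bool) measurable
  ultimately show ?thesis by simp
qed

definition dev :: "nat \<Rightarrow> real \<Rightarrow> real" where "dev n x = \<P>(\<omega> in M. x * sd n \<le> S n \<omega>)"
definition tailT :: "nat \<Rightarrow> real \<Rightarrow> real" where "tailT n x = (\<Sum>\<^sub>\<infinity>i\<in>{..int n}. tailp (x * sd n / b n i))"

lemma dev_prob_eq: "dev_prob M a \<xi> n x = dev n x"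
  by (simp add: dev_prob_def dev_def std_dev_def sd_def s2_def)

lemma tail_sum_eq: "1 \<le> n \<Longrightarrow> tail_sum M a \<xi> n x = tailT n x"
  unfolding tail_sum_def tailT_def using weight_pos
  by (intro infsum_cong) (auto simp: std_dev_def sd_def s2_def intro!: prob_scaled_xi[unfolded s2_def])

lemma tailp_chebyshev: assumes u: "0 < u" shows "tailp u \<le> s2 / u\<^sup>2"
proof -
  have "tailp u \<le> \<P>(\<omega> in M. u\<^sup>2 \<le> (\<xi> 0 \<omega>)\<^sup>2)"
    unfolding tailp_def using u by (intro finite_measure_mono) (auto intro!: power_mono)
  also have "\<dots> \<le> expectation (\<lambda>\<omega>. (\<xi> 0 \<omega>)\<^sup>2) / u\<^sup>2"
    using u by (intro integral_Markov_inequality_measure[where A="space M - space M"] xi_square_integrable) auto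
  finally show ?thesis by (simp add: s2_def)
qed

text \<open>Chebyshev bounds each tail by a multiple of \<open>(b n i)\<^sup>2\<close>, and the
  squares are summable.\<close>

lemma tailT_summable:
  assumes n: "1 \<le> n" and x: "0 < x"
  shows "(\<lambda>i. tailp (x * sd n / b n i)) summable_on {..int n}"
proof (rule summable_on_comparison_test)
  show "(\<lambda>i. s2 / (x * sd n)\<^sup>2 * (b n i)\<^sup>2) summable_on {..int n}"
    by (intro summable_on_cmult_right weight_square_summable n)
  fix i assume "i \<in> {..int n}"
  then have "0 < b n i" using weight_pos[OF n] by simp
  then show "tailp (x * sd n / b n i) \<le> s2 / (x * sd n)\<^sup>2 * (b n i)\<^sup>2"
    using tailp_chebyshev[of "x * sd n / b n i"] x sd_pos[OF n] by (simp add: power_divide)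
qed (rule tailp_nonneg)

lemma tailT_tendsto:
  assumes "1 \<le> n" "0 < x"
  shows "(\<lambda>N. tails (b n) (block n N) (x * sd n)) \<longlonglongrightarrow> tailT n x"
  unfolding tails_def tailT_def by (intro sum_block_tendsto tailT_summable assms)

lemma tails_le_tailT:
  assumes "1 \<le> n" "0 < x" "finite F" "F \<subseteq> {..int n}"
  shows "tails (b n) F (x * sd n) \<le> tailT n x"
  unfolding tails_def tailT_def using assms tailp_nonneg
  by (intro finite_sum_le_infsum tailT_summable) auto

lemma tailT_nonneg: "0 \<le> tailT n x"
  unfolding tailT_def by (intro infsum_nonneg tailp_nonneg)

text \<open>The power bounds with \<open>e = 1 / 4\<close>. The threshold for \<open>n\<close> does
  not depend on \<open>N\<close>, which is what makes the uniform estimates survive the limit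
  \<open>N\<close> to infinity at fixed \<open>n\<close>.\<close>

lemma good_block:
  "\<forall>\<^sub>F n in sequentially. \<forall>N. good n (block n N) (\<lambda>i. b n i / sdN n N)"
proof -
  have "\<forall>\<^sub>F n in sequentially. (2::nat) \<le> n" by (rule eventually_ge_at_top)
  moreover have "0 < (1 / 4 :: real)" by simp
  note relative_weights[OF this]
  ultimately show ?thesis
  proof eventually_elim
    case (elim n)
    have n: "1 \<le> n" using elim by simp
    show ?case
    proof
      fix N
      have s: "0 < sdN n N" by (rule sdN_pos[OF n])
      have "vsum (\<lambda>i. b n i / sdN n N) (block n N) = vsum (b n) (block n N) / (sdN n N)\<^sup>2"
        by (simp add: vsum_def sum_divide_distrib power_divide)
      also have "(sdN n N)\<^sup>2 = vsum (b n) (block n N)" unfolding sdN_def using vsum_nonneg by simp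
      finally have v: "vsum (\<lambda>i. b n i / sdN n N) (block n N) = 1"
        using s by (auto simp: sdN_def)
      have "{1..int (n div 2)} \<subseteq> {i \<in> block n N. real n powr (- 3 / 4) \<le> b n i / sdN n N}"
      proof
        fix i assume i: "i \<in> {1..int (n div 2)}"
        have "real n powr (- 3 / 4) * sdN n N \<le> real n powr (- 1 / 2 - 1 / 4) * sd n"
          using sdN_le[OF n] less_imp_le[OF s] by (intro mult_mono) auto
        also have "\<dots> \<le> b n i" using elim i by blast
        finally show "i \<in> {i \<in> block n N. real n powr (- 3 / 4) \<le> b n i / sdN n N}"
          using i s by (auto simp: block_def field_simps)
      qed
      then have "card {1..int (n div 2)} \<le> card {i \<in> block n N. real n powr (- 3 / 4) \<le> b n i / sdN n N}"
        by (intro card_mono) auto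
      moreover have "n \<le> 4 * (n div 2)" using elim(1) by presburger
      ultimately have "real n / 4 \<le> real (card {i \<in> block n N. real n powr (- 3 / 4) \<le> b n i / sdN n N})"
        by simp
      moreover have "0 < b n i / sdN n N \<and> b n i / sdN n N \<le> real n powr (- 1 / 4)" if i: "i \<in> block n N" for i
      proof -
        have "0 < b n i" using i n by (intro weight_pos) (auto simp: block_def)
        moreover have "b n i \<le> real n powr (- 1 / 2 + 1 / 4) * sdN n N" using elim by blast
        ultimately show ?thesis using s by (simp add: field_simps)
      qed
      ultimately show "good n (block n N) (\<lambda>i. b n i / sdN n N)" unfolding good_def using v by simp
    qed
  qed
qed

lemma wsum_scale: "0 < s \<Longrightarrow> \<P>(\<omega> in M. y / s \<le> wsum (\<lambda>i. w i / s) I \<omega>) = \<P>(\<omega> in M. y \<le> wsum w I \<omega>)"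
proof -
  assume s: "0 < s"
  have "wsum (\<lambda>i. w i / s) I \<omega> = wsum w I \<omega> / s" for \<omega> by (simp add: wsum_def sum_divide_distrib)
  then show ?thesis using s by (simp add: divide_le_cancel)
qed

lemma tails_scale: "0 < s \<Longrightarrow> tails (\<lambda>i. w i / s) I (y / s) = tails w I y"
  by (simp add: tails_def)

text \<open>The slack \<open>\<theta>\<close> absorbs the distance between the full and the block
  sum, whose probability tends to 0 with \<open>N\<close>. Thus an atom of the full sum at the
  threshold does no harm; \<open>\<theta>\<close> is removed later.\<close>

lemma dev_upper:
  assumes n: "1 \<le> n" and \<theta>: "0 < \<theta>"
    and F: "\<forall>\<^sub>F N in sequentially. \<P>(\<omega> in M. (x - \<theta>) * sd n \<le> SN n N \<omega>) \<le> K N" and K: "K \<longlonglongrightarrow> K'"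
  shows "dev n x \<le> K'"
proof -
  have le: "dev n x \<le> \<P>(\<omega> in M. (x - \<theta>) * sd n \<le> SN n N \<omega>) + \<P>(\<omega> in M. \<theta> * sd n \<le> \<bar>S n \<omega> - SN n N \<omega>\<bar>)" for N
  proof -
    have "dev n x \<le> prob ({\<omega>\<in>space M. (x - \<theta>) * sd n \<le> SN n N \<omega>} \<union> {\<omega>\<in>space M. \<theta> * sd n \<le> \<bar>S n \<omega> - SN n N \<omega>\<bar>})"
      unfolding dev_def by (intro finite_measure_mono) (auto simp: algebra_simps)
    also have "\<dots> \<le> \<P>(\<omega> in M. (x - \<theta>) * sd n \<le> SN n N \<omega>) + \<P>(\<omega> in M. \<theta> * sd n \<le> \<bar>S n \<omega> - SN n N \<omega>\<bar>)"
      by (intro measure_Un_le) auto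
    finally show ?thesis .
  qed
  have ev: "\<forall>\<^sub>F N in sequentially. dev n x \<le> K N + \<P>(\<omega> in M. \<theta> * sd n \<le> \<bar>S n \<omega> - SN n N \<omega>\<bar>)"
    using F
  proof eventually_elim
    case (elim N)
    then show ?case using le[of N] by linarith
  qed
  have "(\<lambda>N. K N + \<P>(\<omega> in M. \<theta> * sd n \<le> \<bar>S n \<omega> - SN n N \<omega>\<bar>)) \<longlonglongrightarrow> K' + 0"
    using \<theta> sd_pos[OF n] by (intro tendsto_add K SN_tendsto_prob) auto
  from tendsto_lowerbound[OF this ev] show ?thesis by simp
qed

lemma dev_lower:
  assumes n: "1 \<le> n" and \<theta>: "0 < \<theta>"
    and F: "\<forall>\<^sub>F N in sequentially. K N \<le> \<P>(\<omega> in M. (x + \<theta>) * sd n \<le> SN n N \<omega>)" and K: "K \<longlonglongrightarrow> K'"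
  shows "K' \<le> dev n x"
proof -
  have le: "\<P>(\<omega> in M. (x + \<theta>) * sd n \<le> SN n N \<omega>) \<le> dev n x + \<P>(\<omega> in M. \<theta> * sd n \<le> \<bar>S n \<omega> - SN n N \<omega>\<bar>)" for N
  proof -
    have "\<P>(\<omega> in M. (x + \<theta>) * sd n \<le> SN n N \<omega>) \<le> prob ({\<omega>\<in>space M. x * sd n \<le> S n \<omega>} \<union> {\<omega>\<in>space M. \<theta> * sd n \<le> \<bar>S n \<omega> - SN n N \<omega>\<bar>})"
      by (intro finite_measure_mono) (auto simp: algebra_simps)
    also have "\<dots> \<le> dev n x + \<P>(\<omega> in M. \<theta> * sd n \<le> \<bar>S n \<omega> - SN n N \<omega>\<bar>)"
      unfolding dev_def by (intro measure_Un_le) auto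
    finally show ?thesis .
  qed
  have ev: "\<forall>\<^sub>F N in sequentially. K N - \<P>(\<omega> in M. \<theta> * sd n \<le> \<bar>S n \<omega> - SN n N \<omega>\<bar>) \<le> dev n x"
    using F
  proof eventually_elim
    case (elim N)
    then show ?case using le[of N] by linarith
  qed
  have "(\<lambda>N. K N - \<P>(\<omega> in M. \<theta> * sd n \<le> \<bar>S n \<omega> - SN n N \<omega>\<bar>)) \<longlonglongrightarrow> K' - 0"
    using \<theta> sd_pos[OF n] by (intro tendsto_diff K SN_tendsto_prob) auto
  from tendsto_upperbound[OF this ev] show ?thesis by simp
qed

text \<open>Thresholds are multiples of \<open>sd n\<close>, while the estimates for blocks are in
  units of \<open>sdN n N\<close>; in the limit the discrepancy disappears.\<close>

lemma scaled_tendsto: "1 \<le> n \<Longrightarrow> (\<lambda>N. y * sd n / sdN n N) \<longlonglongrightarrow> y"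
proof -
  assume n: "1 \<le> n"
  have "(\<lambda>N. y * sd n / sdN n N) \<longlonglongrightarrow> y * sd n / sd n"
    using sd_pos[OF n] by (intro tendsto_intros sdN_tendsto n) auto
  then show ?thesis using sd_pos[OF n] by simp
qed

lemma normal_tail_tendsto: "(f \<longlongrightarrow> y) F \<Longrightarrow> ((\<lambda>z. normal_tail (f z)) \<longlongrightarrow> normal_tail y) F"
  by (rule isCont_tendsto_compose[OF isCont_normal_tail])

lemma small_shift:
  assumes "\<And>\<theta>. 0 < \<theta> \<Longrightarrow> \<theta> < \<theta>0 \<Longrightarrow> P (\<theta>::real)" "0 < \<theta>0"
  shows "\<forall>\<^sub>F \<theta> in at_right 0. P \<theta>"
  unfolding eventually_at_right_field using assms by blast

text \<open>Only the normal tail occurs in the bounds, so \<open>N\<close> to infinity and then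
  \<open>\<theta>\<close> to 0 need nothing but its continuity. Halving \<open>c0\<close> leaves
  room for the shifted threshold.\<close>

lemma dev_gaussian_range:
  "\<exists>c0>0. \<forall>e>0. \<forall>\<^sub>F n in sequentially. \<forall>x. 0 < x \<longrightarrow> x \<le> c0 * sqrt (ln (real n)) \<longrightarrow>
     \<bar>dev n x - normal_tail x\<bar> \<le> e * normal_tail x"
proof -
  obtain c0 where c0: "0 < c0" "\<And>e. 0 < e \<Longrightarrow> \<forall>\<^sub>F n in sequentially. \<forall>I w x. good n I w \<longrightarrow> 0 \<le> x \<longrightarrow> x \<le> c0 * sqrt (ln (real n)) \<longrightarrow>
     \<bar>\<P>(\<omega> in M. x \<le> wsum w I \<omega>) - normal_tail x\<bar> \<le> e * normal_tail x"
    using gaussian_range by blast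
  have "\<forall>\<^sub>F n in sequentially. \<forall>x. 0 < x \<longrightarrow> x \<le> c0 / 2 * sqrt (ln (real n)) \<longrightarrow>
     \<bar>dev n x - normal_tail x\<bar> \<le> e * normal_tail x" if e: "0 < e" for e
  proof -
    have "\<forall>\<^sub>F n in sequentially. 1 \<le> ln (real n)" by real_asymp
    moreover have "\<forall>\<^sub>F n in sequentially. (1::nat) \<le> n" by (rule eventually_ge_at_top)
    ultimately show ?thesis using c0(2)[OF e] good_block
    proof eventually_elim
      case (elim n)
      note n = elim(2) and H = elim(3) and G = elim(4)
      show ?case
      proof (intro allI impI)
        fix x assume x: "0 < x" "x \<le> c0 / 2 * sqrt (ln (real n))"
        define B where "B = c0 * sqrt (ln (real n))"
        have B: "x \<le> B / 2" "0 < B" using x c0(1) elim(1) by (auto simp: B_def)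
        have main: "\<forall>\<^sub>F N in sequentially. \<bar>\<P>(\<omega> in M. y * sd n \<le> SN n N \<omega>) - normal_tail (y * sd n / sdN n N)\<bar> \<le> e * normal_tail (y * sd n / sdN n N)"
          if y: "0 < y" "y < B" for y
        proof -
          have "\<forall>\<^sub>F N in sequentially. 0 < y * sd n / sdN n N" "\<forall>\<^sub>F N in sequentially. y * sd n / sdN n N < B"
            using order_tendstoD[OF scaled_tendsto[OF n, of y]] y by auto
          then show ?thesis
          proof eventually_elim
            case (elim N)
            then have "\<bar>\<P>(\<omega> in M. y * sd n / sdN n N \<le> wsum (\<lambda>i. b n i / sdN n N) (block n N) \<omega>) - normal_tail (y * sd n / sdN n N)\<bar> \<le> e * normal_tail (y * sd n / sdN n N)"
              using H[rule_format, OF G[rule_format, of N]] by (simp add: B_def)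
            then show ?case unfolding wsum_scale[OF sdN_pos[OF n]] .
          qed
        qed
        have "\<forall>\<^sub>F \<theta> in at_right 0. dev n x \<le> (1 + e) * normal_tail (x - \<theta>)"
        proof (rule small_shift[OF _ x(1)])
          fix \<theta> assume \<theta>: "0 < \<theta>" "\<theta> < x"
          have ev: "\<forall>\<^sub>F N in sequentially. \<P>(\<omega> in M. (x - \<theta>) * sd n \<le> SN n N \<omega>) \<le> (1 + e) * normal_tail ((x - \<theta>) * sd n / sdN n N)"
            using main[of "x - \<theta>"] \<theta> B by (auto elim!: eventually_mono simp: algebra_simps abs_le_iff)
          show "dev n x \<le> (1 + e) * normal_tail (x - \<theta>)"
            by (rule dev_upper[OF n \<theta>(1) ev]) (intro tendsto_intros normal_tail_tendsto scaled_tendsto n)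
        qed
        moreover have "((\<lambda>\<theta>. (1 + e) * normal_tail (x - \<theta>)) \<longlongrightarrow> (1 + e) * normal_tail (x - 0)) (at_right 0)"
          by (intro tendsto_intros normal_tail_tendsto)
        ultimately have up: "dev n x \<le> (1 + e) * normal_tail (x - 0)"
          by (intro tendsto_lowerbound) auto
        have "\<forall>\<^sub>F \<theta> in at_right 0. (1 - e) * normal_tail (x + \<theta>) \<le> dev n x"
        proof (rule small_shift)
          show "0 < B / 2" using B by simp
          fix \<theta> assume \<theta>: "0 < \<theta>" "\<theta> < B / 2"
          have ev: "\<forall>\<^sub>F N in sequentially. (1 - e) * normal_tail ((x + \<theta>) * sd n / sdN n N) \<le> \<P>(\<omega> in M. (x + \<theta>) * sd n \<le> SN n N \<omega>)"
            using main[of "x + \<theta>"] \<theta> B x by (auto elim!: eventually_mono simp: algebra_simps abs_le_iff)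
          show "(1 - e) * normal_tail (x + \<theta>) \<le> dev n x"
            by (rule dev_lower[OF n \<theta>(1) ev]) (intro tendsto_intros normal_tail_tendsto scaled_tendsto n)
        qed
        moreover have "((\<lambda>\<theta>. (1 - e) * normal_tail (x + \<theta>)) \<longlongrightarrow> (1 - e) * normal_tail (x + 0)) (at_right 0)"
          by (intro tendsto_intros normal_tail_tendsto)
        ultimately have "(1 - e) * normal_tail (x + 0) \<le> dev n x"
          by (intro tendsto_upperbound) auto
        with up show "\<bar>dev n x - normal_tail x\<bar> \<le> e * normal_tail x" by (simp add: algebra_simps abs_le_iff)
      qed
    qed
  qed
  then show ?thesis using c0(1) by (intro exI[of _ "c0 / 2"]) auto
qed


text \<open>Since \<open>sdN n 0\<close> lies below \<open>sd n\<close>, the relative bound for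
  blocks also bounds the weights relative to the full standard deviation.\<close>

lemma argument_large:
  assumes "\<forall>N i. b n i \<le> real n powr (- 1 / 2 + e) * sdN n N" and n: "1 \<le> n" and i: "i \<le> int n" and x: "0 \<le> x"
  shows "x * real n powr (1 / 2 - e) \<le> x * sd n / b n i"
proof -
  have bp: "0 < b n i" using weight_pos[OF n i] .
  have "b n i \<le> real n powr (- 1 / 2 + e) * sdN n 0" using assms(1) by blast
  also have "\<dots> \<le> real n powr (- 1 / 2 + e) * sd n" using sdN_le[OF n] by (intro mult_left_mono) auto
  finally have "real n powr (1 / 2 - e) * b n i \<le> real n powr (1 / 2 - e) * (real n powr (- 1 / 2 + e) * sd n)"
    by (intro mult_left_mono) auto
  also have "\<dots> = sd n" using n by (simp flip: powr_add mult.assoc)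
  finally have "real n powr (1 / 2 - e) \<le> sd n / b n i" using bp by (simp add: pos_le_divide_eq)
  then have "x * real n powr (1 / 2 - e) \<le> x * (sd n / b n i)" using x by (intro mult_left_mono) auto
  then show ?thesis by simp
qed

text \<open>The tail of \<open>\<xi> 0\<close> may be discontinuous, so the shift by
  \<open>\<theta>\<close> is not undone there by a limit: it is enclosed in a relative shift by
  \<open>d\<close>, which \<open>tails_regular\<close> bounds. Only the normal tail is passed to the
  limit.\<close>

lemma dev_jump_range:
  assumes c: "0 < c" and e: "0 < e" "e \<le> 1"
  shows "\<forall>\<^sub>F n in sequentially. \<forall>x. c * sqrt (ln (real n)) \<le> x \<longrightarrow>
     \<bar>dev n x - (tailT n x + normal_tail x)\<bar> \<le> e * (tailT n x + normal_tail x)"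
proof -
  \<comment> \<open>Two relative errors multiply, one from the block estimate and one from shifting
    the level; a third of \<open>e\<close> each stays within \<open>e\<close> because
    \<open>e \<le> 1\<close>.\<close>
  define e' where "e' = e / 3"
  have e': "0 < e'" "e' < 1" "(1 + e') * (1 + e') \<le> 1 + e" "1 - e \<le> (1 - e') * (1 - e')"
  proof -
    have "e * e \<le> 1 * e" using e by (intro mult_right_mono) auto
    moreover have "(1 + e') * (1 + e') = 1 + 2 / 3 * e + e * e / 9" by (simp add: e'_def algebra_simps)
    ultimately show "(1 + e') * (1 + e') \<le> 1 + e" using e by linarith
    show "1 - e \<le> (1 - e') * (1 - e')" using e mult_nonneg_nonneg[of e e] by (simp add: e'_def algebra_simps)
  qed (use e in \<open>auto simp: e'_def\<close>)
  obtain d u1 where d: "0 < d" "d < 1" "0 < u1" "\<And>I w y. (\<forall>i\<in>I. 0 < w i \<and> u1 \<le> y / w i) \<Longrightarrow>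
     tails w I ((1 - d) * y) \<le> (1 + e') * tails w I y \<and> (1 - e') * tails w I y \<le> tails w I ((1 + d) * y)"
    using tails_regular[OF e'(1)] by metis
  have "filterlim (\<lambda>n::nat. real n powr (1 / 2 - 1 / 4)) at_top sequentially" by real_asymp
  then have e1: "\<forall>\<^sub>F n in sequentially. u1 / c \<le> real n powr (1 / 2 - 1 / 4)" unfolding filterlim_at_top by blast
  have e2: "\<forall>\<^sub>F n in sequentially. 1 \<le> ln (real n)" by real_asymp
  have e3: "\<forall>\<^sub>F n in sequentially. (1::nat) \<le> n" by (rule eventually_ge_at_top)
  have c2: "0 < c / 2" using c by simp
  have q: "0 < (1 / 4 :: real)" by simp
  from e1 e2 e3 jump_range[OF c2 e'(1)] good_block relative_weights[OF q] show ?thesis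
  proof eventually_elim
    case (elim n)
    note n = elim(3) and H = elim(4) and G = elim(5)
    show ?case
    proof (intro allI impI)
      fix x assume x: "c * sqrt (ln (real n)) \<le> x"
      define B where "B = c / 2 * sqrt (ln (real n))"
      have B: "0 < B" "2 * B \<le> x" using x c elim(2) by (auto simp: B_def)
      have x0: "0 < x" using B by simp
      have xc: "c \<le> x"
      proof -
        have "c * 1 \<le> c * sqrt (ln (real n))" using c elim(2) by (intro mult_left_mono) auto
        then show ?thesis using x by simp
      qed
      define Q where "Q = normal_tail x"
      have Q0: "0 \<le> Q" by (simp add: Q_def normal_tail_nonneg)
      have bp: "0 < b n i" if "i \<in> block n N" for i N
        using that n by (intro weight_pos) (auto simp: block_def)
      have large: "u1 \<le> x * sd n / b n i" if "i \<in> block n N" for i N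
      proof -
        have "u1 = c * (u1 / c)" using c by simp
        also have "\<dots> \<le> x * real n powr (1 / 2 - 1 / 4)" using elim(1) xc c d x0 by (intro mult_mono) auto
        also have "\<dots> \<le> x * sd n / b n i"
          using elim(6) n x0 that by (intro argument_large) (auto simp: block_def)
        finally show ?thesis .
      qed
      define TN where "TN N = tails (b n) (block n N) (x * sd n)" for N
      have reg: "tails (b n) (block n N) ((1 - d) * (x * sd n)) \<le> (1 + e') * TN N"
        "(1 - e') * TN N \<le> tails (b n) (block n N) ((1 + d) * (x * sd n))" for N
        using d(4)[of "block n N" "b n" "x * sd n"] bp large by (auto simp: TN_def)
      have TN: "TN \<longlonglongrightarrow> tailT n x" unfolding TN_def by (intro tailT_tendsto n x0)
      have main: "\<forall>\<^sub>F N in sequentially. \<bar>\<P>(\<omega> in M. y * sd n \<le> SN n N \<omega>)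
          - (tails (b n) (block n N) (y * sd n) + normal_tail (y * sd n / sdN n N))\<bar>
          \<le> e' * (tails (b n) (block n N) (y * sd n) + normal_tail (y * sd n / sdN n N))"
        if y: "B < y" for y
      proof -
        have "\<forall>\<^sub>F N in sequentially. B < y * sd n / sdN n N"
          using order_tendstoD(1)[OF scaled_tendsto[OF n, of y]] y by auto
        then show ?thesis
        proof eventually_elim
          case (elim N)
          then have "\<bar>\<P>(\<omega> in M. y * sd n / sdN n N \<le> wsum (\<lambda>i. b n i / sdN n N) (block n N) \<omega>)
             - (tails (\<lambda>i. b n i / sdN n N) (block n N) (y * sd n / sdN n N) + normal_tail (y * sd n / sdN n N))\<bar>
             \<le> e' * (tails (\<lambda>i. b n i / sdN n N) (block n N) (y * sd n / sdN n N) + normal_tail (y * sd n / sdN n N))"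
            using H[rule_format, OF G[rule_format, of N]] by (simp add: B_def)
          then show ?case unfolding wsum_scale[OF sdN_pos[OF n]] tails_scale[OF sdN_pos[OF n]] .
        qed
      qed
      \<comment> \<open>\<open>\<theta> < d * x\<close> keeps the shifted thresholds between
        \<open>(1 - d) * x\<close> and \<open>(1 + d) * x\<close>; \<open>\<theta> < x / 2\<close>
        keeps the lower one above \<open>B\<close>.\<close>
      define \<theta>0 where "\<theta>0 = min (d * x) (x / 2)"
      have \<theta>0: "0 < \<theta>0" using d x0 by (simp add: \<theta>0_def)
      have "\<forall>\<^sub>F \<theta> in at_right 0. dev n x \<le> (1 + e') * ((1 + e') * tailT n x + normal_tail (x - \<theta>))"
      proof (rule small_shift[OF _ \<theta>0])
        fix \<theta> assume \<theta>: "0 < \<theta>" "\<theta> < \<theta>0"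
        have "B < x - \<theta>" using \<theta> B by (simp add: \<theta>0_def)
        from main[OF this] have ev: "\<forall>\<^sub>F N in sequentially. \<P>(\<omega> in M. (x - \<theta>) * sd n \<le> SN n N \<omega>)
            \<le> (1 + e') * ((1 + e') * TN N + normal_tail ((x - \<theta>) * sd n / sdN n N))"
        proof eventually_elim
          case (elim N)
          have "(1 - d) * x * sd n \<le> (x - \<theta>) * sd n"
            using \<theta> sd_pos[OF n] by (intro mult_right_mono) (auto simp: \<theta>0_def algebra_simps)
          then have "tails (b n) (block n N) ((x - \<theta>) * sd n) \<le> tails (b n) (block n N) ((1 - d) * (x * sd n))"
            using bp by (intro tails_antimono) (auto simp: mult.assoc)
          also note reg(1)
          finally have "(1 + e') * (tails (b n) (block n N) ((x - \<theta>) * sd n) + normal_tail ((x - \<theta>) * sd n / sdN n N))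
            \<le> (1 + e') * ((1 + e') * TN N + normal_tail ((x - \<theta>) * sd n / sdN n N))"
            using e' by (intro mult_left_mono) auto
          moreover have "\<P>(\<omega> in M. (x - \<theta>) * sd n \<le> SN n N \<omega>)
            \<le> (1 + e') * (tails (b n) (block n N) ((x - \<theta>) * sd n) + normal_tail ((x - \<theta>) * sd n / sdN n N))"
            using elim by (simp add: algebra_simps abs_le_iff)
          ultimately show ?case by linarith
        qed
        show "dev n x \<le> (1 + e') * ((1 + e') * tailT n x + normal_tail (x - \<theta>))"
          by (rule dev_upper[OF n \<theta>(1) ev]) (intro tendsto_intros normal_tail_tendsto scaled_tendsto n TN)
      qed
      moreover have "((\<lambda>\<theta>. (1 + e') * ((1 + e') * tailT n x + normal_tail (x - \<theta>))) \<longlongrightarrow> (1 + e') * ((1 + e') * tailT n x + normal_tail (x - 0))) (at_right 0)"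
        by (intro tendsto_intros normal_tail_tendsto)
      ultimately have "dev n x \<le> (1 + e') * ((1 + e') * tailT n x + normal_tail (x - 0))"
        by (intro tendsto_lowerbound) auto
      also have "\<dots> \<le> (1 + e') * ((1 + e') * tailT n x + (1 + e') * Q)"
        using e' Q0 by (intro mult_left_mono add_left_mono) (auto simp: Q_def algebra_simps)
      also have "\<dots> = ((1 + e') * (1 + e')) * (tailT n x + Q)" by (simp add: algebra_simps)
      also have "\<dots> \<le> (1 + e) * (tailT n x + Q)" using e' Q0 tailT_nonneg by (intro mult_right_mono) auto
      finally have up: "dev n x \<le> (1 + e) * (tailT n x + Q)" .
      have "\<forall>\<^sub>F \<theta> in at_right 0. (1 - e') * ((1 - e') * tailT n x + normal_tail (x + \<theta>)) \<le> dev n x"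
      proof (rule small_shift[OF _ \<theta>0])
        fix \<theta> assume \<theta>: "0 < \<theta>" "\<theta> < \<theta>0"
        have "B < x + \<theta>" using \<theta> B by simp
        from main[OF this] have ev: "\<forall>\<^sub>F N in sequentially. (1 - e') * ((1 - e') * TN N + normal_tail ((x + \<theta>) * sd n / sdN n N))
            \<le> \<P>(\<omega> in M. (x + \<theta>) * sd n \<le> SN n N \<omega>)"
        proof eventually_elim
          case (elim N)
          have "(x + \<theta>) * sd n \<le> (1 + d) * x * sd n"
            using \<theta> sd_pos[OF n] by (intro mult_right_mono) (auto simp: \<theta>0_def algebra_simps)
          then have "tails (b n) (block n N) ((1 + d) * (x * sd n)) \<le> tails (b n) (block n N) ((x + \<theta>) * sd n)"
            using bp by (intro tails_antimono) (auto simp: mult.assoc)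
          with reg(2)[of N] have "(1 - e') * TN N \<le> tails (b n) (block n N) ((x + \<theta>) * sd n)" by linarith
          then have "(1 - e') * ((1 - e') * TN N + normal_tail ((x + \<theta>) * sd n / sdN n N))
            \<le> (1 - e') * (tails (b n) (block n N) ((x + \<theta>) * sd n) + normal_tail ((x + \<theta>) * sd n / sdN n N))"
            using e' by (intro mult_left_mono) auto
          moreover have "(1 - e') * (tails (b n) (block n N) ((x + \<theta>) * sd n) + normal_tail ((x + \<theta>) * sd n / sdN n N))
            \<le> \<P>(\<omega> in M. (x + \<theta>) * sd n \<le> SN n N \<omega>)"
            using elim by (simp add: algebra_simps abs_le_iff)
          ultimately show ?case by linarith
        qed
        show "(1 - e') * ((1 - e') * tailT n x + normal_tail (x + \<theta>)) \<le> dev n x"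
          by (rule dev_lower[OF n \<theta>(1) ev]) (intro tendsto_intros normal_tail_tendsto scaled_tendsto n TN)
      qed
      moreover have "((\<lambda>\<theta>. (1 - e') * ((1 - e') * tailT n x + normal_tail (x + \<theta>))) \<longlongrightarrow> (1 - e') * ((1 - e') * tailT n x + normal_tail (x + 0))) (at_right 0)"
        by (intro tendsto_intros normal_tail_tendsto)
      ultimately have "(1 - e') * ((1 - e') * tailT n x + normal_tail (x + 0)) \<le> dev n x"
        by (intro tendsto_upperbound) auto
      moreover have "(1 - e') * ((1 - e') * tailT n x + (1 - e') * Q) \<le> (1 - e') * ((1 - e') * tailT n x + normal_tail (x + 0))"
        using e' Q0 by (intro mult_left_mono add_left_mono) (auto simp: Q_def algebra_simps)
      moreover have "(1 - e') * ((1 - e') * tailT n x + (1 - e') * Q) = ((1 - e') * (1 - e')) * (tailT n x + Q)" by (simp add: algebra_simps)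
      moreover have "(1 - e) * (tailT n x + Q) \<le> ((1 - e') * (1 - e')) * (tailT n x + Q)" using e' Q0 tailT_nonneg by (intro mult_right_mono) auto
      ultimately have "(1 - e) * (tailT n x + Q) \<le> dev n x" by linarith
      with up show "\<bar>dev n x - (tailT n x + normal_tail x)\<bar> \<le> e * (tailT n x + normal_tail x)"
        unfolding Q_def by (simp add: algebra_simps abs_le_iff)
    qed
  qed
qed

section \<open>Comparing the two terms\<close>

text \<open>Two of the powers in the tail bound go into
  \<open>(b n i)\<^sup>2 / (sd n)\<^sup>2\<close>, which sums to a constant. The remaining
  \<open>t - 2\<close>, up to small losses, act on arguments of order at least nearly
  \<open>sqrt n\<close> and give \<open>n powr (- \<rho>)\<close>, below the normal tail as long as
  \<open>c2\<^sup>2 < t - 2\<close>.\<close>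

lemma jump_term_negligible:
  assumes c: "0 < c" and c2: "0 < c2" "c2 < sqrt (t - 2)" and e: "0 < e"
  shows "\<forall>\<^sub>F n in sequentially. \<forall>x. c \<le> x \<longrightarrow> x \<le> c2 * sqrt (ln (real n)) \<longrightarrow> tailT n x \<le> e * normal_tail x"
proof -
  define \<tau> where "\<tau> = t - 2"
  define \<gamma> where "\<gamma> = c2\<^sup>2"
  have \<tau>: "0 < \<tau>" using t by (simp add: \<tau>_def)
  have \<gamma>: "0 < \<gamma>" "\<gamma> < \<tau>"
  proof -
    have "c2\<^sup>2 < (sqrt (t - 2))\<^sup>2" using c2 by (intro power_strict_mono) auto
    then show "\<gamma> < \<tau>" using t by (simp add: \<gamma>_def \<tau>_def)
  qed (use c2 in \<open>simp add: \<gamma>_def\<close>)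
  \<comment> \<open>\<open>d\<close> is the loss in the tail exponent and \<open>d'\<close> that in
    the weights. Each lowers \<open>2 * \<rho>\<close> by at most a quarter of
    \<open>\<tau> - \<gamma>\<close>, so that \<open>2 * \<rho>\<close> stays above
    \<open>\<gamma>\<close>.\<close>
  define d where "d = (\<tau> - \<gamma>) / 4"
  define d' where "d' = (\<tau> - \<gamma>) / (8 * \<tau>)"
  have d: "0 < d" "d < \<tau>" and d': "0 < d'" "d' < 1 / 4"
    using \<tau> \<gamma> by (auto simp: d_def d'_def field_simps)
  define \<rho> where "\<rho> = (1 / 2 - d') * (\<tau> - d)"
  have \<rho>: "\<gamma> / 2 < \<rho>"
  proof -
    have "2 * \<rho> = \<tau> - d - 2 * (d' * \<tau>) + 2 * (d' * d)" by (simp add: \<rho>_def field_simps)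
    moreover have "d' * \<tau> = (\<tau> - \<gamma>) / 8" using \<tau> by (simp add: d'_def)
    moreover have "0 < d' * d" using d d' by simp
    ultimately have "\<tau> - (\<tau> - \<gamma>) / 4 - (\<tau> - \<gamma>) / 4 < 2 * \<rho>" using d_def by linarith
    moreover have "\<tau> - (\<tau> - \<gamma>) / 4 - (\<tau> - \<gamma>) / 4 = \<gamma> / 2 + \<tau> / 2" by (simp add: field_simps)
    moreover have "\<gamma> / 2 + \<gamma> / 2 < \<gamma> / 2 + \<tau> / 2" using \<gamma>(2) by simp
    ultimately have "\<gamma> / 2 + \<gamma> / 2 < 2 * \<rho>" by linarith
    then show ?thesis by simp
  qed
  have dt: "0 < d" "d < t" using d \<tau> by (auto simp: \<tau>_def)
  obtain u0 C where C: "0 < u0" "0 < C" "\<And>u. u0 \<le> u \<Longrightarrow> tailp u \<le> C * u powr (- (t - d))"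
    using regvar_tail_upper[OF regvar dt] by metis
  define K where "K = sqrt (2 * pi) * exp (3 / 2)"
  have K0: "0 < K" by (simp add: K_def)
  define A where "A = C * c powr (- (t - d)) / s2 * K"
  define \<beta> where "\<beta> = \<rho> - \<gamma> / 2"
  have \<beta>: "0 < \<beta>" using \<rho> by (simp add: \<beta>_def)
  have l1: "(\<lambda>n::nat. real n powr (- \<beta>)) \<longlonglongrightarrow> 0" using \<beta> by real_asymp
  have l2: "(\<lambda>n::nat. sqrt (ln (real n)) * real n powr (- \<beta>)) \<longlonglongrightarrow> 0" using \<beta> by real_asymp
  have "(\<lambda>n::nat. A * (real n powr (- \<beta>) + c2 * (sqrt (ln (real n)) * real n powr (- \<beta>)))) \<longlonglongrightarrow> A * (0 + c2 * 0)"
    by (intro tendsto_intros l1 l2)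
  then have e1: "\<forall>\<^sub>F n in sequentially. A * (real n powr (- \<beta>) + c2 * (sqrt (ln (real n)) * real n powr (- \<beta>))) < e"
    using e by (intro order_tendstoD(2)) auto
  have "filterlim (\<lambda>n::nat. real n powr (1 / 2 - d')) at_top sequentially" using d' by real_asymp
  then have e2: "\<forall>\<^sub>F n in sequentially. u0 / c \<le> real n powr (1 / 2 - d')" unfolding filterlim_at_top by blast
  have e3: "\<forall>\<^sub>F n in sequentially. 1 \<le> ln (real n)" by real_asymp
  have e4: "\<forall>\<^sub>F n in sequentially. (1::nat) \<le> n" by (rule eventually_ge_at_top)
  from e1 e2 e3 e4 relative_weights[OF d'(1)] show ?thesis
  proof eventually_elim
    case (elim n)
    note n = elim(4) and W = elim(5)
    show ?case
    proof (intro allI impI)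
      fix x assume x: "c \<le> x" "x \<le> c2 * sqrt (ln (real n))"
      have x0: "0 < x" using x c by simp
      have sd: "0 < sd n" by (rule sd_pos[OF n])
      define D where "D = C * c powr (- (t - d)) * real n powr (- \<rho>)"
      have D0: "0 \<le> D" using C by (simp add: D_def)
      have tb: "tailp (x * sd n / b n i) \<le> D / (sd n)\<^sup>2 * (b n i)\<^sup>2" if i: "i \<le> int n" for i
      proof -
        have bp: "0 < b n i" using weight_pos[OF n i] .
        define v where "v = sd n / b n i"
        have v: "real n powr (1 / 2 - d') \<le> v"
          using argument_large[of n d' i 1] W n i by (simp add: v_def)
        have v0: "0 < v" using sd bp by (simp add: v_def)
        have "u0 = c * (u0 / c)" using c by simp
        also have "\<dots> \<le> x * v" using x v elim(2) c C(1) v0 by (intro mult_mono) auto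
        finally have "tailp (x * v) \<le> C * (x * v) powr (- (t - d))" by (rule C(3))
        also have "\<dots> = C * (x powr (- (t - d)) * v powr (- (t - d)))" by (simp only: powr_mult)
        also have "\<dots> \<le> C * (c powr (- (t - d)) * (v powr (- 2) * real n powr (- \<rho>)))"
        proof (intro mult_left_mono mult_mono)
          show "x powr (- (t - d)) \<le> c powr (- (t - d))" using x c dt by (intro powr_mono2') auto
          \<comment> \<open>The exponent 2 is kept for summation over \<open>i\<close>; the rest is
            evaluated at the least possible \<open>v\<close>.\<close>
          have "v powr (- (t - d)) = v powr (- 2) * v powr (- (\<tau> - d))"
            unfolding powr_add[symmetric] by (rule arg_cong[where f="\<lambda>z. v powr z"]) (simp add: \<tau>_def)
          also have "v powr (- (\<tau> - d)) \<le> (real n powr (1 / 2 - d')) powr (- (\<tau> - d))"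
            using v n d by (intro powr_mono2') auto
          also have "\<dots> = real n powr (- \<rho>)" by (simp only: powr_powr \<rho>_def mult_minus_right)
          finally show "v powr (- (t - d)) \<le> v powr (- 2) * real n powr (- \<rho>)" by (simp add: mult_left_mono)
        qed (use C in auto)
        also have "v powr (- 2) = (b n i)\<^sup>2 / (sd n)\<^sup>2"
          using v0 by (simp add: powr_minus powr_numeral v_def power_divide)
        finally show ?thesis by (simp add: v_def D_def mult_ac)
      qed
      have "tailT n x \<le> (\<Sum>\<^sub>\<infinity>i\<in>{..int n}. D / (sd n)\<^sup>2 * (b n i)\<^sup>2)"
        unfolding tailT_def using tb
        by (intro infsum_mono tailT_summable n x0 summable_on_cmult_right weight_square_summable) auto
      also have "\<dots> = D / (sd n)\<^sup>2 * (\<Sum>\<^sub>\<infinity>i\<in>{..int n}. (b n i)\<^sup>2)"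
        by (rule infsum_cmult_right')
      also have "(\<Sum>\<^sub>\<infinity>i\<in>{..int n}. (b n i)\<^sup>2) = (sd n)\<^sup>2 / s2"
      proof -
        have "0 \<le> (\<Sum>\<^sub>\<infinity>i\<in>{..int n}. (b n i)\<^sup>2)" by (intro infsum_nonneg) auto
        then have "(sd n)\<^sup>2 = s2 * (\<Sum>\<^sub>\<infinity>i\<in>{..int n}. (b n i)\<^sup>2)" unfolding sd_def using s2_pos by simp
        then show ?thesis using s2_pos by simp
      qed
      also have "D / (sd n)\<^sup>2 * ((sd n)\<^sup>2 / s2) = D / s2" using sd by simp
      finally have T: "tailT n x \<le> D / s2" .
      have "real n powr (- (\<gamma> / 2)) \<le> exp (- x\<^sup>2 / 2)"
      proof -
        have "x\<^sup>2 \<le> (c2 * sqrt (ln (real n)))\<^sup>2" using x x0 by (intro power_mono) auto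
        also have "\<dots> = \<gamma> * ln (real n)" using elim(3) by (simp add: power_mult_distrib \<gamma>_def)
        finally have "exp (- (\<gamma> / 2) * ln (real n)) \<le> exp (- x\<^sup>2 / 2)" by simp
        then show ?thesis using n by (simp add: powr_def)
      qed
      also have "\<dots> \<le> K * (1 + x) * normal_tail x" using normal_tail_exp_ge[of x] x0 by (simp add: K_def)
      also have "\<dots> \<le> K * (1 + c2 * sqrt (ln (real n))) * normal_tail x"
        using x K0 normal_tail_nonneg by (intro mult_right_mono mult_left_mono) auto
      finally have Q: "real n powr (- (\<gamma> / 2)) \<le> K * (1 + c2 * sqrt (ln (real n))) * normal_tail x" .
      have "- \<rho> = - \<beta> + - (\<gamma> / 2)" by (simp add: \<beta>_def)
      then have "real n powr (- \<rho>) = real n powr (- \<beta>) * real n powr (- (\<gamma> / 2))" by (simp only: powr_add)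
      then have "D / s2 = C * c powr (- (t - d)) / s2 * real n powr (- \<beta>) * real n powr (- (\<gamma> / 2))" by (simp add: D_def)
      also have "\<dots> \<le> C * c powr (- (t - d)) / s2 * real n powr (- \<beta>) * (K * (1 + c2 * sqrt (ln (real n))) * normal_tail x)"
        using C s2_pos Q by (intro mult_left_mono) auto
      also have "\<dots> = (A * (real n powr (- \<beta>) + c2 * (sqrt (ln (real n)) * real n powr (- \<beta>)))) * normal_tail x"
        by (simp add: A_def algebra_simps add_divide_distrib)
      also have "\<dots> \<le> e * normal_tail x" using elim(1) normal_tail_nonneg by (intro mult_right_mono) auto
      finally show "tailT n x \<le> e * normal_tail x" using T by linarith
    qed
  qed
qed

text \<open>A small share \<open>k\<close> of the Gaussian exponent beats the power of
  \<open>x\<close> in the tail sum, for all large \<open>x\<close> at once; the rest is evaluated at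
  the lower end of the range and gives \<open>n powr (- (1 - k) * c1\<^sup>2 / 2)\<close>. About
  \<open>n / 2\<close> weights near \<open>sd n / sqrt n\<close> bound the tail sum from
  below.\<close>

lemma gaussian_term_negligible:
  assumes c1: "sqrt (t - 2) < c1" and e: "0 < e"
  shows "\<forall>\<^sub>F n in sequentially. \<forall>x. c1 * sqrt (ln (real n)) \<le> x \<longrightarrow> normal_tail x \<le> e * tailT n x"
proof -
  define \<tau> where "\<tau> = t - 2"
  define \<gamma> where "\<gamma> = c1\<^sup>2"
  have c10: "0 < c1" using c1 t by (meson diff_gt_0_iff_gt less_trans real_sqrt_gt_zero)
  have \<tau>: "0 < \<tau>" using t by (simp add: \<tau>_def)
  have \<gamma>: "\<tau> < \<gamma>"
  proof -
    have "(sqrt (t - 2))\<^sup>2 < c1\<^sup>2" using c1 t by (intro power_strict_mono) auto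
    then show ?thesis using t by (simp add: \<gamma>_def \<tau>_def)
  qed
  define \<Delta> where "\<Delta> = \<gamma> - \<tau>"
  have \<Delta>: "0 < \<Delta>" using \<gamma> by (simp add: \<Delta>_def)
  \<comment> \<open>The three losses are budgeted against the main surplus
    \<open>\<Delta> / 2\<close> in \<open>\<beta>\<close>: \<open>k\<close> costs
    \<open>\<Delta> / 8\<close>, while \<open>d\<close> and \<open>d'\<close> cost at most
    \<open>\<Delta> / 16\<close> each.\<close>
  define k where "k = \<Delta> / (4 * \<gamma>)"
  define d where "d = min 1 (\<Delta> / 8)"
  define d' where "d' = \<Delta> / (16 * (t + 1))"
  have k: "0 < k" "k < 1" using \<Delta> \<gamma> \<tau> by (auto simp: k_def \<Delta>_def field_simps)
  have d: "0 < d" "d \<le> 1" "d \<le> \<Delta> / 8" using \<Delta> by (auto simp: d_def)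
  have d': "0 < d'" using \<Delta> t by (simp add: d'_def)
  \<comment> \<open>The net exponent: the Gaussian decay in \<open>n\<close>, plus 1 for the number
    of weights, minus the decay in \<open>n\<close> of a single tail.\<close>
  define \<beta> where "\<beta> = (1 - k) * \<gamma> / 2 + 1 - (1 / 2 + d') * (t + d)"
  have \<beta>: "0 < \<beta>"
  proof -
    have "k * \<gamma> = \<Delta> / 4" using \<gamma> \<tau> by (simp add: k_def)
    moreover have "d' * (t + d) \<le> d' * (t + 1)" using d d' by (intro mult_left_mono) auto
    moreover have "d' * (t + 1) = \<Delta> / 16" using t by (simp add: d'_def field_simps)
    moreover have "\<beta> = \<gamma> / 2 - k * \<gamma> / 2 + 1 - t / 2 - d / 2 - d' * (t + d)" by (simp add: \<beta>_def algebra_simps add_divide_distrib diff_divide_distrib)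
    ultimately have "\<gamma> / 2 - \<Delta> / 8 + 1 - t / 2 - \<Delta> / 16 - \<Delta> / 16 \<le> \<beta>" using d(3) by linarith
    moreover have "t = \<tau> + 2" "\<gamma> = \<tau> + \<Delta>" by (simp_all add: \<tau>_def \<Delta>_def)
    ultimately show ?thesis using \<Delta> by (simp add: add_divide_distrib)
  qed
  obtain u0 C where C: "0 < u0" "0 < C" "\<And>u. u0 \<le> u \<Longrightarrow> C * u powr (- (t + d)) \<le> tailp u"
    using regvar_tail_lower[OF regvar _ d(1)] t by (metis less_trans zero_less_numeral)
  have "((\<lambda>x::real. x powr (t + d) * exp (- k * x\<^sup>2 / 2)) \<longlongrightarrow> 0) at_top" using k by real_asymp
  then have "\<forall>\<^sub>F x in at_top. x powr (t + d) * exp (- k * x\<^sup>2 / 2) < 1" by (intro order_tendstoD(2)) auto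
  then obtain X where X: "\<And>x. X \<le> x \<Longrightarrow> x powr (t + d) * exp (- k * x\<^sup>2 / 2) < 1" by (auto simp: eventually_at_top_linorder)
  have l1: "(\<lambda>n::nat. real n powr (- \<beta>)) \<longlonglongrightarrow> 0" using \<beta> by real_asymp
  have "(\<lambda>n::nat. 4 / C * real n powr (- \<beta>)) \<longlonglongrightarrow> 4 / C * 0" by (intro tendsto_intros l1)
  then have e1: "\<forall>\<^sub>F n in sequentially. 4 / C * real n powr (- \<beta>) < e" using e by (intro order_tendstoD(2)) auto
  have "filterlim (\<lambda>n::nat. sqrt (ln (real n))) at_top sequentially" by real_asymp
  then have e2: "\<forall>\<^sub>F n in sequentially. max 1 (max X u0) / c1 \<le> sqrt (ln (real n))" unfolding filterlim_at_top by blast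
  have e3: "\<forall>\<^sub>F n in sequentially. 1 \<le> ln (real n)" by real_asymp
  have e4: "\<forall>\<^sub>F n in sequentially. (2::nat) \<le> n" by (rule eventually_ge_at_top)
  from e1 e2 e3 e4 relative_weights[OF d'] show ?thesis
  proof eventually_elim
    case (elim n)
    have n: "1 \<le> n" using elim(4) by simp
    note W = elim(5)
    show ?case
    proof (intro allI impI)
      fix x assume x: "c1 * sqrt (ln (real n)) \<le> x"
      have xb: "max 1 (max X u0) \<le> x"
      proof -
        have "max 1 (max X u0) = c1 * (max 1 (max X u0) / c1)" using c10 by simp
        also have "\<dots> \<le> c1 * sqrt (ln (real n))" using elim(2) c10 by (intro mult_left_mono) auto
        finally show ?thesis using x by simp
      qed
      have x1: "1 \<le> x" using xb by simp
      have sd: "0 < sd n" by (rule sd_pos[OF n])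
      define F where "F = {1..int (n div 2)}"
      define u where "u = x * real n powr (1 / 2 + d')"
      have ux: "x \<le> u"
      proof -
        have "x * 1 \<le> x * real n powr (1 / 2 + d')" using x1 n d' by (intro mult_left_mono ge_one_powr_ge_zero) auto
        then show ?thesis by (simp add: u_def)
      qed
      have "C * u powr (- (t + d)) \<le> tailp u" using ux xb by (intro C(3)) auto
      moreover have "tailp u \<le> tailp (x * sd n / b n i)" if i: "i \<in> F" for i
      proof (rule tailp_antimono)
        have bp: "0 < b n i" using i n by (intro weight_pos) (auto simp: F_def)
        have "real n powr (- 1 / 2 - d') * sd n \<le> b n i" using W i unfolding F_def by blast
        then have "real n powr (1 / 2 + d') * (real n powr (- 1 / 2 - d') * sd n) \<le> real n powr (1 / 2 + d') * b n i"
          by (intro mult_left_mono) auto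
        moreover have "real n powr (1 / 2 + d') * (real n powr (- 1 / 2 - d') * sd n) = sd n"
          using n by (simp flip: powr_add mult.assoc)
        ultimately have "sd n \<le> real n powr (1 / 2 + d') * b n i" by (simp only:)
        then have "sd n / b n i \<le> real n powr (1 / 2 + d')" using bp by (simp add: pos_divide_le_eq)
        then have "x * (sd n / b n i) \<le> x * real n powr (1 / 2 + d')" using x1 by (intro mult_left_mono) auto
        then show "x * sd n / b n i \<le> u" by (simp add: u_def)
      qed
      ultimately have "(\<Sum>i\<in>F. C * u powr (- (t + d))) \<le> tails (b n) F (x * sd n)"
        unfolding tails_def by (intro sum_mono) (auto intro: order_trans)
      also have "\<dots> \<le> tailT n x" using n x1 by (intro tails_le_tailT) (auto simp: F_def)
      finally have "real (n div 2) * (C * u powr (- (t + d))) \<le> tailT n x" by (simp add: F_def)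
      moreover have "real n / 4 * (C * u powr (- (t + d))) \<le> real (n div 2) * (C * u powr (- (t + d)))"
      proof (rule mult_right_mono)
        have "n \<le> 4 * (n div 2)" using elim(4) by presburger
        then show "real n / 4 \<le> real (n div 2)" by linarith
      qed (use C in auto)
      ultimately have T: "real n / 4 * (C * u powr (- (t + d))) \<le> tailT n x" by linarith
      have "normal_tail x \<le> exp (- x\<^sup>2 / 2)" using x1 by (intro normal_tail_le_exp) auto
      also have "\<dots> = exp (- k * x\<^sup>2 / 2) * exp (- (1 - k) * x\<^sup>2 / 2)" by (simp add: field_simps flip: exp_add)
      also have "\<dots> \<le> x powr (- (t + d)) * real n powr (- ((1 - k) * \<gamma> / 2))"
      proof (intro mult_mono)
        have "x powr (t + d) * exp (- k * x\<^sup>2 / 2) \<le> 1" using X[of x] xb by simp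
        moreover have "0 < x powr (t + d)" using x1 by simp
        ultimately have "exp (- k * x\<^sup>2 / 2) \<le> 1 / x powr (t + d)" by (simp only: pos_le_divide_eq mult.commute)
        then show "exp (- k * x\<^sup>2 / 2) \<le> x powr (- (t + d))" by (simp only: powr_minus_divide)
        have "(c1 * sqrt (ln (real n)))\<^sup>2 \<le> x\<^sup>2" using x c10 elim(3) by (intro power_mono) auto
        then have "\<gamma> * ln (real n) \<le> x\<^sup>2" using elim(3) by (simp add: power_mult_distrib \<gamma>_def)
        then have "(1 - k) / 2 * (\<gamma> * ln (real n)) \<le> (1 - k) / 2 * x\<^sup>2" using k by (intro mult_left_mono) auto
        then have "exp (- (1 - k) * x\<^sup>2 / 2) \<le> exp (- ((1 - k) * \<gamma> / 2) * ln (real n))" by (simp add: algebra_simps)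
        then show "exp (- (1 - k) * x\<^sup>2 / 2) \<le> real n powr (- ((1 - k) * \<gamma> / 2))" using n by (simp add: powr_def)
      qed auto
      also have "real n powr (- ((1 - k) * \<gamma> / 2)) = real n powr (- \<beta>) * (real n powr 1 * (real n powr (1 / 2 + d')) powr (- (t + d)))"
        unfolding powr_powr powr_add[symmetric] by (rule arg_cong[where f="\<lambda>z. real n powr z"]) (simp add: \<beta>_def field_simps)
      also have "x powr (- (t + d)) * (real n powr (- \<beta>) * (real n powr 1 * (real n powr (1 / 2 + d')) powr (- (t + d))))
        = 4 / C * real n powr (- \<beta>) * (real n / 4 * (C * u powr (- (t + d))))"
        unfolding u_def powr_mult using C by simp
      also have "\<dots> \<le> e * tailT n x"
        using elim(1) T C e by (intro mult_mono) auto
      finally show "normal_tail x \<le> e * tailT n x" .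
    qed
  qed
qed

lemma tailT_pos:
  assumes n: "1 \<le> n" and x: "0 < x" shows "0 < tailT n x"
proof -
  have "0 < tails (b n) {int n} (x * sd n)" by (simp add: tails_def tailp_pos)
  also have "\<dots> \<le> tailT n x" using n x by (intro tails_le_tailT) auto
  finally show ?thesis .
qed

text \<open>Two ranges are glued. The gluing constant \<open>c1\<close> lies below \<open>c0\<close>
  and below \<open>sqrt (t - 2)\<close>: up to \<open>c1 * sqrt (ln n)\<close> the Gaussian
  approximation holds and the tail sum is negligible, beyond it \<open>dev_jump_range\<close>
  applies.\<close>

lemma dev_uniform:
  assumes c: "0 < c" and e: "0 < e"
  shows "\<forall>\<^sub>F n in sequentially. \<forall>x\<ge>c. \<bar>dev n x - (tailT n x + normal_tail x)\<bar> \<le> e * (tailT n x + normal_tail x)"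
proof -
  define e' where "e' = min 1 (e / 2)"
  have e': "0 < e'" "e' \<le> 1" "2 * e' \<le> e" using e by (auto simp: e'_def)
  obtain c0 where c0: "0 < c0" "\<And>e. 0 < e \<Longrightarrow> \<forall>\<^sub>F n in sequentially. \<forall>x. 0 < x \<longrightarrow> x \<le> c0 * sqrt (ln (real n)) \<longrightarrow>
     \<bar>dev n x - normal_tail x\<bar> \<le> e * normal_tail x" using dev_gaussian_range by blast
  define c1 where "c1 = min c0 (sqrt (t - 2) / 2)"
  have t2: "0 < sqrt (t - 2)" using t by simp
  have "0 < min A (B / 2) \<and> min A (B / 2) < B \<and> min A (B / 2) \<le> A" if "0 < A" "0 < B" for A B :: real
    using that by auto
  from this[OF c0(1) t2] have c1: "0 < c1" "c1 < sqrt (t - 2)" "c1 \<le> c0" by (auto simp only: c1_def)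
  have "\<forall>\<^sub>F n in sequentially. 1 \<le> ln (real n)" by real_asymp
  with c0(2)[OF e'(1)] dev_jump_range[OF c1(1) e'(1,2)] jump_term_negligible[OF c c1(1,2) e'(1)] show ?thesis
  proof eventually_elim
    case (elim n)
    show ?case
    proof (intro allI impI)
      fix x assume x: "c \<le> x"
      define R where "R = tailT n x + normal_tail x"
      have R0: "0 \<le> R" "normal_tail x \<le> R" using tailT_nonneg normal_tail_nonneg by (auto simp: R_def)
      have "\<bar>dev n x - R\<bar> \<le> 2 * e' * R"
      proof (cases "x \<le> c1 * sqrt (ln (real n))")
        case True
        have "c1 * sqrt (ln (real n)) \<le> c0 * sqrt (ln (real n))" using c1 elim(4) by (intro mult_right_mono) auto
        then have "\<bar>dev n x - normal_tail x\<bar> \<le> e' * normal_tail x" using elim(1) x c True by auto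
        moreover have "tailT n x \<le> e' * normal_tail x" using elim(3) x True by blast
        moreover have "e' * normal_tail x \<le> e' * R" using R0 e' by (intro mult_left_mono) auto
        moreover have "0 \<le> tailT n x" by (rule tailT_nonneg)
        ultimately show ?thesis unfolding R_def by linarith
      next
        case False
        then have "\<bar>dev n x - R\<bar> \<le> e' * R" using elim(2) unfolding R_def by auto
        moreover have "0 \<le> e' * R" using e' R0 by simp
        ultimately show ?thesis by linarith
      qed
      also have "\<dots> \<le> e * R" using e' R0 by (intro mult_right_mono) auto
      finally show "\<bar>dev n x - (tailT n x + normal_tail x)\<bar> \<le> e * (tailT n x + normal_tail x)" unfolding R_def .
    qed
  qed
qed

lemma dev_jump:
  assumes c1: "sqrt (t - 2) < c1" and e: "0 < e"
  shows "\<forall>\<^sub>F n in sequentially. \<forall>x\<ge>c1 * sqrt (ln (real n)). \<bar>dev n x - tailT n x\<bar> \<le> e * tailT n x"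
proof -
  define e' where "e' = min 1 (e / 3)"
  have e': "0 < e'" "e' \<le> 1" "3 * e' \<le> e" using e by (auto simp: e'_def)
  have "0 < sqrt (t - 2)" using t by simp
  then have c10: "0 < c1" using c1 by linarith
  from dev_jump_range[OF c10 e'(1,2)] gaussian_term_negligible[OF c1 e'(1)] show ?thesis
  proof eventually_elim
    case (elim n)
    show ?case
    proof (intro allI impI)
      fix x assume x: "c1 * sqrt (ln (real n)) \<le> x"
      define T where "T = tailT n x"
      define Q where "Q = normal_tail x"
      have T0: "0 \<le> T" "0 \<le> Q" by (auto simp: T_def Q_def tailT_nonneg normal_tail_nonneg)
      have 1: "\<bar>dev n x - (T + Q)\<bar> \<le> e' * (T + Q)" using elim(1) x unfolding T_def Q_def by blast
      have 2: "Q \<le> e' * T" using elim(2) x unfolding T_def Q_def by blast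
      have "e' * Q \<le> 1 * Q" using e' T0 by (intro mult_right_mono) auto
      then have "\<bar>dev n x - T\<bar> \<le> 3 * (e' * T)" using 1 2 by (simp add: algebra_simps)
      also have "\<dots> \<le> e * T" using mult_right_mono[OF e'(3) T0(1)] by simp
      finally show "\<bar>dev n x - tailT n x\<bar> \<le> e * tailT n x" unfolding T_def .
    qed
  qed
qed

text \<open>The lower cut-off of \<open>dev_uniform\<close> and \<open>jump_term_negligible\<close>
  excludes \<open>x\<close> near 0; such \<open>x\<close> fall into the pure Gaussian range, so the
  remaining ones satisfy \<open>x \<ge> c0\<close>.\<close>

lemma dev_gaussian:
  assumes c2: "c2 < sqrt (t - 2)" and e: "0 < e"
  shows "\<forall>\<^sub>F n in sequentially. \<forall>x. 0 < x \<longrightarrow> x \<le> c2 * sqrt (ln (real n)) \<longrightarrow> \<bar>dev n x - normal_tail x\<bar> \<le> e * normal_tail x"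
proof -
  define e' where "e' = min 1 (e / 3)"
  have e': "0 < e'" "e' \<le> 1" "3 * e' \<le> e" using e by (auto simp: e'_def)
  obtain c0 where c0: "0 < c0" "\<And>e. 0 < e \<Longrightarrow> \<forall>\<^sub>F n in sequentially. \<forall>x. 0 < x \<longrightarrow> x \<le> c0 * sqrt (ln (real n)) \<longrightarrow>
     \<bar>dev n x - normal_tail x\<bar> \<le> e * normal_tail x" using dev_gaussian_range by blast
  \<comment> \<open>\<open>c2\<close> may be nonpositive; the maximum restores positivity without
    reaching \<open>sqrt (t - 2)\<close>.\<close>
  define c3 where "c3 = max c2 (sqrt (t - 2) / 2)"
  have t2: "0 < sqrt (t - 2)" using t by simp
  have "0 < max A (B / 2) \<and> max A (B / 2) < B \<and> A \<le> max A (B / 2)" if "A < B" "0 < B" for A B :: real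
    using that by auto
  from this[OF c2 t2] have c3: "0 < c3" "c3 < sqrt (t - 2)" "c2 \<le> c3" by (auto simp only: c3_def)
  have "\<forall>\<^sub>F n in sequentially. 1 \<le> ln (real n)" by real_asymp
  with c0(2)[OF e(1)] dev_uniform[OF c0(1) e'(1)] jump_term_negligible[OF c0(1) c3(1,2) e'(1)] show ?thesis
  proof eventually_elim
    case (elim n)
    show ?case
    proof (intro allI impI)
      fix x assume x: "0 < x" "x \<le> c2 * sqrt (ln (real n))"
      have "c2 * sqrt (ln (real n)) \<le> c3 * sqrt (ln (real n))" using c3 elim(4) by (intro mult_right_mono) auto
      then have x3: "x \<le> c3 * sqrt (ln (real n))" using x by linarith
      show "\<bar>dev n x - normal_tail x\<bar> \<le> e * normal_tail x"
      proof (cases "x \<le> c0 * sqrt (ln (real n))")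
        case True then show ?thesis using elim(1) x by blast
      next
        case False
        have "c0 * 1 \<le> c0 * sqrt (ln (real n))" using c0(1) elim(4) by (intro mult_left_mono) auto
        with False have xc: "c0 \<le> x" by linarith
        define T where "T = tailT n x"
        define Q where "Q = normal_tail x"
        have T0: "0 \<le> T" "0 \<le> Q" by (auto simp: T_def Q_def tailT_nonneg normal_tail_nonneg)
        have 1: "\<bar>dev n x - (T + Q)\<bar> \<le> e' * (T + Q)" using elim(2) xc unfolding T_def Q_def by blast
        have 2: "T \<le> e' * Q" using elim(3) xc x3 unfolding T_def Q_def by blast
        have "e' * T \<le> 1 * T" using e' T0 by (intro mult_right_mono) auto
        then have "\<bar>dev n x - Q\<bar> \<le> 3 * (e' * Q)" using 1 2 by (simp add: algebra_simps)
        also have "\<dots> \<le> e * Q" using mult_right_mono[OF e'(3) T0(2)] by simp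
        finally show ?thesis unfolding Q_def .
      qed
    qed
  qed
qed

end

text \<open>The witness is the relative error itself, \<open>u n / v n - 1\<close>.\<close>

lemma relative_error_sequence:
  fixes u v :: "nat \<Rightarrow> real"
  assumes "\<forall>\<^sub>F n in sequentially. 0 < v n" and "\<And>e. 0 < e \<Longrightarrow> \<forall>\<^sub>F n in sequentially. \<bar>u n - v n\<bar> \<le> e * v n"
  shows "\<exists>\<epsilon>. \<epsilon> \<longlonglongrightarrow> 0 \<and> (\<forall>\<^sub>F n in sequentially. u n = (1 + \<epsilon> n) * v n)"
proof (intro exI conjI)
  show "(\<lambda>n. u n / v n - 1) \<longlonglongrightarrow> 0"
  proof (rule tendstoI)
    fix e :: real assume e: "0 < e"
    then have "0 < e / 2" by simp
    from assms(2)[OF this] assms(1) show "\<forall>\<^sub>F n in sequentially. dist (u n / v n - 1) 0 < e"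
    proof eventually_elim
      case (elim n)
      have "u n / v n - 1 = (u n - v n) / v n" using elim by (simp add: diff_divide_distrib)
      then have "\<bar>u n / v n - 1\<bar> = \<bar>u n - v n\<bar> / v n" using elim by simp
      also have "\<dots> \<le> e / 2" using elim by (simp add: pos_divide_le_eq)
      finally show ?case using e by (simp add: dist_real_def)
    qed
  qed
  show "\<forall>\<^sub>F n in sequentially. u n = (1 + (u n / v n - 1)) * v n"
    using assms(1) by eventually_elim auto
qed

text \<open>The estimates for \<open>dev\<close> are uniform in the threshold, so each claim follows
  by inserting \<open>x n\<close>. In the first claim a single sequence serves as both
  \<open>\<epsilon>\<close> and \<open>\<delta>\<close>.\<close>

theorem corollary2p4:
  fixes M :: "'w measure" and \<xi> :: "int \<Rightarrow> 'w \<Rightarrow> real"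
    and t p r :: real and h l :: "real \<Rightarrow> real" and a :: "int \<Rightarrow> real"
  assumes "prob_space M"
    and indep: "prob_space.indep_vars M (\<lambda>_. borel) \<xi> UNIV"
    and ident: "\<forall>i. distr M borel (\<xi> i) = distr M borel (\<xi> 0)"
    and second_moment: "integrable M (\<lambda>\<omega>. (\<xi> 0 \<omega>)\<^sup>2)"
    and centered: "(LINT \<omega>|M. \<xi> 0 \<omega>) = 0"
    and "2 < t" and "slowly_varying h"
    and tail: "\<forall>\<^sub>F x in at_top. measure M {\<omega> \<in> space M. \<xi> 0 \<omega> \<ge> x} = h x / x powr t"
    and "2 < p" and p_moment: "integrable M (\<lambda>\<omega>. \<bar>\<xi> 0 \<omega>\<bar> powr p)"
    and "1 / 2 < r" and "r < 1"
    and "slowly_varying l" and "\<forall>x>0. 0 < l x"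
    and a_nonneg: "\<forall>i\<ge>0. a i = l (of_int i + 1) * (1 + of_int i) powr (- r)"
    and a_neg: "\<forall>i<0. a i = 0"
    and a_0: "a 0 = 1"
  shows
    "(\<forall>x :: nat \<Rightarrow> real. (\<exists>c>0. \<forall>n\<ge>1. c \<le> x n) \<longrightarrow>
        (\<exists>\<epsilon> \<delta> :: nat \<Rightarrow> real. \<epsilon> \<longlonglongrightarrow> 0 \<and> \<delta> \<longlonglongrightarrow> 0 \<and>
          (\<forall>\<^sub>F n in sequentially.
             dev_prob M a \<xi> n (x n) =
               (1 + \<epsilon> n) * tail_sum M a \<xi> n (x n) + (1 - std_normal_cdf (x n)) * (1 + \<delta> n))))
     \<and> (\<forall>(x :: nat \<Rightarrow> real) (c1 :: real).
          sqrt (t - 2) < c1 \<and> (\<forall>\<^sub>F n in sequentially. c1 * sqrt (ln (real n)) \<le> x n) \<longrightarrow>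
          (\<exists>\<epsilon> :: nat \<Rightarrow> real. \<epsilon> \<longlonglongrightarrow> 0 \<and>
            (\<forall>\<^sub>F n in sequentially.
               dev_prob M a \<xi> n (x n) = (1 + \<epsilon> n) * tail_sum M a \<xi> n (x n))))
     \<and> (\<forall>(x :: nat \<Rightarrow> real) (c2 :: real).
          c2 < sqrt (t - 2) \<and>
          (\<forall>\<^sub>F n in sequentially. 0 < x n \<and> x n \<le> c2 * sqrt (ln (real n))) \<longrightarrow>
          (\<exists>\<epsilon> :: nat \<Rightarrow> real. \<epsilon> \<longlonglongrightarrow> 0 \<and>
            (\<forall>\<^sub>F n in sequentially.
               dev_prob M a \<xi> n (x n) = (1 - std_normal_cdf (x n)) * (1 + \<epsilon> n))))"
proof -
  interpret prob_space M by fact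
  \<comment> \<open>Lowers the moment exponent into the interval from 2 to 3 on which the Taylor
    estimates work.\<close>
  define q where "q = min p 3"
  have [measurable]: "\<xi> 0 \<in> borel_measurable M" using indep by (auto simp: indep_vars_def)
  have G: "antimono (\<lambda>u. \<P>(\<omega> in M. u \<le> \<xi> 0 \<omega>))"
    by (intro antimonoI finite_measure_mono) auto
  from regvar_tailI[OF \<open>slowly_varying h\<close> G tail]
  have rv: "regvar_tail (\<lambda>u. \<P>(\<omega> in M. u \<le> \<xi> 0 \<omega>)) t" .
  have q_moment: "integrable M (\<lambda>\<omega>. \<bar>\<xi> 0 \<omega>\<bar> powr q)"
  proof (rule Bochner_Integration.integrable_bound)
    show "integrable M (\<lambda>\<omega>. 1 + \<bar>\<xi> 0 \<omega>\<bar> powr p)" using p_moment by simp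
    have "\<bar>y\<bar> powr q \<le> 1 + \<bar>y\<bar> powr p" for y :: real
    proof (cases "\<bar>y\<bar> \<le> 1")
      case True
      then have "\<bar>y\<bar> powr q \<le> 1" using \<open>2 < p\<close> by (intro powr_le1) (auto simp: q_def)
      then show ?thesis by (simp add: add_increasing2)
    next
      case False
      then have "\<bar>y\<bar> powr q \<le> \<bar>y\<bar> powr p" by (intro powr_mono) (auto simp: q_def)
      then show ?thesis by simp
    qed
    then show "AE \<omega> in M. norm (\<bar>\<xi> 0 \<omega>\<bar> powr q) \<le> norm (1 + \<bar>\<xi> 0 \<omega>\<bar> powr p)"
      by (intro AE_I2) (auto intro: order_trans)
  qed measurable
  \<comment> \<open>Regular variation makes the tail at 1 positive, so \<open>\<xi> 0\<close> cannot
    vanish almost surely and division by \<open>s2\<close> is legitimate.\<close>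
  have var: "0 < expectation (\<lambda>\<omega>. (\<xi> 0 \<omega>)\<^sup>2)"
  proof -
    have "0 < \<P>(\<omega> in M. 1 \<le> \<xi> 0 \<omega>)" using rv by (simp add: regvar_tail_def)
    also have "\<dots> \<le> \<P>(\<omega> in M. 1 \<le> (\<xi> 0 \<omega>)\<^sup>2)" by (intro finite_measure_mono) auto
    also have "\<dots> \<le> expectation (\<lambda>\<omega>. (\<xi> 0 \<omega>)\<^sup>2) / 1"
      by (intro integral_Markov_inequality_measure[where A="space M - space M"] second_moment) auto
    finally show ?thesis by simp
  qed
  interpret iid_sequence M \<xi> q
    using indep ident centered \<open>2 < p\<close> q_moment var by unfold_locales (auto simp: q_def)
  interpret regular_linear_process M \<xi> q t r l a
    using \<open>2 < t\<close> rv assms(11-15) a_neg by unfold_locales (auto simp: tailp_def[abs_def])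
  have n1: "\<forall>\<^sub>F n in sequentially. (1::nat) \<le> n" by (rule eventually_ge_at_top)
  show ?thesis
  proof (intro conjI allI impI)
    fix x :: "nat \<Rightarrow> real" assume "\<exists>c>0. \<forall>n\<ge>1. c \<le> x n"
    then obtain c where c: "0 < c" "\<And>n. 1 \<le> n \<Longrightarrow> c \<le> x n" by blast
    have "\<exists>\<epsilon>. \<epsilon> \<longlonglongrightarrow> 0 \<and> (\<forall>\<^sub>F n in sequentially. dev n (x n) = (1 + \<epsilon> n) * (tailT n (x n) + normal_tail (x n)))"
    proof (rule relative_error_sequence)
      show "\<forall>\<^sub>F n in sequentially. 0 < tailT n (x n) + normal_tail (x n)"
        using n1 by eventually_elim (use c in \<open>auto intro!: add_nonneg_pos tailT_nonneg normal_tail_pos intro: less_imp_le less_le_trans\<close>)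
      show "\<forall>\<^sub>F n in sequentially. \<bar>dev n (x n) - (tailT n (x n) + normal_tail (x n))\<bar> \<le> e * (tailT n (x n) + normal_tail (x n))"
        if "0 < e" for e using dev_uniform[OF c(1) that] n1 by eventually_elim (use c(2) in blast)
    qed
    then obtain \<epsilon> where e: "\<epsilon> \<longlonglongrightarrow> 0" "\<forall>\<^sub>F n in sequentially. dev n (x n) = (1 + \<epsilon> n) * (tailT n (x n) + normal_tail (x n))" by blast
    have "\<forall>\<^sub>F n in sequentially. dev_prob M a \<xi> n (x n) =
               (1 + \<epsilon> n) * tail_sum M a \<xi> n (x n) + (1 - std_normal_cdf (x n)) * (1 + \<epsilon> n)"
      using e(2) n1 by eventually_elim (simp add: dev_prob_eq tail_sum_eq normal_tail_def algebra_simps)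
    then show "\<exists>\<epsilon> \<delta> :: nat \<Rightarrow> real. \<epsilon> \<longlonglongrightarrow> 0 \<and> \<delta> \<longlonglongrightarrow> 0 \<and>
          (\<forall>\<^sub>F n in sequentially. dev_prob M a \<xi> n (x n) =
               (1 + \<epsilon> n) * tail_sum M a \<xi> n (x n) + (1 - std_normal_cdf (x n)) * (1 + \<delta> n))" using e(1) by blast
  next
    fix x :: "nat \<Rightarrow> real" and c1 :: real
    assume "sqrt (t - 2) < c1 \<and> (\<forall>\<^sub>F n in sequentially. c1 * sqrt (ln (real n)) \<le> x n)"
    then have c1: "sqrt (t - 2) < c1" and xc: "\<forall>\<^sub>F n in sequentially. c1 * sqrt (ln (real n)) \<le> x n" by auto
    have "0 < sqrt (t - 2)" using \<open>2 < t\<close> by simp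
    then have c10: "0 < c1" using c1 by linarith
    have "\<exists>\<epsilon>. \<epsilon> \<longlonglongrightarrow> 0 \<and> (\<forall>\<^sub>F n in sequentially. dev n (x n) = (1 + \<epsilon> n) * tailT n (x n))"
    proof (rule relative_error_sequence)
      have "\<forall>\<^sub>F n in sequentially. 1 \<le> ln (real n)" by real_asymp
      then show "\<forall>\<^sub>F n in sequentially. 0 < tailT n (x n)"
        using n1 xc
      proof eventually_elim
        case (elim n)
        have "0 < c1 * sqrt (ln (real n))" using c10 elim(1) by simp
        then show ?case using elim by (intro tailT_pos) auto
      qed
      show "\<forall>\<^sub>F n in sequentially. \<bar>dev n (x n) - tailT n (x n)\<bar> \<le> e * tailT n (x n)"
        if "0 < e" for e using dev_jump[OF c1 that] xc by eventually_elim blast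
    qed
    then obtain \<epsilon> where e: "\<epsilon> \<longlonglongrightarrow> 0" "\<forall>\<^sub>F n in sequentially. dev n (x n) = (1 + \<epsilon> n) * tailT n (x n)" by blast
    have "\<forall>\<^sub>F n in sequentially. dev_prob M a \<xi> n (x n) = (1 + \<epsilon> n) * tail_sum M a \<xi> n (x n)"
      using e(2) n1 by eventually_elim (simp add: dev_prob_eq tail_sum_eq)
    then show "\<exists>\<epsilon> :: nat \<Rightarrow> real. \<epsilon> \<longlonglongrightarrow> 0 \<and> (\<forall>\<^sub>F n in sequentially. dev_prob M a \<xi> n (x n) = (1 + \<epsilon> n) * tail_sum M a \<xi> n (x n))"
      using e(1) by blast
  next
    fix x :: "nat \<Rightarrow> real" and c2 :: real
    assume "c2 < sqrt (t - 2) \<and> (\<forall>\<^sub>F n in sequentially. 0 < x n \<and> x n \<le> c2 * sqrt (ln (real n)))"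
    then have c2: "c2 < sqrt (t - 2)" and xc: "\<forall>\<^sub>F n in sequentially. 0 < x n \<and> x n \<le> c2 * sqrt (ln (real n))" by auto
    have "\<exists>\<epsilon>. \<epsilon> \<longlonglongrightarrow> 0 \<and> (\<forall>\<^sub>F n in sequentially. dev n (x n) = (1 + \<epsilon> n) * normal_tail (x n))"
    proof (rule relative_error_sequence)
      show "\<forall>\<^sub>F n in sequentially. 0 < normal_tail (x n)"
        using xc by eventually_elim (auto intro: normal_tail_pos)
      show "\<forall>\<^sub>F n in sequentially. \<bar>dev n (x n) - normal_tail (x n)\<bar> \<le> e * normal_tail (x n)"
        if "0 < e" for e using dev_gaussian[OF c2 that] xc by eventually_elim blast
    qed
    then obtain \<epsilon> where e: "\<epsilon> \<longlonglongrightarrow> 0" "\<forall>\<^sub>F n in sequentially. dev n (x n) = (1 + \<epsilon> n) * normal_tail (x n)" by blast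
    have "\<forall>\<^sub>F n in sequentially. dev_prob M a \<xi> n (x n) = (1 - std_normal_cdf (x n)) * (1 + \<epsilon> n)"
      using e(2) by eventually_elim (simp add: dev_prob_eq normal_tail_def)
    then show "\<exists>\<epsilon> :: nat \<Rightarrow> real. \<epsilon> \<longlonglongrightarrow> 0 \<and> (\<forall>\<^sub>F n in sequentially. dev_prob M a \<xi> n (x n) = (1 - std_normal_cdf (x n)) * (1 + \<epsilon> n))"
      using e(1) by blast
  qed
qed

end
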